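(* A 2-functor $F$ between (small) $\mathsf{Cat}$-categories is of effective descent in $\mathsf{Cat}\text{-}\mathsf{Cat}$ if \begin{itemize} \item $F$ is surjective on objects; \item $F$ is surjective on composable triples of 2-cells; \item $F$ induces a functor surjective on composable pairs of 2-cells between the categories of composable pairs of 1-cells; \item $F$ induces a functor surjective on 2-cells between the categories of composable triples of 1-cells. \end{itemize}
   Context: $\mathsf{Cat}\text{-}\mathsf{Cat}$ is the category of small categories enriched over the cartesian monoidal category $\mathsf{Cat}$ of small categories, i.e. of small 2-categories and 2-functors. For a 2-category $\mathcal{X}$, the category of 1-cells is $\sum_{x,y}\mathcal{X}(x,y)$, with 1-cells as objects, 2-cells as morphisms and vertical composition. In the second condition, composable triples of 2-cells are triples of consecutive morphisms in this category (vertically composable triples). The category of composable pairs (resp. triples) of 1-cells has composable pairs (resp. triples) of 1-cells as objects and horizontally composable pairs (resp. triples) of 2-cells as morphisms, i.e. $\sum\mathcal{X}(y,z)\times\mathcal{X}(x,y)$ (resp. $\sum\mathcal{X}(z,w)\times\mathcal{X}(y,z)\times\mathcal{X}(x,y)$). The third condition says that the induced functor between the categories of composable pairs is surjective on composable pairs of morphisms, and the fourth that the induced functor between the categories of composable triples is surjective on morphisms. Effective descent: let $\dot\Delta$ be the category of finite ordinals and order preserving maps and $\Delta$ its full subcategory of nonempty ordinals. For a category $\mathbb{X}$ with pullbacks and a morphism $p:E\to B$, compose the augmented simplicial diagram $\mathcal{D}_p:\dot\Delta^{\mathrm{op}}\to\mathbb{X}$, $\mathsf{0}\mapsto B$, $\mathsf{1}\mapsto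 E$, $\mathsf{2}\mapsto E\times_BE$, $\mathsf{3}\mapsto E\times_BE\times_BE,\dots$ (iterated pullbacks of $p$, projections, diagonals) with the basic fibration $(\ )^*:\mathbb{X}^{\mathrm{op}}\to\mathsf{CAT}$, $B\mapsto\mathbb{X}/B$, $p\mapsto p^*$, to obtain $\mathcal{A}_p:\dot\Delta\to\mathsf{CAT}$. The descent category of $p$ is the category of pseudonatural transformations from the constant pseudofunctor at the terminal category to $\mathcal{A}_p|_\Delta$, and $p$ is of effective descent if the canonical comparison functor from $\mathbb{X}/B$ to the descent category is an equivalence. *)

theory Defs
  imports Main "HOL-Library.FuncSet"
begin

section \<open>Categories, functors, natural transformations\<close>

text \<open>Composition is written in the usual order: \<open>g \<odot> f\<close> is \<open>g\<close> after \<open>f\<close>, and is meaningful only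
  if \<open>Dom g = Cod f\<close>.\<close>

record ('o, 'a) cat =
  Obj :: "'o set"
  Arr :: "'a set"
  Dom :: "'a \<Rightarrow> 'o"
  Cod :: "'a \<Rightarrow> 'o"
  Idt :: "'o \<Rightarrow> 'a"
  Cmp :: "'a \<Rightarrow> 'a \<Rightarrow> 'a" (infixr "\<odot>\<index>" 70)

definition homs :: "('o, 'a) cat \<Rightarrow> 'o \<Rightarrow> 'o \<Rightarrow> 'a set" where
  "homs C x y = {f \<in> Arr C. Dom C f = x \<and> Cod C f = y}"

definition comp_pairs :: "('o, 'a) cat \<Rightarrow> ('a \<times> 'a) set" where
  "comp_pairs C = {(g, f). g \<in> Arr C \<and> f \<in> Arr C \<and> Dom C g = Cod C f}"

definition comp_triples :: "('o, 'a) cat \<Rightarrow> ('a \<times> 'a \<times> 'a) set" where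
  "comp_triples C = {(h, g, f). h \<in> Arr C \<and> g \<in> Arr C \<and> f \<in> Arr C \<and>
     Dom C h = Cod C g \<and> Dom C g = Cod C f}"

locale category =
  fixes C :: "('o, 'a) cat" (structure)
  assumes Dom_in: "f \<in> Arr C \<Longrightarrow> Dom C f \<in> Obj C"
    and Cod_in: "f \<in> Arr C \<Longrightarrow> Cod C f \<in> Obj C"
    and Idt_in: "x \<in> Obj C \<Longrightarrow> Idt C x \<in> homs C x x"
    and Cmp_in: "(g, f) \<in> comp_pairs C \<Longrightarrow> g \<odot> f \<in> homs C (Dom C f) (Cod C g)"
    and Cmp_assoc: "(h, g, f) \<in> comp_triples C \<Longrightarrow> (h \<odot> g) \<odot> f = h \<odot> g \<odot> f"
    and Cmp_Idt: "f \<in> Arr C \<Longrightarrow> f \<odot> Idt C (Dom C f) = f"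
    and Idt_Cmp: "f \<in> Arr C \<Longrightarrow> Idt C (Cod C f) \<odot> f = f"

record ('o1, 'a1, 'o2, 'a2) fctr =
  omap :: "'o1 \<Rightarrow> 'o2"
  amap :: "'a1 \<Rightarrow> 'a2"

definition is_functor ::
  "('o1, 'a1) cat \<Rightarrow> ('o2, 'a2) cat \<Rightarrow> ('o1, 'a1, 'o2, 'a2) fctr \<Rightarrow> bool" where
  "is_functor C D F \<longleftrightarrow> category C \<and> category D \<and>
     (\<forall>x \<in> Obj C. omap F x \<in> Obj D) \<and>
     (\<forall>f \<in> Arr C. amap F f \<in> homs D (omap F (Dom C f)) (omap F (Cod C f))) \<and>
     (\<forall>x \<in> Obj C. amap F (Idt C x) = Idt D (omap F x)) \<and>
     (\<forall>(g, f) \<in> comp_pairs C. amap F (g \<odot>\<^bsub>C\<^esub> f) = amap F g \<odot>\<^bsub>D\<^esub> amap F f)"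

text \<open>Wherever functors, and families indexed by the objects or arrows of a category, occur as part
  of the objects or arrows of another category, they are normalised to \<open>undefined\<close> off their domain,
  so that HOL equality is the intended equality.\<close>

definition ext_functor :: "('o1, 'a1) cat \<Rightarrow> ('o1, 'a1, 'o2, 'a2) fctr \<Rightarrow> bool" where
  "ext_functor C F \<longleftrightarrow> omap F \<in> extensional (Obj C) \<and> amap F \<in> extensional (Arr C)"

definition id_functor :: "('o, 'a) cat \<Rightarrow> ('o, 'a, 'o, 'a) fctr" where
  "id_functor C = \<lparr>omap = restrict (\<lambda>x. x) (Obj C), amap = restrict (\<lambda>f. f) (Arr C)\<rparr>"

definition comp_functor ::
  "('o1, 'a1) cat \<Rightarrow> ('o2, 'a2, 'o3, 'a3) fctr \<Rightarrow> ('o1, 'a1, 'o2, 'a2) fctr \<Rightarrow>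
   ('o1, 'a1, 'o3, 'a3) fctr" where
  "comp_functor C G F =
     \<lparr>omap = compose (Obj C) (omap G) (omap F), amap = compose (Arr C) (amap G) (amap F)\<rparr>"

definition nat_trans ::
  "('o1, 'a1) cat \<Rightarrow> ('o2, 'a2) cat \<Rightarrow> ('o1, 'a1, 'o2, 'a2) fctr \<Rightarrow> ('o1, 'a1, 'o2, 'a2) fctr \<Rightarrow>
   ('o1 \<Rightarrow> 'a2) \<Rightarrow> bool" where
  "nat_trans C D F G \<tau> \<longleftrightarrow>
     (\<forall>x \<in> Obj C. \<tau> x \<in> homs D (omap F x) (omap G x)) \<and>
     (\<forall>f \<in> Arr C. amap G f \<odot>\<^bsub>D\<^esub> \<tau> (Dom C f) = \<tau> (Cod C f) \<odot>\<^bsub>D\<^esub> amap F f)"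

definition is_iso :: "('o, 'a) cat \<Rightarrow> 'a \<Rightarrow> bool" where
  "is_iso C f \<longleftrightarrow> f \<in> Arr C \<and>
     (\<exists>g \<in> homs C (Cod C f) (Dom C f).
        g \<odot>\<^bsub>C\<^esub> f = Idt C (Dom C f) \<and> f \<odot>\<^bsub>C\<^esub> g = Idt C (Cod C f))"

definition nat_iso ::
  "('o1, 'a1) cat \<Rightarrow> ('o2, 'a2) cat \<Rightarrow> ('o1, 'a1, 'o2, 'a2) fctr \<Rightarrow> ('o1, 'a1, 'o2, 'a2) fctr \<Rightarrow>
   ('o1 \<Rightarrow> 'a2) \<Rightarrow> bool" where
  "nat_iso C D F G \<tau> \<longleftrightarrow> nat_trans C D F G \<tau> \<and> (\<forall>x \<in> Obj C. is_iso D (\<tau> x))"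

definition is_equivalence ::
  "('o1, 'a1) cat \<Rightarrow> ('o2, 'a2) cat \<Rightarrow> ('o1, 'a1, 'o2, 'a2) fctr \<Rightarrow> bool" where
  "is_equivalence C D F \<longleftrightarrow> is_functor C D F \<and>
     (\<exists>G \<eta> \<epsilon>. is_functor D C G \<and>
        nat_iso C C (id_functor C) (comp_functor C G F) \<eta> \<and>
        nat_iso D D (comp_functor D F G) (id_functor D) \<epsilon>)"

definition prod_cat :: "('o1, 'a1) cat \<Rightarrow> ('o2, 'a2) cat \<Rightarrow> ('o1 \<times> 'o2, 'a1 \<times> 'a2) cat" where
  "prod_cat C D = \<lparr>Obj = Obj C \<times> Obj D, Arr = Arr C \<times> Arr D,
     Dom = map_prod (Dom C) (Dom D), Cod = map_prod (Cod C) (Cod D),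
     Idt = map_prod (Idt C) (Idt D),
     Cmp = (\<lambda>(g, g') (f, f'). (g \<odot>\<^bsub>C\<^esub> f, g' \<odot>\<^bsub>D\<^esub> f'))\<rparr>"

definition sum_cat :: "'i set \<Rightarrow> ('i \<Rightarrow> ('o, 'a) cat) \<Rightarrow> ('i \<times> 'o, 'i \<times> 'a) cat" where
  "sum_cat I H = \<lparr>Obj = (SIGMA i:I. Obj (H i)), Arr = (SIGMA i:I. Arr (H i)),
     Dom = (\<lambda>(i, f). (i, Dom (H i) f)), Cod = (\<lambda>(i, f). (i, Cod (H i) f)),
     Idt = (\<lambda>(i, x). (i, Idt (H i) x)),
     Cmp = (\<lambda>(i, g) (j, f). (i, g \<odot>\<^bsub>H i\<^esub> f))\<rparr>"

definition terminal_cat :: "(unit, unit) cat" where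
  "terminal_cat = \<lparr>Obj = UNIV, Arr = UNIV, Dom = (\<lambda>_. ()), Cod = (\<lambda>_. ()), Idt = (\<lambda>_. ()),
     Cmp = (\<lambda>_ _. ())\<rparr>"

text \<open>The category of finite ordinals and its full subcategory of nonempty ordinals. The ordinal
  \<open>n\<close> is \<open>{..<n}\<close>; an arrow carries its source and its target.\<close>

type_synonym ord_map = "nat \<times> nat \<times> (nat \<Rightarrow> nat)"

definition aug_Delta :: "(nat, ord_map) cat" where
  "aug_Delta = \<lparr>Obj = UNIV,
     Arr = {(m, n, f). f \<in> {..<m} \<rightarrow>\<^sub>E {..<n} \<and> mono_on {..<m} f},
     Dom = (\<lambda>(m, n, f). m), Cod = (\<lambda>(m, n, f). n),
     Idt = (\<lambda>n. (n, n, restrict (\<lambda>i. i) {..<n})),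
     Cmp = (\<lambda>(n', k, g) (m, n, f). (m, k, compose {..<m} g f))\<rparr>"

definition Delta :: "(nat, ord_map) cat" where
  "Delta = aug_Delta\<lparr>Obj := {n. 0 < n}, Arr := {(m, n, f) \<in> Arr aug_Delta. 0 < m \<and> 0 < n}\<rparr>"

definition from_zero :: "nat \<Rightarrow> ord_map" where
  "from_zero n = (0, n, \<lambda>i. undefined)"


section \<open>Pullbacks and slices\<close>

definition is_pullback :: "('o, 'a) cat \<Rightarrow> 'a \<Rightarrow> 'a \<Rightarrow> 'a \<Rightarrow> 'a \<Rightarrow> bool" where
  "is_pullback C f g p q \<longleftrightarrow>
     p \<in> Arr C \<and> q \<in> Arr C \<and> Dom C p = Dom C q \<and> Cod C p = Dom C f \<and> Cod C q = Dom C g \<and>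
     f \<odot>\<^bsub>C\<^esub> p = g \<odot>\<^bsub>C\<^esub> q \<and>
     (\<forall>u \<in> Arr C. \<forall>v \<in> Arr C.
        Dom C u = Dom C v \<and> Cod C u = Dom C f \<and> Cod C v = Dom C g \<and> f \<odot>\<^bsub>C\<^esub> u = g \<odot>\<^bsub>C\<^esub> v \<longrightarrow>
        (\<exists>!h. h \<in> homs C (Dom C u) (Dom C p) \<and> p \<odot>\<^bsub>C\<^esub> h = u \<and> q \<odot>\<^bsub>C\<^esub> h = v))"

locale category_with_pullbacks = category +
  assumes pullbacks: "f \<in> Arr C \<Longrightarrow> g \<in> Arr C \<Longrightarrow> Cod C f = Cod C g \<Longrightarrow> \<exists>p q. is_pullback C f g p q"

text \<open>An arbitrary choice of pullbacks: nothing is known about it beyond the universal property.\<close>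

definition pb :: "('o, 'a) cat \<Rightarrow> 'a \<Rightarrow> 'a \<Rightarrow> 'a \<times> 'a" where
  "pb C f g = (SOME (p, q). is_pullback C f g p q)"

definition pb1 :: "('o, 'a) cat \<Rightarrow> 'a \<Rightarrow> 'a \<Rightarrow> 'a" where
  "pb1 C f g = fst (pb C f g)"

definition pb2 :: "('o, 'a) cat \<Rightarrow> 'a \<Rightarrow> 'a \<Rightarrow> 'a" where
  "pb2 C f g = snd (pb C f g)"

definition pb_lift :: "('o, 'a) cat \<Rightarrow> 'a \<Rightarrow> 'a \<Rightarrow> 'a \<Rightarrow> 'a \<Rightarrow> 'a" where
  "pb_lift C f g u v = (THE h. h \<in> homs C (Dom C u) (Dom C (pb1 C f g)) \<and>
     pb1 C f g \<odot>\<^bsub>C\<^esub> h = u \<and> pb2 C f g \<odot>\<^bsub>C\<^esub> h = v)"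

text \<open>The arrows of the slice over \<open>b\<close> are triples \<open>(a, h, a')\<close>, \<open>h\<close> being an arrow
  from \<open>a\<close> to \<open>a'\<close> over \<open>b\<close>.\<close>

definition slice :: "('o, 'a) cat \<Rightarrow> 'o \<Rightarrow> ('a, 'a \<times> 'a \<times> 'a) cat" where
  "slice C b = \<lparr>Obj = {a \<in> Arr C. Cod C a = b},
     Arr = {(a, h, a'). a \<in> Arr C \<and> Cod C a = b \<and> a' \<in> Arr C \<and> Cod C a' = b \<and>
              h \<in> homs C (Dom C a) (Dom C a') \<and> a' \<odot>\<^bsub>C\<^esub> h = a},
     Dom = (\<lambda>(a, h, a'). a), Cod = (\<lambda>(a, h, a'). a'),
     Idt = (\<lambda>a. (a, Idt C (Dom C a), a)),
     Cmp = (\<lambda>(b, k, b') (a, h, a'). (a, k \<odot>\<^bsub>C\<^esub> h, b'))\<rparr>"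

definition base_change ::
  "('o, 'a) cat \<Rightarrow> 'a \<Rightarrow> ('a, 'a \<times> 'a \<times> 'a, 'a, 'a \<times> 'a \<times> 'a) fctr" where
  "base_change C u = \<lparr>omap = (\<lambda>a. pb1 C u a),
     amap = (\<lambda>(a, h, a'). (pb1 C u a, pb_lift C u a' (pb1 C u a) (h \<odot>\<^bsub>C\<^esub> pb2 C u a), pb1 C u a'))\<rparr>"


section \<open>Pseudofunctors into categories and pseudonatural transformations\<close>

text \<open>The data of a pseudofunctor \<open>A\<close> from a category to categories. The structure isomorphisms are
  \<open>pcomp A g f x : A g (A f x) \<rightarrow> A (g \<odot> f) x\<close> and \<open>punit A n x : x \<rightarrow> A (id\<^sub>n) x\<close>.\<close>

record ('n, 'f, 'o, 'a) psfun =
  pobj :: "'n \<Rightarrow> ('o, 'a) cat"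
  parr :: "'f \<Rightarrow> ('o, 'a, 'o, 'a) fctr"
  pcomp :: "'f \<Rightarrow> 'f \<Rightarrow> 'o \<Rightarrow> 'a"
  punit :: "'n \<Rightarrow> 'o \<Rightarrow> 'a"

text \<open>The basic fibration, a pseudofunctor on the opposite of \<open>C\<close>. Thus \<open>v\<close> after \<open>u\<close> in its index category
  is \<open>u \<odot> v\<close> in \<open>C\<close>; the structure isomorphisms are the canonical comparisons between pullbacks.\<close>

definition basic_fibration :: "('o, 'a) cat \<Rightarrow> ('o, 'a, 'a, 'a \<times> 'a \<times> 'a) psfun" where
  "basic_fibration C = \<lparr>pobj = slice C, parr = base_change C,
     pcomp = (\<lambda>v u a. (pb1 C v (pb1 C u a),
        pb_lift C (u \<odot>\<^bsub>C\<^esub> v) a (pb1 C v (pb1 C u a)) (pb2 C u a \<odot>\<^bsub>C\<^esub> pb2 C v (pb1 C u a)),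
        pb1 C (u \<odot>\<^bsub>C\<^esub> v) a)),
     punit = (\<lambda>b a. (a, pb_lift C (Idt C b) a a (Idt C (Dom C a)), pb1 C (Idt C b) a))\<rparr>"

definition psfun_comp_functor ::
  "('n, 'f, 'o, 'a) psfun \<Rightarrow> ('k, 'l, 'n, 'f) fctr \<Rightarrow> ('k, 'l, 'o, 'a) psfun" where
  "psfun_comp_functor A D = \<lparr>pobj = (\<lambda>n. pobj A (omap D n)), parr = (\<lambda>f. parr A (amap D f)),
     pcomp = (\<lambda>g f. pcomp A (amap D g) (amap D f)), punit = (\<lambda>n. punit A (omap D n))\<rparr>"

definition const_psfun :: "('o, 'a) cat \<Rightarrow> ('n, 'f, 'o, 'a) psfun" where
  "const_psfun T = \<lparr>pobj = (\<lambda>_. T), parr = (\<lambda>_. id_functor T),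
     pcomp = (\<lambda>_ _. Idt T), punit = (\<lambda>_. Idt T)\<rparr>"

text \<open>A pseudonatural transformation \<open>\<alpha>\<close> from \<open>F\<close> to \<open>G\<close> has functors \<open>pncomp \<alpha> n : F n \<rightarrow> G n\<close> and,
  for \<open>f : m \<rightarrow> n\<close>, invertible natural transformations
  \<open>pnsq \<alpha> f x : G f (\<alpha>\<^sub>m x) \<rightarrow> \<alpha>\<^sub>n (F f x)\<close>.\<close>

record ('n, 'f, 'o1, 'a1, 'o2, 'a2) psnat =
  pncomp :: "'n \<Rightarrow> ('o1, 'a1, 'o2, 'a2) fctr"
  pnsq :: "'f \<Rightarrow> 'o1 \<Rightarrow> 'a2"

definition is_psnat ::
  "('n, 'f) cat \<Rightarrow> ('n, 'f, 'o1, 'a1) psfun \<Rightarrow> ('n, 'f, 'o2, 'a2) psfun \<Rightarrow>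
   ('n, 'f, 'o1, 'a1, 'o2, 'a2) psnat \<Rightarrow> bool" where
  "is_psnat J F G \<alpha> \<longleftrightarrow>
     pncomp \<alpha> \<in> extensional (Obj J) \<and> pnsq \<alpha> \<in> extensional (Arr J) \<and>
     (\<forall>n \<in> Obj J. is_functor (pobj F n) (pobj G n) (pncomp \<alpha> n) \<and>
        ext_functor (pobj F n) (pncomp \<alpha> n)) \<and>
     (\<forall>f \<in> Arr J. pnsq \<alpha> f \<in> extensional (Obj (pobj F (Dom J f))) \<and>
        nat_iso (pobj F (Dom J f)) (pobj G (Cod J f))
          (comp_functor (pobj F (Dom J f)) (parr G f) (pncomp \<alpha> (Dom J f)))
          (comp_functor (pobj F (Dom J f)) (pncomp \<alpha> (Cod J f)) (parr F f))
          (pnsq \<alpha> f)) \<and>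
     (\<forall>n \<in> Obj J. \<forall>x \<in> Obj (pobj F n).
        pnsq \<alpha> (Idt J n) x \<odot>\<^bsub>pobj G n\<^esub> punit G n (omap (pncomp \<alpha> n) x) =
        amap (pncomp \<alpha> n) (punit F n x)) \<and>
     (\<forall>(g, f) \<in> comp_pairs J. \<forall>x \<in> Obj (pobj F (Dom J f)).
        pnsq \<alpha> (g \<odot>\<^bsub>J\<^esub> f) x \<odot>\<^bsub>pobj G (Cod J g)\<^esub> pcomp G g f (omap (pncomp \<alpha> (Dom J f)) x) =
        amap (pncomp \<alpha> (Cod J g)) (pcomp F g f x) \<odot>\<^bsub>pobj G (Cod J g)\<^esub>
          pnsq \<alpha> g (omap (parr F f) x) \<odot>\<^bsub>pobj G (Cod J g)\<^esub> amap (parr G g) (pnsq \<alpha> f x))"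

definition is_modification ::
  "('n, 'f) cat \<Rightarrow> ('n, 'f, 'o1, 'a1) psfun \<Rightarrow> ('n, 'f, 'o2, 'a2) psfun \<Rightarrow>
   ('n, 'f, 'o1, 'a1, 'o2, 'a2) psnat \<Rightarrow> ('n, 'f, 'o1, 'a1, 'o2, 'a2) psnat \<Rightarrow>
   ('n \<Rightarrow> 'o1 \<Rightarrow> 'a2) \<Rightarrow> bool" where
  "is_modification J F G \<alpha> \<beta> \<Gamma> \<longleftrightarrow>
     \<Gamma> \<in> extensional (Obj J) \<and>
     (\<forall>n \<in> Obj J. \<Gamma> n \<in> extensional (Obj (pobj F n)) \<and>
        nat_trans (pobj F n) (pobj G n) (pncomp \<alpha> n) (pncomp \<beta> n) (\<Gamma> n)) \<and>
     (\<forall>f \<in> Arr J. \<forall>x \<in> Obj (pobj F (Dom J f)).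
        \<Gamma> (Cod J f) (omap (parr F f) x) \<odot>\<^bsub>pobj G (Cod J f)\<^esub> pnsq \<alpha> f x =
        pnsq \<beta> f x \<odot>\<^bsub>pobj G (Cod J f)\<^esub> amap (parr G f) (\<Gamma> (Dom J f) x))"

definition psnat_cat ::
  "('n, 'f) cat \<Rightarrow> ('n, 'f, 'o1, 'a1) psfun \<Rightarrow> ('n, 'f, 'o2, 'a2) psfun \<Rightarrow>
   (('n, 'f, 'o1, 'a1, 'o2, 'a2) psnat,
    ('n, 'f, 'o1, 'a1, 'o2, 'a2) psnat \<times> ('n \<Rightarrow> 'o1 \<Rightarrow> 'a2) \<times>
      ('n, 'f, 'o1, 'a1, 'o2, 'a2) psnat) cat" where
  "psnat_cat J F G = \<lparr>Obj = {\<alpha>. is_psnat J F G \<alpha>},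
     Arr = {(\<alpha>, \<Gamma>, \<beta>). is_psnat J F G \<alpha> \<and> is_psnat J F G \<beta> \<and> is_modification J F G \<alpha> \<beta> \<Gamma>},
     Dom = (\<lambda>(\<alpha>, \<Gamma>, \<beta>). \<alpha>), Cod = (\<lambda>(\<alpha>, \<Gamma>, \<beta>). \<beta>),
     Idt = (\<lambda>\<alpha>. (\<alpha>, \<lambda>n \<in> Obj J. \<lambda>x \<in> Obj (pobj F n). Idt (pobj G n) (omap (pncomp \<alpha> n) x), \<alpha>)),
     Cmp = (\<lambda>(\<beta>, \<Theta>, \<gamma>) (\<alpha>, \<Gamma>, \<beta>').
        (\<alpha>, \<lambda>n \<in> Obj J. \<lambda>x \<in> Obj (pobj F n). \<Theta> n x \<odot>\<^bsub>pobj G n\<^esub> \<Gamma> n x, \<gamma>))\<rparr>"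


section \<open>Effective descent\<close>

text \<open>Iterated fibre powers of \<open>p\<close>: \<open>fp_str C p n\<close> is the structure arrow from the \<open>n\<close>-fold power to
  \<open>Cod C p\<close> and \<open>fp_proj C p n i\<close>, for \<open>i < n\<close>, its projections to \<open>Dom C p\<close>.\<close>

fun fp_str :: "('o, 'a) cat \<Rightarrow> 'a \<Rightarrow> nat \<Rightarrow> 'a" where
  "fp_str C p 0 = Idt C (Cod C p)"
| "fp_str C p (Suc 0) = p"
| "fp_str C p (Suc (Suc n)) = fp_str C p (Suc n) \<odot>\<^bsub>C\<^esub> pb1 C (fp_str C p (Suc n)) p"

fun fp_proj :: "('o, 'a) cat \<Rightarrow> 'a \<Rightarrow> nat \<Rightarrow> nat \<Rightarrow> 'a" where
  "fp_proj C p 0 i = undefined"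
| "fp_proj C p (Suc 0) i = Idt C (Dom C p)"
| "fp_proj C p (Suc (Suc n)) i =
     (if i = Suc n then pb2 C (fp_str C p (Suc n)) p
      else fp_proj C p (Suc n) i \<odot>\<^bsub>C\<^esub> pb1 C (fp_str C p (Suc n)) p)"

text \<open>The augmented simplicial diagram of \<open>p\<close>, as a functor from \<open>aug_Delta\<close> to the opposite of \<open>C\<close>: an order
  preserving map \<open>f\<close> from \<open>m\<close> to \<open>n\<close> goes to the arrow from the \<open>n\<close>-fold to the \<open>m\<close>-fold power whose
  \<open>i\<close>-th component is the \<open>f i\<close>-th projection.\<close>

definition descent_diagram :: "('o, 'a) cat \<Rightarrow> 'a \<Rightarrow> (nat, ord_map, 'o, 'a) fctr" where
  "descent_diagram C p = \<lparr>omap = (\<lambda>n. Dom C (fp_str C p n)),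
     amap = (\<lambda>(m, n, f). THE h. h \<in> homs C (Dom C (fp_str C p n)) (Dom C (fp_str C p m)) \<and>
        fp_str C p m \<odot>\<^bsub>C\<^esub> h = fp_str C p n \<and>
        (\<forall>i < m. fp_proj C p m i \<odot>\<^bsub>C\<^esub> h = fp_proj C p n (f i)))\<rparr>"

definition descent_psfun ::
  "('o, 'a) cat \<Rightarrow> 'a \<Rightarrow> (nat, ord_map, 'a, 'a \<times> 'a \<times> 'a) psfun" where
  "descent_psfun C p = psfun_comp_functor (basic_fibration C) (descent_diagram C p)"

type_synonym 'a descent_obj = "(nat, ord_map, unit, unit, 'a, 'a \<times> 'a \<times> 'a) psnat"
type_synonym 'a descent_arr =
  "'a descent_obj \<times> (nat \<Rightarrow> unit \<Rightarrow> 'a \<times> 'a \<times> 'a) \<times> 'a descent_obj"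

text \<open>Restriction along the inclusion of \<open>Delta\<close> into \<open>aug_Delta\<close> consists in using \<open>Delta\<close> as the
  index category.\<close>

definition descent_cat :: "('o, 'a) cat \<Rightarrow> 'a \<Rightarrow> ('a descent_obj, 'a descent_arr) cat" where
  "descent_cat C p = psnat_cat Delta (const_psfun terminal_cat) (descent_psfun C p)"

text \<open>With \<open>A = descent_psfun C p\<close>, the comparison sends \<open>a\<close> to the family of the \<open>A (0 \<rightarrow> n) a\<close>, with
  the structure isomorphisms \<open>A f (A (0 \<rightarrow> m) a) \<rightarrow> A (0 \<rightarrow> n) a\<close> of \<open>A\<close>, for \<open>f : m \<rightarrow> n\<close>.\<close>

definition comparison_obj :: "('o, 'a) cat \<Rightarrow> 'a \<Rightarrow> 'a \<Rightarrow> 'a descent_obj" where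
  "comparison_obj C p a = (let A = descent_psfun C p in
     \<lparr>pncomp = (\<lambda>n \<in> Obj Delta.
        \<lparr>omap = (\<lambda>_. omap (parr A (from_zero n)) a),
         amap = (\<lambda>_. Idt (pobj A n) (omap (parr A (from_zero n)) a))\<rparr>),
      pnsq = (\<lambda>f \<in> Arr Delta. \<lambda>_. pcomp A f (from_zero (Dom Delta f)) a)\<rparr>)"

definition comparison ::
  "('o, 'a) cat \<Rightarrow> 'a \<Rightarrow> ('a, 'a \<times> 'a \<times> 'a, 'a descent_obj, 'a descent_arr) fctr" where
  "comparison C p = \<lparr>omap = comparison_obj C p,
     amap = (\<lambda>(a, h, a'). (comparison_obj C p a,
        \<lambda>n \<in> Obj Delta. \<lambda>_. amap (parr (descent_psfun C p) (from_zero n)) (a, h, a'),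
        comparison_obj C p a'))\<rparr>"

definition effective_descent :: "('o, 'a) cat \<Rightarrow> 'a \<Rightarrow> bool" where
  "effective_descent C p \<longleftrightarrow> category_with_pullbacks C \<and> p \<in> Arr C \<and>
     is_equivalence (slice C (Cod C p)) (descent_cat C p) (comparison C p)"


section \<open>Small 2-categories and 2-functors\<close>

text \<open>Categories enriched over small categories. Small means that the objects, 1-cells and 2-cells
  are elements of the type \<open>'u\<close>, which plays the role of the universe and should be infinite, so that
  pullbacks exist. Only the values of \<open>Hom\<close>, \<open>One\<close> and \<open>HCmp\<close> at elements of \<open>Ob\<close> matter; records
  which differ elsewhere only are isomorphic objects of the category \<open>CatCat\<close> below. Horizontal
  composition \<open>HCmp X x y z\<close> takes the cells from \<open>y\<close> to \<open>z\<close> first.\<close>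

record 'u twocat =
  Ob :: "'u set"
  Hom :: "'u \<Rightarrow> 'u \<Rightarrow> ('u, 'u) cat"
  One :: "'u \<Rightarrow> 'u"
  HCmp :: "'u \<Rightarrow> 'u \<Rightarrow> 'u \<Rightarrow> ('u \<times> 'u, 'u \<times> 'u, 'u, 'u) fctr"

locale two_category =
  fixes X :: "'u twocat"
  assumes Hom_category: "\<lbrakk>x \<in> Ob X; y \<in> Ob X\<rbrakk> \<Longrightarrow> category (Hom X x y)"
    and One_in: "x \<in> Ob X \<Longrightarrow> One X x \<in> Obj (Hom X x x)"
    and HCmp_functor: "\<lbrakk>x \<in> Ob X; y \<in> Ob X; z \<in> Ob X\<rbrakk> \<Longrightarrow>
      is_functor (prod_cat (Hom X y z) (Hom X x y)) (Hom X x z) (HCmp X x y z)"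
    and HCmp_assoc_1: "\<lbrakk>w \<in> Ob X; x \<in> Ob X; y \<in> Ob X; z \<in> Ob X;
      f \<in> Obj (Hom X w x); g \<in> Obj (Hom X x y); h \<in> Obj (Hom X y z)\<rbrakk> \<Longrightarrow>
      omap (HCmp X w x z) (omap (HCmp X x y z) (h, g), f) =
      omap (HCmp X w y z) (h, omap (HCmp X w x y) (g, f))"
    and HCmp_assoc_2: "\<lbrakk>w \<in> Ob X; x \<in> Ob X; y \<in> Ob X; z \<in> Ob X;
      \<alpha> \<in> Arr (Hom X w x); \<beta> \<in> Arr (Hom X x y); \<gamma> \<in> Arr (Hom X y z)\<rbrakk> \<Longrightarrow>
      amap (HCmp X w x z) (amap (HCmp X x y z) (\<gamma>, \<beta>), \<alpha>) =
      amap (HCmp X w y z) (\<gamma>, amap (HCmp X w x y) (\<beta>, \<alpha>))"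
    and HCmp_One_1: "\<lbrakk>x \<in> Ob X; y \<in> Ob X; f \<in> Obj (Hom X x y)\<rbrakk> \<Longrightarrow>
      omap (HCmp X x x y) (f, One X x) = f"
    and One_HCmp_1: "\<lbrakk>x \<in> Ob X; y \<in> Ob X; f \<in> Obj (Hom X x y)\<rbrakk> \<Longrightarrow>
      omap (HCmp X x y y) (One X y, f) = f"
    and HCmp_One_2: "\<lbrakk>x \<in> Ob X; y \<in> Ob X; \<alpha> \<in> Arr (Hom X x y)\<rbrakk> \<Longrightarrow>
      amap (HCmp X x x y) (\<alpha>, Idt (Hom X x x) (One X x)) = \<alpha>"
    and One_HCmp_2: "\<lbrakk>x \<in> Ob X; y \<in> Ob X; \<alpha> \<in> Arr (Hom X x y)\<rbrakk> \<Longrightarrow>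
      amap (HCmp X x y y) (Idt (Hom X y y) (One X y), \<alpha>) = \<alpha>"

record 'u twofun =
  fob :: "'u \<Rightarrow> 'u"
  fhom :: "'u \<Rightarrow> 'u \<Rightarrow> ('u, 'u, 'u, 'u) fctr"

locale two_functor = X: two_category X + Y: two_category Y
  for X :: "'u twocat" and Y :: "'u twocat" +
  fixes F :: "'u twofun"
  assumes fob_in: "fob F \<in> Ob X \<rightarrow>\<^sub>E Ob Y"
    and fhom_functor: "\<lbrakk>x \<in> Ob X; y \<in> Ob X\<rbrakk> \<Longrightarrow>
      is_functor (Hom X x y) (Hom Y (fob F x) (fob F y)) (fhom F x y) \<and>
      ext_functor (Hom X x y) (fhom F x y)"
    and fhom_undefined: "\<not> (x \<in> Ob X \<and> y \<in> Ob X) \<Longrightarrow> fhom F x y = undefined"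
    and fhom_One: "x \<in> Ob X \<Longrightarrow> omap (fhom F x x) (One X x) = One Y (fob F x)"
    and fhom_HCmp_1: "\<lbrakk>x \<in> Ob X; y \<in> Ob X; z \<in> Ob X;
      f \<in> Obj (Hom X x y); g \<in> Obj (Hom X y z)\<rbrakk> \<Longrightarrow>
      omap (fhom F x z) (omap (HCmp X x y z) (g, f)) =
      omap (HCmp Y (fob F x) (fob F y) (fob F z)) (omap (fhom F y z) g, omap (fhom F x y) f)"
    and fhom_HCmp_2: "\<lbrakk>x \<in> Ob X; y \<in> Ob X; z \<in> Ob X;
      \<alpha> \<in> Arr (Hom X x y); \<beta> \<in> Arr (Hom X y z)\<rbrakk> \<Longrightarrow>
      amap (fhom F x z) (amap (HCmp X x y z) (\<beta>, \<alpha>)) =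
      amap (HCmp Y (fob F x) (fob F y) (fob F z)) (amap (fhom F y z) \<beta>, amap (fhom F x y) \<alpha>)"

definition id_twofun :: "'u twocat \<Rightarrow> 'u twofun" where
  "id_twofun X = \<lparr>fob = restrict (\<lambda>x. x) (Ob X),
     fhom = (\<lambda>x y. if x \<in> Ob X \<and> y \<in> Ob X then id_functor (Hom X x y) else undefined)\<rparr>"

definition comp_twofun :: "'u twocat \<Rightarrow> 'u twofun \<Rightarrow> 'u twofun \<Rightarrow> 'u twofun" where
  "comp_twofun X G F = \<lparr>fob = compose (Ob X) (fob G) (fob F),
     fhom = (\<lambda>x y. if x \<in> Ob X \<and> y \<in> Ob X
        then comp_functor (Hom X x y) (fhom G (fob F x) (fob F y)) (fhom F x y) else undefined)\<rparr>"

definition CatCat :: "('u twocat, 'u twocat \<times> 'u twofun \<times> 'u twocat) cat" where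
  "CatCat = \<lparr>Obj = {X. two_category X}, Arr = {(X, F, Y). two_functor X Y F},
     Dom = (\<lambda>(X, F, Y). X), Cod = (\<lambda>(X, F, Y). Y),
     Idt = (\<lambda>X. (X, id_twofun X, X)),
     Cmp = (\<lambda>(Y, G, Z) (X, F, Y'). (X, comp_twofun X G F, Z))\<rparr>"


section \<open>The categories of 1-cells and of composable pairs and triples of 1-cells\<close>

definition cells1 :: "'u twocat \<Rightarrow> (('u \<times> 'u) \<times> 'u, ('u \<times> 'u) \<times> 'u) cat" where
  "cells1 X = sum_cat (Ob X \<times> Ob X) (\<lambda>(x, y). Hom X x y)"

definition cells1_map ::
  "'u twofun \<Rightarrow> (('u \<times> 'u) \<times> 'u, ('u \<times> 'u) \<times> 'u, ('u \<times> 'u) \<times> 'u, ('u \<times> 'u) \<times> 'u) fctr" where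
  "cells1_map F = \<lparr>
     omap = (\<lambda>((x, y), f). ((fob F x, fob F y), omap (fhom F x y) f)),
     amap = (\<lambda>((x, y), \<alpha>). ((fob F x, fob F y), amap (fhom F x y) \<alpha>))\<rparr>"

type_synonym 'u pair_cell = "('u \<times> 'u \<times> 'u) \<times> 'u \<times> 'u"

definition cells1_pairs :: "'u twocat \<Rightarrow> ('u pair_cell, 'u pair_cell) cat" where
  "cells1_pairs X =
     sum_cat (Ob X \<times> Ob X \<times> Ob X) (\<lambda>(x, y, z). prod_cat (Hom X y z) (Hom X x y))"

definition cells1_pairs_map ::
  "'u twofun \<Rightarrow> ('u pair_cell, 'u pair_cell, 'u pair_cell, 'u pair_cell) fctr" where
  "cells1_pairs_map F = \<lparr>
     omap = (\<lambda>((x, y, z), (g, f)). ((fob F x, fob F y, fob F z),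
        (omap (fhom F y z) g, omap (fhom F x y) f))),
     amap = (\<lambda>((x, y, z), (\<beta>, \<alpha>)). ((fob F x, fob F y, fob F z),
        (amap (fhom F y z) \<beta>, amap (fhom F x y) \<alpha>)))\<rparr>"

type_synonym 'u triple_cell = "('u \<times> 'u \<times> 'u \<times> 'u) \<times> 'u \<times> 'u \<times> 'u"

definition cells1_triples :: "'u twocat \<Rightarrow> ('u triple_cell, 'u triple_cell) cat" where
  "cells1_triples X = sum_cat (Ob X \<times> Ob X \<times> Ob X \<times> Ob X)
     (\<lambda>(x, y, z, w). prod_cat (Hom X z w) (prod_cat (Hom X y z) (Hom X x y)))"

definition cells1_triples_map ::
  "'u twofun \<Rightarrow> ('u triple_cell, 'u triple_cell, 'u triple_cell, 'u triple_cell) fctr" where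
  "cells1_triples_map F = \<lparr>
     omap = (\<lambda>((x, y, z, w), (h, g, f)). ((fob F x, fob F y, fob F z, fob F w),
        (omap (fhom F z w) h, omap (fhom F y z) g, omap (fhom F x y) f))),
     amap = (\<lambda>((x, y, z, w), (\<gamma>, \<beta>, \<alpha>)). ((fob F x, fob F y, fob F z, fob F w),
        (amap (fhom F z w) \<gamma>, amap (fhom F y z) \<beta>, amap (fhom F x y) \<alpha>)))\<rparr>"

definition surj_on_arrows ::
  "('o1, 'a1) cat \<Rightarrow> ('o2, 'a2) cat \<Rightarrow> ('o1, 'a1, 'o2, 'a2) fctr \<Rightarrow> bool" where
  "surj_on_arrows C D G \<longleftrightarrow> amap G ` Arr C = Arr D"

definition surj_on_comp_pairs ::
  "('o1, 'a1) cat \<Rightarrow> ('o2, 'a2) cat \<Rightarrow> ('o1, 'a1, 'o2, 'a2) fctr \<Rightarrow> bool" where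
  "surj_on_comp_pairs C D G \<longleftrightarrow>
     (\<lambda>(g, f). (amap G g, amap G f)) ` comp_pairs C = comp_pairs D"

definition surj_on_comp_triples ::
  "('o1, 'a1) cat \<Rightarrow> ('o2, 'a2) cat \<Rightarrow> ('o1, 'a1, 'o2, 'a2) fctr \<Rightarrow> bool" where
  "surj_on_comp_triples C D G \<longleftrightarrow>
     (\<lambda>(h, g, f). (amap G h, amap G g, amap G f)) ` comp_triples C = comp_triples D"

end

theory Submission
  imports Defs
begin

text \<open>Transporting a descent datum on \<open>p\<close> along its structure isomorphisms turns it into a
  strict simplicial object, cartesian over the fibre powers of \<open>p\<close>. Hence \<open>p\<close> is of effective
  descent as soon as its pullbacks are regular epimorphisms and every such simplicial object is
  pulled back from an arrow into the codomain of \<open>p\<close>.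

  For 2-functors both conditions are checked on sets of 2-cells with their two partial
  compositions. The first two stages of the simplicial object are an equivalence relation on a
  2-category \<open>C\<close>, compatible with all operations, which moves cells uniquely along the fibres of
  \<open>p\<close>. A configuration of composable classes therefore lifts to \<open>C\<close> whenever its image lifts
  along \<open>p\<close>, and the configurations needed to make the quotient of \<open>C\<close> a 2-category are exactly
  those in the hypotheses: vertical triples for the associativity of vertical composition, squares
  for interchange, horizontal triples for the associativity of horizontal composition.\<close>

section \<open>Categories with pullbacks\<close>

text \<open>The definition of descent uses arbitrary chosen pullbacks, so its structure isomorphisms
  cannot be taken to be identities. Composing the second projection of a chosen pullback with the
  inverse of a structure isomorphism gives the arrows \<open>transition\<close>: the unit and
  composition axioms become strict functoriality, and invertibility becomes the statement that the
  squares over the fibre powers are pullbacks. The relation read off from stage 2 is then reflexive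
  by the degeneracy 2 -> 1 and transitive by filling in stage 3; symmetry follows from unique
  transport along the fibres.

  A second obstacle is that the hom-categories of a 2-category depend on objects. For single-sorted
  2-categories, fibre products and quotients are formed on sets of cells, and bijective
  homomorphisms are invertible. A quotient keeps chosen representatives as its cells and so stays in
  the same type. A fibre product has pairs of triples of elements of the universe as cells; an
  infinite universe makes it possible to code these by single elements, so that the result is again
  a small 2-category.\<close>

context category
begin

lemma Cmp_simps [simp]:
  assumes "g \<in> Arr C" "f \<in> Arr C" "Dom C g = Cod C f"
  shows "g \<odot> f \<in> Arr C" "Dom C (g \<odot> f) = Dom C f" "Cod C (g \<odot> f) = Cod C g"
  using Cmp_in[of g f] assms by (auto simp: comp_pairs_def homs_def)

lemma Idt_simps [simp]:
  assumes "x \<in> Obj C"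
  shows "Idt C x \<in> Arr C" "Dom C (Idt C x) = x" "Cod C (Idt C x) = x"
  using Idt_in[OF assms] by (auto simp: homs_def)

lemma Cmp_assoc' [simp]:
  assumes "h \<in> Arr C" "g \<in> Arr C" "f \<in> Arr C" "Dom C h = Cod C g" "Dom C g = Cod C f"
  shows "(h \<odot> g) \<odot> f = h \<odot> g \<odot> f"
  using Cmp_assoc[of h g f] assms by (auto simp: comp_triples_def)

lemma Cmp_Idt' [simp]: "f \<in> Arr C \<Longrightarrow> Dom C f = x \<Longrightarrow> f \<odot> Idt C x = f"
  using Cmp_Idt by auto

lemma Idt_Cmp' [simp]: "f \<in> Arr C \<Longrightarrow> Cod C f = x \<Longrightarrow> Idt C x \<odot> f = f"
  using Idt_Cmp by auto

declare Dom_in [simp] Cod_in [simp]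

text \<open>Composites are kept nested to the right, where an equation for
  \<open>a \<odot> b\<close> no longer matches once something follows on the right; this is the same
  equation with a tail \<open>h\<close>.\<close>

lemma Cmp_reassoc:
  assumes "a \<odot> b = c" "a \<in> Arr C" "b \<in> Arr C" "Dom C a = Cod C b" "h \<in> Arr C" "Cod C h = Dom C b"
  shows "a \<odot> b \<odot> h = c \<odot> h"
  using assms Cmp_assoc'[of a b h] by simp

lemma is_isoI:
  assumes "f \<in> Arr C" "g \<in> Arr C" "Dom C g = Cod C f" "Cod C g = Dom C f"
    "g \<odot> f = Idt C (Dom C f)" "f \<odot> g = Idt C (Cod C f)"
  shows "is_iso C f"
  using assms unfolding is_iso_def homs_def by blast

lemma is_isoE:
  assumes "is_iso C f"
  obtains g where "f \<in> Arr C" "g \<in> Arr C" "Dom C g = Cod C f" "Cod C g = Dom C f"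
    "g \<odot> f = Idt C (Dom C f)" "f \<odot> g = Idt C (Cod C f)"
  using assms unfolding is_iso_def homs_def by blast

lemma iso_cancel_right:
  assumes "is_iso C k" "u \<in> Arr C" "v \<in> Arr C" "Dom C u = Cod C k" "Dom C v = Cod C k"
    "u \<odot> k = v \<odot> k"
  shows "u = v"
proof -
  obtain g where g: "k \<in> Arr C" "g \<in> Arr C" "Dom C g = Cod C k" "Cod C g = Dom C k"
    "k \<odot> g = Idt C (Cod C k)"
    using assms(1) by (rule is_isoE)
  have "(u \<odot> k) \<odot> g = (v \<odot> k) \<odot> g" using assms(6) by simp
  then show ?thesis using g assms(2-5) by simp
qed

lemma is_iso_comp:
  assumes "is_iso C g" "is_iso C f" "Dom C g = Cod C f"
  shows "is_iso C (g \<odot> f)"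
proof -
  obtain g' where g: "g \<in> Arr C" "g' \<in> Arr C" "Dom C g' = Cod C g" "Cod C g' = Dom C g"
    "g' \<odot> g = Idt C (Dom C g)" "g \<odot> g' = Idt C (Cod C g)"
    using assms(1) by (rule is_isoE)
  obtain f' where f: "f \<in> Arr C" "f' \<in> Arr C" "Dom C f' = Cod C f" "Cod C f' = Dom C f"
    "f' \<odot> f = Idt C (Dom C f)" "f \<odot> f' = Idt C (Cod C f)"
    using assms(2) by (rule is_isoE)
  have "(f' \<odot> g') \<odot> (g \<odot> f) = f' \<odot> (g' \<odot> g) \<odot> f"
    "(g \<odot> f) \<odot> (f' \<odot> g') = g \<odot> (f \<odot> f') \<odot> g'"
    using f(1-4) g(1-4) assms(3) by simp_all
  then show ?thesis
    using f g assms(3) by (intro is_isoI[of _ "f' \<odot> g'"]) simp_all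
qed

lemma is_pullbackD:
  assumes "is_pullback C f g p q"
  shows "p \<in> Arr C" "q \<in> Arr C" "Dom C q = Dom C p" "Cod C p = Dom C f" "Cod C q = Dom C g"
    "f \<odot> p = g \<odot> q"
  using assms by (auto simp: is_pullback_def)

lemma is_pullback_lift:
  assumes "is_pullback C f g p q"
    and "u \<in> Arr C" "v \<in> Arr C" "Dom C u = Dom C v" "Cod C u = Dom C f" "Cod C v = Dom C g"
    "f \<odot> u = g \<odot> v"
  obtains h where "h \<in> Arr C" "Dom C h = Dom C u" "Cod C h = Dom C p" "p \<odot> h = u" "q \<odot> h = v"
  using assms unfolding is_pullback_def homs_def by blast

text \<open>Both arrows factor the cone \<open>(p \<odot> h, q \<odot> h)\<close>, so the uniqueness
  half of the universal property identifies them: the projections are jointly monic.\<close>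

lemma is_pullback_eqI:
  assumes pb: "is_pullback C f g p q" and f: "f \<in> Arr C" "g \<in> Arr C"
    and h: "h \<in> Arr C" "h' \<in> Arr C" "Dom C h = Dom C h'" "Cod C h = Dom C p" "Cod C h' = Dom C p"
    "p \<odot> h = p \<odot> h'" "q \<odot> h = q \<odot> h'"
  shows "h = h'"
proof -
  note pbD = is_pullbackD[OF pb]
  have "f \<odot> p \<odot> h = g \<odot> q \<odot> h"
    using pbD h f by (metis Cmp_assoc')
  moreover have "p \<odot> h \<in> Arr C" "q \<odot> h \<in> Arr C" "Dom C (p \<odot> h) = Dom C (q \<odot> h)"
    "Cod C (p \<odot> h) = Dom C f" "Cod C (q \<odot> h) = Dom C g"
    using pbD(1-5) h(1-5) by simp_all
  ultimately have "\<exists>!k. k \<in> homs C (Dom C (p \<odot> h)) (Dom C p) \<and> p \<odot> k = p \<odot> h \<and> q \<odot> k = q \<odot> h"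
    using pb unfolding is_pullback_def by blast
  moreover have "h \<in> homs C (Dom C (p \<odot> h)) (Dom C p)" "h' \<in> homs C (Dom C (p \<odot> h)) (Dom C p)"
    using h(1-5) pbD by (simp_all add: homs_def)
  ultimately show ?thesis using h(6,7) by metis
qed

text \<open>Unique existence is split into existence and joint monicity; the latter speaks of
  parallel arrows only, so no cone has to be carried along.\<close>

lemma is_pullbackI:
  assumes "f \<in> Arr C" "g \<in> Arr C"
    and "p \<in> Arr C" "q \<in> Arr C" "Dom C p = Dom C q" "Cod C p = Dom C f" "Cod C q = Dom C g"
    "f \<odot> p = g \<odot> q"
    and ex: "\<And>u v. \<lbrakk>u \<in> Arr C; v \<in> Arr C; Dom C u = Dom C v; Cod C u = Dom C f; Cod C v = Dom C g;
      f \<odot> u = g \<odot> v\<rbrakk> \<Longrightarrow>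
      \<exists>h \<in> Arr C. Dom C h = Dom C u \<and> Cod C h = Dom C p \<and> p \<odot> h = u \<and> q \<odot> h = v"
    and un: "\<And>h h'. \<lbrakk>h \<in> Arr C; h' \<in> Arr C; Dom C h = Dom C h'; Cod C h = Dom C p;
      Cod C h' = Dom C p; p \<odot> h = p \<odot> h'; q \<odot> h = q \<odot> h'\<rbrakk> \<Longrightarrow> h = h'"
  shows "is_pullback C f g p q"
  unfolding is_pullback_def
proof (intro conjI ballI impI)
  fix u v assume "u \<in> Arr C" "v \<in> Arr C"
    "Dom C u = Dom C v \<and> Cod C u = Dom C f \<and> Cod C v = Dom C g \<and> f \<odot> u = g \<odot> v"
  then obtain h where h: "h \<in> Arr C" "Dom C h = Dom C u" "Cod C h = Dom C p" "p \<odot> h = u" "q \<odot> h = v"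
    using ex[of u v] by blast
  show "\<exists>!h. h \<in> homs C (Dom C u) (Dom C p) \<and> p \<odot> h = u \<and> q \<odot> h = v"
  proof (rule ex1I[of _ h])
    show "h \<in> homs C (Dom C u) (Dom C p) \<and> p \<odot> h = u \<and> q \<odot> h = v"
      using h by (simp add: homs_def)
    show "h' = h" if "h' \<in> homs C (Dom C u) (Dom C p) \<and> p \<odot> h' = u \<and> q \<odot> h' = v" for h'
      by (rule un) (use that h in \<open>auto simp: homs_def\<close>)
  qed
qed (use assms in simp_all)

text \<open>The inverse of \<open>k\<close> turns factorisations through one apex into
  factorisations through the other. With \<open>k\<close> a structure isomorphism of a descent
  datum, this makes the square of the datum a pullback.\<close>

lemma is_pullback_iso:
  assumes pb: "is_pullback C f g p q" and f: "f \<in> Arr C" "g \<in> Arr C"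
    and p': "p' \<in> Arr C" "q' \<in> Arr C" "Dom C q' = Dom C p'"
    and k: "is_iso C k" "Dom C k = Dom C p" "Cod C k = Dom C p'" "p' \<odot> k = p" "q' \<odot> k = q"
  shows "is_pullback C f g p' q'"
proof -
  obtain l where l: "k \<in> Arr C" "l \<in> Arr C" "Dom C l = Cod C k" "Cod C l = Dom C k"
    "l \<odot> k = Idt C (Dom C k)" "k \<odot> l = Idt C (Cod C k)"
    using k(1) by (rule is_isoE)
  note pbD = is_pullbackD[OF pb]
  have cod: "Cod C p' = Dom C f" "Cod C q' = Dom C g"
    using pbD k l p' Cmp_simps(3) by metis+
  have pl: "p \<odot> l = p'" "q \<odot> l = q'"
    using k l p' by (metis Cmp_assoc' Cmp_Idt')+
  show ?thesis
  proof (rule is_pullbackI)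
    have "(f \<odot> p) \<odot> l = (g \<odot> q) \<odot> l" using pbD(6) by simp
    then show "f \<odot> p' = g \<odot> q'" using pbD(1-5) l k(2,3) f pl by simp
  next
    fix u v assume "u \<in> Arr C" "v \<in> Arr C" "Dom C u = Dom C v" "Cod C u = Dom C f"
      "Cod C v = Dom C g" "f \<odot> u = g \<odot> v"
    then obtain h where h: "h \<in> Arr C" "Dom C h = Dom C u" "Cod C h = Dom C p" "p \<odot> h = u"
      "q \<odot> h = v"
      by (rule is_pullback_lift[OF pb])
    have "p' \<odot> k \<odot> h = u" "q' \<odot> k \<odot> h = v"
      using h k l p' by (metis Cmp_assoc')+
    then show "\<exists>h\<in>Arr C. Dom C h = Dom C u \<and> Cod C h = Dom C p' \<and> p' \<odot> h = u \<and> q' \<odot> h = v"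
      using h k l by (intro bexI[of _ "k \<odot> h"]) simp_all
  next
    fix h h' assume h: "h \<in> Arr C" "h' \<in> Arr C" "Dom C h = Dom C h'" "Cod C h = Dom C p'"
      "Cod C h' = Dom C p'" "p' \<odot> h = p' \<odot> h'" "q' \<odot> h = q' \<odot> h'"
    have "l \<odot> h = l \<odot> h'"
      by (rule is_pullback_eqI[OF pb f]) (use h l k(2,3) pbD in \<open>simp_all add: Cmp_reassoc[OF
        pl(1)] Cmp_reassoc[OF pl(2)]\<close>)
    then have "k \<odot> l \<odot> h = k \<odot> l \<odot> h'" by simp
    then show "h = h'" using h k(2,3) l by (simp add: Cmp_reassoc[OF l(6)])
  qed (use p' f cod in simp_all)
qed

text \<open>A cone over \<open>f \<odot> e\<close> and \<open>g\<close> is factored twice, through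
  the pullback of \<open>f\<close> and then through that of \<open>e\<close>. It makes stage n of a
  descent datum a pullback once stage 1 is one.\<close>

lemma is_pullback_paste:
  assumes pb1: "is_pullback C f g p q" and pb2: "is_pullback C e p r s"
    and arr: "f \<in> Arr C" "g \<in> Arr C" "e \<in> Arr C" and ef: "Cod C e = Dom C f"
  shows "is_pullback C (f \<odot> e) g r (q \<odot> s)"
proof -
  note D1 = is_pullbackD[OF pb1] and D2 = is_pullbackD[OF pb2]
  show ?thesis
  proof (rule is_pullbackI)
    have "(f \<odot> e) \<odot> r = f \<odot> p \<odot> s" using D1 D2 arr ef by simp
    also have "\<dots> = (f \<odot> p) \<odot> s" using D1(1,4) D2(1-5) arr by simp
    also have "\<dots> = g \<odot> q \<odot> s" using D1(6) D1(1-5) D2(1-5) arr by simp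
    finally show "(f \<odot> e) \<odot> r = g \<odot> q \<odot> s" .
  next
    fix u v assume u: "u \<in> Arr C" "v \<in> Arr C" "Dom C u = Dom C v" "Cod C u = Dom C (f \<odot> e)"
      "Cod C v = Dom C g" "(f \<odot> e) \<odot> u = g \<odot> v"
    have u': "Cod C u = Dom C e" using u arr ef by simp
    have "f \<odot> e \<odot> u = g \<odot> v" using u u' arr ef by simp
    then obtain k where k: "k \<in> Arr C" "Dom C k = Dom C u" "Cod C k = Dom C p" "p \<odot> k = e \<odot> u"
      "q \<odot> k = v"
      using is_pullback_lift[OF pb1, of "e \<odot> u" v] u u' arr ef by auto
    obtain h where h: "h \<in> Arr C" "Dom C h = Dom C u" "Cod C h = Dom C r" "r \<odot> h = u" "s \<odot> h = k"
      using is_pullback_lift[OF pb2, of u k] u u' k by auto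
    show "\<exists>h\<in>Arr C. Dom C h = Dom C u \<and> Cod C h = Dom C r \<and> r \<odot> h = u \<and> (q \<odot> s) \<odot> h = v"
      using h k D1 D2 by (intro bexI[of _ h]) simp_all
  next
    fix h h' assume h: "h \<in> Arr C" "h' \<in> Arr C" "Dom C h = Dom C h'" "Cod C h = Dom C r"
      "Cod C h' = Dom C r" "r \<odot> h = r \<odot> h'" "(q \<odot> s) \<odot> h = (q \<odot> s) \<odot> h'"
    have "s \<odot> h = s \<odot> h'"
    proof (rule is_pullback_eqI[OF pb1 arr(1,2)])
      have "e \<odot> r \<odot> k = p \<odot> s \<odot> k" if "k \<in> Arr C" "Cod C k = Dom C r" for k
        using that D1(1-5) D2(1-5) arr by (simp add: Cmp_reassoc[OF D2(6)])
      from this[of h] this[of h'] show "p \<odot> s \<odot> h = p \<odot> s \<odot> h'"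
        using h(1-6) by simp
    qed (use h D1(1-5) D2(1-5) in simp_all)
    then show "h = h'"
      using is_pullback_eqI[OF pb2 arr(3) D1(1), of h h'] h(1-6) by blast
  qed (use D1 D2 arr ef in simp_all)
qed

text \<open>Each pullback factors the cone of the other, and joint monicity makes the two
  factorisations mutually inverse.\<close>

lemma is_pullback_comparison_iso:
  assumes pb: "is_pullback C f g p q" and pb': "is_pullback C f g p' q'" and f: "f \<in> Arr C"
    "g \<in> Arr C"
  obtains k where "is_iso C k" "k \<in> Arr C" "Dom C k = Dom C p" "Cod C k = Dom C p'" "p' \<odot> k = p"
    "q' \<odot> k = q"
proof -
  note D = is_pullbackD[OF pb] and D' = is_pullbackD[OF pb']
  obtain k where k: "k \<in> Arr C" "Dom C k = Dom C p" "Cod C k = Dom C p'" "p' \<odot> k = p" "q' \<odot> k = q"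
    using is_pullback_lift[OF pb', of p q] D by auto
  obtain l where l: "l \<in> Arr C" "Dom C l = Dom C p'" "Cod C l = Dom C p" "p \<odot> l = p'" "q \<odot> l = q'"
    using is_pullback_lift[OF pb, of p' q'] D' by auto
  have "l \<odot> k = Idt C (Dom C k)"
    by (rule is_pullback_eqI[OF pb f]) (use k l D D' in \<open>simp_all add: Cmp_reassoc[OF k(4)]
      Cmp_reassoc[OF k(5)] Cmp_reassoc[OF l(4)] Cmp_reassoc[OF l(5)]\<close>)
  moreover have "k \<odot> l = Idt C (Cod C k)"
    by (rule is_pullback_eqI[OF pb' f]) (use k l D D' in \<open>simp_all add: Cmp_reassoc[OF k(4)]
      Cmp_reassoc[OF k(5)] Cmp_reassoc[OF l(4)] Cmp_reassoc[OF l(5)]\<close>)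
  ultimately have "is_iso C k" using k l by (intro is_isoI[of k l]) simp_all
  then show ?thesis using k that by blast
qed

end

context category_with_pullbacks
begin

lemma pb_is_pullback:
  assumes "f \<in> Arr C" "g \<in> Arr C" "Cod C f = Cod C g"
  shows "is_pullback C f g (pb1 C f g) (pb2 C f g)"
proof -
  have "\<exists>x. case x of (p, q) \<Rightarrow> is_pullback C f g p q"
    using pullbacks[OF assms] by auto
  from someI_ex[OF this] show ?thesis
    by (simp add: pb1_def pb2_def pb_def case_prod_beta')
qed

lemma pb_simps [simp]:
  assumes "f \<in> Arr C" "g \<in> Arr C" "Cod C f = Cod C g"
  shows "pb1 C f g \<in> Arr C" "pb2 C f g \<in> Arr C" "Dom C (pb2 C f g) = Dom C (pb1 C f g)"
    "Cod C (pb1 C f g) = Dom C f" "Cod C (pb2 C f g) = Dom C g"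
  using is_pullbackD[OF pb_is_pullback[OF assms]] by simp_all

lemma pb_square:
  assumes "f \<in> Arr C" "g \<in> Arr C" "Cod C f = Cod C g"
  shows "f \<odot> pb1 C f g = g \<odot> pb2 C f g"
  using is_pullbackD[OF pb_is_pullback[OF assms]] by simp

lemma pb_lift_simps [simp]:
  assumes f: "f \<in> Arr C" "g \<in> Arr C" "Cod C f = Cod C g"
    and u: "u \<in> Arr C" "v \<in> Arr C" "Dom C u = Dom C v" "Cod C u = Dom C f" "Cod C v = Dom C g"
    "f \<odot> u = g \<odot> v"
  shows "pb_lift C f g u v \<in> Arr C" "Dom C (pb_lift C f g u v) = Dom C u"
    "Cod C (pb_lift C f g u v) = Dom C (pb1 C f g)"
    "pb1 C f g \<odot> pb_lift C f g u v = u" "pb2 C f g \<odot> pb_lift C f g u v = v"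
proof -
  have "\<exists>!h. h \<in> homs C (Dom C u) (Dom C (pb1 C f g)) \<and> pb1 C f g \<odot> h = u \<and> pb2 C f g \<odot> h = v"
    using pb_is_pullback[OF f] u unfolding is_pullback_def by blast
  from theI'[OF this] show "pb_lift C f g u v \<in> Arr C" "Dom C (pb_lift C f g u v) = Dom C u"
    "Cod C (pb_lift C f g u v) = Dom C (pb1 C f g)"
    "pb1 C f g \<odot> pb_lift C f g u v = u" "pb2 C f g \<odot> pb_lift C f g u v = v"
    by (simp_all add: pb_lift_def homs_def)
qed

lemmas pb_eqI = is_pullback_eqI[OF pb_is_pullback]

end

section \<open>Slice categories\<close>

lemma slice_simps [simp]:
  "Obj (slice C b) = {a \<in> Arr C. Cod C a = b}"
  "(a, h, a') \<in> Arr (slice C b) \<longleftrightarrow> a \<in> Arr C \<and> Cod C a = b \<and> a' \<in> Arr C \<and> Cod C a' = b \<and>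
     h \<in> homs C (Dom C a) (Dom C a') \<and> a' \<odot>\<^bsub>C\<^esub> h = a"
  "Dom (slice C b) (a, h, a') = a" "Cod (slice C b) (a, h, a') = a'"
  "Idt (slice C b) a = (a, Idt C (Dom C a), a)"
  "(c, k, c') \<odot>\<^bsub>slice C b\<^esub> (a, h, a') = (a, k \<odot>\<^bsub>C\<^esub> h, c')"
  by (simp_all add: slice_def)

lemma slice_homs:
  "t \<in> homs (slice C b) a a' \<longleftrightarrow> a \<in> Arr C \<and> Cod C a = b \<and> a' \<in> Arr C \<and> Cod C a' = b \<and>
     (\<exists>h. t = (a, h, a') \<and> h \<in> Arr C \<and> Dom C h = Dom C a \<and> Cod C h = Dom C a' \<and> a' \<odot>\<^bsub>C\<^esub> h = a)"
  by (cases t) (auto simp: homs_def)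

lemma (in category) slice_category: "category (slice C b)"
proof
  fix s t assume "(s, t) \<in> comp_pairs (slice C b)"
  then show "s \<odot>\<^bsub>slice C b\<^esub> t \<in> homs (slice C b) (Dom (slice C b) t) (Cod (slice C b) s)"
    by (cases s; cases t) (auto simp: slice_homs comp_pairs_def homs_def Cmp_reassoc)
next
  fix r s t assume "(r, s, t) \<in> comp_triples (slice C b)"
  then show "(r \<odot>\<^bsub>slice C b\<^esub> s) \<odot>\<^bsub>slice C b\<^esub> t = r \<odot>\<^bsub>slice C b\<^esub> s \<odot>\<^bsub>slice C b\<^esub> t"
    by (cases r; cases s; cases t) (auto simp: comp_triples_def homs_def)
next
  fix x assume "x \<in> Obj (slice C b)"
  then show "Idt (slice C b) x \<in> homs (slice C b) x x"
    by (auto simp: slice_homs)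
next
  fix t assume "t \<in> Arr (slice C b)"
  then show "Dom (slice C b) t \<in> Obj (slice C b)" "Cod (slice C b) t \<in> Obj (slice C b)"
    "t \<odot>\<^bsub>slice C b\<^esub> Idt (slice C b) (Dom (slice C b) t) = t"
    "Idt (slice C b) (Cod (slice C b) t) \<odot>\<^bsub>slice C b\<^esub> t = t"
    by (cases t; auto simp: homs_def)+
qed

text \<open>An inverse \<open>g\<close> of \<open>h\<close> in \<open>C\<close> is automatically an
  arrow over \<open>b\<close>, since \<open>a \<odot> g = a' \<odot> h \<odot> g = a'\<close>. So
  isomorphisms of the slice are detected in \<open>C\<close>.\<close>

lemma (in category) slice_iso:
  "is_iso (slice C b) (a, h, a') \<longleftrightarrow> (a, h, a') \<in> Arr (slice C b) \<and> is_iso C h"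
proof
  assume *: "is_iso (slice C b) (a, h, a')"
  then obtain t where t: "t \<in> homs (slice C b) a' a"
    "t \<odot>\<^bsub>slice C b\<^esub> (a, h, a') = Idt (slice C b) a" "(a, h, a') \<odot>\<^bsub>slice C b\<^esub> t = Idt (slice C b) a'"
    unfolding is_iso_def by auto
  moreover obtain g where "t = (a', g, a)" "g \<in> Arr C" "Dom C g = Dom C a'" "Cod C g = Dom C a"
    using t unfolding slice_homs by blast
  ultimately have g: "g \<in> Arr C" "Dom C g = Dom C a'" "Cod C g = Dom C a"
    "g \<odot> h = Idt C (Dom C a)" "h \<odot> g = Idt C (Dom C a')"
    by simp_all
  have "(a, h, a') \<in> Arr (slice C b)" using * by (simp add: is_iso_def)
  then have h: "(a, h, a') \<in> Arr (slice C b)" "h \<in> Arr C" "Dom C h = Dom C a" "Cod C h = Dom C a'"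
    by (simp_all add: homs_def)
  have "is_iso C h" by (rule is_isoI[of h g]) (use g h(2-) in simp_all)
  with h show "(a, h, a') \<in> Arr (slice C b) \<and> is_iso C h" by simp
next
  assume *: "(a, h, a') \<in> Arr (slice C b) \<and> is_iso C h"
  then have a: "a \<in> Arr C" "Cod C a = b" "a' \<in> Arr C" "Cod C a' = b"
    "h \<in> Arr C" "Dom C h = Dom C a" "Cod C h = Dom C a'" "a' \<odot> h = a"
    by (simp_all add: homs_def)
  from * obtain g where g: "g \<in> Arr C" "Dom C g = Cod C h" "Cod C g = Dom C h"
    "g \<odot> h = Idt C (Dom C h)" "h \<odot> g = Idt C (Cod C h)"
    using is_isoE by blast
  have "a' \<odot> h \<odot> g = a \<odot> g" by (rule Cmp_reassoc[OF a(8)]) (use a g in simp_all)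
  then have "a \<odot> g = a'" using a g by simp
  then have "(a', g, a) \<in> homs (slice C b) a' a" using a g by (simp add: slice_homs)
  then show "is_iso (slice C b) (a, h, a')"
    using * a g unfolding is_iso_def by (intro conjI bexI[of _ "(a', g, a)"]) simp_all
qed

section \<open>Equivalences\<close>

lemma is_functorD:
  assumes "is_functor C D F"
  shows "category C" "category D" "\<And>x. x \<in> Obj C \<Longrightarrow> omap F x \<in> Obj D"
    "\<And>f. f \<in> Arr C \<Longrightarrow> amap F f \<in> Arr D"
    "\<And>f. f \<in> Arr C \<Longrightarrow> Dom D (amap F f) = omap F (Dom C f)"
    "\<And>f. f \<in> Arr C \<Longrightarrow> Cod D (amap F f) = omap F (Cod C f)"
    "\<And>x. x \<in> Obj C \<Longrightarrow> amap F (Idt C x) = Idt D (omap F x)"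
    "\<And>g f. \<lbrakk>g \<in> Arr C; f \<in> Arr C; Dom C g = Cod C f\<rbrakk> \<Longrightarrow>
       amap F (g \<odot>\<^bsub>C\<^esub> f) = amap F g \<odot>\<^bsub>D\<^esub> amap F f"
  using assms by (auto simp: is_functor_def homs_def comp_pairs_def)

lemma is_functorI:
  assumes "category C" "category D" "\<And>x. x \<in> Obj C \<Longrightarrow> omap F x \<in> Obj D"
    "\<And>f. f \<in> Arr C \<Longrightarrow> amap F f \<in> homs D (omap F (Dom C f)) (omap F (Cod C f))"
    "\<And>x. x \<in> Obj C \<Longrightarrow> amap F (Idt C x) = Idt D (omap F x)"
    "\<And>g f. \<lbrakk>g \<in> Arr C; f \<in> Arr C; Dom C g = Cod C f\<rbrakk> \<Longrightarrow>
       amap F (g \<odot>\<^bsub>C\<^esub> f) = amap F g \<odot>\<^bsub>D\<^esub> amap F f"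
  shows "is_functor C D F"
  using assms by (auto simp: is_functor_def comp_pairs_def)

text \<open>The inverse functor conjugates by chosen isomorphisms \<open>eps d\<close> from images
  under \<open>F\<close> to \<open>d\<close> and lifts the result along the full functor
  \<open>F\<close>. Its functoriality, and naturality and invertibility of the unit, are checked
  after applying \<open>F\<close>, by faithfulness.\<close>

lemma is_equivalenceI:
  fixes C :: "('o1, 'a1) cat" and D :: "('o2, 'a2) cat"
  assumes F: "is_functor C D F"
    and faithful: "\<And>f g. \<lbrakk>f \<in> Arr C; g \<in> Arr C; Dom C f = Dom C g; Cod C f = Cod C g;
      amap F f = amap F g\<rbrakk> \<Longrightarrow> f = g"
    and full: "\<And>x y t. \<lbrakk>x \<in> Obj C; y \<in> Obj C; t \<in> homs D (omap F x) (omap F y)\<rbrakk> \<Longrightarrow>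
      \<exists>f \<in> homs C x y. amap F f = t"
    and ess_surj: "\<And>d. d \<in> Obj D \<Longrightarrow> \<exists>x \<in> Obj C. \<exists>t \<in> homs D (omap F x) d. is_iso D t"
  shows "is_equivalence C D F"
proof -
  interpret C: category C using is_functorD[OF F] by simp
  interpret D: category D using is_functorD[OF F] by simp
  note FD = is_functorD[OF F]
  \<comment> \<open>The object and the isomorphism are chosen together, so that the two components
    of \<open>Q d\<close> belong to each other.\<close>
  define Q where "Q d = (SOME z. fst z \<in> Obj C \<and> snd z \<in> homs D (omap F (fst z)) d \<and>
    is_iso D (snd z))" for d
  define G0 where "G0 d = fst (Q d)" for d
  define eps where "eps d = snd (Q d)" for d
  have Q: "G0 d \<in> Obj C \<and> eps d \<in> homs D (omap F (G0 d)) d \<and> is_iso D (eps d)" if "d \<in> Obj D" for d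
  proof -
    obtain x t where "x \<in> Obj C" "t \<in> homs D (omap F x) d" "is_iso D t"
      using ess_surj[OF \<open>d \<in> Obj D\<close>] by blast
    then have "\<exists>z. fst z \<in> Obj C \<and> snd z \<in> homs D (omap F (fst z)) d \<and> is_iso D (snd z)"
      by (intro exI[of _ "(x, t)"]) simp
    from someI_ex[OF this] show ?thesis by (simp add: Q_def G0_def eps_def)
  qed
  have G0: "G0 d \<in> Obj C" if "d \<in> Obj D" for d using Q[OF that] by simp
  have eps: "eps d \<in> Arr D" "Dom D (eps d) = omap F (G0 d)" "Cod D (eps d) = d" if "d \<in> Obj D" for d
    using Q[OF that] by (auto simp: homs_def)
  define inv where "inv d = (SOME g. g \<in> homs D d (omap F (G0 d)) \<and> g \<odot>\<^bsub>D\<^esub> eps d =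
    Idt D (omap F (G0 d)) \<and>
      eps d \<odot>\<^bsub>D\<^esub> g = Idt D d)" for d
  have "inv d \<in> homs D d (omap F (G0 d)) \<and> inv d \<odot>\<^bsub>D\<^esub> eps d = Idt D (omap F (G0 d)) \<and>
      eps d \<odot>\<^bsub>D\<^esub> inv d = Idt D d" if "d \<in> Obj D" for d
    unfolding inv_def
  proof (rule someI_ex)
    show "\<exists>g. g \<in> homs D d (omap F (G0 d)) \<and> g \<odot>\<^bsub>D\<^esub> eps d = Idt D (omap F (G0 d)) \<and>
      eps d \<odot>\<^bsub>D\<^esub> g = Idt D d"
      using Q[OF that] eps[OF that] unfolding is_iso_def by auto
  qed
  then have inv: "inv d \<in> Arr D" "Dom D (inv d) = d" "Cod D (inv d) = omap F (G0 d)"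
    "inv d \<odot>\<^bsub>D\<^esub> eps d = Idt D (omap F (G0 d))" "eps d \<odot>\<^bsub>D\<^esub> inv d = Idt D d" if "d \<in> Obj D" for d
    using that by (auto simp: homs_def)
  define lift where "lift x y t = (SOME f. f \<in> homs C x y \<and> amap F f = t)" for x y t
  have lift: "lift x y t \<in> Arr C" "Dom C (lift x y t) = x" "Cod C (lift x y t) = y"
    "amap F (lift x y t) = t"
    if "x \<in> Obj C" "y \<in> Obj C" "t \<in> Arr D" "Dom D t = omap F x" "Cod D t = omap F y" for x y t
  proof -
    have "\<exists>f. f \<in> homs C x y \<and> amap F f = t" using full[of x y t] that by (auto simp: homs_def)
    from someI_ex[OF this]
    show "lift x y t \<in> Arr C" "Dom C (lift x y t) = x" "Cod C (lift x y t) = y"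
      "amap F (lift x y t) = t"
      by (auto simp: lift_def homs_def)
  qed
  define G1 where "G1 t = lift (G0 (Dom D t)) (G0 (Cod D t)) (inv (Cod D t) \<odot>\<^bsub>D\<^esub> t \<odot>\<^bsub>D\<^esub> eps (Dom D
    t))" for t
  have G1: "G1 t \<in> Arr C" "Dom C (G1 t) = G0 (Dom D t)" "Cod C (G1 t) = G0 (Cod D t)"
     "amap F (G1 t) = inv (Cod D t) \<odot>\<^bsub>D\<^esub> t \<odot>\<^bsub>D\<^esub> eps (Dom D t)" if "t \<in> Arr D" for t
    using lift[of "G0 (Dom D t)" "G0 (Cod D t)" "inv (Cod D t) \<odot>\<^bsub>D\<^esub> t \<odot>\<^bsub>D\<^esub> eps (Dom D t)"] that
    by (simp_all add: G1_def G0 eps inv)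
  define G where "G = \<lparr>omap = G0, amap = G1\<rparr>"
  have functor_G: "is_functor D C G"
  proof (rule is_functorI)
    fix x assume x: "x \<in> Obj D"
    show "amap G (Idt D x) = Idt C (omap G x)"
      by (rule faithful) (use x in \<open>simp_all add: G_def G0 G1 eps inv FD\<close>)
  next
    fix g f assume a: "g \<in> Arr D" "f \<in> Arr D" "Dom D g = Cod D f"
    \<comment> \<open>The middle factor is displayed because it is an identity: \<open>inv\<close>
      is inverse to \<open>eps\<close>. Cancelling it is all that functoriality requires.\<close>
    have *: "amap F (G1 g) \<odot>\<^bsub>D\<^esub> amap F (G1 f) =
      inv (Cod D g) \<odot>\<^bsub>D\<^esub> g \<odot>\<^bsub>D\<^esub> (eps (Dom D g) \<odot>\<^bsub>D\<^esub> inv (Cod D f)) \<odot>\<^bsub>D\<^esub> f \<odot>\<^bsub>D\<^esub> eps (Dom D f)"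
      using a by (simp add: G1 eps inv(1-3))
    have eq: "amap F (G1 (g \<odot>\<^bsub>D\<^esub> f)) = amap F (G1 g) \<odot>\<^bsub>D\<^esub> amap F (G1 f)"
      unfolding * using a by (simp add: G1 eps inv)
    show "amap G (g \<odot>\<^bsub>D\<^esub> f) = amap G g \<odot>\<^bsub>C\<^esub> amap G f"
      by (rule faithful) (use a eq in \<open>simp_all add: G_def G1(1-3) FD\<close>)
  qed (use G0 G1 FD in \<open>auto simp: G_def homs_def\<close>)
  define eta where "eta x = lift x (G0 (omap F x)) (inv (omap F x))" for x
  have eta: "eta x \<in> Arr C" "Dom C (eta x) = x" "Cod C (eta x) = G0 (omap F x)"
    "amap F (eta x) = inv (omap F x)"
    if "x \<in> Obj C" for x
    using lift[of x "G0 (omap F x)" "inv (omap F x)"] that by (simp_all add: eta_def G0 inv FD)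
  have iso_eta: "is_iso C (eta x)" if x: "x \<in> Obj C" for x
  proof -
    have Fx: "omap F x \<in> Obj D" using x FD by simp
    let ?g = "lift (G0 (omap F x)) x (eps (omap F x))"
    have g: "?g \<in> Arr C" "Dom C ?g = G0 (omap F x)" "Cod C ?g = x" "amap F ?g = eps (omap F x)"
      using lift[of "G0 (omap F x)" x "eps (omap F x)"] x by (simp_all add: G0 eps Fx)
    show ?thesis
    proof (rule C.is_isoI[of _ ?g])
      show "?g \<odot>\<^bsub>C\<^esub> eta x = Idt C (Dom C (eta x))"
        by (rule faithful) (use x g Fx in \<open>simp_all add: eta FD inv\<close>)
      show "eta x \<odot>\<^bsub>C\<^esub> ?g = Idt C (Cod C (eta x))"
        by (rule faithful) (use x g Fx in \<open>simp_all add: eta FD inv G0\<close>)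
    qed (use eta[OF x] g in simp_all)
  qed
  have nat_eta: "nat_iso C C (id_functor C) (comp_functor C G F) eta"
    unfolding nat_iso_def nat_trans_def
  proof (intro conjI ballI)
    fix f assume f: "f \<in> Arr C"
    have *: "inv (omap F (Cod C f)) \<odot>\<^bsub>D\<^esub> amap F f \<odot>\<^bsub>D\<^esub> eps (omap F (Dom C f)) \<odot>\<^bsub>D\<^esub> inv (omap F
      (Dom C f)) =
      inv (omap F (Cod C f)) \<odot>\<^bsub>D\<^esub> amap F f"
      using f by (simp add: inv FD)
    have "G1 (amap F f) \<odot>\<^bsub>C\<^esub> eta (Dom C f) = eta (Cod C f) \<odot>\<^bsub>C\<^esub> f"
      by (rule faithful) (use f * in \<open>simp_all add: G1 eta FD inv(1-3) eps\<close>)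
    then show "amap (comp_functor C G F) f \<odot>\<^bsub>C\<^esub> eta (Dom C f) =
      eta (Cod C f) \<odot>\<^bsub>C\<^esub> amap (id_functor C) f"
      using f by (simp add: comp_functor_def id_functor_def compose_def G_def)
  next
    fix x assume "x \<in> Obj C"
    then show "eta x \<in> homs C (omap (id_functor C) x) (omap (comp_functor C G F) x)"
      by (simp add: homs_def eta id_functor_def comp_functor_def compose_def G_def)
  qed (use iso_eta in simp)
  have nat_eps: "nat_iso D D (comp_functor D F G) (id_functor D) eps"
    unfolding nat_iso_def nat_trans_def
  proof (intro conjI ballI)
    fix f assume f: "f \<in> Arr D"
    have "eps (Cod D f) \<odot>\<^bsub>D\<^esub> amap F (G1 f) = (eps (Cod D f) \<odot>\<^bsub>D\<^esub> inv (Cod D f)) \<odot>\<^bsub>D\<^esub> f \<odot>\<^bsub>D\<^esub> eps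
      (Dom D f)"
      using f by (simp add: G1 eps inv(1-3))
    also have "\<dots> = f \<odot>\<^bsub>D\<^esub> eps (Dom D f)"
      using f by (simp add: inv(5) eps)
    finally show "amap (id_functor D) f \<odot>\<^bsub>D\<^esub> eps (Dom D f) =
      eps (Cod D f) \<odot>\<^bsub>D\<^esub> amap (comp_functor D F G) f"
      using f by (simp add: comp_functor_def id_functor_def compose_def G_def)
  next
    fix x assume "x \<in> Obj D"
    then show "eps x \<in> homs D (omap (comp_functor D F G) x) (omap (id_functor D) x)"
      "is_iso D (eps x)"
      using Q[of x] by (simp_all add: homs_def eps id_functor_def comp_functor_def compose_def
        G_def)
  qed
  show ?thesis
    unfolding is_equivalence_def using F functor_G nat_eta nat_eps by blast
qed

section \<open>The simplicial category\<close>

lemma Arr_aug_Delta: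
  "t \<in> Arr aug_Delta \<longleftrightarrow> (\<exists>m n f. t = (m, n, f) \<and> f \<in> {..<m} \<rightarrow>\<^sub>E {..<n} \<and> mono_on {..<m} f)"
  by (cases t) (simp add: aug_Delta_def)

lemma Arr_Delta: "t \<in> Arr Delta \<longleftrightarrow> t \<in> Arr aug_Delta \<and> 0 < Dom Delta t \<and> 0 < Cod Delta t"
  by (cases t) (auto simp: Delta_def aug_Delta_def)

lemma Delta_simps [simp]:
  "Obj Delta = {n. 0 < n}" "Dom Delta (m, n, f) = m" "Cod Delta (m, n, f) = n"
  "Idt Delta n = (n, n, restrict (\<lambda>i. i) {..<n})"
  "(n', k, g) \<odot>\<^bsub>Delta\<^esub> (m, n, f) = (m, k, compose {..<m} g f)"
  by (simp_all add: Delta_def aug_Delta_def)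

lemma Idt_Delta: "0 < n \<Longrightarrow> Idt Delta n \<in> Arr Delta \<and> Dom Delta (Idt Delta n) = n \<and>
  Cod Delta (Idt Delta n) = n"
  by (auto simp: Arr_Delta Arr_aug_Delta intro!: mono_onI)

lemma Cmp_Delta:
  assumes "g \<in> Arr Delta" "f \<in> Arr Delta" "Dom Delta g = Cod Delta f"
  shows "g \<odot>\<^bsub>Delta\<^esub> f \<in> Arr Delta" "Dom Delta (g \<odot>\<^bsub>Delta\<^esub> f) = Dom Delta f"
    "Cod Delta (g \<odot>\<^bsub>Delta\<^esub> f) = Cod Delta g"
  using assms
  by (auto simp: Arr_Delta Arr_aug_Delta compose_def mono_on_def PiE_iff extensional_def)

text \<open>The points of the ordinal n and, in \<open>edge\<close>, its pairs i <= j, as arrows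
  from 1 and from 2. In a simplicial object they become maps from stage n to stages 1 and 2;
  \<open>edge 1 0 0\<close> becomes the degeneracy from stage 1 to stage 2.\<close>

definition vertex :: "nat \<Rightarrow> nat \<Rightarrow> ord_map" where
  "vertex n i = (1, n, \<lambda>j \<in> {..<1}. i)"

definition edge :: "nat \<Rightarrow> nat \<Rightarrow> nat \<Rightarrow> ord_map" where
  "edge n i j = (2, n, \<lambda>k \<in> {..<2}. if k = 0 then i else j)"

lemma vertex_simps [simp]: "Dom Delta (vertex n i) = 1" "Cod Delta (vertex n i) = n"
  by (simp_all add: vertex_def)

lemma edge_simps [simp]: "Dom Delta (edge n i j) = 2" "Cod Delta (edge n i j) = n"
  by (simp_all add: edge_def)

lemma vertex_in [simp]: "i < n \<Longrightarrow> vertex n i \<in> Arr Delta"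
  by (auto simp: Arr_Delta Arr_aug_Delta vertex_def mono_on_def)

lemma edge_in [simp]: "i \<le> j \<Longrightarrow> j < n \<Longrightarrow> edge n i j \<in> Arr Delta"
  by (auto simp: Arr_Delta Arr_aug_Delta edge_def mono_on_def)

lemma edge_vertex:
  "edge n i j \<odot>\<^bsub>Delta\<^esub> vertex 2 0 = vertex n i"
  "edge n i j \<odot>\<^bsub>Delta\<^esub> vertex 2 (Suc 0) = vertex n j"
  by (auto simp: edge_def vertex_def compose_def fun_eq_iff)

text \<open>For a family of maps out of the stages which does not depend on the vertex used to
  define it, this yields compatibility with every \<open>t\<close>.\<close>

lemma Cmp_vertex:
  assumes "t \<in> Arr Delta" "i < Dom Delta t"
  shows "\<exists>j < Cod Delta t. t \<odot>\<^bsub>Delta\<^esub> vertex (Dom Delta t) i = vertex (Cod Delta t) j"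
  using assms by (auto simp: Arr_Delta Arr_aug_Delta vertex_def compose_def fun_eq_iff PiE_iff)

lemma vertex_Idt: "vertex 1 0 = Idt Delta 1"
  by (auto simp: vertex_def fun_eq_iff)


section \<open>Descent data as cartesian simplicial objects\<close>

lemma terminal_cat_simps [simp]:
  "Obj terminal_cat = UNIV" "Arr terminal_cat = UNIV" "Dom terminal_cat = (\<lambda>_. ())"
  "Cod terminal_cat = (\<lambda>_. ())" "Idt terminal_cat = (\<lambda>_. ())" "Cmp terminal_cat = (\<lambda>_ _. ())"
  by (simp_all add: terminal_cat_def)

lemma terminal_category: "category terminal_cat"
  by unfold_locales (simp_all add: homs_def)

lemma const_psfun_simps [simp]:
  "pobj (const_psfun T) n = T" "parr (const_psfun T) t = id_functor T"
  "pcomp (const_psfun T) g f = Idt T" "punit (const_psfun T) n = Idt T"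
  by (simp_all add: const_psfun_def)

section \<open>Fibre powers and base change\<close>

locale descent = category_with_pullbacks +
  fixes p
  assumes p_in [simp]: "p \<in> Arr C"
begin

abbreviation S where "S \<equiv> fp_str C p"
abbreviation pr where "pr \<equiv> fp_proj C p"
abbreviation D where "D \<equiv> amap (descent_diagram C p)"
abbreviation A where "A \<equiv> descent_psfun C p"

lemma fp_str_in [simp]: "S n \<in> Arr C \<and> Cod C (S n) = Cod C p"
  by (induction n rule: induct_nat_012) simp_all

lemma fp_proj_in [simp]:
  assumes "i < n"
  shows "pr n i \<in> Arr C" "Dom C (pr n i) = Dom C (S n)" "Cod C (pr n i) = Dom C p"
    "p \<odot> pr n i = S n"
proof -
  have "i < n \<longrightarrow> pr n i \<in> Arr C \<and> Dom C (pr n i) = Dom C (S n) \<and> Cod C (pr n i) = Dom C p \<and>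
    p \<odot> pr n i = S n"
  proof (induction n rule: induct_nat_012)
    case (ge2 n)
    have "p \<odot> pr (Suc n) i \<odot> pb1 C (S (Suc n)) p = S (Suc n) \<odot> pb1 C (S (Suc n)) p" if "i < Suc n"
      using ge2 that by (intro Cmp_reassoc) simp_all
    moreover have "p \<odot> pb2 C (S (Suc n)) p = S (Suc n) \<odot> pb1 C (S (Suc n)) p"
      using pb_square[of "S (Suc n)" p] by simp
    ultimately show ?case
      using ge2 by (auto simp: less_Suc_eq)
  qed simp_all
  then show "pr n i \<in> Arr C" "Dom C (pr n i) = Dom C (S n)" "Cod C (pr n i) = Dom C p"
    "p \<odot> pr n i = S n"
    using assms by simp_all
qed

text \<open>Existence half of the universal property of the n-fold fibre power. The arrow
  \<open>u\<close> to the base is a datum of its own: for n = 0 there is no component that would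
  determine it.\<close>

lemma fp_lift:
  assumes "u \<in> Arr C" "Cod C u = Cod C p"
    and "\<And>i. i < n \<Longrightarrow> v i \<in> Arr C \<and> Dom C (v i) = Dom C u \<and> Cod C (v i) = Dom C p \<and> p \<odot> v i = u"
  shows "\<exists>h \<in> Arr C. Dom C h = Dom C u \<and> Cod C h = Dom C (S n) \<and> S n \<odot> h = u \<and>
    (\<forall>i < n. pr n i \<odot> h = v i)"
  using assms(3)
proof (induction n rule: induct_nat_012)
  case 0
  then show ?case using assms(1,2) by (intro bexI[of _ u]) simp_all
next
  case 1
  then show ?case using assms(1,2) by (intro bexI[of _ "v 0"]) simp_all
next
  case (ge2 n)
  have "\<exists>h \<in> Arr C. Dom C h = Dom C u \<and> Cod C h = Dom C (S (Suc n)) \<and> S (Suc n) \<odot> h = u \<and>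
    (\<forall>i < Suc n. pr (Suc n) i \<odot> h = v i)"
    using ge2(2,3) by simp
  then obtain h where h: "h \<in> Arr C" "Dom C h = Dom C u" "Cod C h = Dom C (S (Suc n))"
    "S (Suc n) \<odot> h = u" "\<And>i. i < Suc n \<Longrightarrow> pr (Suc n) i \<odot> h = v i" by blast
  let ?k = "pb_lift C (S (Suc n)) p h (v (Suc n))"
  have v: "v (Suc n) \<in> Arr C" "Dom C (v (Suc n)) = Dom C u" "Cod C (v (Suc n)) = Dom C p"
    "p \<odot> v (Suc n) = u"
    using ge2(3)[of "Suc n"] by simp_all
  have k: "?k \<in> Arr C" "Dom C ?k = Dom C u" "Cod C ?k = Dom C (pb1 C (S (Suc n)) p)"
    "pb1 C (S (Suc n)) p \<odot> ?k = h" "pb2 C (S (Suc n)) p \<odot> ?k = v (Suc n)"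
    using h(1-4) v by simp_all
  show ?case
    using k h(1-4) by (intro bexI[of _ ?k]) (auto simp: less_Suc_eq h(5))
qed

text \<open>Uniqueness half of the universal property. The equation on structure arrows carries the
  case n = 0, where \<open>S 0\<close> is an identity and there are no projections.\<close>

lemma fp_eqI:
  assumes "h \<in> Arr C" "h' \<in> Arr C" "Dom C h = Dom C h'" "Cod C h = Dom C (S n)"
    "Cod C h' = Dom C (S n)"
    and "S n \<odot> h = S n \<odot> h'" "\<And>i. i < n \<Longrightarrow> pr n i \<odot> h = pr n i \<odot> h'"
  shows "h = h'"
  using assms
proof (induction n arbitrary: h h' rule: induct_nat_012)
  case (ge2 n)
  let ?q = "pb1 C (S (Suc n)) p"
  have "?q \<odot> h = ?q \<odot> h'"
  proof (rule ge2(2))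
    fix i assume "i < Suc n"
    then show "pr (Suc n) i \<odot> ?q \<odot> h = pr (Suc n) i \<odot> ?q \<odot> h'"
      using ge2(9)[of i] ge2(3-7) by (simp split: if_splits)
  qed (use ge2(3-8) in simp_all)
  moreover have "pb2 C (S (Suc n)) p \<odot> h = pb2 C (S (Suc n)) p \<odot> h'"
    using ge2(9)[of "Suc n"] by simp
  ultimately show ?case
    using pb_eqI[of "S (Suc n)" p h h'] ge2(3-7) by simp
qed simp_all

text \<open>\<open>D t\<close> is a definite description; the two halves of the universal property
  show that exactly one arrow satisfies it.\<close>

lemma D_simps:
  assumes "t \<in> Arr aug_Delta"
  shows "D t \<in> Arr C" "Dom C (D t) = Dom C (S (Cod Delta t))"
    "Cod C (D t) = Dom C (S (Dom Delta t))"
    "S (Dom Delta t) \<odot> D t = S (Cod Delta t)"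
    "\<And>i. i < Dom Delta t \<Longrightarrow> pr (Dom Delta t) i \<odot> D t = pr (Cod Delta t) (snd (snd t) i)"
proof -
  obtain m n f where t: "t = (m, n, f)" and f: "f \<in> {..<m} \<rightarrow>\<^sub>E {..<n}"
    using assms by (auto simp: Arr_aug_Delta)
  let ?P = "\<lambda>h. h \<in> homs C (Dom C (S n)) (Dom C (S m)) \<and> S m \<odot> h = S n \<and>
    (\<forall>i < m. pr m i \<odot> h = pr n (f i))"
  have "f i < n" if "i < m" for i using f that by auto
  then obtain h where h: "h \<in> Arr C" "Dom C h = Dom C (S n)" "Cod C h = Dom C (S m)" "S m \<odot> h = S n"
    "\<forall>i < m. pr m i \<odot> h = pr n (f i)"
    using fp_lift[of "S n" m "\<lambda>i. pr n (f i)"] by auto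
  have "\<exists>!h. ?P h"
  proof (rule ex1I[of _ h])
    show "?P h" using h by (simp add: homs_def)
    show "h' = h" if "?P h'" for h'
      by (rule fp_eqI[of h' h m]) (use that h in \<open>simp_all add: homs_def\<close>)
  qed
  from theI'[OF this] have "?P (D t)"
    by (simp add: t descent_diagram_def)
  then show "D t \<in> Arr C" "Dom C (D t) = Dom C (S (Cod Delta t))"
    "Cod C (D t) = Dom C (S (Dom Delta t))"
    "S (Dom Delta t) \<odot> D t = S (Cod Delta t)"
    "\<And>i. i < Dom Delta t \<Longrightarrow> pr (Dom Delta t) i \<odot> D t = pr (Cod Delta t) (snd (snd t) i)"
    by (simp_all add: t homs_def)
qed

lemma D_Delta [simp]:
  assumes "t \<in> Arr Delta"
  shows "D t \<in> Arr C" "Dom C (D t) = Dom C (S (Cod Delta t))"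
    "Cod C (D t) = Dom C (S (Dom Delta t))"
    "S (Dom Delta t) \<odot> D t = S (Cod Delta t)"
  using assms D_simps[of t] by (simp_all add: Arr_Delta)

lemma D_Idt: "0 < n \<Longrightarrow> D (Idt Delta n) = Idt C (Dom C (S n))"
  by (rule fp_eqI[of _ _ n])
    (use D_simps[of "Idt Delta n"] Idt_Delta[of n] in \<open>simp_all add: Arr_Delta\<close>)

text \<open>Composition is reversed because the diagram takes values in the opposite category. On
  both sides the i-th component is the projection whose index is the image of i under
  \<open>f\<close> and then \<open>g\<close>.\<close>

lemma D_Cmp:
  assumes "g \<in> Arr Delta" "f \<in> Arr Delta" "Dom Delta g = Cod Delta f"
  shows "D (g \<odot>\<^bsub>Delta\<^esub> f) = D f \<odot> D g"
proof (rule fp_eqI[of _ _ "Dom Delta f"])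
  note c = Cmp_Delta[OF assms]
  show "S (Dom Delta f) \<odot> D (g \<odot>\<^bsub>Delta\<^esub> f) = S (Dom Delta f) \<odot> D f \<odot> D g"
    using c assms D_Delta(4)[OF c(1)] D_Delta(4)[OF assms(1)]
      by (simp add: Cmp_reassoc[OF D_Delta(4)[OF assms(2)]])
  fix i assume i: "i < Dom Delta f"
  have g: "g \<in> Arr aug_Delta" and f: "f \<in> Arr aug_Delta" and gf: "g \<odot>\<^bsub>Delta\<^esub> f \<in> Arr aug_Delta"
    using assms c by (simp_all add: Arr_Delta)
  have "snd (snd f) i < Dom Delta g" "snd (snd (g \<odot>\<^bsub>Delta\<^esub> f)) i = snd (snd g) (snd (snd f) i)"
    using f g assms(3) i by (auto simp: Arr_aug_Delta compose_def)
  then show "pr (Dom Delta f) i \<odot> D (g \<odot>\<^bsub>Delta\<^esub> f) = pr (Dom Delta f) i \<odot> D f \<odot> D g"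
    using D_simps(5)[OF f i] D_simps(5)[OF gf] D_simps(5)[OF g] c assms i
    by (simp add: Cmp_reassoc[OF D_simps(5)[OF f i]])
qed (use Cmp_Delta[OF assms] assms in simp_all)

text \<open>The 0-fold power is the base with an identity as structure arrow, so an arrow into it
  over the base is its own structure arrow. Hence the functors that make up the comparison are base
  changes along \<open>S n\<close>.\<close>

lemma D_from_zero: "D (from_zero n) = S n"
proof -
  have "from_zero n \<in> Arr aug_Delta" by (simp add: from_zero_def Arr_aug_Delta mono_on_def)
  note * = D_simps[OF this]
  show ?thesis
    by (rule fp_eqI[of _ _ 0]) (use *(1-4) in \<open>simp_all add: from_zero_def\<close>)
qed

lemma fp_str_vertex: "0 < n \<Longrightarrow> i < n \<Longrightarrow> p \<odot> D (vertex n i) = S n"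
  using D_Delta(4)[of "vertex n i"] by simp

lemma descent_psfun_simps [simp]:
  "pobj A n = slice C (Dom C (S n))" "parr A t = base_change C (D t)"
  "pcomp A g f a = (pb1 C (D g) (pb1 C (D f) a),
     pb_lift C (D f \<odot> D g) a (pb1 C (D g) (pb1 C (D f) a)) (pb2 C (D f) a \<odot> pb2 C (D g) (pb1 C
       (D f) a)),
     pb1 C (D f \<odot> D g) a)"
  "punit A n a = (a, pb_lift C (Idt C (Dom C (S n))) a a (Idt C (Dom C a)),
    pb1 C (Idt C (Dom C (S n))) a)"
  by (simp_all add: descent_psfun_def psfun_comp_functor_def basic_fibration_def
    descent_diagram_def)

lemma base_change_simps [simp]:
  "omap (base_change C u) a = pb1 C u a"
  "amap (base_change C u) (a, h, a') =
     (pb1 C u a, pb_lift C u a' (pb1 C u a) (h \<odot> pb2 C u a), pb1 C u a')"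
  by (simp_all add: base_change_def)

text \<open>This is the base change \<open>u^*\<close> applied to \<open>h\<close>, without the
  source and target that make it an arrow of the slice.\<close>

abbreviation pull_arr where
  "pull_arr u a h a' \<equiv> pb_lift C u a' (pb1 C u a) (h \<odot> pb2 C u a)"

lemma pb_slice_square:
  assumes "u \<in> Arr C" "a \<in> Arr C" "a' \<in> Arr C" "Cod C a = Cod C u" "Cod C a' = Cod C u"
    and "h \<in> Arr C" "Dom C h = Dom C a" "Cod C h = Dom C a'" "a' \<odot> h = a"
  shows "u \<odot> pb1 C u a = a' \<odot> h \<odot> pb2 C u a"
  using pb_square[of u a] Cmp_reassoc[OF assms(9), of "pb2 C u a"] assms(1-8) by simp

lemma pb_lift_slice:
  assumes "u \<in> Arr C" "a \<in> Arr C" "a' \<in> Arr C" "Cod C a = Cod C u" "Cod C a' = Cod C u"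
    and "h \<in> Arr C" "Dom C h = Dom C a" "Cod C h = Dom C a'" "a' \<odot> h = a"
  shows "pull_arr u a h a' \<in> Arr C"
    "Dom C (pull_arr u a h a') = Dom C (pb1 C u a)"
    "Cod C (pull_arr u a h a') = Dom C (pb1 C u a')"
    "pb1 C u a' \<odot> pull_arr u a h a' = pb1 C u a"
    "pb2 C u a' \<odot> pull_arr u a h a' = h \<odot> pb2 C u a"
  using pb_slice_square[OF assms] assms(1-8) by simp_all

lemma pb_lift_slice_Idt:
  assumes "u \<in> Arr C" "a \<in> Arr C" "Cod C a = Cod C u"
  shows "pull_arr u a (Idt C (Dom C a)) a = Idt C (Dom C (pb1 C u a))"
proof -
  have i: "Idt C (Dom C a) \<in> Arr C" "Dom C (Idt C (Dom C a)) = Dom C a"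
    "Cod C (Idt C (Dom C a)) = Dom C a" "a \<odot> Idt C (Dom C a) = a"
    using assms by simp_all
  note L = pb_lift_slice[OF assms(1,2,2,3,3) i]
  show ?thesis
  proof (rule pb_eqI[of u a])
    show "pb1 C u a \<odot> pull_arr u a (Idt C (Dom C a)) a =
      pb1 C u a \<odot> Idt C (Dom C (pb1 C u a))"
      unfolding L(4) using assms by simp
    show "pb2 C u a \<odot> pull_arr u a (Idt C (Dom C a)) a =
      pb2 C u a \<odot> Idt C (Dom C (pb1 C u a))"
      unfolding L(5) using assms by simp
  qed (use L(1-3) assms in simp_all)
qed

lemma pb_lift_slice_Cmp:
  assumes u: "u \<in> Arr C" "a \<in> Arr C" "a' \<in> Arr C" "a'' \<in> Arr C"
      "Cod C a = Cod C u" "Cod C a' = Cod C u" "Cod C a'' = Cod C u"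
    and h: "h \<in> Arr C" "Dom C h = Dom C a" "Cod C h = Dom C a'" "a' \<odot> h = a"
    and k: "k \<in> Arr C" "Dom C k = Dom C a'" "Cod C k = Dom C a''" "a'' \<odot> k = a'"
  shows "pull_arr u a' k a'' \<odot> pull_arr u a h a' =
    pull_arr u a (k \<odot> h) a''" (is "?k \<odot> ?h = ?kh")
proof -
  have kh: "a'' \<odot> k \<odot> h = a" using Cmp_reassoc[OF k(4), of h] u h k by simp
  note L = pb_lift_slice[OF u(1) u(2) u(3) u(5) u(6) h]
  note M = pb_lift_slice[OF u(1) u(3) u(4) u(6) u(7) k]
  have kh': "k \<odot> h \<in> Arr C" "Dom C (k \<odot> h) = Dom C a" "Cod C (k \<odot> h) = Dom C a''"
    using h(1-3) k(1-3) by simp_all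
  have N: "?kh \<in> Arr C" "Dom C ?kh = Dom C (pb1 C u a)" "Cod C ?kh = Dom C (pb1 C u a'')"
    "pb1 C u a'' \<odot> ?kh = pb1 C u a" "pb2 C u a'' \<odot> ?kh = (k \<odot> h) \<odot> pb2 C u a"
    by (fact pb_lift_slice[OF u(1) u(2) u(4) u(5) u(7) kh' kh])+
  show ?thesis
  proof (rule pb_eqI[of u a''])
    show "pb1 C u a'' \<odot> ?k \<odot> ?h = pb1 C u a'' \<odot> ?kh"
      unfolding N(4) using Cmp_reassoc[OF M(4), of ?h] L(4) M(1-3) L(1-3) u by simp
    have "pb2 C u a'' \<odot> ?k \<odot> ?h = (k \<odot> pb2 C u a') \<odot> ?h"
      using Cmp_reassoc[OF M(5), of ?h] M(1-3) L(1-3) u by simp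
    also have "\<dots> = k \<odot> pb2 C u a' \<odot> ?h" using L(1-3) u k by simp
    also have "\<dots> = (k \<odot> h) \<odot> pb2 C u a" unfolding L(5) using u h k by simp
    finally show "pb2 C u a'' \<odot> ?k \<odot> ?h = pb2 C u a'' \<odot> ?kh" unfolding N(5) .
  qed (use u L(1-3) M(1-3) N(1-3) in simp_all)
qed

text \<open>Base change is functorial, so the base change of the inverse is an inverse.\<close>

lemma pb_lift_slice_iso:
  assumes u: "u \<in> Arr C" "a \<in> Arr C" "a' \<in> Arr C" "Cod C a = Cod C u" "Cod C a' = Cod C u"
    and h: "h \<in> Arr C" "Dom C h = Dom C a" "Cod C h = Dom C a'" "a' \<odot> h = a" and iso: "is_iso C h"
  shows "is_iso C (pull_arr u a h a')"
proof -
  obtain g where g: "g \<in> Arr C" "Dom C g = Dom C a'" "Cod C g = Dom C a"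
    "g \<odot> h = Idt C (Dom C a)" "h \<odot> g = Idt C (Dom C a')"
    using is_isoE[OF iso] h by metis
  have ag: "a \<odot> g = a'" using Cmp_reassoc[OF h(4), of g] g h u by simp
  show ?thesis
    using pb_lift_slice[OF u h] pb_lift_slice[OF u(1) u(3) u(2) u(5) u(4) g(1-3) ag]
      pb_lift_slice_Cmp[OF u(1) u(2) u(3) u(2) u(4) u(5) u(4) h g(1-3) ag]
      pb_lift_slice_Cmp[OF u(1) u(3) u(2) u(3) u(5) u(4) u(5) g(1-3) ag h] g(4,5)
      pb_lift_slice_Idt[of u a] pb_lift_slice_Idt[of u a'] u
    by (intro is_isoI[of _ "pull_arr u a' g a"]) simp_all
qed

text \<open>Collects the facts on the two arrows out of the iterated pullback that occur in the
  composition axiom: \<open>l\<close> is the structure isomorphism to the pullback of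
  \<open>a\<close> along \<open>u \<odot> v\<close>, and \<open>l'\<close> is the base change along
  \<open>v\<close> of a slice arrow \<open>k\<close>. Both translations of that axiom rely on
  it.\<close>

lemma pb_lift_composite:
  assumes u: "u \<in> Arr C" "v \<in> Arr C" "Cod C v = Dom C u"
    and ab: "a \<in> Arr C" "Cod C a = Cod C u" "b \<in> Arr C" "Cod C b = Dom C u"
    and k: "k \<in> Arr C" "Dom C k = Dom C (pb1 C u a)" "Cod C k = Dom C b" "b \<odot> k = pb1 C u a"
  defines "r \<equiv> pb1 C u a"
  defines "w \<equiv> pb2 C u a \<odot> pb2 C v r"
  defines "l \<equiv> pb_lift C (u \<odot> v) a (pb1 C v r) w" and "l' \<equiv> pull_arr v r k b"
  shows "l \<in> Arr C" "Dom C l = Dom C (pb1 C v r)" "Cod C l = Dom C (pb1 C (u \<odot> v) a)"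
    "pb1 C (u \<odot> v) a \<odot> l = pb1 C v r" "pb2 C (u \<odot> v) a \<odot> l = w"
    "l' \<in> Arr C" "Dom C l' = Dom C (pb1 C v r)" "Cod C l' = Dom C (pb1 C v b)"
    "pb1 C v b \<odot> l' = pb1 C v r" "pb2 C v b \<odot> l' = k \<odot> pb2 C v r" "is_iso C k \<Longrightarrow> is_iso C l'"
    "pb2 C v r \<in> Arr C" "Cod C (pb2 C v r) = Dom C k"
proof -
  have r: "r \<in> Arr C" "Cod C r = Dom C u" "u \<odot> r = a \<odot> pb2 C u a"
    unfolding r_def using u ab pb_square[of u a] by simp_all
  have q: "pb1 C v r \<in> Arr C" "pb2 C v r \<in> Arr C" "Dom C (pb2 C v r) = Dom C (pb1 C v r)"
    "Cod C (pb1 C v r) = Dom C v" "Cod C (pb2 C v r) = Dom C r" "v \<odot> pb1 C v r = r \<odot> pb2 C v r"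
    using r u pb_square[of v r] by simp_all
  have "(u \<odot> v) \<odot> pb1 C v r = u \<odot> r \<odot> pb2 C v r"
    using u q(1-5) by (simp add: q(6))
  also have "\<dots> = a \<odot> w"
    using Cmp_reassoc[OF r(3), of "pb2 C v r"] r(1,2) q(2-5) u ab by (simp add: w_def r_def)
  finally show "l \<in> Arr C" "Dom C l = Dom C (pb1 C v r)" "Cod C l = Dom C (pb1 C (u \<odot> v) a)"
    "pb1 C (u \<odot> v) a \<odot> l = pb1 C v r" "pb2 C (u \<odot> v) a \<odot> l = w"
    unfolding l_def using u ab q(1-5) by (simp_all add: w_def r_def)
  have s: "v \<in> Arr C" "r \<in> Arr C" "b \<in> Arr C" "Cod C r = Cod C v" "Cod C b = Cod C v"
      "k \<in> Arr C" "Dom C k = Dom C r" "Cod C k = Dom C b" "b \<odot> k = r"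
    using u ab r k by (simp_all add: r_def)
  show "l' \<in> Arr C" "Dom C l' = Dom C (pb1 C v r)" "Cod C l' = Dom C (pb1 C v b)"
    "pb1 C v b \<odot> l' = pb1 C v r" "pb2 C v b \<odot> l' = k \<odot> pb2 C v r" "is_iso C k \<Longrightarrow> is_iso C l'"
    unfolding l'_def by (rule pb_lift_slice[OF s] pb_lift_slice_iso[OF s])+
  show "pb2 C v r \<in> Arr C" "Cod C (pb2 C v r) = Dom C k"
    using q k by (simp_all add: r_def)
qed

section \<open>Pseudonatural transformations and cartesian simplicial objects\<close>

definition simplicial where
  "simplicial X T \<longleftrightarrow>
     (\<forall>n > 0. X n \<in> Arr C \<and> Cod C (X n) = Dom C (S n)) \<and>
     (\<forall>t \<in> Arr Delta. T t \<in> Arr C \<and> Dom C (T t) = Dom C (X (Cod Delta t)) \<and>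
        Cod C (T t) = Dom C (X (Dom Delta t)) \<and>
        is_pullback C (D t) (X (Dom Delta t)) (X (Cod Delta t)) (T t)) \<and>
     (\<forall>n > 0. T (Idt Delta n) = Idt C (Dom C (X n))) \<and>
     (\<forall>g \<in> Arr Delta. \<forall>f \<in> Arr Delta. Dom Delta g = Cod Delta f \<longrightarrow>
        T (g \<odot>\<^bsub>Delta\<^esub> f) = T f \<odot> T g)"

lemma simplicialD:
  assumes "simplicial X T"
  shows "\<And>n. 0 < n \<Longrightarrow> X n \<in> Arr C" "\<And>n. 0 < n \<Longrightarrow> Cod C (X n) = Dom C (S n)"
    "\<And>t. t \<in> Arr Delta \<Longrightarrow> T t \<in> Arr C" "\<And>t. t \<in> Arr Delta \<Longrightarrow> Dom C (T t) = Dom C (X (Cod Delta t))"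
    "\<And>t. t \<in> Arr Delta \<Longrightarrow> Cod C (T t) = Dom C (X (Dom Delta t))"
    "\<And>t. t \<in> Arr Delta \<Longrightarrow> is_pullback C (D t) (X (Dom Delta t)) (X (Cod Delta t)) (T t)"
    "\<And>t. t \<in> Arr Delta \<Longrightarrow> X (Dom Delta t) \<odot> T t = D t \<odot> X (Cod Delta t)"
    "\<And>n. 0 < n \<Longrightarrow> T (Idt Delta n) = Idt C (Dom C (X n))"
    "\<And>g f. \<lbrakk>g \<in> Arr Delta; f \<in> Arr Delta; Dom Delta g = Cod Delta f\<rbrakk> \<Longrightarrow> T (g \<odot>\<^bsub>Delta\<^esub> f) = T f \<odot> T g"
proof -
  show "\<And>t. t \<in> Arr Delta \<Longrightarrow> is_pullback C (D t) (X (Dom Delta t)) (X (Cod Delta t)) (T t)"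
    using assms unfolding simplicial_def by blast
  then show "\<And>t. t \<in> Arr Delta \<Longrightarrow> X (Dom Delta t) \<odot> T t = D t \<odot> X (Cod Delta t)"
    using is_pullbackD(6) by metis
qed (use assms in \<open>unfold simplicial_def, blast+\<close>)

abbreviation psnat where "psnat \<equiv> is_psnat Delta (const_psfun terminal_cat) A"

text \<open>Out of the terminal category, a functor is an object and a natural transformation an
  arrow. So a descent datum consists of one object over each fibre power and, for each
  \<open>t\<close>, one isomorphism, whose underlying arrow of \<open>C\<close> is
  \<open>cocycle\<close>.\<close>

definition stage where "stage \<alpha> n = omap (pncomp \<alpha> n) ()"
definition cocycle where "cocycle \<alpha> t = fst (snd (pnsq \<alpha> t ()))"

lemma Dom_Delta_pos [simp]: "t \<in> Arr Delta \<Longrightarrow> 0 < Dom Delta t" "t \<in> Arr Delta \<Longrightarrow> 0 < Cod Delta t"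
  by (simp_all add: Arr_Delta)

text \<open>Translates pseudonaturality into equations between arrows of \<open>C\<close>. The last
  two are the unit and the composition axiom; in the latter, the \<open>pb_lift\<close> on the left
  is the structure isomorphism of the basic fibration and \<open>pull_arr\<close> on the right the
  base change of a cocycle.\<close>

lemma psnatD:
  assumes "psnat \<alpha>"
  shows "pncomp \<alpha> \<in> extensional (Obj Delta)" "pnsq \<alpha> \<in> extensional (Arr Delta)"
    "\<And>n. 0 < n \<Longrightarrow> stage \<alpha> n \<in> Arr C" "\<And>n. 0 < n \<Longrightarrow> Cod C (stage \<alpha> n) = Dom C (S n)"
    "\<And>n. 0 < n \<Longrightarrow> pncomp \<alpha> n = \<lparr>omap = \<lambda>_. stage \<alpha> n, amap =
      \<lambda>_. (stage \<alpha> n, Idt C (Dom C (stage \<alpha> n)), stage \<alpha> n)\<rparr>"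
    "\<And>t. t \<in> Arr Delta \<Longrightarrow> pnsq \<alpha> t = (\<lambda>_. (pb1 C (D t) (stage \<alpha> (Dom Delta t)), cocycle \<alpha> t,
      stage \<alpha> (Cod Delta t)))"
    "\<And>t. t \<in> Arr Delta \<Longrightarrow> cocycle \<alpha> t \<in> Arr C"
    "\<And>t. t \<in> Arr Delta \<Longrightarrow> Dom C (cocycle \<alpha> t) = Dom C (pb1 C (D t) (stage \<alpha> (Dom Delta t)))"
    "\<And>t. t \<in> Arr Delta \<Longrightarrow> Cod C (cocycle \<alpha> t) = Dom C (stage \<alpha> (Cod Delta t))"
    "\<And>t. t \<in> Arr Delta \<Longrightarrow> stage \<alpha> (Cod Delta t) \<odot> cocycle \<alpha> t = pb1 C (D t) (stage \<alpha> (Dom Delta t))"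
    "\<And>t. t \<in> Arr Delta \<Longrightarrow> is_iso C (cocycle \<alpha> t)"
    "\<And>n. 0 < n \<Longrightarrow> cocycle \<alpha> (Idt Delta n) \<odot> pb_lift C (Idt C (Dom C (S n))) (stage \<alpha> n) (stage \<alpha> n)
      (Idt C (Dom C (stage \<alpha> n))) =
       Idt C (Dom C (stage \<alpha> n))"
    "\<And>g f. \<lbrakk>g \<in> Arr Delta; f \<in> Arr Delta; Dom Delta g = Cod Delta f\<rbrakk> \<Longrightarrow>
       cocycle \<alpha> (g \<odot>\<^bsub>Delta\<^esub> f) \<odot> pb_lift C (D f \<odot> D g) (stage \<alpha> (Dom Delta f)) (pb1 C (D g)
         (pb1 C (D f) (stage \<alpha> (Dom Delta f))))
         (pb2 C (D f) (stage \<alpha> (Dom Delta f)) \<odot> pb2 C (D g) (pb1 C (D f) (stage \<alpha> (Dom Delta f)))) =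
       cocycle \<alpha> g \<odot> pull_arr (D g) (pb1 C (D f) (stage \<alpha> (Dom Delta f))) (cocycle \<alpha> f) (stage \<alpha>
         (Cod Delta f))"
proof -
  note psn = assms[unfolded is_psnat_def]
  show "pncomp \<alpha> \<in> extensional (Obj Delta)" "pnsq \<alpha> \<in> extensional (Arr Delta)"
    using psn by blast+
  have fn: "is_functor terminal_cat (slice C (Dom C (S n))) (pncomp \<alpha> n)" if "0 < n" for n
    using psn that by simp
  have stage: "stage \<alpha> n \<in> Arr C \<and> Cod C (stage \<alpha> n) = Dom C (S n)" if "0 < n" for n
    using is_functorD(3)[OF fn[OF that], of "()"] by (simp add: stage_def)
  then show X1: "stage \<alpha> n \<in> Arr C" "Cod C (stage \<alpha> n) = Dom C (S n)" if "0 < n" for n using that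
    by simp_all
  \<comment> \<open>The only arrow of the terminal category is an identity, so functoriality
    determines its image.\<close>
  have pn: "pncomp \<alpha> n = \<lparr>omap = \<lambda>_. stage \<alpha> n, amap = \<lambda>_. (stage \<alpha> n, Idt C (Dom C (stage \<alpha> n)),
    stage \<alpha> n)\<rparr>" if "0 < n" for n
    using is_functorD(7)[OF fn[OF that], of "()"]
    by (intro fctr.equality) (simp_all add: stage_def fun_eq_iff)
  then show "pncomp \<alpha> n = \<lparr>omap = \<lambda>_. stage \<alpha> n, amap = \<lambda>_. (stage \<alpha> n, Idt C (Dom C (stage \<alpha> n)),
    stage \<alpha> n)\<rparr>" if "0 < n" for n
    using that .
  have ni: "pnsq \<alpha> t () \<in> homs (slice C (Dom C (S (Cod Delta t)))) (pb1 C (D t) (stage \<alpha>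
    (Dom Delta t))) (stage \<alpha> (Cod Delta t)) \<and>
    is_iso (slice C (Dom C (S (Cod Delta t)))) (pnsq \<alpha> t ())" if t: "t \<in> Arr Delta" for t
  proof -
    have "nat_iso (pobj (const_psfun terminal_cat) (Dom Delta t)) (pobj A (Cod Delta t))
          (comp_functor (pobj (const_psfun terminal_cat) (Dom Delta t)) (parr A t) (pncomp \<alpha>
            (Dom Delta t)))
          (comp_functor (pobj (const_psfun terminal_cat) (Dom Delta t)) (pncomp \<alpha> (Cod Delta t))
            (parr (const_psfun terminal_cat) t))
          (pnsq \<alpha> t)"
      using psn that by auto
    then show ?thesis
      unfolding nat_iso_def nat_trans_def using pn that
      by (simp add: comp_functor_def compose_def id_functor_def)
  qed
  have sq: "pnsq \<alpha> t = (\<lambda>_. (pb1 C (D t) (stage \<alpha> (Dom Delta t)), cocycle \<alpha> t,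
    stage \<alpha> (Cod Delta t)))"
    and cocycle: "cocycle \<alpha> t \<in> Arr C \<and> Dom C (cocycle \<alpha> t) =
      Dom C (pb1 C (D t) (stage \<alpha> (Dom Delta t))) \<and>
      Cod C (cocycle \<alpha> t) = Dom C (stage \<alpha> (Cod Delta t)) \<and>
      stage \<alpha> (Cod Delta t) \<odot> cocycle \<alpha> t = pb1 C (D t) (stage \<alpha> (Dom Delta t)) \<and>
        is_iso C (cocycle \<alpha> t)"
    if t: "t \<in> Arr Delta" for t
  proof -
    obtain h where h: "pnsq \<alpha> t () = (pb1 C (D t) (stage \<alpha> (Dom Delta t)), h,
      stage \<alpha> (Cod Delta t))"
      "h \<in> Arr C" "Dom C h = Dom C (pb1 C (D t) (stage \<alpha> (Dom Delta t)))"
        "Cod C h = Dom C (stage \<alpha> (Cod Delta t))"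
      "stage \<alpha> (Cod Delta t) \<odot> h = pb1 C (D t) (stage \<alpha> (Dom Delta t))"
      using ni[OF t] unfolding slice_homs by blast
    have [simp]: "cocycle \<alpha> t = h" by (simp add: cocycle_def h(1))
    have "is_iso C h" using ni[OF t] unfolding h(1) by (simp add: slice_iso)
    then show "cocycle \<alpha> t \<in> Arr C \<and> Dom C (cocycle \<alpha> t) =
      Dom C (pb1 C (D t) (stage \<alpha> (Dom Delta t))) \<and>
      Cod C (cocycle \<alpha> t) = Dom C (stage \<alpha> (Cod Delta t)) \<and>
      stage \<alpha> (Cod Delta t) \<odot> cocycle \<alpha> t = pb1 C (D t) (stage \<alpha> (Dom Delta t)) \<and>
        is_iso C (cocycle \<alpha> t)"
      using h(2-) by simp
    show "pnsq \<alpha> t = (\<lambda>_. (pb1 C (D t) (stage \<alpha> (Dom Delta t)), cocycle \<alpha> t,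
      stage \<alpha> (Cod Delta t)))"
      by (simp add: fun_eq_iff h(1))
  qed
  show "pnsq \<alpha> t = (\<lambda>_. (pb1 C (D t) (stage \<alpha> (Dom Delta t)), cocycle \<alpha> t, stage \<alpha> (Cod Delta t)))"
    "cocycle \<alpha> t \<in> Arr C" "Dom C (cocycle \<alpha> t) = Dom C (pb1 C (D t) (stage \<alpha> (Dom Delta t)))"
    "Cod C (cocycle \<alpha> t) = Dom C (stage \<alpha> (Cod Delta t))"
    "stage \<alpha> (Cod Delta t) \<odot> cocycle \<alpha> t = pb1 C (D t) (stage \<alpha> (Dom Delta t))"
      "is_iso C (cocycle \<alpha> t)" if "t \<in> Arr Delta" for t
    using sq[OF that] cocycle[OF that] by simp_all
  show "cocycle \<alpha> (Idt Delta n) \<odot> pb_lift C (Idt C (Dom C (S n))) (stage \<alpha> n) (stage \<alpha> n) (Idt C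
    (Dom C (stage \<alpha> n))) =
       Idt C (Dom C (stage \<alpha> n))" if n: "0 < n" for n
  proof -
    show ?thesis
      using psn[THEN conjunct2, THEN conjunct2, THEN conjunct2, THEN conjunct2, THEN conjunct1,
          rule_format, of n "()"] n Idt_Delta[OF n] by (simp del: Delta_simps(4) add: pn sq)
  qed
  show "cocycle \<alpha> (g \<odot>\<^bsub>Delta\<^esub> f) \<odot> pb_lift C (D f \<odot> D g) (stage \<alpha> (Dom Delta f)) (pb1 C (D g)
    (pb1 C (D f) (stage \<alpha> (Dom Delta f))))
         (pb2 C (D f) (stage \<alpha> (Dom Delta f)) \<odot> pb2 C (D g) (pb1 C (D f) (stage \<alpha> (Dom Delta f)))) =
       cocycle \<alpha> g \<odot> pull_arr (D g) (pb1 C (D f) (stage \<alpha> (Dom Delta f))) (cocycle \<alpha> f) (stage \<alpha>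
         (Cod Delta f))"
    if gf: "g \<in> Arr Delta" "f \<in> Arr Delta" "Dom Delta g = Cod Delta f" for g f
  proof -
    have "(g, f) \<in> comp_pairs Delta" using gf by (simp add: comp_pairs_def)
    note * = psn[THEN conjunct2, THEN conjunct2, THEN conjunct2, THEN conjunct2, THEN conjunct2,
      THEN bspec, OF this, unfolded prod.case, rule_format, of "()"]
    let ?L = "pull_arr (D g) (pb1 C (D f) (stage \<alpha> (Dom Delta f))) (cocycle \<alpha> f) (stage \<alpha>
      (Cod Delta f))"
    have c: "D g \<in> Arr C" "pb1 C (D f) (stage \<alpha> (Dom Delta f)) \<in> Arr C"
      "stage \<alpha> (Cod Delta f) \<in> Arr C"
      "Cod C (pb1 C (D f) (stage \<alpha> (Dom Delta f))) = Cod C (D g)" "Cod C (stage \<alpha> (Cod Delta f)) =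
        Cod C (D g)"
      "cocycle \<alpha> f \<in> Arr C" "Dom C (cocycle \<alpha> f) = Dom C (pb1 C (D f) (stage \<alpha> (Dom Delta f)))"
      "Cod C (cocycle \<alpha> f) = Dom C (stage \<alpha> (Cod Delta f))"
      "stage \<alpha> (Cod Delta f) \<odot> cocycle \<alpha> f = pb1 C (D f) (stage \<alpha> (Dom Delta f))"
      using gf stage cocycle[of f] by simp_all
    have L: "?L \<in> Arr C" "Cod C ?L = Dom C (pb1 C (D g) (stage \<alpha> (Cod Delta f)))"
      by (rule pb_lift_slice[OF c])+
    show ?thesis
      using * gf Cmp_Delta[OF gf] L cocycle[of g] stage
      by (simp add: pn sq[OF gf(1)] sq[OF gf(2)] sq[OF Cmp_Delta(1)[OF gf]])
  qed
qed


text \<open>The projection of the chosen pullback, preceded by the inverse of the structure isomorphism.\<close>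

definition transition where
  "transition \<alpha> t = (SOME u. u \<in> Arr C \<and> Dom C u = Dom C (stage \<alpha> (Cod Delta t)) \<and>
    u \<odot> cocycle \<alpha> t = pb2 C (D t) (stage \<alpha> (Dom Delta t)))"

lemma transition_simps:
  assumes a: "psnat \<alpha>" and t: "t \<in> Arr Delta"
  shows "transition \<alpha> t \<in> Arr C" "Dom C (transition \<alpha> t) = Dom C (stage \<alpha> (Cod Delta t))"
    "Cod C (transition \<alpha> t) = Dom C (stage \<alpha> (Dom Delta t))" "transition \<alpha> t \<odot> cocycle \<alpha> t =
      pb2 C (D t) (stage \<alpha> (Dom Delta t))"
proof -
  note P = psnatD[OF a]
  let ?q = "pb2 C (D t) (stage \<alpha> (Dom Delta t))"
  have q: "?q \<in> Arr C" "Dom C ?q = Dom C (cocycle \<alpha> t)" "Cod C ?q = Dom C (stage \<alpha> (Dom Delta t))"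
    using P(3,4,8) t by simp_all
  obtain g where g: "g \<in> Arr C" "Dom C g = Cod C (cocycle \<alpha> t)" "Cod C g = Dom C (cocycle \<alpha> t)"
    "g \<odot> cocycle \<alpha> t = Idt C (Dom C (cocycle \<alpha> t))"
    using is_isoE[OF P(11)[OF t]] by metis
  have "(?q \<odot> g) \<odot> cocycle \<alpha> t = ?q" using q(1,2) g P(7)[OF t] by simp
  moreover have "?q \<odot> g \<in> Arr C" "Dom C (?q \<odot> g) = Dom C (stage \<alpha> (Cod Delta t))"
    using q(1,2) g(1-3) P(9)[OF t] by simp_all
  ultimately have "\<exists>u. u \<in> Arr C \<and> Dom C u = Dom C (stage \<alpha> (Cod Delta t)) \<and> u \<odot> cocycle \<alpha> t = ?q"
    by blast
  from someI_ex[OF this]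
  show transition: "transition \<alpha> t \<in> Arr C" "Dom C (transition \<alpha> t) =
    Dom C (stage \<alpha> (Cod Delta t))" "transition \<alpha> t \<odot> cocycle \<alpha> t = ?q"
    by (simp_all add: transition_def)
  have "Cod C (transition \<alpha> t) = Cod C (transition \<alpha> t \<odot> cocycle \<alpha> t)"
    using transition(1,2) P(7,9)[OF t] by simp
  then show "Cod C (transition \<alpha> t) = Dom C (stage \<alpha> (Dom Delta t))"
    unfolding transition(3) using q by simp
qed

text \<open>The cocycle is invertible and can be cancelled, so the equation in the definition of
  \<open>transition\<close> determines it.\<close>

lemma transition_eqI:
  assumes a: "psnat \<alpha>" and t: "t \<in> Arr Delta"
    and u: "u \<in> Arr C" "Dom C u = Dom C (stage \<alpha> (Cod Delta t))"
      "u \<odot> cocycle \<alpha> t = pb2 C (D t) (stage \<alpha> (Dom Delta t))"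
  shows "transition \<alpha> t = u"
  by (rule iso_cancel_right[OF psnatD(11)[OF a t]])
    (use transition_simps[OF a t] u psnatD(9)[OF a t] in simp_all)

text \<open>The cocycle is an isomorphism from the chosen pullback onto the square of the stages,
  which is therefore cartesian. Followed by second projections, the structure isomorphisms of the
  basic fibration become an identity or a composite of projections, so the unit and composition
  axioms turn into strict functoriality.\<close>

lemma psnat_simplicial:
  assumes a: "psnat \<alpha>"
  shows "simplicial (stage \<alpha>) (transition \<alpha>)"
  unfolding simplicial_def
proof (intro conjI allI ballI impI)
  note P = psnatD[OF a]
  show "stage \<alpha> n \<in> Arr C" "Cod C (stage \<alpha> n) = Dom C (S n)" if "0 < n" for n
    using P(3,4) that by simp_all
  show "transition \<alpha> t \<in> Arr C" "Dom C (transition \<alpha> t) = Dom C (stage \<alpha> (Cod Delta t))"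
    "Cod C (transition \<alpha> t) = Dom C (stage \<alpha> (Dom Delta t))" if t: "t \<in> Arr Delta" for t
    using transition_simps[OF a t] by simp_all
  show "is_pullback C (D t) (stage \<alpha> (Dom Delta t)) (stage \<alpha> (Cod Delta t)) (transition \<alpha> t)"
    if t: "t \<in> Arr Delta" for t
  proof (rule is_pullback_iso[where k = "cocycle \<alpha> t"])
    show "is_pullback C (D t) (stage \<alpha> (Dom Delta t)) (pb1 C (D t) (stage \<alpha> (Dom Delta t))) (pb2 C
      (D t) (stage \<alpha> (Dom Delta t)))"
      using P(3,4) t by (intro pb_is_pullback) simp_all
  qed (use P(3,4,8-11) transition_simps[OF a] t in simp_all)
  show "transition \<alpha> (Idt Delta n) = Idt C (Dom C (stage \<alpha> n))" if n: "0 < n" for n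
  proof -
    have i: "Idt Delta n \<in> Arr Delta" "Dom Delta (Idt Delta n) = n" "Cod Delta (Idt Delta n) = n"
      using Idt_Delta[OF n] by blast+
    note Ti = transition_simps[OF a i(1), unfolded i] and Ki = P(7-9)[OF i(1), unfolded i]
    let ?L = "pb_lift C (Idt C (Dom C (S n))) (stage \<alpha> n) (stage \<alpha> n) (Idt C (Dom C (stage \<alpha> n)))"
    have L: "?L \<in> Arr C" "Cod C ?L = Dom C (pb1 C (Idt C (Dom C (S n))) (stage \<alpha> n))"
      "pb2 C (Idt C (Dom C (S n))) (stage \<alpha> n) \<odot> ?L = Idt C (Dom C (stage \<alpha> n))"
      using P(3,4)[OF n] by simp_all
    \<comment> \<open>By the unit axiom the inserted composite is an identity; regrouped as the
      transition after its cocycle, it becomes a second projection, which \<open>?L\<close>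
      splits.\<close>
    have "transition \<alpha> (Idt Delta n) = transition \<alpha> (Idt Delta n) \<odot> cocycle \<alpha> (Idt Delta n) \<odot> ?L"
      unfolding P(12)[OF n] using Ti(1,2) by simp
    also have "\<dots> = pb2 C (D (Idt Delta n)) (stage \<alpha> n) \<odot> ?L"
      by (rule Cmp_reassoc) (use Ti Ki L n in \<open>simp_all del: Delta_simps add: D_Idt\<close>)
    also have "\<dots> = Idt C (Dom C (stage \<alpha> n))" unfolding D_Idt[OF n] by (rule L)
    finally show ?thesis .
  qed
  show "transition \<alpha> (g \<odot>\<^bsub>Delta\<^esub> f) = transition \<alpha> f \<odot> transition \<alpha> g"
    if g: "g \<in> Arr Delta" and f: "f \<in> Arr Delta" and gf: "Dom Delta g = Cod Delta f" for g f
  proof -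
    define m n k where mnk: "m = Dom Delta f" "n = Cod Delta f" "k = Cod Delta g"
    have fg: "Dom Delta f = m" "Cod Delta f = n" "Dom Delta g = n" "Cod Delta g = k" "0 < m"
      "0 < n" "0 < k"
      using mnk gf f g by simp_all
    note c = Cmp_Delta[OF g f gf, unfolded fg]
    define r where "r = pb1 C (D f) (stage \<alpha> m)"
    define w where "w = pb2 C (D f) (stage \<alpha> m) \<odot> pb2 C (D g) r"
    define l where "l = pb_lift C (D f \<odot> D g) (stage \<alpha> m) (pb1 C (D g) r) w"
    define l' where "l' = pull_arr (D g) r (cocycle \<alpha> f) (stage \<alpha> n)"
    note Xm = P(3,4)[OF fg(5)] and Xn = P(3,4)[OF fg(6)]
    note Tf = transition_simps[OF a f, unfolded fg] and Tg = transition_simps[OF a g, unfolded fg]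
      and Tc = transition_simps[OF a c(1), unfolded c(2,3)]
    note Kf = P(7-11)[OF f, unfolded fg] and Kg = P(7-11)[OF g, unfolded fg]
      and Kc = P(7-11)[OF c(1), unfolded c(2,3)]
    have d: "D f \<in> Arr C" "D g \<in> Arr C" "Cod C (D g) = Dom C (D f)" "stage \<alpha> m \<in> Arr C"
      "Cod C (stage \<alpha> m) = Cod C (D f)"
      "stage \<alpha> n \<in> Arr C" "Cod C (stage \<alpha> n) = Dom C (D f)"
      using D_Delta[OF f] D_Delta[OF g] fg Xm Xn by simp_all
    note L = pb_lift_composite[OF d Kf(1-4), folded r_def, folded w_def, folded l_def l'_def]
    have KL: "cocycle \<alpha> (g \<odot>\<^bsub>Delta\<^esub> f) \<odot> l = cocycle \<alpha> g \<odot> l'"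
      using P(13)[OF g f gf] unfolding l_def l'_def w_def r_def fg .
    \<comment> \<open>The two candidates for the transition of a composite are compared after this
      isomorphism, where both become \<open>w\<close>, the composite of the two second
      projections.\<close>
    have iso: "is_iso C (cocycle \<alpha> g \<odot> l')"
      using Kg(1-3,5) Kf(5) L(6-8,11) by (intro is_iso_comp) simp_all
    have "transition \<alpha> (g \<odot>\<^bsub>Delta\<^esub> f) \<odot> cocycle \<alpha> g \<odot> l' = pb2 C (D (g \<odot>\<^bsub>Delta\<^esub> f)) (stage \<alpha> m) \<odot> l"
      unfolding KL[symmetric]
      by (rule Cmp_reassoc[OF Tc(4)]) (use Tc(1-3) Kc(1-3) L(1-3) D_Cmp[OF g f gf] in simp_all)
    also have "\<dots> = w" unfolding D_Cmp[OF g f gf] by (rule L)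
    finally have e1: "transition \<alpha> (g \<odot>\<^bsub>Delta\<^esub> f) \<odot> cocycle \<alpha> g \<odot> l' = w" .
    have "transition \<alpha> g \<odot> cocycle \<alpha> g \<odot> l' = pb2 C (D g) (stage \<alpha> n) \<odot> l'"
      by (rule Cmp_reassoc[OF Tg(4)]) (use Tg(1-3) Kg(1-3) L(6-8) in simp_all)
    then have "transition \<alpha> f \<odot> transition \<alpha> g \<odot> cocycle \<alpha> g \<odot> l' =
      transition \<alpha> f \<odot> cocycle \<alpha> f \<odot> pb2 C (D g) r"
      unfolding L(10) by simp
    also have "\<dots> = w" unfolding w_def
      by (rule Cmp_reassoc[OF Tf(4)]) (use Tf(1-3) Kf(1-3) L(12,13) in simp_all)
    finally have e2: "(transition \<alpha> f \<odot> transition \<alpha> g) \<odot> cocycle \<alpha> g \<odot> l' = w"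
      using Tf(1-3) Tg(1-3) Kg(1-3) L(6-8) by simp
    show ?thesis
      by (rule iso_cancel_right[OF iso]) (use e1 e2 Tf(1-3) Tg(1-3) Tc(1-3) Kg(1-3) L(6-8) in
        simp_all)
  qed
qed

text \<open>The arrows \<open>k t\<close> compare chosen pullbacks with cartesian squares and are
  therefore invertible, and the coherence axioms hold because their two sides agree after both
  projections of a pullback. Keeping \<open>k\<close> and \<open>\<alpha>\<close> as parameters lets
  \<open>comparison_obj\<close> be recognised as an instance.\<close>

lemma simplicial_psnat:
  assumes sim: "simplicial Y U"
    and k: "\<And>t. t \<in> Arr Delta \<Longrightarrow> k t \<in> Arr C"
      "\<And>t. t \<in> Arr Delta \<Longrightarrow> Dom C (k t) = Dom C (pb1 C (D t) (Y (Dom Delta t)))"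
      "\<And>t. t \<in> Arr Delta \<Longrightarrow> Cod C (k t) = Dom C (Y (Cod Delta t))"
      "\<And>t. t \<in> Arr Delta \<Longrightarrow> Y (Cod Delta t) \<odot> k t = pb1 C (D t) (Y (Dom Delta t))"
      "\<And>t. t \<in> Arr Delta \<Longrightarrow> U t \<odot> k t = pb2 C (D t) (Y (Dom Delta t))"
    and \<alpha>: "pncomp \<alpha> = (\<lambda>n \<in> Obj Delta. \<lparr>omap = \<lambda>_. Y n, amap = \<lambda>_. (Y n, Idt C (Dom C (Y n)),
      Y n)\<rparr>)"
      "pnsq \<alpha> = (\<lambda>t \<in> Arr Delta. \<lambda>_. (pb1 C (D t) (Y (Dom Delta t)), k t, Y (Cod Delta t)))"
  shows "psnat \<alpha>" "\<And>n. 0 < n \<Longrightarrow> stage \<alpha> n = Y n" "\<And>t. t \<in> Arr Delta \<Longrightarrow> cocycle \<alpha> t = k t"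
    "\<And>t. t \<in> Arr Delta \<Longrightarrow> transition \<alpha> t = U t"
proof -
  note Y = simplicialD[OF sim]
  have iso: "is_iso C (k t)" if t: "t \<in> Arr Delta" for t
  proof -
    have "is_pullback C (D t) (Y (Dom Delta t)) (pb1 C (D t) (Y (Dom Delta t))) (pb2 C (D t)
      (Y (Dom Delta t)))"
      using Y(1,2) t by (intro pb_is_pullback) simp_all
    then obtain l where l: "is_iso C l" "l \<in> Arr C"
      "Dom C l = Dom C (pb1 C (D t) (Y (Dom Delta t)))"
      "Cod C l = Dom C (Y (Cod Delta t))" "Y (Cod Delta t) \<odot> l = pb1 C (D t) (Y (Dom Delta t))"
      "U t \<odot> l = pb2 C (D t) (Y (Dom Delta t))"
      using is_pullback_comparison_iso[OF _ Y(6)[OF t]] Y(1)[of "Dom Delta t"] t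
        by (metis D_Delta(1) Dom_Delta_pos(1))
    have "l = k t"
      by (rule is_pullback_eqI[OF Y(6)[OF t]]) (use l k t Y(1) in simp_all)
    with l show ?thesis by simp
  qed
  have Xn: "stage \<alpha> n = Y n" if "0 < n" for n using that by (simp add: stage_def \<alpha>)
  have Kt: "cocycle \<alpha> t = k t" if "t \<in> Arr Delta" for t using that by (simp add: cocycle_def \<alpha>)
  show ps: "psnat \<alpha>"
    unfolding is_psnat_def
  proof (intro conjI ballI)
    show "pncomp \<alpha> \<in> extensional (Obj Delta)" "pnsq \<alpha> \<in> extensional (Arr Delta)"
      unfolding \<alpha> by simp_all
    show "is_functor (pobj (const_psfun terminal_cat) n) (pobj A n) (pncomp \<alpha> n)"
      if "n \<in> Obj Delta" for n
    proof (rule is_functorI)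
      show "category (pobj A n)" by (simp add: slice_category)
    qed (use that Y(1,2) in \<open>simp_all add: \<alpha> terminal_category slice_homs\<close>)
    show "ext_functor (pobj (const_psfun terminal_cat) n) (pncomp \<alpha> n)" for n
      by (simp add: ext_functor_def extensional_def)
    fix t assume t: "t \<in> Arr Delta"
    show "pnsq \<alpha> t \<in> extensional (Obj (pobj (const_psfun terminal_cat) (Dom Delta t)))"
      by (simp add: extensional_def)
    have cocycle: "(pb1 C (D t) (Y (Dom Delta t)), k t, Y (Cod Delta t)) \<in> Arr (slice C (Dom C
      (S (Cod Delta t))))"
      using Y(1,2) k t by (simp add: homs_def)
    have K': "is_iso (slice C (Dom C (S (Cod Delta t)))) (pb1 C (D t) (Y (Dom Delta t)), k t,
      Y (Cod Delta t))"
      using cocycle iso[OF t] by (simp only: slice_iso)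
    have "Y (Dom Delta t) \<in> Arr C" "Cod C (Y (Dom Delta t)) = Cod C (D t)"
      using Y(1,2) t by simp_all
    then have "pull_arr (D t) (Y (Dom Delta t)) (Idt C (Dom C (Y (Dom Delta t)))) (Y (Dom Delta
      t)) = Idt C (Dom C (pb1 C (D t) (Y (Dom Delta t))))"
      by (intro pb_lift_slice_Idt D_Delta t)
    with cocycle K' show "nat_iso (pobj (const_psfun terminal_cat) (Dom Delta t)) (pobj A
      (Cod Delta t))
          (comp_functor (pobj (const_psfun terminal_cat) (Dom Delta t)) (parr A t) (pncomp \<alpha>
            (Dom Delta t)))
          (comp_functor (pobj (const_psfun terminal_cat) (Dom Delta t)) (pncomp \<alpha> (Cod Delta t))
            (parr (const_psfun terminal_cat) t))
          (pnsq \<alpha> t)"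
      using t unfolding nat_iso_def nat_trans_def
      by (simp add: comp_functor_def compose_def id_functor_def \<alpha> homs_def)
  next
    fix n x assume "n \<in> Obj Delta"
    then have n: "0 < n" by simp
    have i: "Idt Delta n \<in> Arr Delta" "Dom Delta (Idt Delta n) = n" "Cod Delta (Idt Delta n) = n"
      using Idt_Delta[OF n] by blast+
    note ki = k[OF i(1), unfolded i D_Idt[OF n]] and Yi = Y(6)[OF i(1), unfolded i Y(8)[OF n]]
    let ?L = "pb_lift C (Idt C (Dom C (S n))) (Y n) (Y n) (Idt C (Dom C (Y n)))"
    have L: "?L \<in> Arr C" "Dom C ?L = Dom C (Y n)"
      "Cod C ?L = Dom C (pb1 C (Idt C (Dom C (S n))) (Y n))"
      "pb1 C (Idt C (Dom C (S n))) (Y n) \<odot> ?L = Y n"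
      "pb2 C (Idt C (Dom C (S n))) (Y n) \<odot> ?L = Idt C (Dom C (Y n))"
      using Y(1,2)[OF n] by simp_all
    have "k (Idt Delta n) \<odot> ?L = Idt C (Dom C (Y n))"
    proof (rule is_pullback_eqI[OF Yi])
      show "Y n \<odot> k (Idt Delta n) \<odot> ?L = Y n \<odot> Idt C (Dom C (Y n))"
        using Cmp_reassoc[OF ki(4), of ?L] ki(1-3) L Y(1)[OF n] by simp
      have "Idt C (Dom C (Y n)) \<odot> k (Idt Delta n) \<odot> ?L = pb2 C (Idt C (Dom C (S n))) (Y n) \<odot> ?L"
        using ki(5) unfolding Y(8)[OF n]
        by (rule Cmp_reassoc) (use ki(1-3) L Y(1)[OF n] in simp_all)
      then show "Idt C (Dom C (Y n)) \<odot> k (Idt Delta n) \<odot> ?L =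
        Idt C (Dom C (Y n)) \<odot> Idt C (Dom C (Y n))"
        unfolding L(5) using Y(1)[OF n] by simp
    qed (use ki(1-3) L(1-3) Y(1)[OF n] D_Delta[OF i(1)] in simp_all)
    then show "pnsq \<alpha> (Idt Delta n) x \<odot>\<^bsub>pobj A n\<^esub> punit A n (omap (pncomp \<alpha> n) x) =
        amap (pncomp \<alpha> n) (punit (const_psfun terminal_cat) n x)"
      using n i by (simp del: Delta_simps(4) add: \<alpha> D_Idt)
  next
    fix gf assume "gf \<in> comp_pairs Delta"
    then obtain g f where gf: "gf = (g, f)" and g: "g \<in> Arr Delta" and f: "f \<in> Arr Delta"
      and gf': "Dom Delta g = Cod Delta f"
      by (auto simp: comp_pairs_def)
    define m n n' where mnl: "m = Dom Delta f" "n = Cod Delta f" "n' = Cod Delta g"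
    have fg: "Dom Delta f = m" "Cod Delta f = n" "Dom Delta g = n" "Cod Delta g = n'" "0 < m"
      "0 < n" "0 < n'"
      using mnl gf' f g by simp_all
    note c = Cmp_Delta[OF g f gf', unfolded fg]
    define r where "r = pb1 C (D f) (Y m)"
    define w where "w = pb2 C (D f) (Y m) \<odot> pb2 C (D g) r"
    define l where "l = pb_lift C (D f \<odot> D g) (Y m) (pb1 C (D g) r) w"
    define l' where "l' = pull_arr (D g) r (k f) (Y n)"
    note Xm = Y(1,2)[OF fg(5)] and Xn = Y(1,2)[OF fg(6)] and Xk = Y(1,2)[OF fg(7)]
    note Tf = Y(3-5)[OF f, unfolded fg] and Tg = Y(3-5)[OF g, unfolded fg]
      and Tc = Y(3-6)[OF c(1), unfolded c(2,3)]
    note Kf = k[OF f, unfolded fg] and Kg = k[OF g, unfolded fg]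
      and Kc = k[OF c(1), unfolded c(2,3) D_Cmp[OF g f gf']]
    have d: "D f \<in> Arr C" "D g \<in> Arr C" "Cod C (D g) = Dom C (D f)" "Y m \<in> Arr C"
      "Cod C (Y m) = Cod C (D f)"
      "Y n \<in> Arr C" "Cod C (Y n) = Dom C (D f)"
      using D_Delta[OF f] D_Delta[OF g] fg Xm Xn by simp_all
    note L = pb_lift_composite[OF d Kf(1-4), folded r_def, folded w_def, folded l_def l'_def]
    \<comment> \<open>The composition axiom, tested on the projections of the cartesian square at
      the composite: over the fibre power both sides give \<open>pb1 C (D g) r\<close>, and along
      \<open>U\<close> both give \<open>w\<close>.\<close>
    have "k (g \<odot>\<^bsub>Delta\<^esub> f) \<odot> l = k g \<odot> l'"
    proof (rule is_pullback_eqI[OF Tc(4)])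
      have "Y n' \<odot> k (g \<odot>\<^bsub>Delta\<^esub> f) \<odot> l = pb1 C (D g) r"
        using Cmp_reassoc[OF Kc(4), of l] Kc(1-3) Xk L(1-4) by simp
      moreover have "Y n' \<odot> k g \<odot> l' = pb1 C (D g) r"
        using Cmp_reassoc[OF Kg(4), of l'] Kg(1-3) Xk L(6-9) by simp
      ultimately show "Y n' \<odot> k (g \<odot>\<^bsub>Delta\<^esub> f) \<odot> l = Y n' \<odot> k g \<odot> l'" by simp
      have e1: "U (g \<odot>\<^bsub>Delta\<^esub> f) \<odot> k (g \<odot>\<^bsub>Delta\<^esub> f) \<odot> l = w"
        using Cmp_reassoc[OF Kc(5), of l] Kc(1-3) Tc(1-3) L(1-3,5) by simp
      have "U g \<odot> k g \<odot> l' = k f \<odot> pb2 C (D g) r"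
        using Cmp_reassoc[OF Kg(5), of l'] Kg(1-3) Tg L(6-8,10) by simp
      then have "U f \<odot> U g \<odot> k g \<odot> l' = w" unfolding w_def
        using Cmp_reassoc[OF Kf(5), of "pb2 C (D g) r"] Kf(1-3) Tf L(12,13) by simp
      then have "U (g \<odot>\<^bsub>Delta\<^esub> f) \<odot> k g \<odot> l' = w"
        unfolding Y(9)[OF g f gf'] using Tf Tg Kg(1-3) L(6-8) by simp
      with e1 show "U (g \<odot>\<^bsub>Delta\<^esub> f) \<odot> k (g \<odot>\<^bsub>Delta\<^esub> f) \<odot> l = U (g \<odot>\<^bsub>Delta\<^esub> f) \<odot> k g \<odot> l'"
        by simp
    qed (use Kc(1-3) Kg(1-3) L(1-3) L(6-8) Xm c D_Delta[OF c(1)] in simp_all)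
    then have *: "\<forall>x. pnsq \<alpha> (g \<odot>\<^bsub>Delta\<^esub> f) x \<odot>\<^bsub>pobj A (Cod Delta g)\<^esub> pcomp A g f (omap (pncomp \<alpha>
      (Dom Delta f)) x) =
        amap (pncomp \<alpha> (Cod Delta g)) (pcomp (const_psfun terminal_cat) g f x) \<odot>\<^bsub>pobj A (Cod Delta
          g)\<^esub>
          pnsq \<alpha> g (omap (parr (const_psfun terminal_cat) f) x) \<odot>\<^bsub>pobj A (Cod Delta g)\<^esub> amap
            (parr A g) (pnsq \<alpha> f x)"
      using f g fg c Kg(1-3) L(6-8) Xk unfolding l_def l'_def w_def r_def
      by (simp add: \<alpha>)
    show "case gf of (g, f) \<Rightarrow> \<forall>x \<in> Obj (pobj (const_psfun terminal_cat) (Dom Delta f)).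
        pnsq \<alpha> (g \<odot>\<^bsub>Delta\<^esub> f) x \<odot>\<^bsub>pobj A (Cod Delta g)\<^esub> pcomp A g f (omap (pncomp \<alpha> (Dom Delta f))
          x) =
        amap (pncomp \<alpha> (Cod Delta g)) (pcomp (const_psfun terminal_cat) g f x) \<odot>\<^bsub>pobj A (Cod Delta
          g)\<^esub>
          pnsq \<alpha> g (omap (parr (const_psfun terminal_cat) f) x) \<odot>\<^bsub>pobj A (Cod Delta g)\<^esub> amap
            (parr A g) (pnsq \<alpha> f x)"
      unfolding gf prod.case using * by simp
  qed
  show "transition \<alpha> t = U t" if "t \<in> Arr Delta" for t
    by (rule transition_eqI[OF ps that]) (use Y(3-5) k that in \<open>simp_all add: Xn Kt\<close>)
qed (use \<alpha> in \<open>simp_all add: stage_def cocycle_def\<close>)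


section \<open>The category of descent data\<close>

definition nat_family where
  "nat_family \<alpha> \<beta> \<gamma> \<longleftrightarrow>
     (\<forall>n > 0. \<gamma> n \<in> Arr C \<and> Dom C (\<gamma> n) = Dom C (stage \<alpha> n) \<and> Cod C (\<gamma> n) = Dom C (stage \<beta> n) \<and>
        stage \<beta> n \<odot> \<gamma> n = stage \<alpha> n) \<and>
     (\<forall>t \<in> Arr Delta. transition \<beta> t \<odot> \<gamma> (Cod Delta t) = \<gamma> (Dom Delta t) \<odot> transition \<alpha> t)"

definition descent_arr where
  "descent_arr \<alpha> \<gamma> \<beta> = (\<alpha>, \<lambda>n \<in> Obj Delta. \<lambda>_::unit. (stage \<alpha> n, \<gamma> n, stage \<beta> n), \<beta>)"

lemma nat_familyD:
  assumes "nat_family \<alpha> \<beta> \<gamma>"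
  shows "\<And>n. 0 < n \<Longrightarrow> \<gamma> n \<in> Arr C" "\<And>n. 0 < n \<Longrightarrow> Dom C (\<gamma> n) = Dom C (stage \<alpha> n)"
    "\<And>n. 0 < n \<Longrightarrow> Cod C (\<gamma> n) = Dom C (stage \<beta> n)" "\<And>n. 0 < n \<Longrightarrow> stage \<beta> n \<odot> \<gamma> n = stage \<alpha> n"
    "\<And>t. t \<in> Arr Delta \<Longrightarrow> transition \<beta> t \<odot> \<gamma> (Cod Delta t) = \<gamma> (Dom Delta t) \<odot> transition \<alpha> t"
  using assms unfolding nat_family_def by blast+

text \<open>Precomposed with the cocycle of \<open>\<alpha>\<close>, the transition square is the
  image of the modification square under \<open>transition \<beta> t\<close>. The cocycle can be
  cancelled, which gives one direction; the other holds because \<open>stage \<beta>\<close> and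
  \<open>transition \<beta> t\<close> are the jointly monic projections of a pullback.\<close>

lemma modification_square_iff:
  assumes a: "psnat \<alpha>" and b: "psnat \<beta>" and t: "t \<in> Arr Delta"
    and \<gamma>: "\<And>n. 0 < n \<Longrightarrow> \<gamma> n \<in> Arr C \<and> Dom C (\<gamma> n) = Dom C (stage \<alpha> n) \<and> Cod C (\<gamma> n) =
      Dom C (stage \<beta> n) \<and>
        stage \<beta> n \<odot> \<gamma> n = stage \<alpha> n"
  shows "\<gamma> (Cod Delta t) \<odot> cocycle \<alpha> t = cocycle \<beta> t \<odot> pull_arr (D t) (stage \<alpha> (Dom Delta t))
    (\<gamma> (Dom Delta t)) (stage \<beta> (Dom Delta t)) \<longleftrightarrow>
    transition \<beta> t \<odot> \<gamma> (Cod Delta t) = \<gamma> (Dom Delta t) \<odot> transition \<alpha> t"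
    (is "_ = cocycle \<beta> t \<odot> ?L \<longleftrightarrow> _")
proof -
  define m n where mn: "m = Dom Delta t" "n = Cod Delta t"
  have mn': "Dom Delta t = m" "Cod Delta t = n" "0 < m" "0 < n" using t mn by simp_all
  note A = psnatD[OF a] and B = psnatD[OF b]
  note Xa = A(3,4) and Xb = B(3,4)
  note Ka = A(7-11)[OF t, unfolded mn'] and Kb = B(7-11)[OF t, unfolded mn']
  note Ta = transition_simps[OF a t, unfolded mn'] and Tb = transition_simps[OF b t, unfolded mn']
  note Dt = D_Delta[OF t, unfolded mn']
  have gm: "\<gamma> m \<in> Arr C" "Dom C (\<gamma> m) = Dom C (stage \<alpha> m)" "Cod C (\<gamma> m) = Dom C (stage \<beta> m)"
    "stage \<beta> m \<odot> \<gamma> m = stage \<alpha> m"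
    and gn: "\<gamma> n \<in> Arr C" "Dom C (\<gamma> n) = Dom C (stage \<alpha> n)" "Cod C (\<gamma> n) = Dom C (stage \<beta> n)"
      "stage \<beta> n \<odot> \<gamma> n = stage \<alpha> n"
    using \<gamma> mn' by blast+
  have s: "D t \<in> Arr C" "stage \<alpha> m \<in> Arr C" "stage \<beta> m \<in> Arr C" "Cod C (stage \<alpha> m) = Cod C (D t)"
    "Cod C (stage \<beta> m) = Cod C (D t)"
    using Dt Xa Xb mn' by simp_all
  note L = pb_lift_slice[OF s gm]
  define w where "w = \<gamma> m \<odot> pb2 C (D t) (stage \<alpha> m)"
  have p2: "pb2 C (D t) (stage \<alpha> m) \<in> Arr C" "Dom C (pb2 C (D t) (stage \<alpha> m)) = Dom C (cocycle \<alpha> t)"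
    "Cod C (pb2 C (D t) (stage \<alpha> m)) = Dom C (stage \<alpha> m)"
    using s Ka by simp_all
  have bL: "transition \<beta> t \<odot> cocycle \<beta> t \<odot> pb_lift C (D t) (stage \<beta> m) (pb1 C (D t) (stage \<alpha> m)) w
    = w"
    unfolding w_def using Cmp_reassoc[OF Tb(4), of "pull_arr (D t) (stage \<alpha> m) (\<gamma> m) (stage \<beta> m)"]
      L(1-3) Tb(1-3) Kb(1-3) unfolding L(5) by simp
  have aw: "(\<gamma> m \<odot> transition \<alpha> t) \<odot> cocycle \<alpha> t = w"
    unfolding w_def Ta(4)[symmetric] using gm(1-3) Ta(1-3) Ka(1-3) by simp
  have aw': "(transition \<beta> t \<odot> \<gamma> n) \<odot> cocycle \<alpha> t = transition \<beta> t \<odot> \<gamma> n \<odot> cocycle \<alpha> t"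
    using gn(1-3) Tb(1-3) Ka(1-3) by simp
  show ?thesis
    unfolding mn' w_def[symmetric]
  proof
    assume "\<gamma> n \<odot> cocycle \<alpha> t = cocycle \<beta> t \<odot> pb_lift C (D t) (stage \<beta> m) (pb1 C (D t) (stage \<alpha>
      m)) w"
    then have "(transition \<beta> t \<odot> \<gamma> n) \<odot> cocycle \<alpha> t = (\<gamma> m \<odot> transition \<alpha> t) \<odot> cocycle \<alpha> t"
      unfolding aw aw' using bL by simp
    then show "transition \<beta> t \<odot> \<gamma> n = \<gamma> m \<odot> transition \<alpha> t"
      using iso_cancel_right[OF Ka(5), of "transition \<beta> t \<odot> \<gamma> n"
        "\<gamma> m \<odot> transition \<alpha> t"] gn(1-3) gm(1-3) Ta(1-3) Tb(1-3) Ka(1-3) by simp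
  next
    assume eq: "transition \<beta> t \<odot> \<gamma> n = \<gamma> m \<odot> transition \<alpha> t"
    have pb: "is_pullback C (D t) (stage \<beta> m) (stage \<beta> n) (transition \<beta> t)"
      using simplicialD(6)[OF psnat_simplicial[OF b] t] unfolding mn' .
    show "\<gamma> n \<odot> cocycle \<alpha> t = cocycle \<beta> t \<odot> pb_lift C (D t) (stage \<beta> m) (pb1 C (D t) (stage \<alpha> m)) w"
    proof (rule is_pullback_eqI[OF pb])
      have "stage \<beta> n \<odot> \<gamma> n \<odot> cocycle \<alpha> t = pb1 C (D t) (stage \<alpha> m)"
        using Cmp_reassoc[OF gn(4), of "cocycle \<alpha> t"] gn(1-3) Ka(1-3) Xb mn' unfolding Ka(4) by simp
      moreover have "stage \<beta> n \<odot> cocycle \<beta> t \<odot> pb_lift C (D t) (stage \<beta> m) (pb1 C (D t) (stage \<alpha>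
        m)) w = pb1 C (D t) (stage \<alpha> m)"
        unfolding w_def using Cmp_reassoc[OF Kb(4), of
          "pull_arr (D t) (stage \<alpha> m) (\<gamma> m) (stage \<beta> m)"]
          L(1-3) Kb(1-3) Xb mn' unfolding L(4) by simp
      ultimately show "stage \<beta> n \<odot> \<gamma> n \<odot> cocycle \<alpha> t = stage \<beta> n \<odot> cocycle \<beta> t \<odot> pb_lift C (D t)
        (stage \<beta> m) (pb1 C (D t) (stage \<alpha> m)) w"
        by simp
      show "transition \<beta> t \<odot> \<gamma> n \<odot> cocycle \<alpha> t = transition \<beta> t \<odot> cocycle \<beta> t \<odot> pb_lift C (D t)
        (stage \<beta> m) (pb1 C (D t) (stage \<alpha> m)) w"
        unfolding bL aw'[symmetric] eq aw ..
    qed (use s gn(1-3) Ka(1-3) Kb(1-3) L(1-3) in \<open>simp_all add: w_def\<close>)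
  qed
qed

lemma modification_iff:
  assumes a: "psnat \<alpha>" and b: "psnat \<beta>"
  shows "is_modification Delta (const_psfun terminal_cat) A \<alpha> \<beta> \<Gamma> \<longleftrightarrow>
    (\<exists>\<gamma>. (\<alpha>, \<Gamma>, \<beta>) = descent_arr \<alpha> \<gamma> \<beta> \<and> nat_family \<alpha> \<beta> \<gamma>)"
proof -
  note A = psnatD[OF a] and B = psnatD[OF b]
  have s: "D t \<in> Arr C" "stage \<alpha> (Dom Delta t) \<in> Arr C" "stage \<beta> (Dom Delta t) \<in> Arr C"
    "Cod C (stage \<alpha> (Dom Delta t)) = Cod C (D t)" "Cod C (stage \<beta> (Dom Delta t)) = Cod C (D t)"
    if "t \<in> Arr Delta" for t
    using A(3,4) B(3,4) that by simp_all
  show ?thesis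
  proof
    assume mod: "is_modification Delta (const_psfun terminal_cat) A \<alpha> \<beta> \<Gamma>"
    define \<gamma> where "\<gamma> n = fst (snd (\<Gamma> n ()))" for n
    have ext: "\<Gamma> \<in> extensional (Obj Delta)"
      using mod unfolding is_modification_def by blast
    have nt: "nat_trans (pobj (const_psfun terminal_cat) n) (pobj A n) (pncomp \<alpha> n) (pncomp \<beta> n)
      (\<Gamma> n)"
      if "0 < n" for n
      using mod that unfolding is_modification_def by auto
    have hom: "\<Gamma> n () \<in> homs (slice C (Dom C (S n))) (stage \<alpha> n) (stage \<beta> n)" if "0 < n" for n
      using nt[OF that] A(5) B(5) that unfolding nat_trans_def by simp
    have g: "\<Gamma> n () = (stage \<alpha> n, \<gamma> n, stage \<beta> n)"
      "\<gamma> n \<in> Arr C \<and> Dom C (\<gamma> n) = Dom C (stage \<alpha> n) \<and> Cod C (\<gamma> n) = Dom C (stage \<beta> n) \<and>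
        stage \<beta> n \<odot> \<gamma> n = stage \<alpha> n" if "0 < n" for n
      using hom[OF that] unfolding slice_homs \<gamma>_def by auto
    have "(\<alpha>, \<Gamma>, \<beta>) = descent_arr \<alpha> \<gamma> \<beta>"
      unfolding descent_arr_def using ext g(1)
      by (auto simp: fun_eq_iff extensional_def)
    moreover have "nat_family \<alpha> \<beta> \<gamma>"
      unfolding nat_family_def
    proof (intro conjI allI ballI impI)
      fix t assume t: "t \<in> Arr Delta"
      have "\<Gamma> (Cod Delta t) () \<odot>\<^bsub>pobj A (Cod Delta t)\<^esub> pnsq \<alpha> t () =
        pnsq \<beta> t () \<odot>\<^bsub>pobj A (Cod Delta t)\<^esub> amap (parr A t) (\<Gamma> (Dom Delta t) ())"
        using mod t unfolding is_modification_def by (auto simp: id_functor_def)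
      then have "\<gamma> (Cod Delta t) \<odot> cocycle \<alpha> t = cocycle \<beta> t \<odot> pull_arr (D t) (stage \<alpha> (Dom Delta
        t)) (\<gamma> (Dom Delta t)) (stage \<beta> (Dom Delta t))"
        using t by (simp add: g(1) A(6) B(6))
      then show "transition \<beta> t \<odot> \<gamma> (Cod Delta t) = \<gamma> (Dom Delta t) \<odot> transition \<alpha> t"
        by (rule modification_square_iff[OF a b t g(2), THEN iffD1, rotated])
    qed (use g(2) in blast)+
    ultimately show "\<exists>\<gamma>. (\<alpha>, \<Gamma>, \<beta>) = descent_arr \<alpha> \<gamma> \<beta> \<and> nat_family \<alpha> \<beta> \<gamma>" by blast
  next
    assume "\<exists>\<gamma>. (\<alpha>, \<Gamma>, \<beta>) = descent_arr \<alpha> \<gamma> \<beta> \<and> nat_family \<alpha> \<beta> \<gamma>"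
    then obtain \<gamma> where G: "\<Gamma> = (\<lambda>n \<in> Obj Delta. \<lambda>_::unit. (stage \<alpha> n, \<gamma> n, stage \<beta> n))"
      and nf: "nat_family \<alpha> \<beta> \<gamma>"
      by (auto simp: descent_arr_def)
    note N = nat_familyD[OF nf]
    show "is_modification Delta (const_psfun terminal_cat) A \<alpha> \<beta> \<Gamma>"
      unfolding is_modification_def
    proof (intro conjI ballI)
      show "\<Gamma> \<in> extensional (Obj Delta)" by (simp add: G)
      show "\<Gamma> n \<in> extensional (Obj (pobj (const_psfun terminal_cat) n))" for n
        by (simp add: extensional_def)
      show "nat_trans (pobj (const_psfun terminal_cat) n) (pobj A n) (pncomp \<alpha> n) (pncomp \<beta> n)
        (\<Gamma> n)"
        if "n \<in> Obj Delta" for n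
        using that N(1-4) A(3-5) B(3-5) by (simp add: nat_trans_def slice_homs G)
    next
      fix t and x :: unit assume t: "t \<in> Arr Delta"
      have "\<gamma> (Cod Delta t) \<odot> cocycle \<alpha> t = cocycle \<beta> t \<odot> pull_arr (D t) (stage \<alpha> (Dom Delta t))
        (\<gamma> (Dom Delta t)) (stage \<beta> (Dom Delta t))"
        using N(5)[OF t] N(1-4) by (intro modification_square_iff[OF a b t, THEN iffD2]) blast+
      then show "\<Gamma> (Cod Delta t) (omap (parr (const_psfun terminal_cat) t) x) \<odot>\<^bsub>pobj A (Cod Delta
        t)\<^esub> pnsq \<alpha> t x =
        pnsq \<beta> t x \<odot>\<^bsub>pobj A (Cod Delta t)\<^esub> amap (parr A t) (\<Gamma> (Dom Delta t) x)"
        using t by (simp add: G A(6) B(6))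
    qed
  qed
qed

lemma descent_cat_simps [simp]:
  "Obj (descent_cat C p) = {\<alpha>. psnat \<alpha>}"
  "Dom (descent_cat C p) (descent_arr \<alpha> \<gamma> \<beta>) = \<alpha>" "Cod (descent_cat C p) (descent_arr \<alpha> \<gamma> \<beta>) = \<beta>"
  by (simp_all add: descent_cat_def psnat_cat_def descent_arr_def)

lemma descent_cat_Arr:
  "s \<in> Arr (descent_cat C p) \<longleftrightarrow>
    (\<exists>\<alpha> \<gamma> \<beta>. s = descent_arr \<alpha> \<gamma> \<beta> \<and> psnat \<alpha> \<and> psnat \<beta> \<and> nat_family \<alpha> \<beta> \<gamma>)"
proof -
  obtain \<alpha> \<Gamma> \<beta> where s: "s = (\<alpha>, \<Gamma>, \<beta>)" by (cases s)
  have "s \<in> Arr (descent_cat C p) \<longleftrightarrow>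
    psnat \<alpha> \<and> psnat \<beta> \<and> is_modification Delta (const_psfun terminal_cat) A \<alpha> \<beta> \<Gamma>"
    by (simp add: s descent_cat_def psnat_cat_def)
  also have "\<dots> \<longleftrightarrow> psnat \<alpha> \<and> psnat \<beta> \<and> (\<exists>\<gamma>. s = descent_arr \<alpha> \<gamma> \<beta> \<and> nat_family \<alpha> \<beta> \<gamma>)"
    by (simp add: modification_iff s cong: conj_cong)
  also have "\<dots> \<longleftrightarrow> (\<exists>\<alpha> \<gamma> \<beta>. s = descent_arr \<alpha> \<gamma> \<beta> \<and> psnat \<alpha> \<and> psnat \<beta> \<and> nat_family \<alpha> \<beta> \<gamma>)"
  proof
    assume "\<exists>\<alpha> \<gamma> \<beta>. s = descent_arr \<alpha> \<gamma> \<beta> \<and> psnat \<alpha> \<and> psnat \<beta> \<and> nat_family \<alpha> \<beta> \<gamma>"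
    then obtain \<alpha>' \<gamma> \<beta>' where *: "s = descent_arr \<alpha>' \<gamma> \<beta>'" "psnat \<alpha>'" "psnat \<beta>'"
      "nat_family \<alpha>' \<beta>' \<gamma>" by blast
    then have "\<alpha>' = \<alpha>" "\<beta>' = \<beta>" by (simp_all add: s descent_arr_def)
    with * show "psnat \<alpha> \<and> psnat \<beta> \<and> (\<exists>\<gamma>. s = descent_arr \<alpha> \<gamma> \<beta> \<and> nat_family \<alpha> \<beta> \<gamma>)" by blast
  qed blast
  finally show ?thesis .
qed

lemma descent_cat_Arr':
  "psnat \<alpha> \<Longrightarrow> psnat \<beta> \<Longrightarrow> nat_family \<alpha> \<beta> \<gamma> \<Longrightarrow> descent_arr \<alpha> \<gamma> \<beta> \<in> Arr (descent_cat C p)"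
  using descent_cat_Arr by blast

lemma descent_arr_eq_iff:
  "descent_arr \<alpha> \<gamma> \<beta> = descent_arr \<alpha> \<gamma>' \<beta> \<longleftrightarrow> (\<forall>n > 0. \<gamma> n = \<gamma>' n)"
  by (auto simp: descent_arr_def fun_eq_iff restrict_def)

lemma descent_cat_Idt:
  assumes "psnat \<alpha>"
  shows "Idt (descent_cat C p) \<alpha> = descent_arr \<alpha> (\<lambda>n. Idt C (Dom C (stage \<alpha> n))) \<alpha>"
    "nat_family \<alpha> \<alpha> (\<lambda>n. Idt C (Dom C (stage \<alpha> n)))"
proof -
  show "Idt (descent_cat C p) \<alpha> = descent_arr \<alpha> (\<lambda>n. Idt C (Dom C (stage \<alpha> n))) \<alpha>"
    using psnatD(5)[OF assms] by (simp add: descent_cat_def psnat_cat_def descent_arr_def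
      fun_eq_iff restrict_def)
  show "nat_family \<alpha> \<alpha> (\<lambda>n. Idt C (Dom C (stage \<alpha> n)))"
    using psnatD(3)[OF assms] transition_simps[OF assms] by (simp add: nat_family_def)
qed

lemma descent_cat_Cmp:
  assumes b: "psnat \<beta>" and d: "nat_family \<beta> \<zeta> \<delta>" and g: "nat_family \<alpha> \<beta> \<gamma>" and a: "psnat \<alpha>"
    and z: "psnat \<zeta>"
  shows "descent_arr \<beta> \<delta> \<zeta> \<odot>\<^bsub>descent_cat C p\<^esub> descent_arr \<alpha> \<gamma> \<beta> = descent_arr \<alpha> (\<lambda>n. \<delta> n \<odot> \<gamma> n) \<zeta>"
    "nat_family \<alpha> \<zeta> (\<lambda>n. \<delta> n \<odot> \<gamma> n)"
proof -
  show "descent_arr \<beta> \<delta> \<zeta> \<odot>\<^bsub>descent_cat C p\<^esub> descent_arr \<alpha> \<gamma> \<beta> = descent_arr \<alpha> (\<lambda>n. \<delta> n \<odot> \<gamma> n) \<zeta>"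
    by (simp add: descent_cat_def psnat_cat_def descent_arr_def fun_eq_iff restrict_def)
  note N = nat_familyD[OF d] and M = nat_familyD[OF g]
  show "nat_family \<alpha> \<zeta> (\<lambda>n. \<delta> n \<odot> \<gamma> n)"
    unfolding nat_family_def
  proof (intro conjI allI impI ballI)
    fix n :: nat assume n: "0 < n"
    show "stage \<zeta> n \<odot> \<delta> n \<odot> \<gamma> n = stage \<alpha> n"
      using Cmp_reassoc[OF N(4)[OF n], of "\<gamma> n"] N(1-3)[OF n] M(1-4)[OF n] psnatD(3)[OF z n] by simp
  next
    fix t assume t: "t \<in> Arr Delta"
    then have mn: "0 < Dom Delta t" "0 < Cod Delta t" by simp_all
    have "transition \<zeta> t \<odot> \<delta> (Cod Delta t) \<odot> \<gamma> (Cod Delta t) =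
      (\<delta> (Dom Delta t) \<odot> transition \<beta> t) \<odot> \<gamma> (Cod Delta t)"
      using N(1-3)[OF mn(2)] M(1-3)[OF mn(2)] transition_simps(1-3)[OF z t]
        by (intro Cmp_reassoc[OF N(5)[OF t]]) simp_all
    also have "\<dots> = \<delta> (Dom Delta t) \<odot> transition \<beta> t \<odot> \<gamma> (Cod Delta t)"
      using N(1-3)[OF mn(1)] M(1-3)[OF mn(2)] transition_simps(1-3)[OF b t] by simp
    also have "\<dots> = (\<delta> (Dom Delta t) \<odot> \<gamma> (Dom Delta t)) \<odot> transition \<alpha> t"
      unfolding M(5)[OF t] using N(1-3)[OF mn(1)] M(1-3)[OF mn(1)] transition_simps(1-3)[OF a t]
        by simp
    finally show "transition \<zeta> t \<odot> \<delta> (Cod Delta t) \<odot> \<gamma> (Cod Delta t) =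
      (\<delta> (Dom Delta t) \<odot> \<gamma> (Dom Delta t)) \<odot> transition \<alpha> t" .
  qed (use N(1-3) M(1-3) in simp_all)
qed

lemma descent_category: "category (descent_cat C p)"
proof
  fix s assume "s \<in> Arr (descent_cat C p)"
  then obtain \<alpha> \<gamma> \<beta> where s: "s = descent_arr \<alpha> \<gamma> \<beta>" and a: "psnat \<alpha>" and b: "psnat \<beta>"
    and g: "nat_family \<alpha> \<beta> \<gamma>"
    using descent_cat_Arr by blast
  show "Dom (descent_cat C p) s \<in> Obj (descent_cat C p)"
    "Cod (descent_cat C p) s \<in> Obj (descent_cat C p)"
    using a b by (simp_all add: s)
  note N = nat_familyD(1-3)[OF g]
  show "s \<odot>\<^bsub>descent_cat C p\<^esub> Idt (descent_cat C p) (Dom (descent_cat C p) s) = s"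
    using descent_cat_Cmp(1)[OF a g descent_cat_Idt(2)[OF a] a b] N
    by (simp add: s descent_cat_Idt(1)[OF a] descent_arr_eq_iff)
  show "Idt (descent_cat C p) (Cod (descent_cat C p) s) \<odot>\<^bsub>descent_cat C p\<^esub> s = s"
    using descent_cat_Cmp(1)[OF b descent_cat_Idt(2)[OF b] g a b] N
    by (simp add: s descent_cat_Idt(1)[OF b] descent_arr_eq_iff)
next
  fix \<alpha> assume "\<alpha> \<in> Obj (descent_cat C p)"
  then have a: "psnat \<alpha>" by simp
  show "Idt (descent_cat C p) \<alpha> \<in> homs (descent_cat C p) \<alpha> \<alpha>"
    using descent_cat_Idt[OF a] descent_cat_Arr'[OF a a] by (simp add: homs_def)
next
  fix r s assume "(r, s) \<in> comp_pairs (descent_cat C p)"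
  then have "r \<in> Arr (descent_cat C p)" "s \<in> Arr (descent_cat C p)" "Dom (descent_cat C p) r =
    Cod (descent_cat C p) s"
    by (simp_all add: comp_pairs_def)
  then obtain \<alpha> \<gamma> \<beta> \<delta> \<zeta> where s: "s = descent_arr \<alpha> \<gamma> \<beta>" "psnat \<alpha>" "psnat \<beta>" "nat_family \<alpha> \<beta> \<gamma>"
    and r: "r = descent_arr \<beta> \<delta> \<zeta>" "psnat \<zeta>" "nat_family \<beta> \<zeta> \<delta>"
    unfolding descent_cat_Arr by auto
  note c = descent_cat_Cmp[OF s(3) r(3) s(4) s(2) r(2)]
  show "r \<odot>\<^bsub>descent_cat C p\<^esub> s \<in> homs (descent_cat C p) (Dom (descent_cat C p) s)
    (Cod (descent_cat C p) r)"
    using descent_cat_Arr'[OF s(2) r(2) c(2)] by (simp add: homs_def s(1) r(1) c(1))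
next
  fix q r s assume "(q, r, s) \<in> comp_triples (descent_cat C p)"
  then have "q \<in> Arr (descent_cat C p)" "r \<in> Arr (descent_cat C p)" "s \<in> Arr (descent_cat C p)"
    "Dom (descent_cat C p) r = Cod (descent_cat C p) s" "Dom (descent_cat C p) q =
      Cod (descent_cat C p) r"
    by (simp_all add: comp_triples_def)
  then obtain \<alpha> \<gamma> \<beta> \<delta> \<zeta> \<epsilon> \<eta> where s: "s = descent_arr \<alpha> \<gamma> \<beta>" "psnat \<alpha>" "psnat \<beta>" "nat_family \<alpha> \<beta> \<gamma>"
    and r: "r = descent_arr \<beta> \<delta> \<zeta>" "psnat \<zeta>" "nat_family \<beta> \<zeta> \<delta>"
    and q: "q = descent_arr \<zeta> \<epsilon> \<eta>" "psnat \<eta>" "nat_family \<zeta> \<eta> \<epsilon>"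
    unfolding descent_cat_Arr by auto
  note c = descent_cat_Cmp[OF s(3) r(3) s(4) s(2) r(2)]
    and d = descent_cat_Cmp[OF r(2) q(3) r(3) s(3) q(2)]
  note N = nat_familyD(1-3)[OF s(4)] nat_familyD(1-3)[OF r(3)] nat_familyD(1-3)[OF q(3)]
  show "(q \<odot>\<^bsub>descent_cat C p\<^esub> r) \<odot>\<^bsub>descent_cat C p\<^esub> s = q \<odot>\<^bsub>descent_cat C p\<^esub> r \<odot>\<^bsub>descent_cat C p\<^esub> s"
    using descent_cat_Cmp(1)[OF s(3) d(2) s(4) s(2) q(2)] descent_cat_Cmp(1)[OF r(2) q(3) c(2)
      s(2) q(2)] N
    by (simp add: s(1) r(1) q(1) c(1) d(1) descent_arr_eq_iff)
qed

text \<open>The inverses of the components again commute with structure arrows and transitions,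
  because the components of \<open>\<gamma>\<close> can be cancelled in the required
  equations.\<close>

lemma descent_iso:
  assumes a: "psnat \<alpha>" and b: "psnat \<beta>" and g: "nat_family \<alpha> \<beta> \<gamma>"
    and iso: "\<And>n. 0 < n \<Longrightarrow> is_iso C (\<gamma> n)"
  shows "is_iso (descent_cat C p) (descent_arr \<alpha> \<gamma> \<beta>)"
proof -
  note N = nat_familyD[OF g]
  have "\<forall>n. \<exists>d. 0 < n \<longrightarrow> d \<in> Arr C \<and> Dom C d = Cod C (\<gamma> n) \<and> Cod C d = Dom C (\<gamma> n) \<and>
    d \<odot> \<gamma> n = Idt C (Dom C (\<gamma> n)) \<and> \<gamma> n \<odot> d = Idt C (Cod C (\<gamma> n))"
    using iso unfolding is_iso_def homs_def by blast
  then obtain \<delta> where "\<forall>n. 0 < n \<longrightarrow> \<delta> n \<in> Arr C \<and> Dom C (\<delta> n) = Cod C (\<gamma> n) \<and> Cod C (\<delta> n) =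
    Dom C (\<gamma> n) \<and>
    \<delta> n \<odot> \<gamma> n = Idt C (Dom C (\<gamma> n)) \<and> \<gamma> n \<odot> \<delta> n = Idt C (Cod C (\<gamma> n))"
    by (rule choice[THEN exE]) blast
  then have d: "\<delta> n \<in> Arr C" "Dom C (\<delta> n) = Dom C (stage \<beta> n)" "Cod C (\<delta> n) = Dom C (stage \<alpha> n)"
    "\<delta> n \<odot> \<gamma> n = Idt C (Dom C (stage \<alpha> n))" "\<gamma> n \<odot> \<delta> n = Idt C (Dom C (stage \<beta> n))" if "0 < n" for n
    using N(2,3) that by simp_all
  have df: "nat_family \<beta> \<alpha> \<delta>"
    unfolding nat_family_def
  proof (intro conjI allI impI ballI)
    fix n :: nat assume n: "0 < n"
    show "stage \<alpha> n \<odot> \<delta> n = stage \<beta> n"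
      using Cmp_reassoc[OF N(4)[OF n], of "\<delta> n"] d[OF n] N(1-3)[OF n] psnatD(3)[OF b n] by simp
  next
    fix t assume t: "t \<in> Arr Delta"
    then have mn: "0 < Dom Delta t" "0 < Cod Delta t" by simp_all
    note dm = d[OF mn(1)] and dn = d[OF mn(2)] and gm = N(1-3)[OF mn(1)] and gn = N(1-3)[OF mn(2)]
    note Ta = transition_simps(1-3)[OF a t] and Tb = transition_simps(1-3)[OF b t]
    have "(transition \<alpha> t \<odot> \<delta> (Cod Delta t)) \<odot> \<gamma> (Cod Delta t) = transition \<alpha> t"
      using Ta gn dn by simp
    also have "\<dots> = \<delta> (Dom Delta t) \<odot> \<gamma> (Dom Delta t) \<odot> transition \<alpha> t"
      using Cmp_reassoc[OF dm(4), of "transition \<alpha> t"] Ta gm dm by simp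
    also have "\<dots> = (\<delta> (Dom Delta t) \<odot> transition \<beta> t) \<odot> \<gamma> (Cod Delta t)"
      unfolding N(5)[OF t, symmetric] using Tb gn dm by simp
    finally show "transition \<alpha> t \<odot> \<delta> (Cod Delta t) = \<delta> (Dom Delta t) \<odot> transition \<beta> t"
      using iso_cancel_right[OF iso[OF mn(2)], of "transition \<alpha> t \<odot> \<delta> (Cod Delta t)"
        "\<delta> (Dom Delta t) \<odot> transition \<beta> t"]
        Ta Tb gn dm dn by simp
  qed (use d in simp_all)
  show ?thesis
  proof (rule category.is_isoI[OF descent_category])
    show "descent_arr \<beta> \<delta> \<alpha> \<in> Arr (descent_cat C p)" "descent_arr \<alpha> \<gamma> \<beta> \<in> Arr (descent_cat C p)"
      using descent_cat_Arr' a b g df by blast+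
  qed (use d descent_cat_Cmp(1)[OF b df g a a] descent_cat_Cmp(1)[OF a g df b b] in
    \<open>simp_all add: descent_cat_Idt(1)[OF a] descent_cat_Idt(1)[OF b] descent_arr_eq_iff\<close>)
qed


section \<open>The comparison functor\<close>

definition fibre_map where
  "fibre_map a t = pb_lift C (S (Dom Delta t)) a (D t \<odot> pb1 C (S (Cod Delta t)) a) (pb2 C
    (S (Cod Delta t)) a)"

lemma fibre_map_square:
  assumes "a \<in> Arr C" "Cod C a = Cod C p" "t \<in> Arr Delta"
  shows "S (Dom Delta t) \<odot> D t \<odot> pb1 C (S (Cod Delta t)) a = a \<odot> pb2 C (S (Cod Delta t)) a"
  using pb_square[of "S (Cod Delta t)" a] Cmp_reassoc[OF D_Delta(4)[OF assms(3)], of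
    "pb1 C (S (Cod Delta t)) a"] assms
  by simp

lemma fibre_map_simps:
  assumes "a \<in> Arr C" "Cod C a = Cod C p" "t \<in> Arr Delta"
  shows "fibre_map a t \<in> Arr C" "Dom C (fibre_map a t) = Dom C (pb1 C (S (Cod Delta t)) a)"
    "Cod C (fibre_map a t) = Dom C (pb1 C (S (Dom Delta t)) a)"
    "pb1 C (S (Dom Delta t)) a \<odot> fibre_map a t = D t \<odot> pb1 C (S (Cod Delta t)) a"
    "pb2 C (S (Dom Delta t)) a \<odot> fibre_map a t = pb2 C (S (Cod Delta t)) a"
  unfolding fibre_map_def using assms fibre_map_square[OF assms] by simp_all

lemma fibre_eqI:
  assumes a: "a \<in> Arr C" "Cod C a = Cod C p" and h: "h \<in> Arr C" "h' \<in> Arr C" "Dom C h = Dom C h'"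
    "Cod C h = Dom C (pb1 C (S n) a)" "Cod C h' = Dom C (pb1 C (S n) a)"
    "pb1 C (S n) a \<odot> h = pb1 C (S n) a \<odot> h'" "pb2 C (S n) a \<odot> h = pb2 C (S n) a \<odot> h'"
  shows "h = h'"
  by (rule pb_eqI[of "S n" a]) (use assms in simp_all)

text \<open>On pullbacks of \<open>a\<close>, \<open>fibre_map a t\<close> is \<open>D t\<close> on
  the base and the identity on \<open>a\<close>. Since
  \<open>S (Dom Delta t) \<odot> D t = S (Cod Delta t)\<close>, pasting its square with the pullback
  of \<open>a\<close> along \<open>S (Dom Delta t)\<close> gives the pullback along
  \<open>S (Cod Delta t)\<close>, which makes the square cartesian.\<close>

lemma fibre_map_simplicial:
  assumes a: "a \<in> Arr C" "Cod C a = Cod C p"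
  shows "simplicial (\<lambda>n. pb1 C (S n) a) (fibre_map a)"
  unfolding simplicial_def
proof (intro conjI allI ballI impI)
  fix t assume t: "t \<in> Arr Delta"
  note fibre_map = fibre_map_simps[OF a t] and Dt = D_Delta[OF t]
  show "fibre_map a t \<in> Arr C" "Dom C (fibre_map a t) = Dom C (pb1 C (S (Cod Delta t)) a)"
    "Cod C (fibre_map a t) = Dom C (pb1 C (S (Dom Delta t)) a)" using fibre_map by simp_all
  have P: "pb1 C (S n) a \<in> Arr C" "pb2 C (S n) a \<in> Arr C"
    "Dom C (pb2 C (S n) a) = Dom C (pb1 C (S n) a)"
    "Cod C (pb1 C (S n) a) = Dom C (S n)" "Cod C (pb2 C (S n) a) = Dom C a"
    "S n \<odot> pb1 C (S n) a = a \<odot> pb2 C (S n) a" for n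
    using a pb_square[of "S n" a] by simp_all
  show "is_pullback C (D t) (pb1 C (S (Dom Delta t)) a) (pb1 C (S (Cod Delta t)) a) (fibre_map a t)"
  proof (rule is_pullbackI)
    fix u v assume u: "u \<in> Arr C" "v \<in> Arr C" "Dom C u = Dom C v" "Cod C u = Dom C (D t)"
      "Cod C v = Dom C (pb1 C (S (Dom Delta t)) a)" "D t \<odot> u = pb1 C (S (Dom Delta t)) a \<odot> v"
    have "S (Cod Delta t) \<odot> u = S (Dom Delta t) \<odot> D t \<odot> u"
      using Cmp_reassoc[OF Dt(4), of u] u Dt(1-3) by simp
    also have "\<dots> = a \<odot> pb2 C (S (Dom Delta t)) a \<odot> v"
      unfolding u(6) using Cmp_reassoc[OF P(6), where h = v] u P(1-5) a by simp
    finally obtain h where h: "h \<in> Arr C" "Dom C h = Dom C u"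
      "Cod C h = Dom C (pb1 C (S (Cod Delta t)) a)"
      "pb1 C (S (Cod Delta t)) a \<odot> h = u" "pb2 C (S (Cod Delta t)) a \<odot> h =
        pb2 C (S (Dom Delta t)) a \<odot> v"
      using is_pullback_lift[OF pb_is_pullback[of "S (Cod Delta t)" a], of u
        "pb2 C (S (Dom Delta t)) a \<odot> v"]
        a u P(1-5) Dt(1-3) by auto
    have "fibre_map a t \<odot> h = v"
    proof (rule fibre_eqI[OF a, of _ _ "Dom Delta t"])
      show "pb1 C (S (Dom Delta t)) a \<odot> fibre_map a t \<odot> h = pb1 C (S (Dom Delta t)) a \<odot> v"
        using Cmp_reassoc[OF fibre_map(4), of h] fibre_map(1-3) h Dt(1-3) P(1-5) u(6) by simp
      show "pb2 C (S (Dom Delta t)) a \<odot> fibre_map a t \<odot> h = pb2 C (S (Dom Delta t)) a \<odot> v"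
        using Cmp_reassoc[OF fibre_map(5), of h] fibre_map(1-3) h P(1-5) by simp
    qed (use fibre_map(1-3) h(1-3) u(1-5) in simp_all)
    then show "\<exists>h\<in>Arr C. Dom C h = Dom C u \<and> Cod C h = Dom C (pb1 C (S (Cod Delta t)) a) \<and>
      pb1 C (S (Cod Delta t)) a \<odot> h = u \<and> fibre_map a t \<odot> h = v"
      using h by blast
  next
    fix h h' assume h: "h \<in> Arr C" "h' \<in> Arr C" "Dom C h = Dom C h'"
      "Cod C h = Dom C (pb1 C (S (Cod Delta t)) a)" "Cod C h' = Dom C (pb1 C (S (Cod Delta t)) a)"
      "pb1 C (S (Cod Delta t)) a \<odot> h = pb1 C (S (Cod Delta t)) a \<odot> h'"
        "fibre_map a t \<odot> h = fibre_map a t \<odot> h'"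
    have "pb2 C (S (Dom Delta t)) a \<odot> fibre_map a t \<odot> k = pb2 C (S (Cod Delta t)) a \<odot> k"
      if "k \<in> Arr C" "Cod C k = Dom C (pb1 C (S (Cod Delta t)) a)" for k
      by (rule Cmp_reassoc[OF fibre_map(5)]) (use that fibre_map(1-3) P(1-5) in simp_all)
    from this[of h] this[of h'] have "pb2 C (S (Cod Delta t)) a \<odot> h =
      pb2 C (S (Cod Delta t)) a \<odot> h'"
      using h by simp
    with h show "h = h'" using fibre_eqI[OF a, of h h' "Cod Delta t"] by blast
  qed (use fibre_map P Dt in simp_all)
next
  fix n :: nat assume n: "0 < n"
  have i: "Idt Delta n \<in> Arr Delta" "Dom Delta (Idt Delta n) = n" "Cod Delta (Idt Delta n) = n"
    using Idt_Delta[OF n] by blast+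
  note fibre_map = fibre_map_simps[OF a i(1), unfolded i D_Idt[OF n]]
  show "fibre_map a (Idt Delta n) = Idt C (Dom C (pb1 C (S n) a))"
    by (rule fibre_eqI[OF a, of _ _ n]) (use fibre_map a in simp_all)
next
  fix g f assume g: "g \<in> Arr Delta" and f: "f \<in> Arr Delta" and gf: "Dom Delta g = Cod Delta f"
  note c = Cmp_Delta[OF g f gf]
  note Vg = fibre_map_simps[OF a g, unfolded gf] and Vf = fibre_map_simps[OF a f]
    and Vc = fibre_map_simps[OF a c(1), unfolded c(2,3) D_Cmp[OF g f gf]]
  have P: "pb1 C (S n) a \<in> Arr C" "Cod C (pb1 C (S n) a) = Dom C (S n)"
    "pb2 C (S n) a \<in> Arr C" "Dom C (pb2 C (S n) a) = Dom C (pb1 C (S n) a)" for n using a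
      by simp_all
  show "fibre_map a (g \<odot>\<^bsub>Delta\<^esub> f) = fibre_map a f \<odot> fibre_map a g"
  proof (rule fibre_eqI[OF a, of _ _ "Dom Delta f"])
    show "pb1 C (S (Dom Delta f)) a \<odot> fibre_map a (g \<odot>\<^bsub>Delta\<^esub> f) =
      pb1 C (S (Dom Delta f)) a \<odot> fibre_map a f \<odot> fibre_map a g"
      using Cmp_reassoc[OF Vf(4), of "fibre_map a g"] Vg Vf(1-3) P f g gf by (simp add: Vc(4))
    show "pb2 C (S (Dom Delta f)) a \<odot> fibre_map a (g \<odot>\<^bsub>Delta\<^esub> f) =
      pb2 C (S (Dom Delta f)) a \<odot> fibre_map a f \<odot> fibre_map a g"
      using Cmp_reassoc[OF Vf(5), of "fibre_map a g"] Vg Vf(1-3) P by (simp add: Vc(5))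
  qed (use Vg(1-3) Vf(1-3) Vc(1-3) c in simp_all)
qed (use a in simp_all)

text \<open>The structure isomorphisms of the basic fibration are the comparison arrows which
  \<open>simplicial_psnat\<close> asks for when the transitions are \<open>fibre_map a\<close>. So
  the coherence of the comparison needs no calculation of its own.\<close>

lemma comparison_obj_psnat:
  assumes a: "a \<in> Arr C" "Cod C a = Cod C p"
  shows "psnat (comparison_obj C p a)"
    "\<And>n. 0 < n \<Longrightarrow> stage (comparison_obj C p a) n = pb1 C (S n) a"
    "\<And>t. t \<in> Arr Delta \<Longrightarrow> transition (comparison_obj C p a) t = fibre_map a t"
proof -
  let ?k = "\<lambda>t. pb_lift C (S (Cod Delta t)) a (pb1 C (D t) (pb1 C (S (Dom Delta t)) a))
    (pb2 C (S (Dom Delta t)) a \<odot> pb2 C (D t) (pb1 C (S (Dom Delta t)) a))"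
  have P: "pb1 C (S n) a \<in> Arr C" "pb2 C (S n) a \<in> Arr C"
    "Dom C (pb2 C (S n) a) = Dom C (pb1 C (S n) a)"
    "Cod C (pb1 C (S n) a) = Dom C (S n)" "Cod C (pb2 C (S n) a) = Dom C a"
    "S n \<odot> pb1 C (S n) a = a \<odot> pb2 C (S n) a" for n
    using a pb_square[of "S n" a] by simp_all
  have k: "?k t \<in> Arr C" "Dom C (?k t) = Dom C (pb1 C (D t) (pb1 C (S (Dom Delta t)) a))"
    "Cod C (?k t) = Dom C (pb1 C (S (Cod Delta t)) a)"
    "pb1 C (S (Cod Delta t)) a \<odot> ?k t = pb1 C (D t) (pb1 C (S (Dom Delta t)) a)"
    "fibre_map a t \<odot> ?k t = pb2 C (D t) (pb1 C (S (Dom Delta t)) a)" if t: "t \<in> Arr Delta" for t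
  proof -
    define R where "R = pb1 C (S (Dom Delta t)) a"
    have R: "R \<in> Arr C" "Cod C R = Dom C (S (Dom Delta t))" by (simp_all add: R_def P)
    note Dt = D_Delta[OF t] and fibre_map = fibre_map_simps[OF a t]
    have Q: "pb1 C (D t) R \<in> Arr C" "pb2 C (D t) R \<in> Arr C"
      "Dom C (pb2 C (D t) R) = Dom C (pb1 C (D t) R)"
      "Cod C (pb1 C (D t) R) = Dom C (S (Cod Delta t))" "Cod C (pb2 C (D t) R) = Dom C R"
      "D t \<odot> pb1 C (D t) R = R \<odot> pb2 C (D t) R"
      using R Dt pb_square[of "D t" R] by simp_all
    have "S (Cod Delta t) \<odot> pb1 C (D t) R = S (Dom Delta t) \<odot> D t \<odot> pb1 C (D t) R"
      using Cmp_reassoc[OF Dt(4), of "pb1 C (D t) R"] Q Dt(1-3) by simp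
    also have "\<dots> = a \<odot> pb2 C (S (Dom Delta t)) a \<odot> pb2 C (D t) R"
      unfolding Q(6) using Cmp_reassoc[OF P(6), where h = "pb2 C (D t) R"] Q(1-5) P(1-5) a
        by (simp add: R_def)
    finally have "S (Cod Delta t) \<odot> pb1 C (D t) R = a \<odot> pb2 C (S (Dom Delta t)) a \<odot> pb2 C (D t) R" .
    then have k: "?k t \<in> Arr C" "Dom C (?k t) = Dom C (pb1 C (D t) R)"
      "Cod C (?k t) = Dom C (pb1 C (S (Cod Delta t)) a)"
      "pb1 C (S (Cod Delta t)) a \<odot> ?k t = pb1 C (D t) R"
      "pb2 C (S (Cod Delta t)) a \<odot> ?k t = pb2 C (S (Dom Delta t)) a \<odot> pb2 C (D t) R"
      unfolding R_def[symmetric] using Q(1-5) a P(1-5) by (simp_all add: R_def)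
    show "?k t \<in> Arr C" "Dom C (?k t) = Dom C (pb1 C (D t) (pb1 C (S (Dom Delta t)) a))"
      "Cod C (?k t) = Dom C (pb1 C (S (Cod Delta t)) a)"
      "pb1 C (S (Cod Delta t)) a \<odot> ?k t = pb1 C (D t) (pb1 C (S (Dom Delta t)) a)"
      using k(1-4) unfolding R_def .
    have "fibre_map a t \<odot> ?k t = pb2 C (D t) R"
    proof (rule fibre_eqI[OF a, of _ _ "Dom Delta t"])
      show "pb1 C (S (Dom Delta t)) a \<odot> fibre_map a t \<odot> ?k t =
        pb1 C (S (Dom Delta t)) a \<odot> pb2 C (D t) R"
        using Cmp_reassoc[OF fibre_map(4) _ _ _ k(1,3)[folded fibre_map(2)]] fibre_map(1-3) k(1-4)
          Dt(1-3) P(1-5) Q(6) by (simp add: R_def)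
      show "pb2 C (S (Dom Delta t)) a \<odot> fibre_map a t \<odot> ?k t =
        pb2 C (S (Dom Delta t)) a \<odot> pb2 C (D t) R"
        using Cmp_reassoc[OF fibre_map(5) _ _ _ k(1,3)[folded fibre_map(2)]] fibre_map(1-3) P(1-5)
          by (simp add: k(5))
    qed (use fibre_map(1-3) k(1-3) Q(1-5) in \<open>simp_all add: R_def\<close>)
    then show "fibre_map a t \<odot> ?k t = pb2 C (D t) (pb1 C (S (Dom Delta t)) a)"
      unfolding R_def .
  qed
  \<comment> \<open>By \<open>D_from_zero\<close>, the functor at the arrow from 0 to n is base
    change along \<open>S n\<close>, and the structure isomorphism has the form
    \<open>?k\<close>.\<close>
  have c: "pncomp (comparison_obj C p a) = (\<lambda>n \<in> Obj Delta. \<lparr>omap = \<lambda>_. pb1 C (S n) a,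
       amap = \<lambda>_. (pb1 C (S n) a, Idt C (Dom C (pb1 C (S n) a)), pb1 C (S n) a)\<rparr>)"
    "pnsq (comparison_obj C p a) = (\<lambda>t \<in> Arr Delta. \<lambda>_. (pb1 C (D t) (pb1 C (S (Dom Delta t)) a),
      ?k t, pb1 C (S (Cod Delta t)) a))"
    unfolding comparison_obj_def Let_def psnat.simps
    by (rule restrict_ext; simp add: D_from_zero)+
  note r = simplicial_psnat[OF fibre_map_simplicial[OF a] k c]
  show "psnat (comparison_obj C p a)" by (rule r(1))
  show "\<And>n. 0 < n \<Longrightarrow> stage (comparison_obj C p a) n = pb1 C (S n) a" by (rule r(2))
  show "\<And>t. t \<in> Arr Delta \<Longrightarrow> transition (comparison_obj C p a) t = fibre_map a t" by (rule r(4))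
qed

lemma comparison_arr:
  assumes a: "a \<in> Arr C" "Cod C a = Cod C p" and a': "a' \<in> Arr C" "Cod C a' = Cod C p"
    and h: "h \<in> Arr C" "Dom C h = Dom C a" "Cod C h = Dom C a'" "a' \<odot> h = a"
  shows "amap (comparison C p) (a, h, a') = descent_arr (comparison_obj C p a)
      (\<lambda>n. pull_arr (S n) a h a') (comparison_obj C p a')"
    "nat_family (comparison_obj C p a) (comparison_obj C p a')
      (\<lambda>n. pull_arr (S n) a h a')"
proof -
  note c = comparison_obj_psnat[OF a] and c' = comparison_obj_psnat[OF a']
  show "amap (comparison C p) (a, h, a') = descent_arr (comparison_obj C p a)
      (\<lambda>n. pull_arr (S n) a h a') (comparison_obj C p a')"
    by (simp add: comparison_def descent_arr_def D_from_zero fun_eq_iff restrict_def c(2) c'(2))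
  have s: "S n \<in> Arr C" "a \<in> Arr C" "a' \<in> Arr C" "Cod C a = Cod C (S n)" "Cod C a' = Cod C (S n)"
    for n
    using a a' by simp_all
  note L = pb_lift_slice[OF s h]
  show "nat_family (comparison_obj C p a) (comparison_obj C p a')
      (\<lambda>n. pull_arr (S n) a h a')"
    unfolding nat_family_def
  proof (intro conjI allI impI ballI)
    fix t assume t: "t \<in> Arr Delta"
    define m n where mn: "m = Dom Delta t" "n = Cod Delta t"
    define L1 where "L1 n = pull_arr (S n) a h a'" for n
    note M = L[folded L1_def]
    note fibre_map = fibre_map_simps[OF a t, folded mn]
      and V' = fibre_map_simps[OF a' t, folded mn] and Dt = D_Delta[OF t, folded mn]
    have P: "pb1 C (S n) a \<in> Arr C" "pb2 C (S n) a \<in> Arr C"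
      "Dom C (pb2 C (S n) a) = Dom C (pb1 C (S n) a)"
      "Cod C (pb1 C (S n) a) = Dom C (S n)" "Cod C (pb2 C (S n) a) = Dom C a" for n
      using a by simp_all
    have P': "pb1 C (S n) a' \<in> Arr C" "pb2 C (S n) a' \<in> Arr C" "Dom C (pb2 C (S n) a') =
      Dom C (pb1 C (S n) a')"
      "Cod C (pb1 C (S n) a') = Dom C (S n)" "Cod C (pb2 C (S n) a') = Dom C a'" for n
      using a' by simp_all
    have "fibre_map a' t \<odot> L1 n = L1 m \<odot> fibre_map a t"
    proof (rule fibre_eqI[OF a', of _ _ m])
      have "pb1 C (S m) a' \<odot> fibre_map a' t \<odot> L1 n = (D t \<odot> pb1 C (S n) a') \<odot> L1 n"
        by (rule Cmp_reassoc[OF V'(4)]) (use V'(1-3) M(1-3) P' in simp_all)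
      also have "\<dots> = D t \<odot> pb1 C (S n) a" using M Dt P' by simp
      also have "\<dots> = pb1 C (S m) a' \<odot> L1 m \<odot> fibre_map a t"
        using Cmp_reassoc[OF M(4), where h = "fibre_map a t"] fibre_map M(1-3) P' by simp
      finally show "pb1 C (S m) a' \<odot> fibre_map a' t \<odot> L1 n = pb1 C (S m) a' \<odot> L1 m \<odot> fibre_map a
        t" .
      have "pb2 C (S m) a' \<odot> fibre_map a' t \<odot> L1 n = pb2 C (S n) a' \<odot> L1 n"
        by (rule Cmp_reassoc[OF V'(5)]) (use V'(1-3) M(1-3) P' in simp_all)
      also have "\<dots> = h \<odot> pb2 C (S n) a" by (rule M(5))
      also have "\<dots> = (h \<odot> pb2 C (S m) a) \<odot> fibre_map a t" using fibre_map h P by simp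
      also have "\<dots> = pb2 C (S m) a' \<odot> L1 m \<odot> fibre_map a t"
        using Cmp_reassoc[OF M(5), where h = "fibre_map a t"] fibre_map M(1-3) P' by simp
      finally show "pb2 C (S m) a' \<odot> fibre_map a' t \<odot> L1 n = pb2 C (S m) a' \<odot> L1 m \<odot> fibre_map a
        t" .
    qed (use fibre_map(1-3) V'(1-3) M(1-3) in simp_all)
    then show "transition (comparison_obj C p a') t \<odot> pull_arr (S (Cod Delta t)) a h a' =
      pull_arr (S (Dom Delta t)) a h a' \<odot> transition (comparison_obj C p a) t"
      unfolding c(3)[OF t] c'(3)[OF t] L1_def mn .
  qed (use L in \<open>simp_all add: c(2) c'(2)\<close>)
qed

lemma comparison_functor: "is_functor (slice C (Cod C p)) (descent_cat C p) (comparison C p)"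
proof (rule is_functorI)
  fix a assume "a \<in> Obj (slice C (Cod C p))"
  then have a: "a \<in> Arr C" "Cod C a = Cod C p" by simp_all
  note c = comparison_obj_psnat[OF a]
  show "omap (comparison C p) a \<in> Obj (descent_cat C p)"
    using c(1) by (simp add: comparison_def)
  have "amap (comparison C p) (a, Idt C (Dom C a), a) = Idt (descent_cat C p) (comparison_obj C p
    a)"
  proof -
    have *: "pull_arr (S n) a (Idt C (Dom C a)) a = Idt C (Dom C (pb1 C (S n) a))" for n
      by (rule pb_lift_slice_Idt) (use a in simp_all)
    have "amap (comparison C p) (a, Idt C (Dom C a), a) = descent_arr (comparison_obj C p a)
      (\<lambda>n. pull_arr (S n) a (Idt C (Dom C a)) a) (comparison_obj C p a)"
      by (rule comparison_arr(1)) (use a in simp_all)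
    then show ?thesis
      unfolding * descent_cat_Idt(1)[OF c(1)] using c(2) by (simp add: descent_arr_eq_iff)
  qed
  then show "amap (comparison C p) (Idt (slice C (Cod C p)) a) =
    Idt (descent_cat C p) (omap (comparison C p) a)"
    by (simp add: comparison_def)
next
  fix s assume "s \<in> Arr (slice C (Cod C p))"
  then obtain a h a' where s: "s = (a, h, a')" and a: "a \<in> Arr C" "Cod C a = Cod C p"
    and a': "a' \<in> Arr C" "Cod C a' = Cod C p"
    and h: "h \<in> Arr C" "Dom C h = Dom C a" "Cod C h = Dom C a'" "a' \<odot> h = a"
    by (cases s) (auto simp: homs_def)
  show "amap (comparison C p) s \<in> homs (descent_cat C p) (omap (comparison C p) (Dom (slice C
    (Cod C p)) s))
    (omap (comparison C p) (Cod (slice C (Cod C p)) s))"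
    using descent_cat_Arr'[OF comparison_obj_psnat(1)[OF a] comparison_obj_psnat(1)[OF a']
      comparison_arr(2)[OF a a' h]]
    unfolding s comparison_arr(1)[OF a a' h] by (simp add: homs_def comparison_def)
next
  fix r s assume "r \<in> Arr (slice C (Cod C p))" "s \<in> Arr (slice C (Cod C p))"
    "Dom (slice C (Cod C p)) r = Cod (slice C (Cod C p)) s"
  then obtain a h a' k a'' where s: "s = (a, h, a')" and r: "r = (a', k, a'')"
    and a: "a \<in> Arr C" "Cod C a = Cod C p" and a': "a' \<in> Arr C" "Cod C a' = Cod C p"
    and a'': "a'' \<in> Arr C" "Cod C a'' = Cod C p"
    and h: "h \<in> Arr C" "Dom C h = Dom C a" "Cod C h = Dom C a'" "a' \<odot> h = a"
    and k: "k \<in> Arr C" "Dom C k = Dom C a'" "Cod C k = Dom C a''" "a'' \<odot> k = a'"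
    by (cases s; cases r) (auto simp: homs_def)
  have "a'' \<odot> k \<odot> h = a" using Cmp_reassoc[OF k(4), of h] h k a'' by simp
  then have kh: "k \<odot> h \<in> Arr C" "Dom C (k \<odot> h) = Dom C a" "Cod C (k \<odot> h) = Dom C a''"
    "a'' \<odot> k \<odot> h = a"
    using h k by simp_all
  have *: "pull_arr (S n) a' k a'' \<odot> pull_arr (S n) a h a' =
    pull_arr (S n) a (k \<odot> h) a''" for n
    by (rule pb_lift_slice_Cmp) (use a a' a'' h k in simp_all)
  show "amap (comparison C p) (r \<odot>\<^bsub>slice C (Cod C p)\<^esub> s) =
    amap (comparison C p) r \<odot>\<^bsub>descent_cat C p\<^esub> amap (comparison C p) s"
    unfolding s r slice_simps comparison_arr(1)[OF a a' h] comparison_arr(1)[OF a' a'' k]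
      comparison_arr(1)[OF a a'' kh]
      descent_cat_Cmp(1)[OF comparison_obj_psnat(1)[OF a'] comparison_arr(2)[OF a' a'' k]
        comparison_arr(2)[OF a a' h]
        comparison_obj_psnat(1)[OF a] comparison_obj_psnat(1)[OF a'']] * ..
qed (simp_all add: slice_category descent_category)

end

text \<open>The first assumption makes the pullback of \<open>p\<close> along each \<open>a\<close>
  a coequaliser of its kernel pair, phrased with all pairs that it equalises so that no kernel pair
  is chosen. In the second, \<open>q\<close> exhibits stage 1 as pulled back from \<open>a\<close>,
  and its last equation expresses that \<open>q\<close> does not see which vertex of stage 2 is
  taken.\<close>

locale descent_criterion = descent +
  assumes regular_epi: "\<lbrakk>a \<in> Arr C; Cod C a = Cod C p; u \<in> Arr C; Dom C u = Dom C (pb1 C p a);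
      \<And>r s. \<lbrakk>r \<in> Arr C; s \<in> Arr C; Dom C r = Dom C s; Cod C r = Dom C (pb1 C p a);
        Cod C s = Dom C (pb1 C p a); pb2 C p a \<odot> r = pb2 C p a \<odot> s\<rbrakk> \<Longrightarrow> u \<odot> r = u \<odot> s\<rbrakk> \<Longrightarrow>
      \<exists>!h. h \<in> Arr C \<and> Dom C h = Dom C a \<and> Cod C h = Cod C u \<and> h \<odot> pb2 C p a = u"
    and descend: "simplicial Y U \<Longrightarrow>
      \<exists>a q. a \<in> Arr C \<and> Cod C a = Cod C p \<and> is_pullback C p a (Y 1) q \<and>
        q \<odot> U (vertex 2 0) = q \<odot> U (vertex 2 1)"
begin

text \<open>The uniqueness half of \<open>regular_epi\<close>, for the arrow
  \<open>h \<odot> pb2 C p a\<close>. Equality of the two codomains is read off from the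
  composites.\<close>

lemma pb2_epi:
  assumes a: "a \<in> Arr C" "Cod C a = Cod C p" and h: "h \<in> Arr C" "k \<in> Arr C" "Dom C h = Dom C a"
    "Dom C k = Dom C a" "h \<odot> pb2 C p a = k \<odot> pb2 C p a"
  shows "h = k"
proof -
  have P: "pb2 C p a \<in> Arr C" "Cod C (pb2 C p a) = Dom C a" "Dom C (pb2 C p a) = Dom C (pb1 C p a)"
    using a by simp_all
  have "Cod C h = Cod C (h \<odot> pb2 C p a)" using h(1-4) P by simp
  also have "\<dots> = Cod C k" unfolding h(5) using h(1-4) P by simp
  finally have ck: "Cod C h = Cod C k" .
  have "\<exists>!l. l \<in> Arr C \<and> Dom C l = Dom C a \<and> Cod C l = Cod C (h \<odot> pb2 C p a) \<and> l \<odot> pb2 C p a =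
    h \<odot> pb2 C p a"
    by (rule regular_epi) (use a h(1-4) P in simp_all)
  then show ?thesis using h ck P by (metis Cmp_simps(3))
qed

text \<open>Stage 1 of a morphism, followed by the projection to \<open>a'\<close>, coequalises the
  kernel pair of the projection to \<open>a\<close>: two arrows with equal composite to
  \<open>a\<close> are the two vertices of one arrow into stage 2, where naturality applies. This
  gives \<open>h\<close>. The other stages are determined by stage 1 through a vertex.\<close>

lemma comparison_full:
  assumes a: "a \<in> Arr C" "Cod C a = Cod C p" and a': "a' \<in> Arr C" "Cod C a' = Cod C p"
    and g: "nat_family (comparison_obj C p a) (comparison_obj C p a') \<gamma>"
  shows "\<exists>h. h \<in> Arr C \<and> Dom C h = Dom C a \<and> Cod C h = Dom C a' \<and> a' \<odot> h = a \<and>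
    (\<forall>n > 0. \<gamma> n = pull_arr (S n) a h a')"
proof -
  note c = comparison_obj_psnat[OF a] and c' = comparison_obj_psnat[OF a']
  note N = nat_familyD[OF g]
  have P: "pb1 C (S n) a \<in> Arr C" "pb2 C (S n) a \<in> Arr C"
    "Dom C (pb2 C (S n) a) = Dom C (pb1 C (S n) a)"
    "Cod C (pb1 C (S n) a) = Dom C (S n)" "Cod C (pb2 C (S n) a) = Dom C a"
    "S n \<odot> pb1 C (S n) a = a \<odot> pb2 C (S n) a" for n
    using a pb_square[of "S n" a] by simp_all
  have P': "pb1 C (S n) a' \<in> Arr C" "pb2 C (S n) a' \<in> Arr C" "Dom C (pb2 C (S n) a') =
    Dom C (pb1 C (S n) a')"
    "Cod C (pb1 C (S n) a') = Dom C (S n)" "Cod C (pb2 C (S n) a') = Dom C a'"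
    "S n \<odot> pb1 C (S n) a' = a' \<odot> pb2 C (S n) a'" for n
    using a' pb_square[of "S n" a'] by simp_all
  have g: "\<gamma> n \<in> Arr C" "Dom C (\<gamma> n) = Dom C (pb1 C (S n) a)" "Cod C (\<gamma> n) = Dom C (pb1 C (S n) a')"
    "pb1 C (S n) a' \<odot> \<gamma> n = pb1 C (S n) a" if "0 < n" for n
    using N(1-4)[OF that] c(2)[OF that] c'(2)[OF that] by simp_all
  have nat: "fibre_map a' t \<odot> \<gamma> (Cod Delta t) = \<gamma> (Dom Delta t) \<odot> fibre_map a t"
    if "t \<in> Arr Delta" for t
    using N(5)[OF that] c(3)[OF that] c'(3)[OF that] by simp
  define u where "u = pb2 C p a' \<odot> \<gamma> 1"
  note g1 = g[of 1, simplified] and P1 = P[of "Suc 0", simplified] and P1' = P'[of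
    "Suc 0", simplified]
  have u: "u \<in> Arr C" "Dom C u = Dom C (pb1 C p a)" "Cod C u = Dom C a'"
    unfolding u_def using g1 P1' by simp_all
  \<comment> \<open>The right-hand side does not involve the vertex \<open>i\<close>; that
    independence is what makes \<open>u\<close> descend.\<close>
  have uV: "u \<odot> fibre_map a (vertex n i) = pb2 C (S n) a' \<odot> \<gamma> n" if i: "i < n" for n i
  proof -
    note fibre_map = fibre_map_simps[OF a vertex_in[OF i], simplified]
      and V' = fibre_map_simps[OF a' vertex_in[OF i], simplified]
    have n: "0 < n" using i by simp
    have "u \<odot> fibre_map a (vertex n i) = pb2 C p a' \<odot> fibre_map a' (vertex n i) \<odot> \<gamma> n"
      using nat[OF vertex_in[OF i], simplified] g1 P1' fibre_map unfolding u_def by simp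
    also have "\<dots> = pb2 C (S n) a' \<odot> \<gamma> n"
      by (rule Cmp_reassoc[OF V'(5)]) (use V' P1' P' g[OF n] in simp_all)
    finally show ?thesis .
  qed
  have "\<exists>!h. h \<in> Arr C \<and> Dom C h = Dom C a \<and> Cod C h = Cod C u \<and> h \<odot> pb2 C p a = u"
  proof (rule regular_epi[OF a u(1,2)])
    fix r s assume r: "r \<in> Arr C" and s: "s \<in> Arr C" and rs: "Dom C r = Dom C s"
      "Cod C r = Dom C (pb1 C p a)" "Cod C s = Dom C (pb1 C p a)" "pb2 C p a \<odot> r = pb2 C p a \<odot> s"
    \<comment> \<open>As \<open>r\<close> and \<open>s\<close> have the same image in
      \<open>a\<close>, their images in the domain of \<open>p\<close> form a pair in the 2-fold
      power. Together with the common image in \<open>a\<close> this pair is an arrow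
      \<open>?z\<close> into stage 2, with vertices \<open>r\<close> and \<open>s\<close>.\<close>
    define v where "v i = (if i = 0 then pb1 C p a \<odot> r else pb1 C p a \<odot> s)" for i :: nat
    have pr: "p \<odot> pb1 C p a \<odot> r = a \<odot> pb2 C p a \<odot> r"
      using Cmp_reassoc[OF P1(6), of r] r rs P1(1-5) a by simp
    have ps: "p \<odot> pb1 C p a \<odot> s = p \<odot> pb1 C p a \<odot> r"
      unfolding pr rs(4) using Cmp_reassoc[OF P1(6) _ _ _ s] s rs(3) P1(1-5) a by simp
    have d: "Dom C (p \<odot> pb1 C p a \<odot> r) = Dom C r"
      using r rs(2) P1(1-5) by simp
    have "\<exists>h \<in> Arr C. Dom C h = Dom C (p \<odot> pb1 C p a \<odot> r) \<and> Cod C h = Dom C (S 2) \<and> S 2 \<odot> h =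
      p \<odot> pb1 C p a \<odot> r \<and>
      (\<forall>i < 2. fp_proj C p 2 i \<odot> h = v i)"
      by (rule fp_lift) (use r s rs(1-3) P1(1-5) ps in \<open>simp_all add: v_def\<close>)
    then obtain k where k: "k \<in> Arr C" "Dom C k = Dom C (p \<odot> pb1 C p a \<odot> r)" "Cod C k = Dom C (S 2)"
      "S 2 \<odot> k = p \<odot> pb1 C p a \<odot> r" "\<forall>i < 2. fp_proj C p 2 i \<odot> k = v i"
      by blast
    note k = k(1) k(2)[unfolded d] k(3) k(4)[unfolded pr] k(5)[rule_format]
    let ?z = "pb_lift C (S 2) a k (pb2 C p a \<odot> r)"
    have z: "?z \<in> Arr C" "Dom C ?z = Dom C r" "Cod C ?z = Dom C (pb1 C (S 2) a)"
      "pb1 C (S 2) a \<odot> ?z = k" "pb2 C (S 2) a \<odot> ?z = pb2 C p a \<odot> r"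
      using k(1-4) r rs(2) P1(1-5) a by simp_all
    have Vz: "fibre_map a (vertex 2 i) \<odot> ?z = w"
      if i: "i < 2" and w: "w \<in> Arr C" "Dom C w = Dom C r" "Cod C w = Dom C (pb1 C p a)"
        "pb2 C p a \<odot> w = pb2 C p a \<odot> r"
        "pb1 C p a \<odot> w = v i" for i w
    proof (rule fibre_eqI[OF a, of _ _ "Suc 0"])
      note fibre_map = fibre_map_simps[OF a vertex_in[OF i], simplified]
      note Dv = D_Delta(1-3)[OF vertex_in[OF i], simplified]
      have "D (vertex 2 i) = fp_proj C p 2 i"
        using D_simps(5)[of "vertex 2 i" 0] vertex_in[OF i] Dv by (simp add: Arr_Delta vertex_def)
      then have "D (vertex 2 i) \<odot> k = v i" using k(5)[OF i] by simp
      moreover have "pb1 C p a \<odot> fibre_map a (vertex 2 i) \<odot> ?z =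
        (D (vertex 2 i) \<odot> pb1 C (S 2) a) \<odot> ?z"
        by (rule Cmp_reassoc[OF fibre_map(4)]) (use fibre_map z P1 in simp_all)
      moreover have "(D (vertex 2 i) \<odot> pb1 C (S 2) a) \<odot> ?z = D (vertex 2 i) \<odot> k"
        using z Dv P[of 2] by simp
      ultimately show "pb1 C (S (Suc 0)) a \<odot> fibre_map a (vertex 2 i) \<odot> ?z =
        pb1 C (S (Suc 0)) a \<odot> w"
        using w by simp
      have "pb2 C p a \<odot> fibre_map a (vertex 2 i) \<odot> ?z = pb2 C (S 2) a \<odot> ?z"
        by (rule Cmp_reassoc[OF fibre_map(5)]) (use fibre_map z P1 in simp_all)
      then show "pb2 C (S (Suc 0)) a \<odot> fibre_map a (vertex 2 i) \<odot> ?z = pb2 C (S (Suc 0)) a \<odot> w"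
        using w z by simp
    qed (use w z fibre_map_simps[OF a vertex_in[OF i]] in simp_all)
    have uw: "u \<odot> w = (pb2 C (S 2) a' \<odot> \<gamma> 2) \<odot> ?z" if i: "i < 2"
      and w: "fibre_map a (vertex 2 i) \<odot> ?z = w" for i w
      unfolding w[symmetric]
      by (rule Cmp_reassoc[OF uV[OF i]]) (use u z fibre_map_simps[OF a vertex_in[OF i]] in simp_all)
    show "u \<odot> r = u \<odot> s"
      using uw[of 0, OF _ Vz[of 0 r]] uw[of 1, OF _ Vz[of 1 s]] r s rs by (simp add: v_def)
  qed
  then obtain h where h: "h \<in> Arr C" "Dom C h = Dom C a" "Cod C h = Dom C a'" "h \<odot> pb2 C p a = u"
    using u by auto
  \<comment> \<open>That \<open>h\<close> lies over the base is tested after the epimorphism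
    \<open>pb2 C p a\<close>.\<close>
  have "(a' \<odot> h) \<odot> pb2 C p a = a' \<odot> u" using h P1 a' by (simp del: h(4) add: h(4)[symmetric])
  also have "\<dots> = (p \<odot> pb1 C p a') \<odot> \<gamma> 1"
    unfolding u_def P1'(6) using g1 P1' a' by simp
  also have "\<dots> = a \<odot> pb2 C p a" unfolding P1(6)[symmetric] using g1 P1'(1-5) P1(1-5) by simp
  finally have ah: "a' \<odot> h = a"
    using pb2_epi[OF a, of "a' \<odot> h" a] h a a' by simp
  have "\<gamma> n = pull_arr (S n) a h a'" if n: "0 < n" for n
  proof (rule fibre_eqI[OF a', of _ _ n])
    have s: "S n \<in> Arr C" "a \<in> Arr C" "a' \<in> Arr C" "Cod C a = Cod C (S n)" "Cod C a' = Cod C (S n)"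
      using a a' by simp_all
    note L = pb_lift_slice[OF s h(1-3) ah] and fibre_map = fibre_map_simps[OF a vertex_in[OF n],
      simplified]
    show "pb1 C (S n) a' \<odot> \<gamma> n = pb1 C (S n) a' \<odot> pull_arr (S n) a h a'"
      unfolding L(4) by (rule g[OF n])
    have "pb2 C (S n) a' \<odot> \<gamma> n = h \<odot> pb2 C p a \<odot> fibre_map a (vertex n 0)"
      unfolding uV[OF n, symmetric] h(4)[symmetric] using h(1-3) P1 fibre_map by simp
    then show "pb2 C (S n) a' \<odot> \<gamma> n = pb2 C (S n) a' \<odot> pull_arr (S n) a h a'"
      unfolding L(5) fibre_map(5) .
    show "pull_arr (S n) a h a' \<in> Arr C" by (rule L)
    show "Dom C (\<gamma> n) = Dom C (pull_arr (S n) a h a')"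
      unfolding L(2) by (rule g[OF n])
    show "Cod C (pull_arr (S n) a h a') = Dom C (pb1 C (S n) a')" by (rule L)
  qed (use g[OF n] in simp_all)
  with h ah show ?thesis by blast
qed

text \<open>Following any vertex by \<open>q\<close> gives the same map \<open>Q n\<close> from
  stage n to \<open>a\<close>. By pasting, \<open>Q n\<close> exhibits stage n as a pullback of
  \<open>a\<close> along \<open>S n\<close>; the comparison isomorphisms with the chosen pullbacks
  commute with transitions because \<open>Q\<close> does.\<close>

lemma comparison_ess_surj:
  assumes b: "psnat \<beta>"
  shows "\<exists>a \<gamma>. a \<in> Arr C \<and> Cod C a = Cod C p \<and> nat_family (comparison_obj C p a) \<beta> \<gamma> \<and>
    (\<forall>n > 0. is_iso C (\<gamma> n))"
proof -
  note sim = psnat_simplicial[OF b]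
  note Y = simplicialD[OF sim]
  obtain a q where a: "a \<in> Arr C" "Cod C a = Cod C p" and pb: "is_pullback C p a (stage \<beta> 1) q"
    and q2: "q \<odot> transition \<beta> (vertex 2 0) = q \<odot> transition \<beta> (vertex 2 1)"
    using descend[OF sim] by blast
  note c = comparison_obj_psnat[OF a]
  note pbD = is_pullbackD[OF pb]
  define Q where "Q n = q \<odot> transition \<beta> (vertex n 0)" for n
  have Q: "Q n \<in> Arr C" "Dom C (Q n) = Dom C (stage \<beta> n)" "Cod C (Q n) = Dom C a" if n: "0 < n"
    for n
    unfolding Q_def using pbD Y(3-5)[OF vertex_in[OF n]] by simp_all
  \<comment> \<open>The edge from 0 to \<open>i\<close> reduces independence of the vertex in stage
    n to the equation for the two vertices of stage 2.\<close>
  have qv: "q \<odot> transition \<beta> (vertex n i) = Q n" if i: "i < n" for n i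
  proof -
    have n: "0 < n" using i by simp
    note Te = Y(3-5)[OF edge_in[OF _ i, of 0], simplified]
    have v: "transition \<beta> (vertex n 0) = transition \<beta> (vertex 2 0) \<odot> transition \<beta> (edge n 0 i)"
      "transition \<beta> (vertex n i) = transition \<beta> (vertex 2 1) \<odot> transition \<beta> (edge n 0 i)"
      using Y(9)[of "edge n 0 i" "vertex 2 0"] Y(9)[of "edge n 0 i" "vertex 2 1"] i
      by (simp_all add: edge_vertex)
    note T0 = Y(3-5)[OF vertex_in[of 0 2], simplified]
      and T1 = Y(3-5)[OF vertex_in[of 1 2], simplified]
    have "q \<odot> transition \<beta> (vertex n i) = (q \<odot> transition \<beta> (vertex 2 1)) \<odot> transition \<beta> (edge n 0
      i)"
      unfolding v using T1 Te pbD by simp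
    also have "\<dots> = Q n"
      unfolding q2[symmetric] Q_def v using T0 Te pbD by simp
    finally show ?thesis .
  qed
  have pbn: "is_pullback C (S n) a (stage \<beta> n) (Q n)" if n: "0 < n" for n
  proof -
    note v = vertex_in[OF n]
    have "is_pullback C (p \<odot> D (vertex n 0)) a (stage \<beta> n) (q \<odot> transition \<beta> (vertex n 0))"
      by (rule is_pullback_paste[OF pb]) (use Y(6)[OF v] D_Delta[OF v] a in simp_all)
    then show ?thesis using fp_str_vertex[OF n n] by (simp add: Q_def)
  qed
  have "\<forall>n. \<exists>g. 0 < n \<longrightarrow> is_iso C g \<and> g \<in> Arr C \<and> Dom C g = Dom C (pb1 C (S n) a) \<and>
    Cod C g = Dom C (stage \<beta> n) \<and> stage \<beta> n \<odot> g = pb1 C (S n) a \<and> Q n \<odot> g = pb2 C (S n) a"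
  proof
    fix n
    have s: "is_pullback C (S n) a (pb1 C (S n) a) (pb2 C (S n) a)"
      using a by (intro pb_is_pullback) simp_all
    show "\<exists>g. 0 < n \<longrightarrow> is_iso C g \<and> g \<in> Arr C \<and> Dom C g = Dom C (pb1 C (S n) a) \<and>
      Cod C g = Dom C (stage \<beta> n) \<and> stage \<beta> n \<odot> g = pb1 C (S n) a \<and> Q n \<odot> g = pb2 C (S n) a"
      using is_pullback_comparison_iso[OF s pbn] a fp_str_in by metis
  qed
  then obtain \<gamma> where "\<forall>n. 0 < n \<longrightarrow> is_iso C (\<gamma> n) \<and> \<gamma> n \<in> Arr C \<and> Dom C (\<gamma> n) =
    Dom C (pb1 C (S n) a) \<and>
    Cod C (\<gamma> n) = Dom C (stage \<beta> n) \<and> stage \<beta> n \<odot> \<gamma> n = pb1 C (S n) a \<and> Q n \<odot> \<gamma> n = pb2 C (S n) a"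
    by (rule choice[THEN exE]) blast
  then have g: "is_iso C (\<gamma> n)" "\<gamma> n \<in> Arr C" "Dom C (\<gamma> n) = Dom C (pb1 C (S n) a)"
    "Cod C (\<gamma> n) = Dom C (stage \<beta> n)" "stage \<beta> n \<odot> \<gamma> n = pb1 C (S n) a"
      "Q n \<odot> \<gamma> n = pb2 C (S n) a" if "0 < n" for n
    using that by blast+
  have "nat_family (comparison_obj C p a) \<beta> \<gamma>"
    unfolding nat_family_def
  proof (intro conjI allI impI ballI)
    fix t assume t: "t \<in> Arr Delta"
    define m n where mn: "m = Dom Delta t" "n = Cod Delta t"
    have m: "0 < m" and n: "0 < n" using t mn by simp_all
    note fibre_map = fibre_map_simps[OF a t, folded mn] and Dt = D_Delta[OF t, folded mn]
      and U = Y(3-5,7)[OF t, folded mn]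
    note Xm = Y(1,2)[OF m] and Xn = Y(1,2)[OF n]
    have P: "pb1 C (S n) a \<in> Arr C" "Cod C (pb1 C (S n) a) = Dom C (S n)" for n
      using a by simp_all
    have "transition \<beta> t \<odot> \<gamma> n = \<gamma> m \<odot> fibre_map a t"
    proof (rule is_pullback_eqI[OF pbn[OF m]])
      have "stage \<beta> m \<odot> transition \<beta> t \<odot> \<gamma> n = (D t \<odot> stage \<beta> n) \<odot> \<gamma> n"
        by (rule Cmp_reassoc[OF U(4)]) (use U g[OF n] Xm in simp_all)
      also have "\<dots> = D t \<odot> pb1 C (S n) a" using Dt Xn g[OF n] by simp
      also have "\<dots> = stage \<beta> m \<odot> \<gamma> m \<odot> fibre_map a t"
        using Cmp_reassoc[OF g(5)[OF m], of "fibre_map a t"] g[OF m] fibre_map Xm by simp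
      finally show "stage \<beta> m \<odot> transition \<beta> t \<odot> \<gamma> n = stage \<beta> m \<odot> \<gamma> m \<odot> fibre_map a t" .
      \<comment> \<open>\<open>t\<close> takes vertex 0 of \<open>m\<close> to some vertex of
        \<open>n\<close>, and \<open>Q n\<close> may be computed with that vertex as well as with
        0.\<close>
      obtain j where j: "j < n" "t \<odot>\<^bsub>Delta\<^esub> vertex m 0 = vertex n j"
        using Cmp_vertex[OF t, of 0] mn m by auto
      have "transition \<beta> (vertex n j) = transition \<beta> (vertex m 0) \<odot> transition \<beta> t"
        using Y(9)[OF t vertex_in[OF m]] mn j by simp
      then have "Q n = Q m \<odot> transition \<beta> t"
        unfolding qv[OF j(1), symmetric] Q_def[of m] using Y(3-5)[OF vertex_in[OF m]] pbD U by simp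
      then have "Q m \<odot> transition \<beta> t \<odot> \<gamma> n = Q n \<odot> \<gamma> n"
        using Q[OF m] U g[OF n] by simp
      also have "\<dots> = Q m \<odot> \<gamma> m \<odot> fibre_map a t"
        using Cmp_reassoc[OF g(6)[OF m], of "fibre_map a t"] g(2-4)[OF m] g(6)[OF n] fibre_map
          Q[OF m] by simp
      finally show "Q m \<odot> transition \<beta> t \<odot> \<gamma> n = Q m \<odot> \<gamma> m \<odot> fibre_map a t" .
    qed (use U fibre_map g(2-4)[OF m] g(2-4)[OF n] a in simp_all)
    then show "transition \<beta> t \<odot> \<gamma> (Cod Delta t) = \<gamma> (Dom Delta t) \<odot> transition (comparison_obj C p
      a) t"
      unfolding c(3)[OF t] mn .
  qed (use g c(2) in simp_all)
  with a g(1) show ?thesis by blast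
qed

theorem effective_descent: "effective_descent C p"
proof -
  have "is_equivalence (slice C (Cod C p)) (descent_cat C p) (comparison C p)"
  proof (rule is_equivalenceI[OF comparison_functor])
    fix s t assume s: "s \<in> Arr (slice C (Cod C p))" "t \<in> Arr (slice C (Cod C p))"
      "Dom (slice C (Cod C p)) s = Dom (slice C (Cod C p)) t" "Cod (slice C (Cod C p)) s =
        Cod (slice C (Cod C p)) t"
      "amap (comparison C p) s = amap (comparison C p) t"
    from s(1-4) obtain a h k a' where st: "s = (a, h, a')" "t = (a, k, a')" and a: "a \<in> Arr C"
      "Cod C a = Cod C p"
      and a': "a' \<in> Arr C" "Cod C a' = Cod C p"
      and h: "h \<in> Arr C" "Dom C h = Dom C a" "Cod C h = Dom C a'" "a' \<odot> h = a"
      and k: "k \<in> Arr C" "Dom C k = Dom C a" "Cod C k = Dom C a'" "a' \<odot> k = a"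
      by (cases s; cases t) (auto simp: homs_def)
    \<comment> \<open>Stage 1 is enough for faithfulness: it determines \<open>h\<close> on the
      image of an epimorphism.\<close>
    have "pull_arr (S 1) a h a' = pull_arr (S 1) a k a'"
      using s(5) unfolding st comparison_arr(1)[OF a a' h] comparison_arr(1)[OF a a' k]
        descent_arr_eq_iff
      by (metis zero_less_one)
    moreover have sl: "p \<in> Arr C" "a \<in> Arr C" "a' \<in> Arr C" "Cod C a = Cod C p" "Cod C a' = Cod C p"
      using a a' by simp_all
    ultimately have "h \<odot> pb2 C p a = k \<odot> pb2 C p a"
      using pb_lift_slice(5)[OF sl h] pb_lift_slice(5)[OF sl k]
        by (metis One_nat_def fp_str.simps(2))
    then have "h = k" using pb2_epi[OF a] h k by simp
    then show "s = t" by (simp add: st)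
  next
    fix a a' t assume "a \<in> Obj (slice C (Cod C p))" "a' \<in> Obj (slice C (Cod C p))"
      and t: "t \<in> homs (descent_cat C p) (omap (comparison C p) a) (omap (comparison C p) a')"
    then have a: "a \<in> Arr C" "Cod C a = Cod C p" and a': "a' \<in> Arr C" "Cod C a' = Cod C p"
      by simp_all
    from t obtain \<gamma> where t: "t = descent_arr (comparison_obj C p a) \<gamma> (comparison_obj C p a')"
      and g: "nat_family (comparison_obj C p a) (comparison_obj C p a') \<gamma>"
      by (auto simp: homs_def descent_cat_Arr comparison_def)
    from comparison_full[OF a a' g] obtain h where h: "h \<in> Arr C" "Dom C h = Dom C a"
      "Cod C h = Dom C a'" "a' \<odot> h = a"
      and gh: "\<forall>n > 0. \<gamma> n = pull_arr (S n) a h a'" by blast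
    have "amap (comparison C p) (a, h, a') = t"
      unfolding comparison_arr(1)[OF a a' h] t descent_arr_eq_iff using gh by simp
    then show "\<exists>f \<in> homs (slice C (Cod C p)) a a'. amap (comparison C p) f = t"
      using a a' h by (intro bexI[of _ "(a, h, a')"]) (simp_all add: slice_homs)
  next
    fix \<beta> assume "\<beta> \<in> Obj (descent_cat C p)"
    then have b: "psnat \<beta>" by simp
    from comparison_ess_surj[OF b] obtain a \<gamma> where a: "a \<in> Arr C" "Cod C a = Cod C p"
      and g: "nat_family (comparison_obj C p a) \<beta> \<gamma>" "\<forall>n > 0. is_iso C (\<gamma> n)" by blast
    note c = comparison_obj_psnat[OF a]
    show "\<exists>a \<in> Obj (slice C (Cod C p)). \<exists>t \<in> homs (descent_cat C p) (omap (comparison C p) a) \<beta>.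
      is_iso (descent_cat C p) t"
      using a g descent_iso[OF c(1) b g(1)] descent_cat_Arr'[OF c(1) b g(1)]
      by (intro bexI[of _ a] bexI[of _ "descent_arr (comparison_obj C p a) \<gamma> \<beta>"]) (simp_all add:
        homs_def comparison_def)
  qed
  then show ?thesis
    unfolding effective_descent_def using category_with_pullbacks_axioms by simp
qed

end

section \<open>Single-sorted 2-categories\<close>

text \<open>A strict 2-category as its set of 2-cells, objects and 1-cells being identified with the
  identity 2-cells on them. In direction \<open>Hor\<close> the operations are the boundary objects and
  horizontal composition, in direction \<open>Ver\<close> the boundary 1-cells and vertical composition.\<close>

datatype dir = Hor | Ver

record 'k ss2 =
  Cell :: "'k set"
  Src :: "dir \<Rightarrow> 'k \<Rightarrow> 'k"
  Tgt :: "dir \<Rightarrow> 'k \<Rightarrow> 'k"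
  Comp :: "dir \<Rightarrow> 'k \<Rightarrow> 'k \<Rightarrow> 'k"

definition comps :: "'k ss2 \<Rightarrow> dir \<Rightarrow> ('k \<times> 'k) set" where
  "comps S i = {(y, x). y \<in> Cell S \<and> x \<in> Cell S \<and> Src S i y = Tgt S i x}"

locale ss2 =
  fixes S :: "'k ss2"
  assumes Src_in [simp]: "x \<in> Cell S \<Longrightarrow> Src S i x \<in> Cell S"
    and Tgt_in [simp]: "x \<in> Cell S \<Longrightarrow> Tgt S i x \<in> Cell S"
    and Src_Src [simp]: "x \<in> Cell S \<Longrightarrow> Src S i (Src S i x) = Src S i x"
    and Tgt_Src [simp]: "x \<in> Cell S \<Longrightarrow> Tgt S i (Src S i x) = Src S i x"
    and Src_Tgt [simp]: "x \<in> Cell S \<Longrightarrow> Src S i (Tgt S i x) = Tgt S i x"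
    and Tgt_Tgt [simp]: "x \<in> Cell S \<Longrightarrow> Tgt S i (Tgt S i x) = Tgt S i x"
    and Comp_in: "(y, x) \<in> comps S i \<Longrightarrow> Comp S i y x \<in> Cell S"
    and Src_Comp: "(y, x) \<in> comps S i \<Longrightarrow> Src S i (Comp S i y x) = Src S i x"
    and Tgt_Comp: "(y, x) \<in> comps S i \<Longrightarrow> Tgt S i (Comp S i y x) = Tgt S i y"
    and Comp_assoc: "\<lbrakk>(z, y) \<in> comps S i; (y, x) \<in> comps S i\<rbrakk> \<Longrightarrow>
      Comp S i (Comp S i z y) x = Comp S i z (Comp S i y x)"
    and Comp_Src: "x \<in> Cell S \<Longrightarrow> Comp S i x (Src S i x) = x"
    and Comp_Tgt: "x \<in> Cell S \<Longrightarrow> Comp S i (Tgt S i x) x = x"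
    and Src_Ver_Hor: "x \<in> Cell S \<Longrightarrow> Src S Ver (Src S Hor x) = Src S Hor x"
      "x \<in> Cell S \<Longrightarrow> Src S Ver (Tgt S Hor x) = Tgt S Hor x"
    and Hor_Ver: "x \<in> Cell S \<Longrightarrow> Src S Hor (Src S Ver x) = Src S Hor x"
      "x \<in> Cell S \<Longrightarrow> Src S Hor (Tgt S Ver x) = Src S Hor x"
      "x \<in> Cell S \<Longrightarrow> Tgt S Hor (Src S Ver x) = Tgt S Hor x"
      "x \<in> Cell S \<Longrightarrow> Tgt S Hor (Tgt S Ver x) = Tgt S Hor x"
    and Ver_Comp_Hor: "(y, x) \<in> comps S Hor \<Longrightarrow> Src S Ver (Comp S Hor y x) =
      Comp S Hor (Src S Ver y) (Src S Ver x)"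
      "(y, x) \<in> comps S Hor \<Longrightarrow> Tgt S Ver (Comp S Hor y x) = Comp S Hor (Tgt S Ver y) (Tgt S Ver x)"
    and interchange: "\<lbrakk>(y', y) \<in> comps S Ver; (x', x) \<in> comps S Ver; (y, x) \<in> comps S Hor\<rbrakk> \<Longrightarrow>
      Comp S Hor (Comp S Ver y' y) (Comp S Ver x' x) = Comp S Ver (Comp S Hor y' x') (Comp S Hor y
        x)"
begin

lemma Tgt_Ver_Hor:
  assumes "x \<in> Cell S"
  shows "Tgt S Ver (Src S Hor x) = Src S Hor x" "Tgt S Ver (Tgt S Hor x) = Tgt S Hor x"
  using Src_Ver_Hor[OF assms] assms Tgt_Src by (metis Src_in, metis Tgt_in)

lemma Hor_Comp_Ver:
  assumes "(y, x) \<in> comps S Ver"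
  shows "Src S Hor (Comp S Ver y x) = Src S Hor x" "Tgt S Hor (Comp S Ver y x) = Tgt S Hor x"
proof -
  have "x \<in> Cell S" using assms by (simp add: comps_def)
  then show "Src S Hor (Comp S Ver y x) = Src S Hor x" "Tgt S Hor (Comp S Ver y x) = Tgt S Hor x"
    using Comp_in[OF assms] Src_Comp[OF assms] Hor_Ver by metis+
qed

text \<open>Vertically composable cells have the same horizontal boundary, so horizontal
  composability of the lower row of a square passes to the upper row. This is why squares are
  described by three conditions only.\<close>

lemma comps_Hor_upper:
  assumes "(y', y) \<in> comps S Ver" "(x', x) \<in> comps S Ver" "(y, x) \<in> comps S Hor"
  shows "(y', x') \<in> comps S Hor"
  using assms Hor_Ver unfolding comps_def by (auto, metis)

end

section \<open>Homomorphisms, fibre products and quotients\<close>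

definition ss2_hom :: "'k ss2 \<Rightarrow> 'l ss2 \<Rightarrow> ('k \<Rightarrow> 'l) \<Rightarrow> bool" where
  "ss2_hom S T h \<longleftrightarrow> (\<forall>x \<in> Cell S. h x \<in> Cell T \<and>
       (\<forall>i. h (Src S i x) = Src T i (h x) \<and> h (Tgt S i x) = Tgt T i (h x))) \<and>
     (\<forall>i. \<forall>(y, x) \<in> comps S i. h (Comp S i y x) = Comp T i (h y) (h x))"

lemma ss2_homD:
  assumes "ss2_hom S T h"
  shows "x \<in> Cell S \<Longrightarrow> h x \<in> Cell T" "x \<in> Cell S \<Longrightarrow> h (Src S i x) = Src T i (h x)"
    "x \<in> Cell S \<Longrightarrow> h (Tgt S i x) = Tgt T i (h x)"
    "(y, x) \<in> comps S i \<Longrightarrow> h (Comp S i y x) = Comp T i (h y) (h x)"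
    "(y, x) \<in> comps S i \<Longrightarrow> (h y, h x) \<in> comps T i"
proof -
  note H = assms[unfolded ss2_hom_def]
  show "x \<in> Cell S \<Longrightarrow> h x \<in> Cell T" "x \<in> Cell S \<Longrightarrow> h (Src S i x) = Src T i (h x)"
    "x \<in> Cell S \<Longrightarrow> h (Tgt S i x) = Tgt T i (h x)"
    "(y, x) \<in> comps S i \<Longrightarrow> h (Comp S i y x) = Comp T i (h y) (h x)"
    using H by blast+
  show "(h y, h x) \<in> comps T i" if "(y, x) \<in> comps S i"
  proof -
    have "y \<in> Cell S" "x \<in> Cell S" "Src S i y = Tgt S i x" using that by (simp_all add: comps_def)
    moreover from this have "h y \<in> Cell T" "h x \<in> Cell T" "h (Src S i y) = Src T i (h y)"
      "h (Tgt S i x) = Tgt T i (h x)" using H by blast+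
    ultimately show ?thesis by (simp add: comps_def)
  qed
qed

lemma ss2_homI:
  assumes "\<And>x. x \<in> Cell S \<Longrightarrow> h x \<in> Cell T"
    "\<And>x i. x \<in> Cell S \<Longrightarrow> h (Src S i x) = Src T i (h x)"
    "\<And>x i. x \<in> Cell S \<Longrightarrow> h (Tgt S i x) = Tgt T i (h x)"
    "\<And>y x i. (y, x) \<in> comps S i \<Longrightarrow> h (Comp S i y x) = Comp T i (h y) (h x)"
  shows "ss2_hom S T h"
  using assms unfolding ss2_hom_def by blast

definition ss2_pullback :: "'k ss2 \<Rightarrow> 'l ss2 \<Rightarrow> ('k \<Rightarrow> 'm) \<Rightarrow> ('l \<Rightarrow> 'm) \<Rightarrow> ('k \<times> 'l) ss2" where
  "ss2_pullback S T f g = \<lparr>Cell = {(x, y). x \<in> Cell S \<and> y \<in> Cell T \<and> f x = g y},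
     Src = (\<lambda>i. map_prod (Src S i) (Src T i)), Tgt = (\<lambda>i. map_prod (Tgt S i) (Tgt T i)),
     Comp = (\<lambda>i (y, y') (x, x'). (Comp S i y x, Comp T i y' x'))\<rparr>"

lemma ss2_pullback:
  assumes S: "ss2 S" and T: "ss2 T" and f: "ss2_hom S U f" and g: "ss2_hom T U g"
  shows "ss2 (ss2_pullback S T f g)" "ss2_hom (ss2_pullback S T f g) S fst"
    "ss2_hom (ss2_pullback S T f g) T snd"
proof -
  interpret S: ss2 S by fact
  interpret T: ss2 T by fact
  note F = ss2_homD[OF f] and G = ss2_homD[OF g]
  have c: "(y, x) \<in> comps (ss2_pullback S T f g) i \<longleftrightarrow> (fst y, fst x) \<in> comps S i \<and>
    (snd y, snd x) \<in> comps T i \<and>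
    f (fst y) = g (snd y) \<and> f (fst x) = g (snd x)" for x y i
    by (cases x; cases y) (auto simp: comps_def ss2_pullback_def)
  show "ss2 (ss2_pullback S T f g)"
  proof
    fix z y x i assume "(z, y) \<in> comps (ss2_pullback S T f g) i"
      "(y, x) \<in> comps (ss2_pullback S T f g) i"
    then show "Comp (ss2_pullback S T f g) i (Comp (ss2_pullback S T f g) i z y) x =
      Comp (ss2_pullback S T f g) i z (Comp (ss2_pullback S T f g) i y x)"
      unfolding c by (simp add: ss2_pullback_def split_beta S.Comp_assoc T.Comp_assoc)
  next
    fix y x i assume "(y, x) \<in> comps (ss2_pullback S T f g) i"
    then show "Comp (ss2_pullback S T f g) i y x \<in> Cell (ss2_pullback S T f g)"
      "Src (ss2_pullback S T f g) i (Comp (ss2_pullback S T f g) i y x) =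
        Src (ss2_pullback S T f g) i x"
      "Tgt (ss2_pullback S T f g) i (Comp (ss2_pullback S T f g) i y x) =
        Tgt (ss2_pullback S T f g) i y"
      unfolding c
      by (cases x; cases y; simp add: ss2_pullback_def S.Comp_in T.Comp_in S.Src_Comp T.Src_Comp
        S.Tgt_Comp T.Tgt_Comp F G)+
  next
    fix y x assume "(y, x) \<in> comps (ss2_pullback S T f g) Hor"
    then show "Src (ss2_pullback S T f g) Ver (Comp (ss2_pullback S T f g) Hor y x) =
      Comp (ss2_pullback S T f g) Hor (Src (ss2_pullback S T f g) Ver y) (Src (ss2_pullback S T f
        g) Ver x)"
     "Tgt (ss2_pullback S T f g) Ver (Comp (ss2_pullback S T f g) Hor y x) =
      Comp (ss2_pullback S T f g) Hor (Tgt (ss2_pullback S T f g) Ver y) (Tgt (ss2_pullback S T f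
        g) Ver x)"
      unfolding c by (cases x; cases y; simp add: ss2_pullback_def S.Ver_Comp_Hor T.Ver_Comp_Hor)+
  next
    fix y' y x' x assume "(y', y) \<in> comps (ss2_pullback S T f g) Ver"
      "(x', x) \<in> comps (ss2_pullback S T f g) Ver"
      "(y, x) \<in> comps (ss2_pullback S T f g) Hor"
    then show "Comp (ss2_pullback S T f g) Hor (Comp (ss2_pullback S T f g) Ver y' y)
      (Comp (ss2_pullback S T f g) Ver x' x) =
      Comp (ss2_pullback S T f g) Ver (Comp (ss2_pullback S T f g) Hor y' x') (Comp (ss2_pullback
        S T f g) Hor y x)"
      unfolding c by (simp add: ss2_pullback_def split_beta S.interchange T.interchange)
  qed (auto simp: ss2_pullback_def F G S.Comp_Src T.Comp_Src S.Comp_Tgt T.Comp_Tgt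
      S.Src_Ver_Hor T.Src_Ver_Hor S.Hor_Ver T.Hor_Ver)
  show "ss2_hom (ss2_pullback S T f g) S fst" "ss2_hom (ss2_pullback S T f g) T snd"
    by (rule ss2_homI; auto simp: ss2_pullback_def)+
qed

text \<open>The axioms which involve a configuration of composable cells hold in the quotient
  since such configurations lift along \<open>q\<close>.\<close>

lemma ss2_quotient:
  assumes S: "ss2 S"
    and Src: "\<And>x x' i. \<lbrakk>x \<in> Cell S; x' \<in> Cell S; q x = q x'\<rbrakk> \<Longrightarrow> q (Src S i x) = q (Src S i x')"
    and Tgt: "\<And>x x' i. \<lbrakk>x \<in> Cell S; x' \<in> Cell S; q x = q x'\<rbrakk> \<Longrightarrow> q (Tgt S i x) = q (Tgt S i x')"
    and Comp: "\<And>y x y' x' i. \<lbrakk>(y, x) \<in> comps S i; (y', x') \<in> comps S i; q y = q y'; q x = q x'\<rbrakk> \<Longrightarrow>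
      q (Comp S i y x) = q (Comp S i y' x')"
    and triples: "\<And>z y x i. \<lbrakk>x \<in> Cell S; y \<in> Cell S; z \<in> Cell S; q (Src S i z) = q (Tgt S i y);
      q (Src S i y) = q (Tgt S i x)\<rbrakk> \<Longrightarrow>
      \<exists>z' y' x'. (z', y') \<in> comps S i \<and> (y', x') \<in> comps S i \<and> q z' = q z \<and> q y' = q y \<and> q x' = q x"
    and squares: "\<And>y' y x' x. \<lbrakk>y' \<in> Cell S; y \<in> Cell S; x' \<in> Cell S; x \<in> Cell S;
      q (Src S Ver y') = q (Tgt S Ver y);
      q (Src S Ver x') = q (Tgt S Ver x); q (Src S Hor y) = q (Tgt S Hor x)\<rbrakk> \<Longrightarrow>
      \<exists>w' w v' v. (w', w) \<in> comps S Ver \<and> (v', v) \<in> comps S Ver \<and> (w, v) \<in> comps S Hor \<and>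
        q w' = q y' \<and> q w = q y \<and> q v' = q x' \<and> q v = q x"
  shows "\<exists>A. ss2 A \<and> Cell A = q ` Cell S \<and> ss2_hom S A q \<and>
    (\<forall>i. \<forall>(w, v) \<in> comps A i. \<exists>(y, x) \<in> comps S i. q y = w \<and> q x = v)"
proof -
  interpret ss2 S by fact
  define rep where "rep z = (SOME x. x \<in> Cell S \<and> q x = z)" for z
  have rep: "rep (q x) \<in> Cell S" "q (rep (q x)) = q x" if "x \<in> Cell S" for x
  proof -
    have "\<exists>x'. x' \<in> Cell S \<and> q x' = q x" using that by blast
    from someI_ex[OF this] show "rep (q x) \<in> Cell S" "q (rep (q x)) = q x" by (auto simp: rep_def)
  qed
  \<comment> \<open>Composites need representatives chosen in pairs: separately chosen
    representatives of composable classes need not be composable.\<close>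
  define rep2 where "rep2 i w z = (SOME yx. yx \<in> comps S i \<and> q (fst yx) = w \<and> q (snd yx) = z)"
    for i w z
  have rep2: "rep2 i (q y) (q x) \<in> comps S i" "q (fst (rep2 i (q y) (q x))) = q y"
    "q (snd (rep2 i (q y) (q x))) = q x"
    if "(y, x) \<in> comps S i" for y x i
  proof -
    have "\<exists>yx. yx \<in> comps S i \<and> q (fst yx) = q y \<and> q (snd yx) = q x"
      using that by (intro exI[of _ "(y, x)"]) simp
    from someI_ex[OF this] show "rep2 i (q y) (q x) \<in> comps S i" "q (fst (rep2 i (q y) (q x))) =
      q y"
      "q (snd (rep2 i (q y) (q x))) = q x"
      by (auto simp: rep2_def)
  qed
  define A where "A = \<lparr>Cell = q ` Cell S, Src = (\<lambda>i z. q (Src S i (rep z))), Tgt =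
    (\<lambda>i z. q (Tgt S i (rep z))),
    Comp = (\<lambda>i w z. q (Comp S i (fst (rep2 i w z)) (snd (rep2 i w z))))\<rparr>"
  have CA: "Cell A = q ` Cell S" by (simp add: A_def)
  have SA: "Src A i (q x) = q (Src S i x)" and TA: "Tgt A i (q x) = q (Tgt S i x)" if "x \<in> Cell S"
    for x i
    using Src[of "rep (q x)" x i] Tgt[of "rep (q x)" x i] rep[OF that] that by (simp_all add: A_def)
  have MA: "Comp A i (q y) (q x) = q (Comp S i y x)" if "(y, x) \<in> comps S i" for y x i
    using Comp[of "fst (rep2 i (q y) (q x))" "snd (rep2 i (q y) (q x))" i y x] rep2[OF that] that
    by (simp add: A_def)
  have cS: "y \<in> Cell S" "x \<in> Cell S" "Src S i y = Tgt S i x" if "(y, x) \<in> comps S i" for y x i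
    using that by (simp_all add: comps_def)
  have l3: "\<exists>z' y' x'. (z', y') \<in> comps S i \<and> (y', x') \<in> comps S i \<and> q z' = c \<and> q y' = b \<and> q x' = a"
    if "(c, b) \<in> comps A i" "(b, a) \<in> comps A i" for a b c i
  proof -
    from that obtain z y x where "z \<in> Cell S" "y \<in> Cell S" "x \<in> Cell S" "c = q z" "b = q y"
      "a = q x"
      "Src A i c = Tgt A i b" "Src A i b = Tgt A i a"
      by (auto simp: comps_def CA)
    then show ?thesis using triples[of x y z i] by (simp add: SA TA)
  qed
  \<comment> \<open>A composable pair becomes a composable triple by adding an identity, so that
    lifting of triples covers it.\<close>
  have l2: "\<exists>y x. (y, x) \<in> comps S i \<and> q y = b \<and> q x = a" if ba: "(b, a) \<in> comps A i" for a b i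
  proof -
    from ba obtain y where "y \<in> Cell S" "b = q y" by (auto simp: comps_def CA)
    then have "(Tgt A i b, b) \<in> comps A i" by (simp add: comps_def CA SA TA)
    from l3[OF this ba] show ?thesis by blast
  qed
  have l4: "\<exists>w' w v' v. (w', w) \<in> comps S Ver \<and> (v', v) \<in> comps S Ver \<and> (w, v) \<in> comps S Hor \<and>
        q w' = b' \<and> q w = b \<and> q v' = a' \<and> q v = a"
    if "(b', b) \<in> comps A Ver" "(a', a) \<in> comps A Ver" "(b, a) \<in> comps A Hor" for b' b a' a
  proof -
    from that obtain y' y x' x where "y' \<in> Cell S" "y \<in> Cell S" "x' \<in> Cell S" "x \<in> Cell S"
      "b' = q y'" "b = q y" "a' = q x'" "a = q x"
      "Src A Ver b' = Tgt A Ver b" "Src A Ver a' = Tgt A Ver a" "Src A Hor b = Tgt A Hor a"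
      by (auto simp: comps_def CA)
    then show ?thesis using squares[of y' y x' x] by (simp add: SA TA)
  qed
  have "ss2 A"
  proof
    fix a i assume "a \<in> Cell A"
    then obtain x where x: "x \<in> Cell S" "a = q x" by (auto simp: CA)
    show "Src A i a \<in> Cell A" "Tgt A i a \<in> Cell A" "Src A i (Src A i a) = Src A i a"
      "Tgt A i (Src A i a) = Src A i a" "Src A i (Tgt A i a) = Tgt A i a"
        "Tgt A i (Tgt A i a) = Tgt A i a"
      using x by (simp_all add: CA SA TA)
    have "(x, Src S i x) \<in> comps S i" "(Tgt S i x, x) \<in> comps S i"
      using x by (simp_all add: comps_def)
    then show "Comp A i a (Src A i a) = a" "Comp A i (Tgt A i a) a = a"
      using x by (simp_all add: SA TA MA Comp_Src Comp_Tgt)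
    show "Src A Ver (Src A Hor a) = Src A Hor a" "Src A Ver (Tgt A Hor a) = Tgt A Hor a"
      "Src A Hor (Src A Ver a) = Src A Hor a" "Src A Hor (Tgt A Ver a) = Src A Hor a"
      "Tgt A Hor (Src A Ver a) = Tgt A Hor a" "Tgt A Hor (Tgt A Ver a) = Tgt A Hor a"
      using x by (simp_all add: SA TA Src_Ver_Hor Hor_Ver)
  next
    fix b a i assume "(b, a) \<in> comps A i"
    then obtain y x where yx: "(y, x) \<in> comps S i" "b = q y" "a = q x" using l2 by blast
    show "Comp A i b a \<in> Cell A" "Src A i (Comp A i b a) = Src A i a" "Tgt A i (Comp A i b a) =
      Tgt A i b"
      using cS[OF yx(1)] Comp_in[OF yx(1)] Src_Comp[OF yx(1)] Tgt_Comp[OF yx(1)]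
      by (simp_all add: yx(2,3) MA[OF yx(1)] CA SA TA)
  next
    fix c b a i assume "(c, b) \<in> comps A i" "(b, a) \<in> comps A i"
    then obtain z y x where zyx: "(z, y) \<in> comps S i" "(y, x) \<in> comps S i" "c = q z" "b = q y"
      "a = q x"
      using l3 by blast
    have "(Comp S i z y, x) \<in> comps S i" "(z, Comp S i y x) \<in> comps S i"
      using cS[OF zyx(1)] cS[OF zyx(2)] Comp_in[OF zyx(1)] Comp_in[OF zyx(2)] Src_Comp[OF zyx(1)]
        Tgt_Comp[OF zyx(2)]
      by (simp_all add: comps_def)
    then show "Comp A i (Comp A i c b) a = Comp A i c (Comp A i b a)"
      using zyx by (simp add: MA Comp_assoc)
  next
    fix b a assume "(b, a) \<in> comps A Hor"
    then obtain y x where yx: "(y, x) \<in> comps S Hor" "b = q y" "a = q x" using l2 by blast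
    have "(Src S Ver y, Src S Ver x) \<in> comps S Hor" "(Tgt S Ver y, Tgt S Ver x) \<in> comps S Hor"
      using cS[OF yx(1)] by (simp_all add: comps_def Hor_Ver)
    then show "Src A Ver (Comp A Hor b a) = Comp A Hor (Src A Ver b) (Src A Ver a)"
      "Tgt A Ver (Comp A Hor b a) = Comp A Hor (Tgt A Ver b) (Tgt A Ver a)"
      using cS[OF yx(1)] Comp_in[OF yx(1)] by (simp_all add: yx(2,3) MA yx(1) SA TA Ver_Comp_Hor)
  next
    fix b' b a' a assume "(b', b) \<in> comps A Ver" "(a', a) \<in> comps A Ver" "(b, a) \<in> comps A Hor"
    from l4[OF this] obtain y' y x' x where yx: "(y', y) \<in> comps S Ver" "(x', x) \<in> comps S Ver"
      "(y, x) \<in> comps S Hor"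
      "b' = q y'" "b = q y" "a' = q x'" "a = q x" by blast
    note u = comps_Hor_upper[OF yx(1-3)]
    have "(Comp S Ver y' y, Comp S Ver x' x) \<in> comps S Hor"
      using cS[OF yx(3)] Comp_in[OF yx(1)] Comp_in[OF yx(2)] Hor_Comp_Ver[OF yx(1)]
        Hor_Comp_Ver[OF yx(2)]
      by (simp add: comps_def)
    moreover have "(Comp S Hor y' x', Comp S Hor y x) \<in> comps S Ver"
      using cS[OF yx(1)] cS[OF yx(2)] Comp_in[OF yx(3)] Comp_in[OF u] Ver_Comp_Hor[OF yx(3)]
        Ver_Comp_Hor[OF u]
      by (simp add: comps_def)
    ultimately show "Comp A Hor (Comp A Ver b' b) (Comp A Ver a' a) =
      Comp A Ver (Comp A Hor b' a') (Comp A Hor b a)"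
      using yx u by (simp add: MA interchange)
  qed
  moreover have "ss2_hom S A q"
    by (rule ss2_homI) (auto simp: CA SA TA MA)
  ultimately show ?thesis using l2 CA by (intro exI[of _ A]) fastforce
qed

text \<open>An injection is a quotient map for the equality relation, and all the lifting conditions
  are then met by the given cells themselves.\<close>

lemma ss2_transport:
  assumes S: "ss2 S" and j: "inj_on j (Cell S)"
  shows "\<exists>A. ss2 A \<and> Cell A = j ` Cell S \<and> ss2_hom S A j"
proof -
  interpret ss2 S by fact
  have j: "j x = j y \<longleftrightarrow> x = y" if "x \<in> Cell S" "y \<in> Cell S" for x y
    using j that by (auto dest: inj_onD)
  have "\<exists>A. ss2 A \<and> Cell A = j ` Cell S \<and> ss2_hom S A j \<and>
    (\<forall>i. \<forall>(w, v) \<in> comps A i. \<exists>(y, x) \<in> comps S i. j y = w \<and> j x = v)"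
  proof (rule ss2_quotient[OF S])
    fix y x y' x' i assume "(y, x) \<in> comps S i" "(y', x') \<in> comps S i" "j y = j y'" "j x = j x'"
    then have "y = y'" "x = x'" using j by (auto simp: comps_def)
    then show "j (Comp S i y x) = j (Comp S i y' x')" by simp
  next
    fix z y x i assume "x \<in> Cell S" "y \<in> Cell S" "z \<in> Cell S" "j (Src S i z) = j (Tgt S i y)"
      "j (Src S i y) = j (Tgt S i x)"
    then show "\<exists>z' y' x'. (z', y') \<in> comps S i \<and> (y', x') \<in> comps S i \<and> j z' = j z \<and> j y' = j y \<and>
      j x' = j x"
      by (intro exI[of _ z] exI[of _ y] exI[of _ x]) (simp add: j comps_def)
  next
    fix y' y x' x assume "y' \<in> Cell S" "y \<in> Cell S" "x' \<in> Cell S" "x \<in> Cell S"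
      "j (Src S Ver y') = j (Tgt S Ver y)"
      "j (Src S Ver x') = j (Tgt S Ver x)" "j (Src S Hor y) = j (Tgt S Hor x)"
    then show "\<exists>w' w v' v. (w', w) \<in> comps S Ver \<and> (v', v) \<in> comps S Ver \<and> (w, v) \<in> comps S Hor \<and>
        j w' = j y' \<and> j w = j y \<and> j v' = j x' \<and> j v = j x"
      by (intro exI[of _ y'] exI[of _ y] exI[of _ x'] exI[of _ x]) (simp add: j comps_def)
  qed (simp_all add: j)
  then show ?thesis by blast
qed

text \<open>The induced map preserves composites because every composable pair of \<open>A\<close>
  is the image of a composable pair of \<open>S\<close>; surjectivity on cells alone does not give
  this.\<close>

lemma ss2_hom_factor:
  assumes q: "ss2_hom S A q" "ss2 S"
    and surj: "Cell A = q ` Cell S" "\<And>i w v. (w, v) \<in> comps A i \<Longrightarrow> \<exists>y x. (y, x) \<in> comps S i \<and> q y =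
      w \<and> q x = v"
    and u: "ss2_hom S Z u" "\<And>x x'. \<lbrakk>x \<in> Cell S; x' \<in> Cell S; q x = q x'\<rbrakk> \<Longrightarrow> u x = u x'"
  shows "\<exists>h. ss2_hom A Z h \<and> (\<forall>x \<in> Cell S. h (q x) = u x)"
proof -
  interpret ss2 S by fact
  note Q = ss2_homD[OF q(1)] and U = ss2_homD[OF u(1)]
  define h where "h z = u (SOME x. x \<in> Cell S \<and> q x = z)" for z
  have h: "h (q x) = u x" if "x \<in> Cell S" for x
  proof -
    have "\<exists>x'. x' \<in> Cell S \<and> q x' = q x" using that by blast
    from someI_ex[OF this] show ?thesis using u(2)[OF _ that] unfolding h_def by blast
  qed
  have "ss2_hom A Z h"
  proof (rule ss2_homI)
    fix a i assume "a \<in> Cell A"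
    then obtain x where x: "x \<in> Cell S" "a = q x" using surj(1) by blast
    show "h a \<in> Cell Z" "h (Src A i a) = Src Z i (h a)" "h (Tgt A i a) = Tgt Z i (h a)"
      using x by (simp_all add: h U flip: Q(2,3))
  next
    fix w v i assume "(w, v) \<in> comps A i"
    then obtain y x where yx: "(y, x) \<in> comps S i" "q y = w" "q x = v" using surj(2) by blast
    have c: "y \<in> Cell S" "x \<in> Cell S" using yx(1) by (simp_all add: comps_def)
    show "h (Comp A i w v) = Comp Z i (h w) (h v)"
      using yx(1) c Comp_in[OF yx(1)] by (simp add: h U(4) yx(2,3)[symmetric] flip: Q(4))
  qed
  with h show ?thesis by blast
qed

text \<open>The identity of \<open>S\<close> factors through \<open>h\<close>: by injectivity on
  boundaries, composable pairs of \<open>T\<close> come from composable pairs of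
  \<open>S\<close>.\<close>

lemma ss2_hom_inverse:
  assumes S: "ss2 S" and h: "ss2_hom S T h" and bij: "bij_betw h (Cell S) (Cell T)"
  obtains g where "ss2_hom T S g" "\<And>x. x \<in> Cell S \<Longrightarrow> g (h x) = x" "\<And>y. y \<in> Cell T \<Longrightarrow> h (g y) = y"
proof -
  note H = ss2_homD[OF h]
  have T: "Cell T = h ` Cell S" and inj: "inj_on h (Cell S)"
    using bij by (simp_all add: bij_betw_def)
  have "\<exists>y x. (y, x) \<in> comps S i \<and> h y = w \<and> h x = v" if "(w, v) \<in> comps T i" for i w v
  proof -
    from that obtain y x where yx: "y \<in> Cell S" "x \<in> Cell S" "w = h y" "v = h x"
      "Src T i w = Tgt T i v"
      by (auto simp: comps_def T)
    then have "h (Src S i y) = h (Tgt S i x)" by (simp add: H)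
    then have "Src S i y = Tgt S i x"
      using inj yx S by (auto dest: inj_onD simp: ss2.Src_in ss2.Tgt_in)
    with yx show ?thesis by (auto simp: comps_def)
  qed
  moreover have "ss2_hom S S (\<lambda>x. x)" by (rule ss2_homI) simp_all
  moreover have "x = x'" if "x \<in> Cell S" "x' \<in> Cell S" "h x = h x'" for x x'
    using inj that by (auto dest: inj_onD)
  ultimately have "\<exists>g. ss2_hom T S g \<and> (\<forall>x \<in> Cell S. g (h x) = x)"
    by (rule ss2_hom_factor[OF h S T])
  then obtain g where g: "ss2_hom T S g" "\<forall>x \<in> Cell S. g (h x) = x" by blast
  show ?thesis
    by (rule that[of g]) (use g T in auto)
qed

section \<open>Lifting of configurations and descent of a quotient\<close>

definition lifts_triples :: "'k ss2 \<Rightarrow> 'l ss2 \<Rightarrow> ('k \<Rightarrow> 'l) \<Rightarrow> bool" where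
  "lifts_triples S T p \<longleftrightarrow> (\<forall>i c b a. (c, b) \<in> comps T i \<longrightarrow> (b, a) \<in> comps T i \<longrightarrow>
     (\<exists>z y x. (z, y) \<in> comps S i \<and> (y, x) \<in> comps S i \<and> p z = c \<and> p y = b \<and> p x = a))"

definition lifts_squares :: "'k ss2 \<Rightarrow> 'l ss2 \<Rightarrow> ('k \<Rightarrow> 'l) \<Rightarrow> bool" where
  "lifts_squares S T p \<longleftrightarrow> (\<forall>b' b a' a. (b', b) \<in> comps T Ver \<longrightarrow> (a', a) \<in> comps T Ver \<longrightarrow>
    (b, a) \<in> comps T Hor \<longrightarrow>
     (\<exists>y' y x' x. (y', y) \<in> comps S Ver \<and> (x', x) \<in> comps S Ver \<and> (y, x) \<in> comps S Hor \<and>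
        p y' = b' \<and> p y = b \<and> p x' = a' \<and> p x = a))"

text \<open>A pair extended by the identity on its target is a triple; in
  \<open>lifts_cells\<close>, a single cell is extended to a pair in the same way.\<close>

lemma lifts_pairs:
  assumes T: "ss2 T" and l: "lifts_triples S T p" and ba: "(b, a) \<in> comps T i"
  shows "\<exists>y x. (y, x) \<in> comps S i \<and> p y = b \<and> p x = a"
proof -
  interpret T: ss2 T by fact
  have "(Tgt T i b, b) \<in> comps T i" using ba by (simp add: comps_def)
  with l ba show ?thesis unfolding lifts_triples_def by blast
qed

lemma lifts_cells:
  assumes T: "ss2 T" and l: "lifts_triples S T p" and a: "a \<in> Cell T"
  shows "\<exists>x \<in> Cell S. p x = a"
proof -
  interpret T: ss2 T by fact
  have "(Tgt T Ver a, a) \<in> comps T Ver" using a by (simp add: comps_def)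
  from lifts_pairs[OF T l this] show ?thesis by (auto simp: comps_def)
qed

text \<open>The relation \<open>R\<close> is the image in \<open>C \<times> C\<close> of the second stage of a descent datum on \<open>c\<close>;
  it moves the cells of \<open>C\<close> along the fibres of \<open>p\<close>.\<close>

lemma ss2_descend:
  assumes C: "ss2 C" and E: "ss2 E" and B: "ss2 B" and p: "ss2_hom E B p" and c: "ss2_hom C E c"
    and triples: "lifts_triples E B p" and squares: "lifts_squares E B p"
    and R_cell: "\<And>x y. (x, y) \<in> R \<Longrightarrow> x \<in> Cell C \<and> y \<in> Cell C \<and> p (c x) = p (c y)"
    and R_refl: "\<And>x. x \<in> Cell C \<Longrightarrow> (x, x) \<in> R"
    and R_trans: "\<And>x y z. (x, y) \<in> R \<Longrightarrow> (y, z) \<in> R \<Longrightarrow> (x, z) \<in> R"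
    and R_ex: "\<And>x e. x \<in> Cell C \<Longrightarrow> e \<in> Cell E \<Longrightarrow> p e = p (c x) \<Longrightarrow> \<exists>y. (x, y) \<in> R \<and> c y = e"
    and R_unique: "\<And>x y z. (x, y) \<in> R \<Longrightarrow> (x, z) \<in> R \<Longrightarrow> c y = c z \<Longrightarrow> y = z"
    and R_Src: "\<And>x y i. (x, y) \<in> R \<Longrightarrow> (Src C i x, Src C i y) \<in> R"
    and R_Tgt: "\<And>x y i. (x, y) \<in> R \<Longrightarrow> (Tgt C i x, Tgt C i y) \<in> R"
    and R_Comp: "\<And>x x' y y' i. \<lbrakk>(x, x') \<in> R; (y, y') \<in> R; (y, x) \<in> comps C i;
      (y', x') \<in> comps C i\<rbrakk> \<Longrightarrow>
      (Comp C i y x, Comp C i y' x') \<in> R"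
  shows "\<exists>(A :: 'k ss2) q a. ss2 (A :: 'k ss2) \<and> ss2_hom (C :: 'k ss2) A q \<and> Cell A = q ` Cell C \<and>
    ss2_hom A B a \<and>
    (\<forall>x \<in> Cell C. a (q x) = p (c x)) \<and> (\<forall>x \<in> Cell C. \<forall>y \<in> Cell C. q x = q y \<longleftrightarrow> (x, y) \<in> R)"
proof -
  interpret C: ss2 C by fact
  note P = ss2_homD[OF p] and c' = ss2_homD[OF c]
  \<comment> \<open>Transport \<open>y\<close> back to the point \<open>c x\<close> of the fibre. By
    transitivity and uniqueness of transport the result is \<open>x\<close>.\<close>
  have sym: "(y, x) \<in> R" if xy: "(x, y) \<in> R" for x y
  proof -
    have "x \<in> Cell C" "y \<in> Cell C" "p (c x) = p (c y)" using R_cell[OF xy] by simp_all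
    then obtain z where z: "(y, z) \<in> R" "c z = c x" using R_ex[of y "c x"] c' by blast
    then have "z = x" using R_unique[OF R_trans[OF xy z(1)] R_refl] \<open>x \<in> Cell C\<close> by simp
    with z show ?thesis by simp
  qed
  \<comment> \<open>A class is represented by one of its members, chosen from the whole class, so
    that the quotient has the same type of cells as \<open>C\<close>. Related cells get the same
    representative because they are related to the same cells.\<close>
  define q where "q x = (SOME y. (x, y) \<in> R)" for x
  have Rq: "(x, q x) \<in> R" if "x \<in> Cell C" for x
    using R_refl[OF that] unfolding q_def by (rule someI)
  have q: "q x = q y \<longleftrightarrow> (x, y) \<in> R" if "x \<in> Cell C" "y \<in> Cell C" for x y
  proof
    assume "q x = q y"
    then show "(x, y) \<in> R" using R_trans[OF Rq[OF that(1)] sym] Rq[OF that(2)] by simp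
  next
    assume "(x, y) \<in> R"
    then have "(x, z) \<in> R \<longleftrightarrow> (y, z) \<in> R" for z using R_trans sym by blast
    then show "q x = q y" by (simp add: q_def)
  qed
  \<comment> \<open>A cell of \<open>C\<close> is determined by its class and its image in
    \<open>E\<close>, as it must be if \<open>C\<close> is to be the fibre product of
    \<open>E\<close> and the quotient.\<close>
  have eqI: "u = v" if "u \<in> Cell C" "v \<in> Cell C" "q u = q v" "c u = c v" for u v
    using R_unique[OF R_refl, of u v] that q by blast
  have pcq: "p (c u) = p (c v)" if "u \<in> Cell C" "v \<in> Cell C" "q u = q v" for u v
    using R_cell q that by blast
  have move: "\<exists>y \<in> Cell C. q y = q x \<and> c y = e" if xe: "x \<in> Cell C" "e \<in> Cell E" "p e = p (c x)"
    for x e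
  proof -
    obtain y where "(x, y) \<in> R" "c y = e" using R_ex[OF xe] by blast
    then show ?thesis using R_cell[of x y] q[of x y] xe(1) by auto
  qed
  have down: "(p (c y), p (c x)) \<in> comps B i" if "x \<in> Cell C" "y \<in> Cell C"
    "q (Src C i y) = q (Tgt C i x)" for x y i
  proof -
    have "p (c (Src C i y)) = p (c (Tgt C i x))" using that by (intro pcq) simp_all
    then show ?thesis using that P c' by (simp add: comps_def)
  qed
  \<comment> \<open>The two boundaries to be matched have equal classes by assumption and equal
    images in \<open>E\<close> by composability there, so \<open>eqI\<close> identifies
    them.\<close>
  have up: "(y', x') \<in> comps C i"
    if "x' \<in> Cell C" "y' \<in> Cell C" "x \<in> Cell C" "y \<in> Cell C" "q x' = q x" "q y' = q y"
      "q (Src C i y) = q (Tgt C i x)" "(c y', c x') \<in> comps E i" for x y x' y' i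
  proof -
    have "q (Src C i y') = q (Src C i y)" "q (Tgt C i x') = q (Tgt C i x)"
      using q that R_Src[of y' y i] R_Tgt[of x' x i] by simp_all
    then have *: "q (Src C i y') = q (Tgt C i x')" using that(7) by simp
    have "Src C i y' = Tgt C i x'"
      by (rule eqI[OF _ _ *]) (use that(1,2,8) c' in \<open>simp_all add: comps_def\<close>)
    with that show ?thesis by (simp add: comps_def)
  qed
  have cE: "y \<in> Cell E" "x \<in> Cell E" if "(y, x) \<in> comps E i" for y x i
    using that by (simp_all add: comps_def)
  have "\<exists>A. ss2 A \<and> Cell A = q ` Cell C \<and> ss2_hom C A q \<and>
    (\<forall>i. \<forall>(w, v) \<in> comps A i. \<exists>(y, x) \<in> comps C i. q y = w \<and> q x = v)"
  proof (rule ss2_quotient[OF C])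
    fix x x' i assume "x \<in> Cell C" "x' \<in> Cell C" "q x = q x'"
    then show "q (Src C i x) = q (Src C i x')" "q (Tgt C i x) = q (Tgt C i x')"
      using R_Src R_Tgt by (simp_all add: q)
  next
    fix y x y' x' i assume "(y, x) \<in> comps C i" "(y', x') \<in> comps C i" "q y = q y'" "q x = q x'"
    moreover from this have "y \<in> Cell C" "x \<in> Cell C" "y' \<in> Cell C" "x' \<in> Cell C"
      by (simp_all add: comps_def)
    ultimately show "q (Comp C i y x) = q (Comp C i y' x')"
      using C.Comp_in R_Comp by (simp add: q)
  next
    fix z y x i assume a: "x \<in> Cell C" "y \<in> Cell C" "z \<in> Cell C" "q (Src C i z) = q (Tgt C i y)"
      "q (Src C i y) = q (Tgt C i x)"
    \<comment> \<open>The images of the classes in \<open>B\<close> form a composable triple. It is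
      lifted to \<open>E\<close>, and the cells of \<open>C\<close> are then moved along the fibres
      to lie over this lift.\<close>
    obtain e f g where e: "(g, f) \<in> comps E i" "(f, e) \<in> comps E i" "p g = p (c z)"
      "p f = p (c y)" "p e = p (c x)"
      using triples down[OF a(2,3,4)] down[OF a(1,2,5)] unfolding lifts_triples_def by meson
    obtain z' y' x' where "x' \<in> Cell C" "q x' = q x" "c x' = e" "y' \<in> Cell C" "q y' = q y"
      "c y' = f"
      "z' \<in> Cell C" "q z' = q z" "c z' = g"
      using move[OF a(1), of e] move[OF a(2), of f] move[OF a(3), of g] e cE[OF e(1)] cE[OF e(2)]
        by blast
    moreover from this have "(z', y') \<in> comps C i" "(y', x') \<in> comps C i"
      using up[of y' z' y z i] up[of x' y' x y i] e a by simp_all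
    ultimately show "\<exists>z' y' x'. (z', y') \<in> comps C i \<and> (y', x') \<in> comps C i \<and> q z' = q z \<and> q y' =
      q y \<and> q x' = q x"
      by blast
  next
    fix y' y x' x assume a: "y' \<in> Cell C" "y \<in> Cell C" "x' \<in> Cell C" "x \<in> Cell C"
      "q (Src C Ver y') = q (Tgt C Ver y)"
      "q (Src C Ver x') = q (Tgt C Ver x)" "q (Src C Hor y) = q (Tgt C Hor x)"
    obtain f' f e' e where e: "(f', f) \<in> comps E Ver" "(e', e) \<in> comps E Ver" "(f, e) \<in> comps E Hor"
      "p f' = p (c y')" "p f = p (c y)" "p e' = p (c x')" "p e = p (c x)"
      using squares down[OF a(2,1,5)] down[OF a(4,3,6)] down[OF a(4,2,7)] unfolding
        lifts_squares_def by meson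
    obtain w' w v' v where w: "w' \<in> Cell C" "q w' = q y'" "c w' = f'" "w \<in> Cell C" "q w = q y"
      "c w = f"
      "v' \<in> Cell C" "q v' = q x'" "c v' = e'" "v \<in> Cell C" "q v = q x" "c v = e"
      using move[OF a(1), of f'] move[OF a(2), of f] move[OF a(3), of e'] move[OF a(4), of e] e
        cE[OF e(1)] cE[OF e(2)] by blast
    then have "(w', w) \<in> comps C Ver" "(v', v) \<in> comps C Ver" "(w, v) \<in> comps C Hor"
      using up[of w w' y y' Ver] up[of v v' x x' Ver] up[of v w x y Hor] e a by simp_all
    with w show "\<exists>w' w v' v. (w', w) \<in> comps C Ver \<and> (v', v) \<in> comps C Ver \<and> (w, v) \<in> comps C Hor \<and>
        q w' = q y' \<and> q w = q y \<and> q v' = q x' \<and> q v = q x"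
      by blast
  qed
  then obtain A where A: "ss2 A" "Cell A = q ` Cell C" "ss2_hom C A q"
    "\<And>i w v. (w, v) \<in> comps A i \<Longrightarrow> \<exists>y x. (y, x) \<in> comps C i \<and> q y = w \<and> q x = v"
    by fast
  have pc: "ss2_hom C B (\<lambda>x. p (c x))"
    by (rule ss2_homI) (simp_all add: P c')
  obtain a where "ss2_hom A B a" "\<forall>x \<in> Cell C. a (q x) = p (c x)"
    using ss2_hom_factor[OF A(3) C A(2,4) pc pcq] by blast
  with A q show ?thesis by blast
qed

section \<open>The 2-cells of a 2-category\<close>

text \<open>A 2-cell carries its source and target objects because the hom-categories of different
  pairs of objects may share elements.\<close>

definition cells :: "'u twocat \<Rightarrow> ('u \<times> 'u \<times> 'u) ss2" where
  "cells X = \<lparr>Cell = {(x, y, \<alpha>). x \<in> Ob X \<and> y \<in> Ob X \<and> \<alpha> \<in> Arr (Hom X x y)},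
     Src = (\<lambda>i (x, y, \<alpha>). case i of Hor \<Rightarrow> (x, x, Idt (Hom X x x) (One X x))
       | Ver \<Rightarrow> (x, y, Idt (Hom X x y) (Dom (Hom X x y) \<alpha>))),
     Tgt = (\<lambda>i (x, y, \<alpha>). case i of Hor \<Rightarrow> (y, y, Idt (Hom X y y) (One X y))
       | Ver \<Rightarrow> (x, y, Idt (Hom X x y) (Cod (Hom X x y) \<alpha>))),
     Comp = (\<lambda>i (y, z, \<beta>) (x, y', \<alpha>). case i of Hor \<Rightarrow> (x, z, amap (HCmp X x y z) (\<beta>, \<alpha>))
       | Ver \<Rightarrow> (x, y', \<beta> \<odot>\<^bsub>Hom X x y'\<^esub> \<alpha>))\<rparr>"

definition cellmap :: "'u twofun \<Rightarrow> 'u \<times> 'u \<times> 'u \<Rightarrow> 'u \<times> 'u \<times> 'u" where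
  "cellmap F = (\<lambda>(x, y, \<alpha>). (fob F x, fob F y, amap (fhom F x y) \<alpha>))"

lemma cells_simps [simp]:
  "(x, y, \<alpha>) \<in> Cell (cells X) \<longleftrightarrow> x \<in> Ob X \<and> y \<in> Ob X \<and> \<alpha> \<in> Arr (Hom X x y)"
  "Src (cells X) Hor (x, y, \<alpha>) = (x, x, Idt (Hom X x x) (One X x))"
  "Src (cells X) Ver (x, y, \<alpha>) = (x, y, Idt (Hom X x y) (Dom (Hom X x y) \<alpha>))"
  "Tgt (cells X) Hor (x, y, \<alpha>) = (y, y, Idt (Hom X y y) (One X y))"
  "Tgt (cells X) Ver (x, y, \<alpha>) = (x, y, Idt (Hom X x y) (Cod (Hom X x y) \<alpha>))"
  "Comp (cells X) Hor (y, z, \<beta>) (x, y', \<alpha>) = (x, z, amap (HCmp X x y z) (\<beta>, \<alpha>))"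
  "Comp (cells X) Ver (y, z, \<beta>) (x, y', \<alpha>) = (x, y', \<beta> \<odot>\<^bsub>Hom X x y'\<^esub> \<alpha>)"
  by (simp_all add: cells_def)

lemma cellmap_simp [simp]: "cellmap F (x, y, \<alpha>) = (fob F x, fob F y, amap (fhom F x y) \<alpha>)"
  by (simp add: cellmap_def)

context two_category
begin

lemma Hom_simps [simp]:
  assumes "x \<in> Ob X" "y \<in> Ob X"
  shows "\<alpha> \<in> Arr (Hom X x y) \<Longrightarrow> Dom (Hom X x y) \<alpha> \<in> Obj (Hom X x y)"
    "\<alpha> \<in> Arr (Hom X x y) \<Longrightarrow> Cod (Hom X x y) \<alpha> \<in> Obj (Hom X x y)"
    "f \<in> Obj (Hom X x y) \<Longrightarrow> Idt (Hom X x y) f \<in> Arr (Hom X x y)"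
    "f \<in> Obj (Hom X x y) \<Longrightarrow> Dom (Hom X x y) (Idt (Hom X x y) f) = f"
    "f \<in> Obj (Hom X x y) \<Longrightarrow> Cod (Hom X x y) (Idt (Hom X x y) f) = f"
  using category.Dom_in category.Cod_in category.Idt_simps Hom_category[OF assms] by metis+

lemma HCmp_simps [simp]:
  assumes "x \<in> Ob X" "y \<in> Ob X" "z \<in> Ob X"
  shows "g \<in> Obj (Hom X y z) \<Longrightarrow> f \<in> Obj (Hom X x y) \<Longrightarrow> omap (HCmp X x y z) (g, f) \<in> Obj (Hom X x z)"
    "\<beta> \<in> Arr (Hom X y z) \<Longrightarrow> \<alpha> \<in> Arr (Hom X x y) \<Longrightarrow> amap (HCmp X x y z) (\<beta>, \<alpha>) \<in> Arr (Hom X x z)"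
    "\<beta> \<in> Arr (Hom X y z) \<Longrightarrow> \<alpha> \<in> Arr (Hom X x y) \<Longrightarrow> Dom (Hom X x z) (amap (HCmp X x y z) (\<beta>, \<alpha>)) =
      omap (HCmp X x y z) (Dom (Hom X y z) \<beta>, Dom (Hom X x y) \<alpha>)"
    "\<beta> \<in> Arr (Hom X y z) \<Longrightarrow> \<alpha> \<in> Arr (Hom X x y) \<Longrightarrow> Cod (Hom X x z) (amap (HCmp X x y z) (\<beta>, \<alpha>)) =
      omap (HCmp X x y z) (Cod (Hom X y z) \<beta>, Cod (Hom X x y) \<alpha>)"
    "g \<in> Obj (Hom X y z) \<Longrightarrow> f \<in> Obj (Hom X x y) \<Longrightarrow>
      amap (HCmp X x y z) (Idt (Hom X y z) g, Idt (Hom X x y) f) =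
        Idt (Hom X x z) (omap (HCmp X x y z) (g, f))"
  using is_functorD(3)[OF HCmp_functor[OF assms], of "(g, f)"] is_functorD(4)[OF HCmp_functor[OF
    assms], of "(\<beta>, \<alpha>)"]
    is_functorD(5)[OF HCmp_functor[OF assms], of "(\<beta>, \<alpha>)"] is_functorD(6)[OF HCmp_functor[OF
      assms], of "(\<beta>, \<alpha>)"]
    is_functorD(7)[OF HCmp_functor[OF assms], of "(g, f)"]
  by (simp_all add: prod_cat_def)

lemma HCmp_Cmp:
  assumes "x \<in> Ob X" "y \<in> Ob X" "z \<in> Ob X"
    and "\<beta>' \<in> Arr (Hom X y z)" "\<beta> \<in> Arr (Hom X y z)" "Dom (Hom X y z) \<beta>' = Cod (Hom X y z) \<beta>"
    and "\<alpha>' \<in> Arr (Hom X x y)" "\<alpha> \<in> Arr (Hom X x y)" "Dom (Hom X x y) \<alpha>' = Cod (Hom X x y) \<alpha>"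
  shows "amap (HCmp X x y z) (\<beta>' \<odot>\<^bsub>Hom X y z\<^esub> \<beta>, \<alpha>' \<odot>\<^bsub>Hom X x y\<^esub> \<alpha>) =
    amap (HCmp X x y z) (\<beta>', \<alpha>') \<odot>\<^bsub>Hom X x z\<^esub> amap (HCmp X x y z) (\<beta>, \<alpha>)"
  using is_functorD(8)[OF HCmp_functor[OF assms(1-3)], of "(\<beta>', \<alpha>')" "(\<beta>, \<alpha>)"] assms
  by (simp add: prod_cat_def)

text \<open>Allows equations between 1-cells to be read off from equations between their identity
  2-cells.\<close>

lemma Idt_eq_iff:
  assumes "x \<in> Ob X" "y \<in> Ob X" "f \<in> Obj (Hom X x y)" "g \<in> Obj (Hom X x y)"
  shows "Idt (Hom X x y) f = Idt (Hom X x y) g \<longleftrightarrow> f = g"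
  using Hom_simps(4)[OF assms(1,2)] assms(3,4) by metis

lemma comps_cells_Hor:
  "(b, a) \<in> comps (cells X) Hor \<longleftrightarrow> (\<exists>x y z \<alpha> \<beta>. b = (y, z, \<beta>) \<and> a = (x, y, \<alpha>) \<and> x \<in> Ob X \<and>
    y \<in> Ob X \<and> z \<in> Ob X \<and>
    \<alpha> \<in> Arr (Hom X x y) \<and> \<beta> \<in> Arr (Hom X y z))"
  by (cases a; cases b) (auto simp: comps_def)

lemma comps_cells_Ver:
  "(b, a) \<in> comps (cells X) Ver \<longleftrightarrow> (\<exists>x y \<alpha> \<beta>. b = (x, y, \<beta>) \<and> a = (x, y, \<alpha>) \<and> x \<in> Ob X \<and> y \<in> Ob X \<and>
    \<alpha> \<in> Arr (Hom X x y) \<and> \<beta> \<in> Arr (Hom X x y) \<and> Dom (Hom X x y) \<beta> = Cod (Hom X x y) \<alpha>)"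
  by (cases a; cases b) (auto simp: comps_def Idt_eq_iff)

lemma ss2_cells: "ss2 (cells X)"
proof
  note One_in [simp]
  fix a i assume a: "a \<in> Cell (cells X)"
  then obtain x y \<alpha> where a: "a = (x, y, \<alpha>)" "x \<in> Ob X" "y \<in> Ob X" "\<alpha> \<in> Arr (Hom X x y)"
    by (cases a) auto
  interpret H: category "Hom X x y" using Hom_category a by blast
  show "Src (cells X) i a \<in> Cell (cells X)" "Tgt (cells X) i a \<in> Cell (cells X)"
    "Src (cells X) i (Src (cells X) i a) = Src (cells X) i a"
      "Tgt (cells X) i (Src (cells X) i a) = Src (cells X) i a"
    "Src (cells X) i (Tgt (cells X) i a) = Tgt (cells X) i a"
      "Tgt (cells X) i (Tgt (cells X) i a) = Tgt (cells X) i a"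
    "Comp (cells X) i a (Src (cells X) i a) = a" "Comp (cells X) i (Tgt (cells X) i a) a = a"
    by (cases i; use a in \<open>simp add: HCmp_One_2 One_HCmp_2\<close>)+
  show "Src (cells X) Ver (Src (cells X) Hor a) = Src (cells X) Hor a"
    "Src (cells X) Ver (Tgt (cells X) Hor a) = Tgt (cells X) Hor a"
    "Src (cells X) Hor (Src (cells X) Ver a) = Src (cells X) Hor a"
    "Src (cells X) Hor (Tgt (cells X) Ver a) = Src (cells X) Hor a"
    "Tgt (cells X) Hor (Src (cells X) Ver a) = Tgt (cells X) Hor a"
    "Tgt (cells X) Hor (Tgt (cells X) Ver a) = Tgt (cells X) Hor a"
    using a by simp_all
next
  fix b a i assume ba: "(b, a) \<in> comps (cells X) i"
  show "Comp (cells X) i b a \<in> Cell (cells X)"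
    "Src (cells X) i (Comp (cells X) i b a) = Src (cells X) i a"
    "Tgt (cells X) i (Comp (cells X) i b a) = Tgt (cells X) i b"
    by (cases i; use ba Hom_category in \<open>auto simp: comps_cells_Hor comps_cells_Ver
      category.Cmp_simps\<close>)+
next
  fix c b a i assume "(c, b) \<in> comps (cells X) i" "(b, a) \<in> comps (cells X) i"
  then show "Comp (cells X) i (Comp (cells X) i c b) a = Comp (cells X) i c (Comp (cells X) i b a)"
    by (cases i) (use Hom_category in \<open>auto simp: comps_cells_Hor comps_cells_Ver HCmp_assoc_2
      category.Cmp_assoc'\<close>)
next
  fix b a assume "(b, a) \<in> comps (cells X) Hor"
  then show "Src (cells X) Ver (Comp (cells X) Hor b a) = Comp (cells X) Hor (Src (cells X) Ver b)
    (Src (cells X) Ver a)"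
    "Tgt (cells X) Ver (Comp (cells X) Hor b a) = Comp (cells X) Hor (Tgt (cells X) Ver b)
      (Tgt (cells X) Ver a)"
    by (auto simp: comps_cells_Hor)
next
  fix b' b a' a assume "(b', b) \<in> comps (cells X) Ver" "(a', a) \<in> comps (cells X) Ver"
    "(b, a) \<in> comps (cells X) Hor"
  then show "Comp (cells X) Hor (Comp (cells X) Ver b' b) (Comp (cells X) Ver a' a) =
      Comp (cells X) Ver (Comp (cells X) Hor b' a') (Comp (cells X) Hor b a)"
    by (auto simp: comps_cells_Hor comps_cells_Ver HCmp_Cmp)
qed

end

section \<open>2-functors as homomorphisms of cells\<close>

lemma (in two_functor) fhom_simps:
  assumes "x \<in> Ob X" "y \<in> Ob X"
  shows "f \<in> Obj (Hom X x y) \<Longrightarrow> omap (fhom F x y) f \<in> Obj (Hom Y (fob F x) (fob F y))"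
    "\<alpha> \<in> Arr (Hom X x y) \<Longrightarrow> amap (fhom F x y) \<alpha> \<in> Arr (Hom Y (fob F x) (fob F y))"
    "\<alpha> \<in> Arr (Hom X x y) \<Longrightarrow> Dom (Hom Y (fob F x) (fob F y)) (amap (fhom F x y) \<alpha>) =
      omap (fhom F x y) (Dom (Hom X x y) \<alpha>)"
    "\<alpha> \<in> Arr (Hom X x y) \<Longrightarrow> Cod (Hom Y (fob F x) (fob F y)) (amap (fhom F x y) \<alpha>) =
      omap (fhom F x y) (Cod (Hom X x y) \<alpha>)"
    "f \<in> Obj (Hom X x y) \<Longrightarrow> amap (fhom F x y) (Idt (Hom X x y) f) =
      Idt (Hom Y (fob F x) (fob F y)) (omap (fhom F x y) f)"
    "\<lbrakk>\<beta> \<in> Arr (Hom X x y); \<alpha> \<in> Arr (Hom X x y); Dom (Hom X x y) \<beta> = Cod (Hom X x y) \<alpha>\<rbrakk> \<Longrightarrow>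
      amap (fhom F x y) (\<beta> \<odot>\<^bsub>Hom X x y\<^esub> \<alpha>) = amap (fhom F x y) \<beta> \<odot>\<^bsub>Hom Y (fob F x) (fob F y)\<^esub> amap
        (fhom F x y) \<alpha>"
  using is_functorD(3-8)[OF conjunct1[OF fhom_functor[OF assms]]] by blast+

lemma (in two_functor) fob_simp: "x \<in> Ob X \<Longrightarrow> fob F x \<in> Ob Y"
  using fob_in by auto

lemma (in two_functor) cellmap_hom: "ss2_hom (cells X) (cells Y) (cellmap F)"
proof (rule ss2_homI)
  fix a i assume a: "a \<in> Cell (cells X)"
  then obtain x y \<alpha> where a: "a = (x, y, \<alpha>)" "x \<in> Ob X" "y \<in> Ob X" "\<alpha> \<in> Arr (Hom X x y)"
    by (cases a) auto
  show "cellmap F a \<in> Cell (cells Y)" "cellmap F (Src (cells X) i a) =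
    Src (cells Y) i (cellmap F a)"
    "cellmap F (Tgt (cells X) i a) = Tgt (cells Y) i (cellmap F a)"
    by (cases i; use a in \<open>simp add: fhom_simps fob_simp X.One_in fhom_One\<close>)+
next
  fix b a i assume "(b, a) \<in> comps (cells X) i"
  then show "cellmap F (Comp (cells X) i b a) = Comp (cells Y) i (cellmap F b) (cellmap F a)"
    by (cases i) (auto simp: X.comps_cells_Hor X.comps_cells_Ver fhom_HCmp_2 fhom_simps)
qed

lemma fctr_eqI:
  assumes "ext_functor C F" "ext_functor C G"
    and "\<And>x. x \<in> Obj C \<Longrightarrow> omap F x = omap G x" "\<And>f. f \<in> Arr C \<Longrightarrow> amap F f = amap G f"
  shows "F = G"
proof (rule fctr.equality)
  show "omap F = omap G" "amap F = amap G"
    using assms unfolding ext_functor_def by (auto intro: extensionalityI)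
qed simp

text \<open>Values at objects and 1-cells are recovered from those at identity 2-cells; off these
  domains both 2-functors are \<open>undefined\<close>.\<close>

lemma cellmap_faithful:
  assumes F: "two_functor X Y F" and G: "two_functor X Y G"
    and eq: "\<And>c. c \<in> Cell (cells X) \<Longrightarrow> cellmap F c = cellmap G c"
  shows "F = G"
proof -
  interpret F: two_functor X Y F by fact
  interpret G: two_functor X Y G by fact
  have fob: "fob F x = fob G x" if "x \<in> Ob X" for x
    using eq[of "(x, x, Idt (Hom X x x) (One X x))"] that by (simp add: F.X.One_in)
  have fhom: "fhom F x y = fhom G x y" if x: "x \<in> Ob X" and y: "y \<in> Ob X" for x y
  proof (rule fctr_eqI)
    show "ext_functor (Hom X x y) (fhom F x y)" "ext_functor (Hom X x y) (fhom G x y)"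
      using F.fhom_functor G.fhom_functor x y by blast+
    show a: "amap (fhom F x y) \<alpha> = amap (fhom G x y) \<alpha>" if "\<alpha> \<in> Arr (Hom X x y)" for \<alpha>
      using eq[of "(x, y, \<alpha>)"] x y that by simp
    fix f assume f: "f \<in> Obj (Hom X x y)"
    then have i: "Idt (Hom X x y) f \<in> Arr (Hom X x y)" "Dom (Hom X x y) (Idt (Hom X x y) f) = f"
      using x y by simp_all
    show "omap (fhom F x y) f = omap (fhom G x y) f"
      using F.fhom_simps(3)[OF x y i(1)] G.fhom_simps(3)[OF x y i(1)] a[OF i(1)] fob[OF x] fob[OF
        y] i(2) by simp
  qed
  show ?thesis
  proof (rule twofun.equality)
    show "fob F = fob G" using F.fob_in G.fob_in fob by (auto intro: PiE_ext)
    show "fhom F = fhom G"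
      using fhom F.fhom_undefined G.fhom_undefined by (intro ext) metis
  qed simp
qed

text \<open>Identity 2-cells on objects and on 1-cells are boundaries of cells, and \<open>h\<close>
  preserves boundaries. So \<open>h\<close> induces maps on objects and 1-cells, and the equations
  of a 2-functor are those of a homomorphism.\<close>

lemma cellmap_full:
  assumes X: "two_category X" and Y: "two_category Y" and h: "ss2_hom (cells X) (cells Y) h"
  shows "\<exists>F. two_functor X Y F \<and> (\<forall>c \<in> Cell (cells X). cellmap F c = h c)"
proof -
  interpret X: two_category X by fact
  interpret Y: two_category Y by fact
  note H = ss2_homD[OF h]
  note X.One_in [simp] Y.One_in [simp]
  define o0 where "o0 x = fst (h (x, x, Idt (Hom X x x) (One X x)))" for x
  define a0 where "a0 x y \<alpha> = snd (snd (h (x, y, \<alpha>)))" for x y \<alpha>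
  \<comment> \<open>The image of an identity 2-cell will turn out to be the identity of this 1-cell,
    which is therefore its domain.\<close>
  define f0 where "f0 x y f = Dom (Hom Y (o0 x) (o0 y)) (a0 x y (Idt (Hom X x y) f))" for x y f
  have hc: "h (x, y, \<alpha>) = (o0 x, o0 y, a0 x y \<alpha>)" if "x \<in> Ob X" "y \<in> Ob X" "\<alpha> \<in> Arr (Hom X x y)"
    for x y \<alpha>
  proof -
    obtain x' y' \<alpha>' where e: "h (x, y, \<alpha>) = (x', y', \<alpha>')" by (cases "h (x, y, \<alpha>)")
    have "h (x, x, Idt (Hom X x x) (One X x)) = Src (cells Y) Hor (x', y', \<alpha>')"
      "h (y, y, Idt (Hom X y y) (One X y)) = Tgt (cells Y) Hor (x', y', \<alpha>')"
      using H(2)[of "(x, y, \<alpha>)" Hor] H(3)[of "(x, y, \<alpha>)" Hor] that by (simp_all add: e)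
    then show ?thesis by (simp add: e o0_def a0_def)
  qed
  have o0: "o0 x \<in> Ob Y" if "x \<in> Ob X" for x
    using H(1)[of "(x, x, Idt (Hom X x x) (One X x))"] that by (simp add: hc)
  have a0: "a0 x y \<alpha> \<in> Arr (Hom Y (o0 x) (o0 y))" if "x \<in> Ob X" "y \<in> Ob X" "\<alpha> \<in> Arr (Hom X x y)"
    for x y \<alpha>
    using H(1)[of "(x, y, \<alpha>)"] that by (simp add: hc)
  have aI: "a0 x y (Idt (Hom X x y) f) = Idt (Hom Y (o0 x) (o0 y)) (f0 x y f)"
    if "x \<in> Ob X" "y \<in> Ob X" "f \<in> Obj (Hom X x y)" for x y f
    using H(2)[of "(x, y, Idt (Hom X x y) f)" Ver] that by (simp add: hc f0_def)
  have f0: "f0 x y f \<in> Obj (Hom Y (o0 x) (o0 y))" if "x \<in> Ob X" "y \<in> Ob X" "f \<in> Obj (Hom X x y)"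
    for x y f
    unfolding f0_def using that a0 o0 by simp
  have Da: "Dom (Hom Y (o0 x) (o0 y)) (a0 x y \<alpha>) = f0 x y (Dom (Hom X x y) \<alpha>)"
    "Cod (Hom Y (o0 x) (o0 y)) (a0 x y \<alpha>) = f0 x y (Cod (Hom X x y) \<alpha>)"
    if "x \<in> Ob X" "y \<in> Ob X" "\<alpha> \<in> Arr (Hom X x y)" for x y \<alpha>
    using H(2)[of "(x, y, \<alpha>)" Ver] H(3)[of "(x, y, \<alpha>)" Ver] that a0 f0 o0
    by (simp_all add: hc aI Y.Idt_eq_iff)
  have aV: "a0 x y (\<beta> \<odot>\<^bsub>Hom X x y\<^esub> \<alpha>) = a0 x y \<beta> \<odot>\<^bsub>Hom Y (o0 x) (o0 y)\<^esub> a0 x y \<alpha>"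
    if "x \<in> Ob X" "y \<in> Ob X" "\<alpha> \<in> Arr (Hom X x y)" "\<beta> \<in> Arr (Hom X x y)"
      "Dom (Hom X x y) \<beta> = Cod (Hom X x y) \<alpha>" for x y \<alpha> \<beta>
    using H(4)[of "(x, y, \<beta>)" "(x, y, \<alpha>)" Ver] that category.Cmp_simps(1)[OF X.Hom_category[OF
      that(1,2)] that(4,3,5)]
    by (simp add: hc X.comps_cells_Ver)
  have aH: "a0 x z (amap (HCmp X x y z) (\<beta>, \<alpha>)) = amap (HCmp Y (o0 x) (o0 y) (o0 z)) (a0 y z \<beta>,
    a0 x y \<alpha>)"
    if "x \<in> Ob X" "y \<in> Ob X" "z \<in> Ob X" "\<alpha> \<in> Arr (Hom X x y)" "\<beta> \<in> Arr (Hom X y z)" for x y z \<alpha> \<beta>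
    using H(4)[of "(y, z, \<beta>)" "(x, y, \<alpha>)" Hor] that by (simp add: hc X.comps_cells_Hor)
  have fH: "f0 x z (omap (HCmp X x y z) (g, f)) = omap (HCmp Y (o0 x) (o0 y) (o0 z)) (f0 y z g,
    f0 x y f)"
    if "x \<in> Ob X" "y \<in> Ob X" "z \<in> Ob X" "f \<in> Obj (Hom X x y)" "g \<in> Obj (Hom X y z)" for x y z f g
    using aH[of x y z "Idt (Hom X x y) f" "Idt (Hom X y z) g"] that f0 o0
    by (simp add: aI Y.Idt_eq_iff)
  have fO: "f0 x x (One X x) = One Y (o0 x)" if "x \<in> Ob X" for x
    using H(2)[of "(x, x, Idt (Hom X x x) (One X x))" Hor] that f0 o0
    by (simp add: hc aI Y.Idt_eq_iff)
  define F where "F = \<lparr>fob = restrict o0 (Ob X), fhom = (\<lambda>x y. if x \<in> Ob X \<and> y \<in> Ob X then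
    \<lparr>omap = restrict (f0 x y) (Obj (Hom X x y)), amap = restrict (a0 x y) (Arr (Hom X x y))\<rparr> else
      undefined)\<rparr>"
  have "two_functor X Y F"
  proof
    show "fob F \<in> Ob X \<rightarrow>\<^sub>E Ob Y" using o0 by (simp add: F_def)
    show "is_functor (Hom X x y) (Hom Y (fob F x) (fob F y)) (fhom F x y) \<and>
      ext_functor (Hom X x y) (fhom F x y)"
      if x: "x \<in> Ob X" and y: "y \<in> Ob X" for x y
    proof
      show "ext_functor (Hom X x y) (fhom F x y)" using x y by (simp add: F_def ext_functor_def)
      show "is_functor (Hom X x y) (Hom Y (fob F x) (fob F y)) (fhom F x y)"
        using x y o0 f0 a0 Da aI aV X.Hom_category[OF x y] Y.Hom_category[OF o0[OF x] o0[OF y]]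
        by (intro is_functorI) (simp_all add: F_def homs_def category.Cmp_simps)
    qed
    show "fhom F x y = undefined" if "\<not> (x \<in> Ob X \<and> y \<in> Ob X)" for x y
      using that by (auto simp: F_def)
  qed (use fH fO aH in \<open>simp_all add: F_def\<close>)
  moreover have "cellmap F c = h c" if "c \<in> Cell (cells X)" for c
    using that by (cases c) (simp add: F_def hc)
  ultimately show ?thesis by blast
qed

text \<open>This inverts \<open>cells\<close> up to isomorphism. Objects and 1-cells are the cells
  fixed by \<open>Src S Hor\<close> and \<open>Src S Ver\<close>, so that \<open>One\<close> and
  \<open>Idt\<close> act as identities. Cells of all dimensions are thus elements of one type, as
  required of \<open>'u\<close>.\<close>

lemma ss2_realize:
  fixes S :: "'u ss2"
  assumes "ss2 S"
  shows "\<exists>(X :: 'u twocat) h. two_category X \<and> ss2_hom S (cells X) h \<and>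
    bij_betw h (Cell S) (Cell (cells X))"
proof -
  interpret ss2 S by fact
  define H where "H x y = \<lparr>Obj = {f \<in> Cell S. Src S Ver f = f \<and> Src S Hor f = x \<and> Tgt S Hor f = y},
    Arr = {f \<in> Cell S. Src S Hor f = x \<and> Tgt S Hor f = y}, Dom = Src S Ver, Cod = Tgt S Ver,
    Idt = (\<lambda>f. f), Cmp = Comp S Ver\<rparr>" for x y
  define X where "X = \<lparr>Ob = {x \<in> Cell S. Src S Hor x = x}, Hom = H, One = (\<lambda>x. x),
    HCmp = (\<lambda>x y z. \<lparr>omap = (\<lambda>(g, f). Comp S Hor g f), amap = (\<lambda>(g, f). Comp S Hor g f)\<rparr>)\<rparr>"
  have ver: "Tgt S Ver x = x" if "x \<in> Cell S" "Src S Ver x = x" for x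
    using that Tgt_Src[of x Ver] by simp
  have hor: "Tgt S Hor x = x" "Src S Ver x = x" "Tgt S Ver x = x" if "x \<in> Cell S"
    "Src S Hor x = x" for x
    using that Tgt_Src[of x Hor] Src_Ver_Hor[of x] Tgt_Ver_Hor[of x] by simp_all
  have cat: "category (H x y)" for x y
  proof
    fix g f assume "(g, f) \<in> comp_pairs (H x y)"
    then have gf: "(g, f) \<in> comps S Ver" "Src S Hor f = x" "Tgt S Hor f = y"
      by (simp_all add: comp_pairs_def H_def comps_def)
    then show "g \<odot>\<^bsub>H x y\<^esub> f \<in> homs (H x y) (Dom (H x y) f) (Cod (H x y) g)"
      using Comp_in[OF gf(1)] Src_Comp[OF gf(1)] Tgt_Comp[OF gf(1)] Hor_Comp_Ver[OF gf(1)]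
      by (simp add: homs_def H_def)
  next
    fix h g f assume "(h, g, f) \<in> comp_triples (H x y)"
    then show "(h \<odot>\<^bsub>H x y\<^esub> g) \<odot>\<^bsub>H x y\<^esub> f = h \<odot>\<^bsub>H x y\<^esub> g \<odot>\<^bsub>H x y\<^esub> f"
      by (simp add: comp_triples_def H_def comps_def Comp_assoc)
  next
    fix f assume f: "f \<in> Arr (H x y)"
    then show "f \<odot>\<^bsub>H x y\<^esub> Idt (H x y) (Dom (H x y) f) = f"
      "Idt (H x y) (Cod (H x y) f) \<odot>\<^bsub>H x y\<^esub> f = f"
      "Dom (H x y) f \<in> Obj (H x y)" "Cod (H x y) f \<in> Obj (H x y)"
      by (simp_all add: H_def Comp_Src Comp_Tgt Hor_Ver)
  qed (auto simp: H_def homs_def ver)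
  have Hor: "Comp S Hor g f \<in> Cell S" "Src S Hor (Comp S Hor g f) = Src S Hor f"
    "Tgt S Hor (Comp S Hor g f) = Tgt S Hor g"
    "Src S Ver (Comp S Hor g f) = Comp S Hor (Src S Ver g) (Src S Ver f)"
    "Tgt S Ver (Comp S Hor g f) = Comp S Hor (Tgt S Ver g) (Tgt S Ver f)"
    if "g \<in> Cell S" "f \<in> Cell S" "Src S Hor g = y" "Tgt S Hor f = y" for g f y
  proof -
    have "(g, f) \<in> comps S Hor" using that by (simp add: comps_def)
    then show "Comp S Hor g f \<in> Cell S" "Src S Hor (Comp S Hor g f) = Src S Hor f"
      "Tgt S Hor (Comp S Hor g f) = Tgt S Hor g"
      "Src S Ver (Comp S Hor g f) = Comp S Hor (Src S Ver g) (Src S Ver f)"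
      "Tgt S Ver (Comp S Hor g f) = Comp S Hor (Tgt S Ver g) (Tgt S Ver f)"
      using Comp_in Src_Comp Tgt_Comp Ver_Comp_Hor by blast+
  qed
  have two: "two_category X"
  proof (rule two_category.intro)
    fix x y z assume "x \<in> Ob X" "y \<in> Ob X" "z \<in> Ob X"
    show "is_functor (prod_cat (Hom X y z) (Hom X x y)) (Hom X x z) (HCmp X x y z)"
    proof (rule is_functorI)
      interpret A: category "H y z" by (rule cat)
      interpret B: category "H x y" by (rule cat)
      show "category (prod_cat (Hom X y z) (Hom X x y))"
      proof
        fix g f assume "(g, f) \<in> comp_pairs (prod_cat (Hom X y z) (Hom X x y))"
        then show "g \<odot>\<^bsub>prod_cat (Hom X y z) (Hom X x y)\<^esub> f \<in> homs (prod_cat (Hom X y z) (Hom X x y))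
          (Dom (prod_cat (Hom X y z) (Hom X x y)) f) (Cod (prod_cat (Hom X y z) (Hom X x y)) g)"
          by (auto simp: prod_cat_def comp_pairs_def homs_def X_def)
      next
        fix h g f assume "(h, g, f) \<in> comp_triples (prod_cat (Hom X y z) (Hom X x y))"
        then show "(h \<odot>\<^bsub>prod_cat (Hom X y z) (Hom X x y)\<^esub> g) \<odot>\<^bsub>prod_cat (Hom X y z) (Hom X x y)\<^esub> f =
          h \<odot>\<^bsub>prod_cat (Hom X y z) (Hom X x y)\<^esub> g \<odot>\<^bsub>prod_cat (Hom X y z) (Hom X x y)\<^esub> f"
          by (auto simp: prod_cat_def comp_triples_def X_def)
      qed (auto simp: prod_cat_def homs_def X_def)
      show "category (Hom X x z)" by (simp add: X_def cat)
      fix g f assume "g \<in> Arr (prod_cat (Hom X y z) (Hom X x y))"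
        "f \<in> Arr (prod_cat (Hom X y z) (Hom X x y))"
        "Dom (prod_cat (Hom X y z) (Hom X x y)) g = Cod (prod_cat (Hom X y z) (Hom X x y)) f"
      then show "amap (HCmp X x y z) (g \<odot>\<^bsub>prod_cat (Hom X y z) (Hom X x y)\<^esub> f) =
        amap (HCmp X x y z) g \<odot>\<^bsub>Hom X x z\<^esub> amap (HCmp X x y z) f"
        by (auto simp: X_def prod_cat_def H_def interchange comps_def)
    qed (auto simp: prod_cat_def X_def H_def homs_def Hor Hor_Ver)
  next
    fix x y assume "x \<in> Ob X" "y \<in> Ob X"
    show "category (Hom X x y)" by (simp add: X_def cat)
  next
    fix x assume "x \<in> Ob X"
    then show "One X x \<in> Obj (Hom X x x)" by (simp add: X_def H_def hor)
  next
    fix w x y z f g h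
    assume "f \<in> Arr (Hom X w x)" "g \<in> Arr (Hom X x y)" "h \<in> Arr (Hom X y z)"
    then show "amap (HCmp X w x z) (amap (HCmp X x y z) (h, g), f) = amap (HCmp X w y z) (h,
      amap (HCmp X w x y) (g, f))"
      by (simp add: X_def H_def Comp_assoc comps_def)
  next
    fix w x y z f g h
    assume "f \<in> Obj (Hom X w x)" "g \<in> Obj (Hom X x y)" "h \<in> Obj (Hom X y z)"
    then show "omap (HCmp X w x z) (omap (HCmp X x y z) (h, g), f) = omap (HCmp X w y z) (h,
      omap (HCmp X w x y) (g, f))"
      by (simp add: X_def H_def Comp_assoc comps_def)
  next
    fix x y f assume "f \<in> Obj (Hom X x y)"
    then show "omap (HCmp X x x y) (f, One X x) = f" "omap (HCmp X x y y) (One X y, f) = f"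
      using Comp_Src[of f Hor] Comp_Tgt[of f Hor] by (auto simp: X_def H_def)
  next
    fix x y f assume "f \<in> Arr (Hom X x y)"
    then show "amap (HCmp X x x y) (f, Idt (Hom X x x) (One X x)) = f"
      "amap (HCmp X x y y) (Idt (Hom X y y) (One X y), f) = f"
      using Comp_Src[of f Hor] Comp_Tgt[of f Hor] by (auto simp: X_def H_def)
  qed
  define h where "h f = (Src S Hor f, Tgt S Hor f, f)" for f
  have "ss2_hom S (cells X) h"
  proof (rule ss2_homI)
    fix f i assume f: "f \<in> Cell S"
    show "h f \<in> Cell (cells X)" "h (Src S i f) = Src (cells X) i (h f)"
      "h (Tgt S i f) = Tgt (cells X) i (h f)"
      by (cases i; use f in \<open>simp add: h_def X_def H_def Hor_Ver\<close>)+
  next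
    fix g f i assume gf: "(g, f) \<in> comps S i"
    then show "h (Comp S i g f) = Comp (cells X) i (h g) (h f)"
      using Src_Comp[OF gf] Tgt_Comp[OF gf] Hor_Comp_Ver[of g f]
      by (cases i) (simp_all add: h_def X_def H_def)
  qed
  moreover have "bij_betw h (Cell S) (Cell (cells X))"
    by (rule bij_betwI[where g = "\<lambda>(x, y, f). f"]) (auto simp: h_def X_def H_def)
  ultimately show ?thesis using two by (intro exI[of _ X] exI[of _ h]) simp
qed


section \<open>Pullbacks of 2-categories\<close>

lemma id_functor:
  assumes "category C"
  shows "is_functor C C (id_functor C) \<and> ext_functor C (id_functor C)"
proof
  interpret category C by fact
  show "is_functor C C (id_functor C)"
    by (rule is_functorI) (simp_all add: id_functor_def homs_def assms)
qed (simp add: ext_functor_def id_functor_def)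

lemma comp_functor:
  assumes F: "is_functor C D F" and G: "is_functor D E G"
  shows "is_functor C E (comp_functor C G F) \<and> ext_functor C (comp_functor C G F)"
proof
  interpret category C using is_functorD(1)[OF F] .
  show "is_functor C E (comp_functor C G F)"
    by (rule is_functorI)
      (simp_all add: comp_functor_def compose_def homs_def is_functorD[OF F] is_functorD[OF G])
  show "ext_functor C (comp_functor C G F)"
    by (simp add: ext_functor_def comp_functor_def compose_def)
qed

lemma id_two_functor: "two_category X \<Longrightarrow> two_functor X X (id_twofun X)"
proof -
  assume "two_category X"
  then interpret two_category X .
  show ?thesis
    by unfold_locales
      (use One_in Hom_category id_functor in \<open>auto simp: id_twofun_def id_functor_def\<close>)
qed

lemma comp_two_functor:
  assumes F: "two_functor X Y F" and G: "two_functor Y Z G"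
  shows "two_functor X Z (comp_twofun X G F)"
proof -
  interpret F: two_functor X Y F by fact
  interpret G: two_functor Y Z G by fact
  show ?thesis
  proof
    show "is_functor (Hom X x y) (Hom Z (fob (comp_twofun X G F) x) (fob (comp_twofun X G F) y))
      (fhom (comp_twofun X G F) x y) \<and>
      ext_functor (Hom X x y) (fhom (comp_twofun X G F) x y)" if "x \<in> Ob X" "y \<in> Ob X" for x y
      using comp_functor[OF conjunct1[OF F.fhom_functor[OF that]] conjunct1[OF G.fhom_functor[OF
        F.fob_simp F.fob_simp]]] that
      by (simp add: comp_twofun_def compose_def)
    show "fhom (comp_twofun X G F) x y = undefined" if "\<not> (x \<in> Ob X \<and> y \<in> Ob X)" for x y
      using that by (auto simp: comp_twofun_def)
  qed (use F.fob_simp G.fob_simp F.fhom_simps F.fhom_One G.fhom_One F.fhom_HCmp_1 G.fhom_HCmp_1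
      F.fhom_HCmp_2 G.fhom_HCmp_2 F.X.One_in in \<open>auto simp: comp_twofun_def comp_functor_def
        compose_def\<close>)
qed

lemma cellmap_id: "c \<in> Cell (cells X) \<Longrightarrow> cellmap (id_twofun X) c = c"
  by (cases c) (simp add: id_twofun_def id_functor_def)

lemma cellmap_comp: "c \<in> Cell (cells X) \<Longrightarrow> cellmap (comp_twofun X G F) c = cellmap G (cellmap F c)"
  by (cases c) (simp add: comp_twofun_def comp_functor_def compose_def)

section \<open>The category of 2-categories and its pullbacks, cell by cell\<close>

abbreviation cm :: "'u twocat \<times> 'u twofun \<times> 'u twocat \<Rightarrow> 'u \<times> 'u \<times> 'u \<Rightarrow> 'u \<times> 'u \<times> 'u" where
  "cm t \<equiv> cellmap (fst (snd t))"

lemma CatCat_Arr: "t \<in> Arr CatCat \<longleftrightarrow> two_functor (Dom CatCat t) (Cod CatCat t) (fst (snd t))"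
  by (cases t) (simp add: CatCat_def)

lemma CatCat_simps:
  "Obj CatCat = {X. two_category X}" "Dom CatCat (X, F, Y) = X" "Cod CatCat (X, F, Y) = Y"
  "Idt CatCat X = (X, id_twofun X, X)" "(Y, G, Z) \<odot>\<^bsub>CatCat\<^esub> (X, F, Y') = (X, comp_twofun X G F, Z)"
  by (simp_all add: CatCat_def)

lemma cm_hom: "t \<in> Arr CatCat \<Longrightarrow> ss2_hom (cells (Dom CatCat t)) (cells (Cod CatCat t)) (cm t)"
  by (simp add: CatCat_Arr two_functor.cellmap_hom)

lemma CatCat_ss2:
  assumes "t \<in> Arr CatCat"
  shows "ss2 (cells (Dom CatCat t))" "ss2 (cells (Cod CatCat t))"
  using assms unfolding CatCat_Arr two_functor_def by (simp_all add: two_category.ss2_cells)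

lemma CatCat_eqI:
  assumes "s \<in> Arr CatCat" "t \<in> Arr CatCat" "Dom CatCat s = Dom CatCat t"
    "Cod CatCat s = Cod CatCat t"
    and "\<And>c. c \<in> Cell (cells (Dom CatCat s)) \<Longrightarrow> cm s c = cm t c"
  shows "s = t"
proof -
  have "fst (snd s) = fst (snd t)"
    by (rule cellmap_faithful[of "Dom CatCat s" "Cod CatCat s"]) (use assms in \<open>simp_all add:
      CatCat_Arr\<close>)
  then show ?thesis using assms(3,4) by (cases s; cases t) (simp add: CatCat_simps)
qed

lemma CatCat_full:
  assumes "two_category X" "two_category Y" "ss2_hom (cells X) (cells Y) h"
  obtains t where "t \<in> Arr CatCat" "Dom CatCat t = X" "Cod CatCat t = Y"
    "\<And>c. c \<in> Cell (cells X) \<Longrightarrow> cm t c = h c"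
proof -
  obtain F where F: "two_functor X Y F" "\<forall>c \<in> Cell (cells X). cellmap F c = h c"
    using cellmap_full[OF assms] by blast
  show ?thesis
    by (rule that[of "(X, F, Y)"]) (use F in \<open>simp_all add: CatCat_Arr CatCat_simps\<close>)
qed

lemma CatCat_Cmp:
  assumes "s \<in> Arr CatCat" "t \<in> Arr CatCat" "Dom CatCat s = Cod CatCat t"
  shows "s \<odot>\<^bsub>CatCat\<^esub> t \<in> Arr CatCat" "Dom CatCat (s \<odot>\<^bsub>CatCat\<^esub> t) = Dom CatCat t"
    "Cod CatCat (s \<odot>\<^bsub>CatCat\<^esub> t) = Cod CatCat s"
    "c \<in> Cell (cells (Dom CatCat t)) \<Longrightarrow> cm (s \<odot>\<^bsub>CatCat\<^esub> t) c = cm s (cm t c)"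
proof -
  obtain Y G Z X F where st: "s = (Y, G, Z)" "t = (X, F, Y)"
    using assms(3) by (cases s; cases t) (simp add: CatCat_simps)
  show "s \<odot>\<^bsub>CatCat\<^esub> t \<in> Arr CatCat" "Dom CatCat (s \<odot>\<^bsub>CatCat\<^esub> t) = Dom CatCat t"
    "Cod CatCat (s \<odot>\<^bsub>CatCat\<^esub> t) = Cod CatCat s"
    "c \<in> Cell (cells (Dom CatCat t)) \<Longrightarrow> cm (s \<odot>\<^bsub>CatCat\<^esub> t) c = cm s (cm t c)"
    using assms(1,2) unfolding st
    by (simp_all add: CatCat_simps CatCat_Arr comp_two_functor cellmap_comp)
qed

lemma CatCat_category: "category CatCat"
proof
  fix x :: "'a twocat" assume "x \<in> Obj CatCat"
  then show "Idt CatCat x \<in> homs CatCat x x"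
    by (simp add: homs_def CatCat_Arr CatCat_simps id_two_functor)
next
  fix t :: "'a twocat \<times> 'a twofun \<times> 'a twocat" assume t: "t \<in> Arr CatCat"
  then show o: "Dom CatCat t \<in> Obj CatCat" "Cod CatCat t \<in> Obj CatCat"
    unfolding CatCat_Arr two_functor_def by (simp_all add: CatCat_simps)
  have i: "Idt CatCat (Dom CatCat t) \<in> Arr CatCat" "Idt CatCat (Cod CatCat t) \<in> Arr CatCat"
    using o by (simp_all add: CatCat_Arr CatCat_simps id_two_functor)
  show "t \<odot>\<^bsub>CatCat\<^esub> Idt CatCat (Dom CatCat t) = t"
    by (rule CatCat_eqI) (use t i CatCat_Cmp[OF t i(1)] in \<open>simp_all add: CatCat_simps cellmap_id\<close>)
  show "Idt CatCat (Cod CatCat t) \<odot>\<^bsub>CatCat\<^esub> t = t"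
    by (rule CatCat_eqI) (use t i CatCat_Cmp[OF i(2) t] ss2_homD(1)[OF cm_hom[OF t]] in \<open>simp_all
      add: CatCat_simps cellmap_id\<close>)
next
  fix g f :: "'a twocat \<times> 'a twofun \<times> 'a twocat" assume "(g, f) \<in> comp_pairs CatCat"
  then show "g \<odot>\<^bsub>CatCat\<^esub> f \<in> homs CatCat (Dom CatCat f) (Cod CatCat g)"
    using CatCat_Cmp[of g f] by (simp add: comp_pairs_def homs_def)
next
  fix h g f :: "'a twocat \<times> 'a twofun \<times> 'a twocat" assume "(h, g, f) \<in> comp_triples CatCat"
  then have a: "h \<in> Arr CatCat" "g \<in> Arr CatCat" "f \<in> Arr CatCat" "Dom CatCat h = Cod CatCat g"
    "Dom CatCat g = Cod CatCat f" by (simp_all add: comp_triples_def)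
  have hg: "h \<odot>\<^bsub>CatCat\<^esub> g \<in> Arr CatCat" "Dom CatCat (h \<odot>\<^bsub>CatCat\<^esub> g) = Cod CatCat f"
    "Cod CatCat (h \<odot>\<^bsub>CatCat\<^esub> g) = Cod CatCat h"
    and gf: "g \<odot>\<^bsub>CatCat\<^esub> f \<in> Arr CatCat" "Dom CatCat (g \<odot>\<^bsub>CatCat\<^esub> f) = Dom CatCat f"
    "Dom CatCat h = Cod CatCat (g \<odot>\<^bsub>CatCat\<^esub> f)"
    using CatCat_Cmp(1-3) a by metis+
  note c = CatCat_Cmp(4)[OF a(1,2,4)] CatCat_Cmp(4)[OF a(2,3,5)] CatCat_Cmp[OF hg(1) a(3) hg(2)]
    CatCat_Cmp[OF a(1) gf(1,3)]
  show "(h \<odot>\<^bsub>CatCat\<^esub> g) \<odot>\<^bsub>CatCat\<^esub> f = h \<odot>\<^bsub>CatCat\<^esub> g \<odot>\<^bsub>CatCat\<^esub> f"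
    by (rule CatCat_eqI) (use a hg gf c ss2_homD(1)[OF cm_hom[OF a(3)]] in simp_all)
qed

text \<open>An infinite set is equinumerous with its square. A cell of a fibre product is a pair of
  triples, which five applications of a pairing injection code by one element.\<close>

lemma infinite_triple_inj:
  assumes "infinite (UNIV :: 'u set)"
  shows "\<exists>j :: ('u \<times> 'u \<times> 'u) \<times> 'u \<times> 'u \<times> 'u \<Rightarrow> 'u. inj j"
proof -
  have "(card_of (UNIV \<times> UNIV :: ('u \<times> 'u) set), card_of (UNIV :: 'u set)) \<in> ordIso"
    using card_of_Times_same_infinite[OF assms] .
  then obtain k :: "'u \<times> 'u \<Rightarrow> 'u" where k: "inj k"
    using card_of_ordIso[of "UNIV \<times> UNIV :: ('u \<times> 'u) set" "UNIV :: 'u set"]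
    by (auto simp: bij_betw_def)
  have "inj (\<lambda>((a, b, c), (d, e, f)). k (k (a, k (b, c)), k (d, k (e, f))))"
    by (rule injI) (auto dest!: injD[OF k])
  then show ?thesis by blast
qed

text \<open>The cells are first renamed to elements of the universe, since
  \<open>ss2_realize\<close> needs them there; the resulting bijection of cells is then inverted as
  a homomorphism.\<close>

lemma CatCat_realize:
  fixes S :: "'k ss2"
  assumes S: "ss2 S" and j: "inj (j :: 'k \<Rightarrow> 'u)"
  obtains X :: "'u twocat" and h k where "two_category X" "ss2_hom S (cells X) h"
    "ss2_hom (cells X) S k"
    "\<And>x. x \<in> Cell S \<Longrightarrow> k (h x) = x" "\<And>c. c \<in> Cell (cells X) \<Longrightarrow> h (k c) = c"
proof -
  have j': "inj_on j (Cell S)" using j by (rule inj_on_subset) simp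
  obtain A where A: "ss2 A" "Cell A = j ` Cell S" "ss2_hom S A j"
    using ss2_transport[OF S j'] by blast
  obtain X :: "'u twocat" and g where X: "two_category X" "ss2_hom A (cells X) g"
    "bij_betw g (Cell A) (Cell (cells X))"
    using ss2_realize[OF A(1)] by blast
  have h: "ss2_hom S (cells X) (\<lambda>x. g (j x))"
    by (rule ss2_homI) (simp_all add: ss2_homD[OF A(3)] ss2_homD[OF X(2)])
  have "bij_betw j (Cell S) (Cell A)" using j' A(2) by (simp add: bij_betw_def)
  then have "bij_betw (\<lambda>x. g (j x)) (Cell S) (Cell (cells X))"
    using bij_betw_trans[OF _ X(3)] by (simp add: comp_def)
  from ss2_hom_inverse[OF S h this] obtain k where "ss2_hom (cells X) S k"
    "\<And>x. x \<in> Cell S \<Longrightarrow> k (g (j x)) = x" "\<And>c. c \<in> Cell (cells X) \<Longrightarrow> g (j (k c)) = c" by blast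
  with X(1) h show ?thesis by (rule that)
qed

text \<open>A mediating map is chosen cell by cell. The projections preserve boundaries and
  composites and are jointly injective, which forces the map to preserve them too; so a pullback of
  sets of cells is a pullback of 2-categories.\<close>

lemma CatCat_is_pullbackI:
  assumes f: "f \<in> Arr CatCat" "g \<in> Arr CatCat" and p: "p \<in> Arr CatCat" "q \<in> Arr CatCat"
    and dc: "Dom CatCat p = Dom CatCat q" "Cod CatCat p = Dom CatCat f"
      "Cod CatCat q = Dom CatCat g"
      "Cod CatCat f = Cod CatCat g"
    and sq: "\<And>z. z \<in> Cell (cells (Dom CatCat p)) \<Longrightarrow> cm f (cm p z) = cm g (cm q z)"
    and ex: "\<And>x y. \<lbrakk>x \<in> Cell (cells (Dom CatCat f)); y \<in> Cell (cells (Dom CatCat g)); cm f x =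
      cm g y\<rbrakk> \<Longrightarrow>
      \<exists>z \<in> Cell (cells (Dom CatCat p)). cm p z = x \<and> cm q z = y"
    and un: "\<And>z z'. \<lbrakk>z \<in> Cell (cells (Dom CatCat p)); z' \<in> Cell (cells (Dom CatCat p)); cm p z =
      cm p z'; cm q z = cm q z'\<rbrakk> \<Longrightarrow> z = z'"
  shows "is_pullback CatCat f g p q"
proof -
  interpret category CatCat by (rule CatCat_category)
  note Cm = CatCat_Cmp
  have cell: "cm t c \<in> Cell (cells (Cod CatCat t))" if "t \<in> Arr CatCat"
    "c \<in> Cell (cells (Dom CatCat t))" for t c
    using ss2_homD(1)[OF cm_hom[OF that(1)] that(2)] .
  show ?thesis
  proof (rule is_pullbackI)
    show "f \<odot>\<^bsub>CatCat\<^esub> p = g \<odot>\<^bsub>CatCat\<^esub> q"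
      by (rule CatCat_eqI) (use f p dc sq Cm(4)[OF f(1) p(1)] Cm(4)[OF f(2) p(2)] in simp_all)
  next
    fix u v assume u: "u \<in> Arr CatCat" "v \<in> Arr CatCat" "Dom CatCat u = Dom CatCat v"
      "Cod CatCat u = Dom CatCat f"
      "Cod CatCat v = Dom CatCat g" "f \<odot>\<^bsub>CatCat\<^esub> u = g \<odot>\<^bsub>CatCat\<^esub> v"
    have uv: "cm f (cm u c) = cm g (cm v c)" if "c \<in> Cell (cells (Dom CatCat u))" for c
      using Cm(4)[OF f(1) u(1)] Cm(4)[OF f(2) u(2)] u that by metis
    define h where "h c = (SOME z. z \<in> Cell (cells (Dom CatCat p)) \<and> cm p z = cm u c \<and> cm q z =
      cm v c)" for c
    have h: "h c \<in> Cell (cells (Dom CatCat p))" "cm p (h c) = cm u c" "cm q (h c) = cm v c"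
      if "c \<in> Cell (cells (Dom CatCat u))" for c
    proof -
      have "cm u c \<in> Cell (cells (Dom CatCat f))" "cm v c \<in> Cell (cells (Dom CatCat g))"
        using cell[OF u(1) that] cell[OF u(2), of c] u(3-5) that by simp_all
      from ex[OF this uv[OF that]] have "\<exists>z. z \<in> Cell (cells (Dom CatCat p)) \<and> cm p z = cm u c \<and>
        cm q z = cm v c"
        by blast
      from someI_ex[OF this] show "h c \<in> Cell (cells (Dom CatCat p))" "cm p (h c) = cm u c"
        "cm q (h c) = cm v c"
        by (auto simp: h_def)
    qed
    have hom: "ss2_hom (cells (Dom CatCat u)) (cells (Dom CatCat p)) h"
    proof (rule ss2_homI)
      note P = ss2_homD[OF cm_hom[OF p(1)]] and Q = ss2_homD[OF cm_hom[OF p(2)], folded dc(1)]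
      note U = ss2_homD[OF cm_hom[OF u(1)]] and V = ss2_homD[OF cm_hom[OF u(2)], folded u(3)]
      interpret SU: ss2 "cells (Dom CatCat u)" by (rule CatCat_ss2[OF u(1)])
      interpret SP: ss2 "cells (Dom CatCat p)" by (rule CatCat_ss2[OF p(1)])
      fix c assume c: "c \<in> Cell (cells (Dom CatCat u))"
      show "h c \<in> Cell (cells (Dom CatCat p))" by (rule h[OF c])
      show "h (Src (cells (Dom CatCat u)) i c) = Src (cells (Dom CatCat p)) i (h c)"
        "h (Tgt (cells (Dom CatCat u)) i c) = Tgt (cells (Dom CatCat p)) i (h c)" for i
        by (rule un; use c h P Q U V dc(2,3) u(4,5) in simp)+
    next
      note P = ss2_homD[OF cm_hom[OF p(1)]] and Q = ss2_homD[OF cm_hom[OF p(2)], folded dc(1)]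
      note U = ss2_homD[OF cm_hom[OF u(1)]] and V = ss2_homD[OF cm_hom[OF u(2)], folded u(3)]
      interpret SU: ss2 "cells (Dom CatCat u)" by (rule CatCat_ss2[OF u(1)])
      interpret SP: ss2 "cells (Dom CatCat p)" by (rule CatCat_ss2[OF p(1)])
      fix b a i assume ba: "(b, a) \<in> comps (cells (Dom CatCat u)) i"
      then have c: "b \<in> Cell (cells (Dom CatCat u))" "a \<in> Cell (cells (Dom CatCat u))"
        "Src (cells (Dom CatCat u)) i b = Tgt (cells (Dom CatCat u)) i a"
        by (simp_all add: comps_def)
      \<comment> \<open>Before composites are compared, the images have to be composable; this too
        is tested on the two projections.\<close>
      have "Src (cells (Dom CatCat p)) i (h b) = Tgt (cells (Dom CatCat p)) i (h a)"
      proof (rule un)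
        show "cm p (Src (cells (Dom CatCat p)) i (h b)) = cm p (Tgt (cells (Dom CatCat p)) i (h a))"
          using P(2,3) h c U(2)[OF c(1), of i] U(3)[OF c(2), of i] dc(2,3) u(4,5) by simp
        show "cm q (Src (cells (Dom CatCat p)) i (h b)) = cm q (Tgt (cells (Dom CatCat p)) i (h a))"
          using Q(2,3) h c V(2)[OF c(1), of i] V(3)[OF c(2), of i] dc(2,3) u(4,5) by simp
      qed (use h c in simp_all)
      then have hba: "(h b, h a) \<in> comps (cells (Dom CatCat p)) i" using h c
        by (simp add: comps_def)
      show "h (Comp (cells (Dom CatCat u)) i b a) = Comp (cells (Dom CatCat p)) i (h b) (h a)"
        by (rule un) (use SU.Comp_in[OF ba] SP.Comp_in[OF hba] h c P(4)[OF hba] Q(4)[OF hba]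
          U(4)[OF ba] V(4)[OF ba] dc(2,3) u(4,5) in simp_all)
    qed
    have "two_category (Dom CatCat u)" "two_category (Dom CatCat p)"
      using Dom_in[OF u(1)] Dom_in[OF p(1)] by (simp_all add: CatCat_simps)
    from CatCat_full[OF this hom] obtain t where t: "t \<in> Arr CatCat" "Dom CatCat t = Dom CatCat u"
      "Cod CatCat t = Dom CatCat p" "\<And>c. c \<in> Cell (cells (Dom CatCat u)) \<Longrightarrow> cm t c = h c" by blast
    have "p \<odot>\<^bsub>CatCat\<^esub> t = u"
      by (rule CatCat_eqI) (use p t u dc h Cm(4)[OF p(1) t(1)] in simp_all)
    moreover have "q \<odot>\<^bsub>CatCat\<^esub> t = v"
      by (rule CatCat_eqI) (use p t u dc h Cm(4)[OF p(2) t(1)] in simp_all)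
    ultimately show "\<exists>h\<in>Arr CatCat. Dom CatCat h = Dom CatCat u \<and> Cod CatCat h = Dom CatCat p \<and>
      p \<odot>\<^bsub>CatCat\<^esub> h = u \<and> q \<odot>\<^bsub>CatCat\<^esub> h = v"
      using t by blast
  next
    fix h h' assume h: "h \<in> Arr CatCat" "h' \<in> Arr CatCat" "Dom CatCat h = Dom CatCat h'"
      "Cod CatCat h = Dom CatCat p"
      "Cod CatCat h' = Dom CatCat p" "p \<odot>\<^bsub>CatCat\<^esub> h = p \<odot>\<^bsub>CatCat\<^esub> h'"
        "q \<odot>\<^bsub>CatCat\<^esub> h = q \<odot>\<^bsub>CatCat\<^esub> h'"
    have "cm p (cm h c) = cm p (cm h' c)" "cm q (cm h c) = cm q (cm h' c)"
      if "c \<in> Cell (cells (Dom CatCat h))" for c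
      using Cm(4)[OF p(1) h(1)] Cm(4)[OF p(1) h(2)] Cm(4)[OF p(2) h(1)] Cm(4)[OF p(2) h(2)] h dc
        that by metis+
    then have eq: "cm h c = cm h' c" if "c \<in> Cell (cells (Dom CatCat h))" for c
      by (rule un[rotated 2]) (use that h(3-5) cell[OF h(1), of c] cell[OF h(2), of c] in simp_all)
    show "h = h'"
      by (rule CatCat_eqI[OF h(1,2,3)]) (use h(4,5) eq in simp_all)
  qed (use f p dc in simp_all)
qed

context
  assumes infinite_UNIV: "infinite (UNIV :: 'u set)"
begin

text \<open>The description by cells is stated together with the universal property, to be
  transported afterwards to pullbacks of which only the latter is known.\<close>

lemma CatCat_pullback_ex:
  fixes f g :: "'u twocat \<times> 'u twofun \<times> 'u twocat"
  assumes f: "f \<in> Arr CatCat" "g \<in> Arr CatCat" "Cod CatCat f = Cod CatCat g"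
  shows "\<exists>p q. is_pullback CatCat f g p q \<and>
    (\<forall>x \<in> Cell (cells (Dom CatCat f)). \<forall>y \<in> Cell (cells (Dom CatCat g)). cm f x = cm g y \<longrightarrow>
      (\<exists>z \<in> Cell (cells (Dom CatCat p)). cm p z = x \<and> cm q z = y)) \<and>
    (\<forall>z \<in> Cell (cells (Dom CatCat p)). \<forall>z' \<in> Cell (cells (Dom CatCat p)). cm p z = cm p z' \<longrightarrow>
      cm q z = cm q z' \<longrightarrow> z = z')"
proof -
  interpret category CatCat by (rule CatCat_category)
  let ?P = "ss2_pullback (cells (Dom CatCat f)) (cells (Dom CatCat g)) (cm f) (cm g)"
  note P = ss2_pullback[OF CatCat_ss2(1)[OF f(1)] CatCat_ss2(1)[OF f(2)] cm_hom[OF f(1)] cm_hom[OF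
    f(2), folded f(3)]]
  have CP: "(x, y) \<in> Cell ?P \<longleftrightarrow> x \<in> Cell (cells (Dom CatCat f)) \<and> y \<in> Cell (cells (Dom CatCat g)) \<and>
    cm f x = cm g y" for x y
    by (simp add: ss2_pullback_def)
  obtain j :: "('u \<times> 'u \<times> 'u) \<times> 'u \<times> 'u \<times> 'u \<Rightarrow> 'u" where "inj j"
    using infinite_triple_inj[OF infinite_UNIV] by blast
  from CatCat_realize[OF P(1) this] obtain W :: "'u twocat" and h k where
    W: "two_category W" "ss2_hom ?P (cells W) h" "ss2_hom (cells W) ?P k"
    "\<And>x. x \<in> Cell ?P \<Longrightarrow> k (h x) = x" "\<And>c. c \<in> Cell (cells W) \<Longrightarrow> h (k c) = c" by blast
  have hom: "ss2_hom (cells W) (cells (Dom CatCat f)) (\<lambda>c. fst (k c))"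
    "ss2_hom (cells W) (cells (Dom CatCat g)) (\<lambda>c. snd (k c))"
    by (rule ss2_homI; simp add: ss2_homD[OF W(3)] ss2_homD[OF P(2)] ss2_homD[OF P(3)])+
  have dom: "two_category (Dom CatCat f)" "two_category (Dom CatCat g)"
    using Dom_in[OF f(1)] Dom_in[OF f(2)] by (simp_all add: CatCat_simps)
  from CatCat_full[OF W(1) dom(1) hom(1)] obtain p where p: "p \<in> Arr CatCat" "Dom CatCat p = W"
    "Cod CatCat p = Dom CatCat f"
      "\<And>c. c \<in> Cell (cells W) \<Longrightarrow> cm p c = fst (k c)"
    by blast
  from CatCat_full[OF W(1) dom(2) hom(2)] obtain q where q: "q \<in> Arr CatCat" "Dom CatCat q = W"
    "Cod CatCat q = Dom CatCat g"
      "\<And>c. c \<in> Cell (cells W) \<Longrightarrow> cm q c = snd (k c)"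
    by blast
  have kP: "cm f (fst (k c)) = cm g (snd (k c))" if "c \<in> Cell (cells W)" for c
    using ss2_homD(1)[OF W(3) that] CP[of "fst (k c)" "snd (k c)"] by simp
  have ex: "\<exists>z \<in> Cell (cells (Dom CatCat p)). cm p z = x \<and> cm q z = y"
    if "x \<in> Cell (cells (Dom CatCat f))" "y \<in> Cell (cells (Dom CatCat g))" "cm f x = cm g y" for x y
  proof -
    have xy: "(x, y) \<in> Cell ?P" using that CP by blast
    then show ?thesis using W(4)[OF xy] ss2_homD(1)[OF W(2) xy] p q by (intro bexI[of _
      "h (x, y)"]) simp_all
  qed
  have un: "z = z'" if "z \<in> Cell (cells (Dom CatCat p))" "z' \<in> Cell (cells (Dom CatCat p))"
    "cm p z = cm p z'" "cm q z = cm q z'" for z z'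
  proof -
    have "k z = k z'" using that p q by (intro prod_eqI) simp_all
    then have "h (k z) = h (k z')" by simp
    then show ?thesis using W(5) that p(2) by simp
  qed
  have "is_pullback CatCat f g p q"
    by (rule CatCat_is_pullbackI[OF f(1,2) p(1) q(1)]) (use p q f kP ex un in simp_all)
  with ex un show ?thesis by blast
qed

lemma CatCat_pullbacks: "category_with_pullbacks (CatCat :: ('u twocat, 'u twocat \<times> 'u twofun \<times> 'u
  twocat) cat)"
  unfolding category_with_pullbacks_def category_with_pullbacks_axioms_def
  using CatCat_category CatCat_pullback_ex by blast

text \<open>Chosen pullbacks are known by their universal property only. The comparison isomorphism
  with a constructed pullback is a bijection on cells compatible with the projections, and carries
  the description by cells over.\<close>

lemma CatCat_is_pullbackD:
  fixes f g :: "'u twocat \<times> 'u twofun \<times> 'u twocat"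
  assumes pb: "is_pullback CatCat f g p q" and f: "f \<in> Arr CatCat" "g \<in> Arr CatCat"
    "Cod CatCat f = Cod CatCat g"
  shows "\<lbrakk>x \<in> Cell (cells (Dom CatCat f)); y \<in> Cell (cells (Dom CatCat g)); cm f x = cm g y\<rbrakk> \<Longrightarrow>
      \<exists>z \<in> Cell (cells (Dom CatCat p)). cm p z = x \<and> cm q z = y"
    "\<lbrakk>z \<in> Cell (cells (Dom CatCat p)); z' \<in> Cell (cells (Dom CatCat p)); cm p z =
      cm p z'; cm q z = cm q z'\<rbrakk> \<Longrightarrow> z = z'"
proof -
  interpret category CatCat by (rule CatCat_category)
  obtain p' q' where pq: "is_pullback CatCat f g p' q' \<and>
    (\<forall>x \<in> Cell (cells (Dom CatCat f)). \<forall>y \<in> Cell (cells (Dom CatCat g)). cm f x = cm g y \<longrightarrow>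
      (\<exists>z \<in> Cell (cells (Dom CatCat p')). cm p' z = x \<and> cm q' z = y)) \<and>
    (\<forall>z \<in> Cell (cells (Dom CatCat p')). \<forall>z' \<in> Cell (cells (Dom CatCat p')).
      cm p' z = cm p' z' \<longrightarrow> cm q' z = cm q' z' \<longrightarrow> z = z')"
    using CatCat_pullback_ex[OF f] by (elim exE)
  then have pb': "is_pullback CatCat f g p' q'" by (rule conjunct1)
  have ex: "\<exists>z \<in> Cell (cells (Dom CatCat p')). cm p' z = x \<and> cm q' z = y"
    if "x \<in> Cell (cells (Dom CatCat f))" "y \<in> Cell (cells (Dom CatCat g))" "cm f x = cm g y" for x y
    using pq[THEN conjunct2, THEN conjunct1] that by blast
  have un: "z = z'" if "z \<in> Cell (cells (Dom CatCat p'))" "z' \<in> Cell (cells (Dom CatCat p'))"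
    "cm p' z = cm p' z'" "cm q' z = cm q' z'" for z z'
    using pq[THEN conjunct2, THEN conjunct2] that by blast
  obtain k where k: "is_iso CatCat k" "k \<in> Arr CatCat" "Dom CatCat k = Dom CatCat p"
    "Cod CatCat k = Dom CatCat p'"
    "p' \<odot>\<^bsub>CatCat\<^esub> k = p" "q' \<odot>\<^bsub>CatCat\<^esub> k = q"
    using is_pullback_comparison_iso[OF pb pb' f(1,2)] by blast
  obtain l where l: "l \<in> Arr CatCat" "Dom CatCat l = Dom CatCat p'" "Cod CatCat l = Dom CatCat p"
    "l \<odot>\<^bsub>CatCat\<^esub> k = Idt CatCat (Dom CatCat p)" "k \<odot>\<^bsub>CatCat\<^esub> l = Idt CatCat (Dom CatCat p')"
    using is_isoE[OF k(1)] k(3,4) by metis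
  note D' = is_pullbackD[OF pb']
  have pk: "cm p z = cm p' (cm k z)" "cm q z = cm q' (cm k z)"
    if "z \<in> Cell (cells (Dom CatCat p))" for z
    using CatCat_Cmp(4)[OF D'(1) k(2)] CatCat_Cmp(4)[OF D'(2) k(2)] k D'(3) that by auto
  have lk: "cm l (cm k z) = z" if "z \<in> Cell (cells (Dom CatCat p))" for z
    using CatCat_Cmp(4)[OF l(1) k(2)] l k that by (simp add: CatCat_simps cellmap_id)
  have kl: "cm k (cm l z) = z" if "z \<in> Cell (cells (Dom CatCat p'))" for z
    using CatCat_Cmp(4)[OF k(2) l(1)] l k that by (simp add: CatCat_simps cellmap_id)
  have cl: "cm l z \<in> Cell (cells (Dom CatCat p))" if "z \<in> Cell (cells (Dom CatCat p'))" for z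
    using ss2_homD(1)[OF cm_hom[OF l(1)], of z] l that by simp
  have ck: "cm k z \<in> Cell (cells (Dom CatCat p'))" if "z \<in> Cell (cells (Dom CatCat p))" for z
    using ss2_homD(1)[OF cm_hom[OF k(2)], of z] k that by simp
  show "\<exists>z \<in> Cell (cells (Dom CatCat p)). cm p z = x \<and> cm q z = y"
    if xy: "x \<in> Cell (cells (Dom CatCat f))" "y \<in> Cell (cells (Dom CatCat g))" "cm f x = cm g y"
  proof -
    obtain z where "z \<in> Cell (cells (Dom CatCat p'))" "cm p' z = x" "cm q' z = y" using ex[OF xy]
      by blast
    then show ?thesis using cl kl pk by (intro bexI[of _ "cm l z"]) simp_all
  qed
  show "z = z'" if "z \<in> Cell (cells (Dom CatCat p))" "z' \<in> Cell (cells (Dom CatCat p))"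
    "cm p z = cm p z'" "cm q z = cm q z'"
    using un[of "cm k z" "cm k z'"] ck pk lk that by metis
qed

end

section \<open>Effective descent of 2-functors\<close>

locale lifting_two_functor =
  fixes p :: "'u twocat \<times> 'u twofun \<times> 'u twocat"
  assumes infinite_UNIV: "infinite (UNIV :: 'u set)"
    and p_arr: "p \<in> Arr CatCat"
    and triples: "lifts_triples (cells (Dom CatCat p)) (cells (Cod CatCat p)) (cm p)"
    and squares: "lifts_squares (cells (Dom CatCat p)) (cells (Cod CatCat p)) (cm p)"
begin

sublocale descent "CatCat :: ('u twocat, 'u twocat \<times> 'u twofun \<times> 'u twocat) cat" p
  using CatCat_pullbacks[OF infinite_UNIV] p_arr by (simp add: descent_def descent_axioms_def)

abbreviation cellset where "cellset M \<equiv> Cell (cells M)"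

lemmas pullback_cells = CatCat_is_pullbackD[OF infinite_UNIV]

lemma cm_in: "t \<in> Arr CatCat \<Longrightarrow> Dom CatCat t = M \<Longrightarrow> Cod CatCat t = N \<Longrightarrow> c \<in> cellset M \<Longrightarrow>
  cm t c \<in> cellset N"
  using ss2_homD(1)[OF cm_hom] by blast

text \<open>A cell or composable pair over the domain of \<open>a\<close> is pushed to the base,
  lifted along \<open>p\<close> and paired with itself, so \<open>\<rho>\<close> is surjective on
  cells and on composable pairs. As \<open>u\<close> is constant on the fibres of
  \<open>\<rho>\<close>, it factors through it.\<close>

lemma CatCat_regular_epi:
  fixes a u :: "'u twocat \<times> 'u twofun \<times> 'u twocat"
  assumes a: "a \<in> Arr CatCat" "Cod CatCat a = Cod CatCat p"
    and u: "u \<in> Arr CatCat" "Dom CatCat u = Dom CatCat (pb1 CatCat p a)"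
    and coeq: "\<And>r s. \<lbrakk>r \<in> Arr CatCat; s \<in> Arr CatCat; Dom CatCat r = Dom CatCat s;
        Cod CatCat r = Dom CatCat (pb1 CatCat p a); Cod CatCat s = Dom CatCat (pb1 CatCat p a);
        pb2 CatCat p a \<odot>\<^bsub>CatCat\<^esub> r = pb2 CatCat p a \<odot>\<^bsub>CatCat\<^esub> s\<rbrakk> \<Longrightarrow> u \<odot>\<^bsub>CatCat\<^esub> r = u \<odot>\<^bsub>CatCat\<^esub> s"
  shows "\<exists>!h. h \<in> Arr CatCat \<and> Dom CatCat h = Dom CatCat a \<and> Cod CatCat h = Cod CatCat u \<and>
    h \<odot>\<^bsub>CatCat\<^esub> pb2 CatCat p a = u"
proof -
  define \<pi> where "\<pi> = pb1 CatCat p a"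
  define \<rho> where "\<rho> = pb2 CatCat p a"
  define P where "P = Dom CatCat \<pi>"
  have pb: "is_pullback CatCat p a \<pi> \<rho>"
    unfolding \<pi>_def \<rho>_def by (rule pb_is_pullback) (use a p_arr in simp_all)
  note ex = pullback_cells(1)[OF pb p_arr a(1) a(2)[symmetric], folded P_def]
  note un = pullback_cells(2)[OF pb p_arr a(1) a(2)[symmetric], folded P_def]
  have pi: "\<pi> \<in> Arr CatCat" "Dom CatCat \<pi> = P" "Cod CatCat \<pi> = Dom CatCat p"
    and rho: "\<rho> \<in> Arr CatCat" "Dom CatCat \<rho> = P" "Cod CatCat \<rho> = Dom CatCat a"
    and sq: "p \<odot>\<^bsub>CatCat\<^esub> \<pi> = a \<odot>\<^bsub>CatCat\<^esub> \<rho>"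
    using is_pullbackD[OF pb] by (simp_all add: P_def)
  have u': "Dom CatCat u = P" using u(2) by (simp add: P_def \<pi>_def)
  note Hpi = ss2_homD[OF cm_hom[OF pi(1)], unfolded pi(2,3)]
    and Hrho = ss2_homD[OF cm_hom[OF rho(1)], unfolded rho(2,3)]
    and Hp = ss2_homD[OF cm_hom[OF p_arr]] and Ha = ss2_homD[OF cm_hom[OF a(1)], unfolded a(2)]
  interpret SA: ss2 "cells (Dom CatCat a)" by (rule CatCat_ss2[OF a(1)])
  interpret SP: ss2 "cells P" using CatCat_ss2(1)[OF pi(1)] unfolding pi(2) .
  \<comment> \<open>Two cells with the same image under \<open>\<rho>\<close> are the components of
    one cell of its kernel pair, on which the hypothesis on \<open>u\<close> can be
    evaluated.\<close>
  have const: "cm u w = cm u w'" if w: "w \<in> cellset P" "w' \<in> cellset P" "cm \<rho> w = cm \<rho> w'" for w w'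
  proof -
    have pbk: "is_pullback CatCat \<rho> \<rho> (pb1 CatCat \<rho> \<rho>) (pb2 CatCat \<rho> \<rho>)"
      by (rule pb_is_pullback) (use rho in simp_all)
    define r where "r = pb1 CatCat \<rho> \<rho>"
    define s where "s = pb2 CatCat \<rho> \<rho>"
    have r: "r \<in> Arr CatCat" "s \<in> Arr CatCat" "Dom CatCat r = Dom CatCat s" "Cod CatCat r = P"
      "Cod CatCat s = P"
      and rs: "\<rho> \<odot>\<^bsub>CatCat\<^esub> r = \<rho> \<odot>\<^bsub>CatCat\<^esub> s"
      using is_pullbackD[OF pbk] rho by (simp_all add: r_def s_def)
    obtain z where z: "z \<in> cellset (Dom CatCat r)" "cm r z = w" "cm s z = w'"
      using pullback_cells(1)[OF pbk rho(1) rho(1), of w w'] w rho unfolding r_def s_def by auto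
    have "u \<odot>\<^bsub>CatCat\<^esub> r = u \<odot>\<^bsub>CatCat\<^esub> s"
      by (rule coeq) (use r rs in \<open>simp_all add: P_def \<pi>_def \<rho>_def\<close>)
    then have "cm u (cm r z) = cm u (cm s z)"
      using CatCat_Cmp(4)[OF u(1) r(1)] CatCat_Cmp(4)[OF u(1) r(2)] r(3-5) u' z(1) by metis
    then show ?thesis by (simp add: z)
  qed
  have lift: "\<exists>z \<in> cellset P. cm \<pi> z = e \<and> cm \<rho> z = w"
    if "e \<in> cellset (Dom CatCat p)" "w \<in> cellset (Dom CatCat a)" "cm p e = cm a w" for e w
    using ex[OF that] .
  have surj: "cellset (Dom CatCat a) = cm \<rho> ` cellset P"
  proof
    show "cm \<rho> ` cellset P \<subseteq> cellset (Dom CatCat a)" using Hrho(1) by blast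
    show "cellset (Dom CatCat a) \<subseteq> cm \<rho> ` cellset P"
    proof
      fix w assume w: "w \<in> cellset (Dom CatCat a)"
      then obtain e where "e \<in> cellset (Dom CatCat p)" "cm p e = cm a w"
        using lifts_cells[OF CatCat_ss2(2)[OF p_arr] triples Ha(1)] by blast
      with lift w show "w \<in> cm \<rho> ` cellset P" by blast
    qed
  qed
  have pairs: "\<exists>y x. (y, x) \<in> comps (cells P) i \<and> cm \<rho> y = w \<and> cm \<rho> x = v"
    if wv: "(w, v) \<in> comps (cells (Dom CatCat a)) i" for i w v
  proof -
    obtain f e where fe: "(f, e) \<in> comps (cells (Dom CatCat p)) i" "cm p f = cm a w"
      "cm p e = cm a v"
      using lifts_pairs[OF CatCat_ss2(2)[OF p_arr] triples Ha(5)[OF wv]] by blast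
    have c: "w \<in> cellset (Dom CatCat a)" "v \<in> cellset (Dom CatCat a)" "f \<in> cellset (Dom CatCat p)"
      "e \<in> cellset (Dom CatCat p)"
      "Src (cells (Dom CatCat a)) i w = Tgt (cells (Dom CatCat a)) i v"
        "Src (cells (Dom CatCat p)) i f = Tgt (cells (Dom CatCat p)) i e"
      using wv fe(1) by (simp_all add: comps_def)
    obtain y x where yx: "y \<in> cellset P" "cm \<pi> y = f" "cm \<rho> y = w" "x \<in> cellset P" "cm \<pi> x = e"
      "cm \<rho> x = v"
      using lift[OF c(3,1) fe(2)] lift[OF c(4,2) fe(3)] by blast
    \<comment> \<open>Both projections of the boundaries agree: in the domain of \<open>p\<close>
      because the lift is composable, in that of \<open>a\<close> because the given pair is.\<close>
    have "Src (cells P) i y = Tgt (cells P) i x"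
      by (rule un) (use yx c Hpi Hrho in simp_all)
    then have "(y, x) \<in> comps (cells P) i" using yx by (simp add: comps_def)
    with yx show ?thesis by blast
  qed
  have homs: "ss2_hom (cells P) (cells (Dom CatCat a)) (cm \<rho>)"
    "ss2_hom (cells P) (cells (Cod CatCat u)) (cm u)"
    using cm_hom[OF rho(1)] cm_hom[OF u(1)] unfolding rho u' by simp_all
  obtain h0 where h0: "ss2_hom (cells (Dom CatCat a)) (cells (Cod CatCat u)) h0"
    "\<forall>x \<in> cellset P. h0 (cm \<rho> x) = cm u x"
    using ss2_hom_factor[OF homs(1) SP.ss2_axioms surj pairs homs(2) const] by blast
  have "two_category (Dom CatCat a)" "two_category (Cod CatCat u)"
    using Dom_in[OF a(1)] Cod_in[OF u(1)] by (simp_all only: CatCat_simps mem_Collect_eq)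
  from CatCat_full[OF this h0(1)] obtain h where h: "h \<in> Arr CatCat" "Dom CatCat h = Dom CatCat a"
    "Cod CatCat h = Cod CatCat u" "\<And>c. c \<in> cellset (Dom CatCat a) \<Longrightarrow> cm h c = h0 c" by blast
  show ?thesis
    unfolding \<rho>_def[symmetric]
  proof (rule ex1I[of _ h])
    have hr: "Dom CatCat h = Cod CatCat \<rho>" using h(2) rho(3) by simp
    have "h \<odot>\<^bsub>CatCat\<^esub> \<rho> = u"
      by (rule CatCat_eqI) (use CatCat_Cmp[OF h(1) rho(1) hr] u(1) u' h rho(2) h0(2) Hrho(1) in
        simp_all)
    then show "h \<in> Arr CatCat \<and> Dom CatCat h = Dom CatCat a \<and> Cod CatCat h = Cod CatCat u \<and>
      h \<odot>\<^bsub>CatCat\<^esub> \<rho> = u"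
      using h(1-3) by blast
    fix k assume k: "k \<in> Arr CatCat \<and> Dom CatCat k = Dom CatCat a \<and> Cod CatCat k = Cod CatCat u \<and>
      k \<odot>\<^bsub>CatCat\<^esub> \<rho> = u"
    then have kr: "k \<in> Arr CatCat" "Dom CatCat k = Cod CatCat \<rho>" using rho(3) by simp_all
    show "k = h"
    proof (rule CatCat_eqI)
      fix c assume "c \<in> cellset (Dom CatCat k)"
      then obtain x where x: "x \<in> cellset P" "c = cm \<rho> x" using k surj by auto
      have "cm k c = cm u x" using CatCat_Cmp(4)[OF kr(1) rho(1) kr(2), of x] k x rho(2) by simp
      also have "\<dots> = cm h c" using h(4)[of c] h0(2) x Hrho(1) by simp
      finally show "cm k c = cm h c" .
    qed (use k h in simp_all)
  qed
qed

text \<open>Cells of the n-fold power behave as n-tuples of cells over a common cell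
  \<open>b\<close>. As the pullbacks in \<open>S\<close> and \<open>pr\<close> are arbitrary
  choices, this is proved by induction on n; for n = 0 the tuple is just \<open>b\<close>.\<close>

lemma cells_fp_ex:
  assumes b: "b \<in> cellset (Cod CatCat p)" and e: "\<And>i. i < n \<Longrightarrow> e i \<in> cellset (Dom CatCat p) \<and>
    cm p (e i) = b"
  shows "\<exists>s \<in> cellset (Dom CatCat (S n)). cm (S n) s = b \<and> (\<forall>i < n. cm (pr n i) s = e i)"
  using e
proof (induction n rule: induct_nat_012)
  case 0
  then show ?case using b by (simp add: CatCat_simps cellmap_id)
next
  case 1
  then show ?case using b by (intro bexI[of _ "e 0"]) (simp_all add: CatCat_simps cellmap_id)
next
  case (ge2 n)
  have "\<exists>s \<in> cellset (Dom CatCat (S (Suc n))). cm (S (Suc n)) s = b \<and>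
    (\<forall>i < Suc n. cm (pr (Suc n) i) s = e i)"
    using ge2(2,3) by simp
  then obtain s where s: "s \<in> cellset (Dom CatCat (S (Suc n)))" "cm (S (Suc n)) s = b"
    "\<forall>i < Suc n. cm (pr (Suc n) i) s = e i"
    by blast
  have en: "e (Suc n) \<in> cellset (Dom CatCat p)" "cm p (e (Suc n)) = b" using ge2(3)[of "Suc n"]
    by simp_all
  define \<pi> where "\<pi> = pb1 CatCat (S (Suc n)) p"
  define \<rho> where "\<rho> = pb2 CatCat (S (Suc n)) p"
  have pb: "is_pullback CatCat (S (Suc n)) p \<pi> \<rho>"
    unfolding \<pi>_def \<rho>_def by (rule pb_is_pullback) simp_all
  note pbD = is_pullbackD[OF pb]
  have f: "S (Suc n) \<in> Arr CatCat" "Cod CatCat (S (Suc n)) = Cod CatCat p"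
    using fp_str_in by blast+
  obtain z where z: "z \<in> cellset (Dom CatCat \<pi>)" "cm \<pi> z = s" "cm \<rho> z = e (Suc n)"
    using pullback_cells(1)[OF pb f(1) p_arr f(2) s(1) en(1)] s(2) en(2) by auto
  have "cm (S (Suc n) \<odot>\<^bsub>CatCat\<^esub> \<pi>) z = b"
    using CatCat_Cmp(4)[OF f(1) pbD(1) pbD(4)[symmetric] z(1)] s z by simp
  moreover have "cm (pr (Suc n) i \<odot>\<^bsub>CatCat\<^esub> \<pi>) z = e i" if "i < Suc n" for i
    using CatCat_Cmp(4)[OF fp_proj_in(1)[OF that] pbD(1) _ z(1)] fp_proj_in(2)[OF that] pbD(4) s z
      that by simp
  moreover have "Dom CatCat (S (Suc n) \<odot>\<^bsub>CatCat\<^esub> \<pi>) = Dom CatCat \<pi>"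
    using CatCat_Cmp(2)[OF f(1) pbD(1) pbD(4)[symmetric]] .
  ultimately show ?case
    using z by (intro bexI[of _ z]) (auto simp: less_Suc_eq \<pi>_def \<rho>_def)
qed

text \<open>The empty power is excluded: its cells are those of the base, which the empty family of
  projections does not separate.\<close>

lemma cells_fp_unique:
  assumes "s \<in> cellset (Dom CatCat (S n))" "s' \<in> cellset (Dom CatCat (S n))" "0 < n"
    and "\<And>i. i < n \<Longrightarrow> cm (pr n i) s = cm (pr n i) s'"
  shows "s = s'"
  using assms
proof (induction n arbitrary: s s' rule: induct_nat_012)
  case 1
  then show ?case by (simp add: CatCat_simps cellmap_id)
next
  case (ge2 n)
  define \<pi> where "\<pi> = pb1 CatCat (S (Suc n)) p"
  define \<rho> where "\<rho> = pb2 CatCat (S (Suc n)) p"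
  have pb: "is_pullback CatCat (S (Suc n)) p \<pi> \<rho>"
    unfolding \<pi>_def \<rho>_def by (rule pb_is_pullback) simp_all
  note pbD = is_pullbackD[OF pb]
  have f: "S (Suc n) \<in> Arr CatCat" "Cod CatCat (S (Suc n)) = Cod CatCat p"
    using fp_str_in by blast+
  have d: "Dom CatCat (S (Suc (Suc n))) = Dom CatCat \<pi>"
    using CatCat_Cmp(2)[OF f(1) pbD(1) pbD(4)[symmetric]] by (simp add: \<pi>_def)
  have s: "s \<in> cellset (Dom CatCat \<pi>)" "s' \<in> cellset (Dom CatCat \<pi>)" using ge2(3,4) d by simp_all
  have ps: "cm \<pi> s \<in> cellset (Dom CatCat (S (Suc n)))" "cm \<pi> s' \<in> cellset (Dom CatCat (S (Suc n)))"
    using cm_in[OF pbD(1) refl pbD(4)] s by blast+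
  have pp: "cm (pr (Suc n) i \<odot>\<^bsub>CatCat\<^esub> \<pi>) z = cm (pr (Suc n) i) (cm \<pi> z)"
    if "i < Suc n" "z \<in> cellset (Dom CatCat \<pi>)" for i z
    using CatCat_Cmp(4)[OF fp_proj_in(1)[OF that(1)] pbD(1) _ that(2)] fp_proj_in(2)[OF that(1)]
      pbD(4) by simp
  have "cm \<pi> s = cm \<pi> s'"
  proof (rule ge2(2)[OF ps])
    fix i assume i: "i < Suc n"
    then show "cm (pr (Suc n) i) (cm \<pi> s) = cm (pr (Suc n) i) (cm \<pi> s')"
      using ge2(6)[of i] pp[OF i s(1)] pp[OF i s(2)] by (simp add: \<pi>_def)
  qed simp
  moreover have "cm \<rho> s = cm \<rho> s'"
    using ge2(6)[of "Suc n"] by (simp add: \<rho>_def)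
  ultimately show ?case
    using pullback_cells(2)[OF pb f(1) p_arr f(2) s] by blast
qed simp

lemma D_vertex: "i < n \<Longrightarrow> D (vertex n i) = pr n i"
  using D_simps(5)[of "vertex n i" 0] vertex_in[of i n] D_Delta(1-3)[OF vertex_in[of i n]]
  by (simp add: Arr_Delta vertex_def)

text \<open>The two vertex maps embed stage 2 into pairs of cells of stage 1. The image
  \<open>R\<close> meets the conditions of \<open>ss2_descend\<close>, and the quotient is realised
  as a 2-category over the base. Stage 1 is its pullback along \<open>p\<close> because
  \<open>R\<close> transports cells uniquely along the fibres.\<close>

lemma CatCat_descend:
  assumes sim: "simplicial Y U"
  shows "\<exists>a q. a \<in> Arr CatCat \<and> Cod CatCat a = Cod CatCat p \<and> is_pullback CatCat p a (Y 1) q \<and>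
    q \<odot>\<^bsub>CatCat\<^esub> U (vertex 2 0) = q \<odot>\<^bsub>CatCat\<^esub> U (vertex 2 1)"
proof -
  \<comment> \<open>The index of the first stage has to stay \<open>1\<close> instead of becoming
    \<open>Suc 0\<close>, since the facts about stages and vertices below are stated with
    it.\<close>
  note One_nat_def [simp del]
  note Ys = simplicialD[OF sim] and edge_vertex = edge_vertex[folded One_nat_def]
  define Z where "Z n = Dom CatCat (Y n)" for n
  define E where "E n = Dom CatCat (S n)" for n
  have E1: "E 1 = Dom CatCat p" by (simp add: E_def One_nat_def)
  have Y: "Y n \<in> Arr CatCat" "Dom CatCat (Y n) = Z n" "Cod CatCat (Y n) = E n" if "0 < n" for n
    using Ys(1,2)[OF that] by (simp_all add: Z_def E_def)
  have U: "U t \<in> Arr CatCat" "Dom CatCat (U t) = Z (Cod Delta t)"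
    "Cod CatCat (U t) = Z (Dom Delta t)" if "t \<in> Arr Delta" for t
    using Ys(3-5)[OF that] by (simp_all add: Z_def)
  have Dt: "D t \<in> Arr CatCat" "Dom CatCat (D t) = E (Cod Delta t)"
    "Cod CatCat (D t) = E (Dom Delta t)" if "t \<in> Arr Delta" for t
    using D_Delta[OF that] by (simp_all add: E_def)
  have Yc: "cm (Y n) x \<in> cellset (E n)" if "x \<in> cellset (Z n)" "0 < n" for n x
    using cm_in[OF Y] that by blast
  have Uc: "cm (U t) x \<in> cellset (Z (Dom Delta t))" if "t \<in> Arr Delta"
    "x \<in> cellset (Z (Cod Delta t))" for t x
    using cm_in[OF U] that by blast
  have Dc: "cm (D t) x \<in> cellset (E (Dom Delta t))" if "t \<in> Arr Delta"
    "x \<in> cellset (E (Cod Delta t))" for t x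
    using cm_in[OF Dt] that by blast
  have YU: "cm (Y (Dom Delta t)) (cm (U t) x) = cm (D t) (cm (Y (Cod Delta t)) x)"
    if t: "t \<in> Arr Delta" and x: "x \<in> cellset (Z (Cod Delta t))" for t x
  proof -
    have c: "Dom CatCat (Y (Dom Delta t)) = Cod CatCat (U t)"
      "Dom CatCat (D t) = Cod CatCat (Y (Cod Delta t))"
      using Y U Dt t by simp_all
    have "cm (Y (Dom Delta t) \<odot>\<^bsub>CatCat\<^esub> U t) x = cm (Y (Dom Delta t)) (cm (U t) x)"
      "cm (D t \<odot>\<^bsub>CatCat\<^esub> Y (Cod Delta t)) x = cm (D t) (cm (Y (Cod Delta t)) x)"
      using CatCat_Cmp(4)[OF Y(1) U(1) c(1)] CatCat_Cmp(4)[OF Dt(1) Y(1) c(2)] t x U(2) Y(2)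
        by simp_all
    then show ?thesis using Ys(7)[OF t] by simp
  qed
  have UU: "cm (U f) (cm (U g) x) = cm (U (g \<odot>\<^bsub>Delta\<^esub> f)) x"
    if "g \<in> Arr Delta" "f \<in> Arr Delta" "Dom Delta g = Cod Delta f" "x \<in> cellset (Z (Cod Delta g))"
      for g f x
  proof -
    have "Dom CatCat (U f) = Cod CatCat (U g)" using U that by simp
    then show ?thesis
      unfolding Ys(9)[OF that(1-3)] using CatCat_Cmp(4)[OF U(1)[OF that(2)] U(1)[OF that(1)]]
        U(2)[OF that(1)] that(4) by simp
  qed
  have DD: "cm (D f) (cm (D g) x) = cm (D (g \<odot>\<^bsub>Delta\<^esub> f)) x"
    if "g \<in> Arr Delta" "f \<in> Arr Delta" "Dom Delta g = Cod Delta f" "x \<in> cellset (E (Cod Delta g))"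
      for g f x
  proof -
    have "Dom CatCat (D f) = Cod CatCat (D g)" using Dt that by simp
    then show ?thesis
      unfolding D_Cmp[OF that(1-3)] using CatCat_Cmp(4)[OF Dt(1)[OF that(2)] Dt(1)[OF that(1)]]
        Dt(2)[OF that(1)] that(4) by simp
  qed
  \<comment> \<open>Here and in \<open>U_un\<close>, cartesianness is read on cells: a cell of the
    stage at \<open>Cod Delta t\<close> amounts to a cell of the fibre power and one of the stage at
    \<open>Dom Delta t\<close> which agree.\<close>
  have U_ex: "\<exists>z \<in> cellset (Z (Cod Delta t)). cm (Y (Cod Delta t)) z = s \<and> cm (U t) z = x"
    if t: "t \<in> Arr Delta" and "s \<in> cellset (E (Cod Delta t))" "x \<in> cellset (Z (Dom Delta t))"
      "cm (D t) s = cm (Y (Dom Delta t)) x" for t s x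
    using pullback_cells(1)[OF Ys(6)[OF t] Dt(1)[OF t], of s x] Y Dt t that by simp
  have U_un: "z = z'" if t: "t \<in> Arr Delta" and "z \<in> cellset (Z (Cod Delta t))"
    "z' \<in> cellset (Z (Cod Delta t))"
    "cm (Y (Cod Delta t)) z = cm (Y (Cod Delta t)) z'" "cm (U t) z = cm (U t) z'" for t z z'
    using pullback_cells(2)[OF Ys(6)[OF t] Dt(1)[OF t], of z z'] Y Dt t that by simp
  have v2: "vertex 2 0 \<in> Arr Delta" "vertex 2 1 \<in> Arr Delta" by simp_all
  define s0 where "s0 = cm (U (vertex 2 0))"
  define s1 where "s1 = cm (U (vertex 2 1))"
  define c where "c = cm (Y 1)"
  have E_un: "s = s'" if s: "s \<in> cellset (E n)" "s' \<in> cellset (E n)" "0 < n"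
    and eq: "\<And>i. i < n \<Longrightarrow> cm (D (vertex n i)) s = cm (D (vertex n i)) s'" for s s' n
  proof (rule cells_fp_unique[OF s[unfolded E_def]])
    show "cm (pr n i) s = cm (pr n i) s'" if "i < n" for i
      using eq[OF that] unfolding D_vertex[OF that] .
  qed
  have E_ex: "\<exists>s \<in> cellset (E n). \<forall>i < n. cm (D (vertex n i)) s = e i"
    if e: "\<And>i. i < n \<Longrightarrow> e i \<in> cellset (E 1) \<and> cm p (e i) = cm p (e 0)" and n: "0 < n" for e n
  proof -
    have "cm p (e 0) \<in> cellset (Cod CatCat p)"
      using cm_in[OF p_arr refl refl, of "e 0"] e[OF n] E1 by simp
    then have "\<exists>s \<in> cellset (Dom CatCat (S n)). cm (S n) s = cm p (e 0) \<and> (\<forall>i < n. cm (pr n i) s =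
      e i)"
    proof (rule cells_fp_ex)
      show "e i \<in> cellset (Dom CatCat p) \<and> cm p (e i) = cm p (e 0)" if "i < n" for i
        using e[OF that] unfolding E1 .
    qed
    then obtain s where "s \<in> cellset (Dom CatCat (S n))" "\<forall>i < n. cm (pr n i) s = e i" by blast
    then show ?thesis by (intro bexI[of _ s]) (simp_all add: E_def D_vertex)
  qed
  have E_ex2: "\<exists>s \<in> cellset (E 2). cm (D (vertex 2 0)) s = e \<and> cm (D (vertex 2 1)) s = e'"
    if "e \<in> cellset (E 1)" "e' \<in> cellset (E 1)" "cm p e' = cm p e" for e e'
  proof -
    have "\<exists>s \<in> cellset (E 2). \<forall>i < 2. cm (D (vertex 2 i)) s = (if i = 0 then e else e')"
      by (rule E_ex) (use that in simp_all)
    then obtain s where "s \<in> cellset (E 2)" "\<forall>i < 2. cm (D (vertex 2 i)) s = (if i =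
      0 then e else e')" by blast
    from this(1) this(2)[rule_format, of 0] this(2)[rule_format, of 1] show ?thesis
      by (intro bexI[of _ s]) simp_all
  qed
  have E_ex3: "\<exists>s \<in> cellset (E 3). cm (D (vertex 3 0)) s = e \<and> cm (D (vertex 3 1)) s = e' \<and>
    cm (D (vertex 3 2)) s = e''"
    if "e \<in> cellset (E 1)" "e' \<in> cellset (E 1)" "e'' \<in> cellset (E 1)" "cm p e' = cm p e"
      "cm p e'' = cm p e" for e e' e''
  proof -
    have "\<exists>s \<in> cellset (E 3). \<forall>i < 3. cm (D (vertex 3 i)) s = (if i = 0 then e else if i =
      1 then e' else e'')"
      by (rule E_ex) (use that in simp_all)
    then obtain s where "s \<in> cellset (E 3)"
      "\<forall>i < 3. cm (D (vertex 3 i)) s = (if i = 0 then e else if i = 1 then e' else e'')" by blast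
    from this(1) this(2)[rule_format, of 0] this(2)[rule_format, of 1] this(2)[rule_format, of 2]
      show ?thesis
      by (intro bexI[of _ s]) simp_all
  qed
  have pD: "cm p (cm (D (vertex n i)) s) = cm (S n) s" if "i < n" "s \<in> cellset (E n)" for n i s
  proof -
    have "Dom CatCat p = Cod CatCat (D (vertex n i))" using Dt(3)[OF vertex_in[OF that(1)]] E1
      by simp
    then show ?thesis
      using CatCat_Cmp(4)[OF p_arr Dt(1)[OF vertex_in[OF that(1)]]] fp_str_vertex[of n i] that
        Dt(2)[OF vertex_in[OF that(1)]] by simp
  qed
  have sc: "s0 w \<in> cellset (Z 1)" "s1 w \<in> cellset (Z 1)" if "w \<in> cellset (Z 2)" for w
    using Uc[OF v2(1), of w] Uc[OF v2(2), of w] that by (simp_all add: s0_def s1_def)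
  have cs: "c (s0 w) = cm (D (vertex 2 0)) (cm (Y 2) w)"
    "c (s1 w) = cm (D (vertex 2 1)) (cm (Y 2) w)" if "w \<in> cellset (Z 2)" for w
    using YU[OF v2(1), of w] YU[OF v2(2), of w] that by (simp_all add: s0_def s1_def c_def)
  \<comment> \<open>The first vertex and the image of the second one determine both projections of
    the image in \<open>E 2\<close>, hence that image; the pullback square at
    \<open>vertex 2 0\<close> then determines the cell.\<close>
  have inj: "w = w'" if w: "w \<in> cellset (Z 2)" "w' \<in> cellset (Z 2)" and s: "s0 w = s0 w'"
    "c (s1 w) = c (s1 w')" for w w'
  proof (rule U_un[OF v2(1)])
    have "cm (D (vertex 2 i)) (cm (Y 2) w) = cm (D (vertex 2 i)) (cm (Y 2) w')" if "i < 2" for i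
    proof -
      have "i = 0 \<or> i = 1" using that by (simp add: less_2_cases_iff One_nat_def)
      then show ?thesis using cs[OF w(1)] cs[OF w(2)] s by auto
    qed
    then show "cm (Y (Cod Delta (vertex 2 0))) w = cm (Y (Cod Delta (vertex 2 0))) w'"
      using E_un[of "cm (Y 2) w" 2 "cm (Y 2) w'"] Yc[of w 2] Yc[of w' 2] w by simp
  qed (use w s in \<open>simp_all add: s0_def\<close>)
  have pc: "cm p (c (s0 w)) = cm p (c (s1 w))" if "w \<in> cellset (Z 2)" for w
    using cs[OF that] pD[of 0 2] pD[of 1 2] Yc[of w 2] that by simp
  define R where "R = (\<lambda>w. (s0 w, s1 w)) ` cellset (Z 2)"
  have RI: "(s0 w, s1 w) \<in> R" if "w \<in> cellset (Z 2)" for w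
    using that unfolding R_def by blast
  have RE: "\<exists>w \<in> cellset (Z 2). s0 w = x \<and> s1 w = y" if "(x, y) \<in> R" for x y
    using that unfolding R_def by blast
  have Zcat: "two_category (Z 1)"
    using Dom_in[OF Y(1)[of 1]] Y(2)[of 1] by (simp add: CatCat_simps)
  have SZ: "ss2 (cells (Z n))" if "0 < n" for n
    using CatCat_ss2(1)[OF Y(1)[OF that]] Y(2)[OF that] by simp
  have c_hom: "ss2_hom (cells (Z 1)) (cells (Dom CatCat p)) c"
    using cm_hom[OF Y(1)[of 1]] Y(2,3)[of 1] E1 by (simp add: c_def)
  have s_hom: "ss2_hom (cells (Z 2)) (cells (Z 1)) s0" "ss2_hom (cells (Z 2)) (cells (Z 1)) s1"
    using cm_hom[OF U(1)[OF v2(1)]] cm_hom[OF U(1)[OF v2(2)]] U(2,3)[OF v2(1)] U(2,3)[OF v2(2)]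
    by (simp_all add: s0_def s1_def)
  note H0 = ss2_homD[OF s_hom(1)] and H1 = ss2_homD[OF s_hom(2)] and Hc = ss2_homD[OF c_hom]
  interpret Z2: ss2 "cells (Z 2)" using SZ by simp
  have "\<exists>(A0 :: ('u \<times> 'u \<times> 'u) ss2) q a. ss2 A0 \<and> ss2_hom (cells (Z 1)) A0 q \<and> Cell A0 =
    q ` cellset (Z 1) \<and>
    ss2_hom A0 (cells (Cod CatCat p)) a \<and> (\<forall>x \<in> cellset (Z 1). a (q x) = cm p (c x)) \<and>
    (\<forall>x \<in> cellset (Z 1). \<forall>y \<in> cellset (Z 1). q x = q y \<longleftrightarrow> (x, y) \<in> R)"
  proof (rule ss2_descend[OF SZ CatCat_ss2[OF p_arr] cm_hom[OF p_arr] c_hom triples squares])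
    show "x \<in> cellset (Z 1) \<and> y \<in> cellset (Z 1) \<and> cm p (c x) = cm p (c y)" if "(x, y) \<in> R" for x y
      using RE[OF that] sc pc by blast
    show "(x, x) \<in> R" if x: "x \<in> cellset (Z 1)" for x
    proof -
      \<comment> \<open>The degenerate cell on \<open>x\<close> has \<open>x\<close> as both
        vertices, because \<open>edge 1 0 0\<close> composed with either vertex of 2 is the identity
        of 1.\<close>
      have e: "edge 1 0 0 \<in> Arr Delta" by simp
      have w: "cm (U (edge 1 0 0)) x \<in> cellset (Z 2)" using Uc[OF e] x by simp
      have "U (vertex 1 0) = Idt CatCat (Z 1)"
        unfolding vertex_Idt Z_def by (rule Ys(8)) simp
      then have "s0 (cm (U (edge 1 0 0)) x) = x" "s1 (cm (U (edge 1 0 0)) x) = x"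
        using UU[OF e v2(1)] UU[OF e v2(2)] x by (simp_all add: s0_def s1_def edge_vertex
          CatCat_simps cellmap_id)
      with RI[OF w] show ?thesis by simp
    qed
    show "\<exists>y. (x, y) \<in> R \<and> c y = e"
      if x: "x \<in> cellset (Z 1)" and e: "e \<in> cellset (Dom CatCat p)" "cm p e = cm p (c x)" for x e
    proof -
      \<comment> \<open>The pair \<open>(c x, e)\<close> is a cell of \<open>E 2\<close>. The
        pullback square at \<open>vertex 2 0\<close> lifts it to a cell of stage 2 with first vertex
        \<open>x\<close>; its second vertex lies over \<open>e\<close>.\<close>
      obtain s where s: "s \<in> cellset (E 2)" "cm (D (vertex 2 0)) s = c x"
        "cm (D (vertex 2 1)) s = e"
        using E_ex2[of "c x" e] e Hc(1)[OF x] E1 by metis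
      have "\<exists>w \<in> cellset (Z 2). cm (Y 2) w = s \<and> s0 w = x"
        using U_ex[OF v2(1), of s x] s x by (simp add: c_def s0_def)
      then obtain w where w: "w \<in> cellset (Z 2)" "cm (Y 2) w = s" "s0 w = x" by blast
      then have "c (s1 w) = e" using cs(2)[OF w(1)] s(3) by simp
      with RI[OF w(1)] w(3) show ?thesis by blast
    qed
    show "y = z" if "(x, y) \<in> R" "(x, z) \<in> R" "c y = c z" for x y z
      using RE[OF that(1)] RE[OF that(2)] that(3) inj by metis
    show "(Src (cells (Z 1)) i x, Src (cells (Z 1)) i y) \<in> R"
      "(Tgt (cells (Z 1)) i x, Tgt (cells (Z 1)) i y) \<in> R"
      if "(x, y) \<in> R" for x y i
      using RE[OF that] RI H0(2,3) H1(2,3) Z2.Src_in Z2.Tgt_in by metis+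
    show "(Comp (cells (Z 1)) i y x, Comp (cells (Z 1)) i y' x') \<in> R"
      if xy: "(x, x') \<in> R" "(y, y') \<in> R" "(y, x) \<in> comps (cells (Z 1)) i"
        "(y', x') \<in> comps (cells (Z 1)) i" for x x' y y' i
    proof -
      obtain v w where v: "v \<in> cellset (Z 2)" "y = s0 v" "y' = s1 v" and w: "w \<in> cellset (Z 2)"
        "x = s0 w" "x' = s1 w"
        using RE[OF xy(1)] RE[OF xy(2)] by metis
      \<comment> \<open>Composability in stage 2 follows from composability of both vertices, by
        \<open>inj\<close>; the composite there then witnesses the relation.\<close>
      have "Src (cells (Z 2)) i v = Tgt (cells (Z 2)) i w"
        by (rule inj) (use v w xy(3,4) H0 H1 in \<open>simp_all add: comps_def\<close>)
      then have vw: "(v, w) \<in> comps (cells (Z 2)) i" using v w by (simp add: comps_def)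
      then show ?thesis
        using H0(4)[OF vw] H1(4)[OF vw] RI[OF Z2.Comp_in[OF vw]] v w by simp
    qed
    show "(x, z) \<in> R" if xy: "(x, y) \<in> R" "(y, z) \<in> R" for x y z
    proof -
      obtain w w' where w: "w \<in> cellset (Z 2)" "s0 w = x" "s1 w = y" and w': "w' \<in> cellset (Z 2)"
        "s0 w' = y" "s1 w' = z"
        using RE[OF xy(1)] RE[OF xy(2)] by blast
      have xyz: "x \<in> cellset (Z 1)" "y \<in> cellset (Z 1)" "z \<in> cellset (Z 1)"
        using sc w w' by blast+
      \<comment> \<open>The images of \<open>x\<close>, \<open>y\<close> and \<open>z\<close> form a
        cell of \<open>E 3\<close>, which lifts to a cell \<open>t\<close> of stage 3 with first
        vertex \<open>x\<close>. By \<open>inj\<close>, applied successively, the faces 01 and 12 of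
        \<open>t\<close> are \<open>w\<close> and \<open>w'\<close>; then the face 02 relates
        \<open>x\<close> to \<open>z\<close>.\<close>
      obtain s where s: "s \<in> cellset (E 3)" "cm (D (vertex 3 0)) s = c x"
        "cm (D (vertex 3 1)) s = c y"
        "cm (D (vertex 3 2)) s = c z"
        using E_ex3[of "c x" "c y" "c z"] pc[OF w(1)] pc[OF w'(1)] Hc(1)[OF xyz(1)] Hc(1)[OF
          xyz(2)] Hc(1)[OF xyz(3)]
          w w' E1 by metis
      have v3: "vertex 3 i \<in> Arr Delta" if "i < 3" for i using that by simp
      have "\<exists>t \<in> cellset (Z 3). cm (Y 3) t = s \<and> cm (U (vertex 3 0)) t = x"
        using U_ex[OF v3[of 0], of s x] s xyz by (simp add: c_def)
      then obtain t where t: "t \<in> cellset (Z 3)" "cm (Y 3) t = s" "cm (U (vertex 3 0)) t = x"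
        by blast
      have ct: "c (cm (U (vertex 3 1)) t) = c y" "c (cm (U (vertex 3 2)) t) = c z"
        using YU[OF v3[of 1], of t] YU[OF v3[of 2], of t] t s by (simp_all add: c_def)
      have face: "cm (U (edge 3 i j)) t \<in> cellset (Z 2)" "s0 (cm (U (edge 3 i j)) t) =
        cm (U (vertex 3 i)) t"
        "s1 (cm (U (edge 3 i j)) t) = cm (U (vertex 3 j)) t" if "i \<le> j" "j < 3" for i j
      proof -
        have e: "edge 3 i j \<in> Arr Delta" using that by simp
        show "cm (U (edge 3 i j)) t \<in> cellset (Z 2)" using Uc[OF e] t by simp
        show "s0 (cm (U (edge 3 i j)) t) = cm (U (vertex 3 i)) t"
          "s1 (cm (U (edge 3 i j)) t) = cm (U (vertex 3 j)) t"
          using UU[OF e v2(1)] UU[OF e v2(2)] t by (simp_all add: s0_def s1_def edge_vertex)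
      qed
      have "cm (U (edge 3 0 1)) t = w"
        by (rule inj) (use face[of 0 1] w t ct in simp_all)
      then have "cm (U (vertex 3 1)) t = y" using face[of 0 1] w by simp
      note y = this
      have "cm (U (edge 3 1 2)) t = w'"
        by (rule inj) (use face[of 1 2] w' ct y in simp_all)
      then have "cm (U (vertex 3 2)) t = z" using face[of 1 2] w' by simp
      then show ?thesis using RI[OF face(1)[of 0 2]] face(2,3)[of 0 2] t by simp
    qed
  qed simp
  then obtain A0 :: "('u \<times> 'u \<times> 'u) ss2" and q a where *: "ss2 A0 \<and> ss2_hom (cells (Z 1)) A0 q \<and>
    Cell A0 = q ` cellset (Z 1) \<and> ss2_hom A0 (cells (Cod CatCat p)) a \<and>
      (\<forall>x \<in> cellset (Z 1). a (q x) = cm p (c x)) \<and>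
    (\<forall>x \<in> cellset (Z 1). \<forall>y \<in> cellset (Z 1). q x = q y \<longleftrightarrow> (x, y) \<in> R)"
    by (elim exE)
  then have A0: "ss2 A0" and q: "ss2_hom (cells (Z 1)) A0 q" "Cell A0 = q ` cellset (Z 1)"
    and a: "ss2_hom A0 (cells (Cod CatCat p)) a" by blast+
  have aq: "a (q x) = cm p (c x)" if "x \<in> cellset (Z 1)" for x using * that by blast
  have qR: "q x = q y \<longleftrightarrow> (x, y) \<in> R" if "x \<in> cellset (Z 1)" "y \<in> cellset (Z 1)" for x y
    using * that by blast
  obtain j :: "('u \<times> 'u \<times> 'u) \<times> 'u \<times> 'u \<times> 'u \<Rightarrow> 'u" where j: "inj j"
    using infinite_triple_inj[OF infinite_UNIV] by blast
  \<comment> \<open>The cells of the quotient are triples; the coding of pairs of triples is used on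
    the diagonal.\<close>
  have "inj (\<lambda>x. j (x, x))" by (rule injI) (simp add: inj_eq[OF j])
  from CatCat_realize[OF A0 this] obtain W :: "'u twocat" and h k where
    W: "two_category W" "ss2_hom A0 (cells W) h" "ss2_hom (cells W) A0 k"
    "\<And>x. x \<in> Cell A0 \<Longrightarrow> k (h x) = x" "\<And>c. c \<in> cellset W \<Longrightarrow> h (k c) = c" by blast
  note Hh = ss2_homD[OF W(2)] and Hk = ss2_homD[OF W(3)] and Hq = ss2_homD[OF q(1)]
    and Ha = ss2_homD[OF a]
  have hom: "ss2_hom (cells W) (cells (Cod CatCat p)) (\<lambda>x. a (k x))"
    "ss2_hom (cells (Z 1)) (cells W) (\<lambda>x. h (q x))"
    by (rule ss2_homI; simp add: Hh Hk Hq Ha)+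
  have "two_category (Cod CatCat p)" using Cod_in[OF p_arr] by (simp add: CatCat_simps)
  from CatCat_full[OF W(1) this hom(1)] obtain a' where a': "a' \<in> Arr CatCat" "Dom CatCat a' = W"
    "Cod CatCat a' = Cod CatCat p" "\<And>c. c \<in> cellset W \<Longrightarrow> cm a' c = a (k c)" by blast
  from CatCat_full[OF Zcat W(1) hom(2)] obtain q' where q': "q' \<in> Arr CatCat"
    "Dom CatCat q' = Z 1" "Cod CatCat q' = W"
    "\<And>c. c \<in> cellset (Z 1) \<Longrightarrow> cm q' c = h (q c)" by blast
  have "is_pullback CatCat p a' (Y 1) q'"
  proof (rule CatCat_is_pullbackI[OF p_arr a'(1) Y(1) q'(1)])
    show "cm p (cm (Y 1) z) = cm a' (cm q' z)" if "z \<in> cellset (Dom CatCat (Y 1))" for z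
      using that Y(2)[of 1] q'(4) a'(4) aq W(4) Hh(1) Hq(1) by (simp add: c_def)
    show "\<exists>z \<in> cellset (Dom CatCat (Y 1)). cm (Y 1) z = e \<and> cm q' z = v"
      if e: "e \<in> cellset (Dom CatCat p)" and v: "v \<in> cellset (Dom CatCat a')"
        and ev: "cm p e = cm a' v" for e v
    proof -
      \<comment> \<open>The cell \<open>v\<close> is the class of some \<open>x\<close> of stage 1.
        Transporting \<open>x\<close> to the point \<open>e\<close> of its fibre gives a cell with
        the same class and the prescribed image.\<close>
      have "k v \<in> Cell A0" using Hk(1) v a'(2) by simp
      then obtain x where x: "x \<in> cellset (Z 1)" "k v = q x" using q(2) by blast
      have "cm p e = cm p (c x)" using ev a'(4)[of v] v a'(2) x aq by simp
      then obtain s where s: "s \<in> cellset (E 2)" "cm (D (vertex 2 0)) s = c x"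
        "cm (D (vertex 2 1)) s = e"
        using E_ex2[of "c x" e] e Hc(1)[OF x(1)] E1 by metis
      have "\<exists>w \<in> cellset (Z 2). cm (Y 2) w = s \<and> s0 w = x"
        using U_ex[OF v2(1), of s x] s x by (simp add: c_def s0_def)
      then obtain w where w: "w \<in> cellset (Z 2)" "cm (Y 2) w = s" "s0 w = x" by blast
      have "c (s1 w) = e" using cs(2)[OF w(1)] s(3) w(2) by simp
      moreover have "q (s1 w) = k v" using qR[OF x(1) sc(2)[OF w(1)]] RI[OF w(1)] w(3) x(2) by simp
      ultimately show ?thesis
        using sc(2)[OF w(1)] q'(4) W(5) v a'(2) Y(2)[of 1] by (intro bexI[of _
          "s1 w"]) (simp_all add: c_def)
    qed
    show "z = z'" if z: "z \<in> cellset (Dom CatCat (Y 1))" "z' \<in> cellset (Dom CatCat (Y 1))"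
      "cm (Y 1) z = cm (Y 1) z'" "cm q' z = cm q' z'" for z z'
    proof -
      have z': "z \<in> cellset (Z 1)" "z' \<in> cellset (Z 1)" using z Y(2)[of 1] by simp_all
      then have "k (h (q z)) = k (h (q z'))" using z(4) q'(4) by simp
      then have "q z = q z'" using W(4) Hq(1) z' by simp
      \<comment> \<open>\<open>z\<close> and \<open>z'\<close> are both transports of
        \<open>z\<close> to the same point of the fibre, so they coincide.\<close>
      then have "(z, z') \<in> R" "(z, z) \<in> R" using qR z' by blast+
      then show ?thesis using z(3) inj RE unfolding c_def[symmetric] by metis
    qed
  qed (use Y q' a' E1 in simp_all)
  moreover have "q' \<odot>\<^bsub>CatCat\<^esub> U (vertex 2 0) = q' \<odot>\<^bsub>CatCat\<^esub> U (vertex 2 1)"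
  proof (rule CatCat_eqI)
    have d: "Dom CatCat q' = Cod CatCat (U (vertex 2 0))"
      "Dom CatCat q' = Cod CatCat (U (vertex 2 1))"
      using q'(2) U(3)[OF v2(1)] U(3)[OF v2(2)] by simp_all
    note Q = CatCat_Cmp[OF q'(1) U(1)[OF v2(1)] d(1)] CatCat_Cmp[OF q'(1) U(1)[OF v2(2)] d(2)]
    show "q' \<odot>\<^bsub>CatCat\<^esub> U (vertex 2 0) \<in> Arr CatCat" "q' \<odot>\<^bsub>CatCat\<^esub> U (vertex 2 1) \<in> Arr CatCat"
      "Cod CatCat (q' \<odot>\<^bsub>CatCat\<^esub> U (vertex 2 0)) = Cod CatCat (q' \<odot>\<^bsub>CatCat\<^esub> U (vertex 2 1))"
      "Dom CatCat (q' \<odot>\<^bsub>CatCat\<^esub> U (vertex 2 0)) = Dom CatCat (q' \<odot>\<^bsub>CatCat\<^esub> U (vertex 2 1))"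
      using Q U(2)[OF v2(1)] U(2)[OF v2(2)] by simp_all
    fix w assume "w \<in> cellset (Dom CatCat (q' \<odot>\<^bsub>CatCat\<^esub> U (vertex 2 0)))"
    then have w: "w \<in> cellset (Z 2)" using Q(2) U(2)[OF v2(1)] by simp
    have "q (s0 w) = q (s1 w)" using qR[OF sc(1)[OF w] sc(2)[OF w]] RI[OF w] by simp
    then show "cm (q' \<odot>\<^bsub>CatCat\<^esub> U (vertex 2 0)) w = cm (q' \<odot>\<^bsub>CatCat\<^esub> U (vertex 2 1)) w"
      using Q(4)[of w] Q(8)[of w] w U(2)[OF v2(1)] U(2)[OF v2(2)] q'(4) sc[OF w]
        by (simp add: s0_def s1_def)
  qed
  ultimately show ?thesis using a' by blast
qed

sublocale descent_criterion "CatCat :: ('u twocat, 'u twocat \<times> 'u twofun \<times> 'u twocat) cat" p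
  by unfold_locales (rule CatCat_regular_epi CatCat_descend; assumption)+

end

section \<open>The surjectivity hypotheses in terms of 2-cells\<close>

context two_functor
begin

text \<open>Consecutive arrows of \<open>cells1\<close> lie in one summand, hence in one
  hom-category; they are triples composable in direction \<open>Ver\<close>.\<close>

lemma lifts_triples_Ver:
  assumes "surj_on_comp_triples (cells1 X) (cells1 Y) (cells1_map F)"
    and cba: "(c, b) \<in> comps (cells Y) Ver" "(b, a) \<in> comps (cells Y) Ver"
  shows "\<exists>z y x. (z, y) \<in> comps (cells X) Ver \<and> (y, x) \<in> comps (cells X) Ver \<and>
    cellmap F z = c \<and> cellmap F y = b \<and> cellmap F x = a"
proof -
  obtain u v \<gamma> \<beta> \<alpha> where c: "c = (u, v, \<gamma>)" "b = (u, v, \<beta>)" "a = (u, v, \<alpha>)" "u \<in> Ob Y" "v \<in> Ob Y"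
    "\<gamma> \<in> Arr (Hom Y u v)" "\<beta> \<in> Arr (Hom Y u v)" "\<alpha> \<in> Arr (Hom Y u v)"
    "Dom (Hom Y u v) \<gamma> = Cod (Hom Y u v) \<beta>" "Dom (Hom Y u v) \<beta> = Cod (Hom Y u v) \<alpha>"
    using cba by (auto simp: Y.comps_cells_Ver)
  then have "(((u, v), \<gamma>), ((u, v), \<beta>), ((u, v), \<alpha>)) \<in> comp_triples (cells1 Y)"
    by (simp add: comp_triples_def cells1_def sum_cat_def)
  also have "\<dots> = (\<lambda>(h, g, f). (amap (cells1_map F) h, amap (cells1_map F) g,
    amap (cells1_map F) f)) ` comp_triples (cells1 X)"
    using assms(1) by (simp add: surj_on_comp_triples_def)
  finally obtain h g f where hgf: "(h, g, f) \<in> comp_triples (cells1 X)"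
    "amap (cells1_map F) h = ((u, v), \<gamma>)"
    "amap (cells1_map F) g = ((u, v), \<beta>)" "amap (cells1_map F) f = ((u, v), \<alpha>)"
    by auto
  then obtain x y \<gamma>' \<beta>' \<alpha>' where "h = ((x, y), \<gamma>')" "g = ((x, y), \<beta>')" "f = ((x, y), \<alpha>')"
    "x \<in> Ob X" "y \<in> Ob X"
    "\<gamma>' \<in> Arr (Hom X x y)" "\<beta>' \<in> Arr (Hom X x y)" "\<alpha>' \<in> Arr (Hom X x y)"
    "Dom (Hom X x y) \<gamma>' = Cod (Hom X x y) \<beta>'" "Dom (Hom X x y) \<beta>' = Cod (Hom X x y) \<alpha>'"
    by (cases h; cases g; cases f) (auto simp: comp_triples_def cells1_def sum_cat_def)
  with hgf(2-4) c(1-3) show ?thesis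
    by (intro exI[of _ "(x, y, \<gamma>')"] exI[of _ "(x, y, \<beta>')"] exI[of _ "(x, y, \<alpha>')"])
      (auto simp: X.comps_cells_Ver cells1_map_def)
qed

text \<open>The index of a summand of \<open>cells1_triples\<close> records the four objects once,
  so an arrow there is a horizontally composable triple of 2-cells.\<close>

lemma lifts_triples_Hor:
  assumes "surj_on_arrows (cells1_triples X) (cells1_triples Y) (cells1_triples_map F)"
    and cba: "(c, b) \<in> comps (cells Y) Hor" "(b, a) \<in> comps (cells Y) Hor"
  shows "\<exists>z y x. (z, y) \<in> comps (cells X) Hor \<and> (y, x) \<in> comps (cells X) Hor \<and>
    cellmap F z = c \<and> cellmap F y = b \<and> cellmap F x = a"
proof -
  obtain t u v w \<gamma> \<beta> \<alpha> where c: "c = (v, w, \<gamma>)" "b = (u, v, \<beta>)" "a = (t, u, \<alpha>)"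
    "t \<in> Ob Y" "u \<in> Ob Y" "v \<in> Ob Y" "w \<in> Ob Y"
    "\<gamma> \<in> Arr (Hom Y v w)" "\<beta> \<in> Arr (Hom Y u v)" "\<alpha> \<in> Arr (Hom Y t u)"
    using cba by (auto simp: Y.comps_cells_Hor)
  then have "((t, u, v, w), (\<gamma>, \<beta>, \<alpha>)) \<in> Arr (cells1_triples Y)"
    by (simp add: cells1_triples_def sum_cat_def prod_cat_def)
  also have "\<dots> = amap (cells1_triples_map F) ` Arr (cells1_triples X)"
    using assms(1) by (simp add: surj_on_arrows_def)
  finally obtain f where f: "f \<in> Arr (cells1_triples X)" "amap (cells1_triples_map F) f =
    ((t, u, v, w), (\<gamma>, \<beta>, \<alpha>))"
    by auto
  then obtain t' u' v' w' \<gamma>' \<beta>' \<alpha>' where "f = ((t', u', v', w'), (\<gamma>', \<beta>', \<alpha>'))"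
    "t' \<in> Ob X" "u' \<in> Ob X" "v' \<in> Ob X" "w' \<in> Ob X"
    "\<gamma>' \<in> Arr (Hom X v' w')" "\<beta>' \<in> Arr (Hom X u' v')" "\<alpha>' \<in> Arr (Hom X t' u')"
    by (cases f) (auto simp: cells1_triples_def sum_cat_def prod_cat_def)
  with f(2) c(1-3) show ?thesis
    by (intro exI[of _ "(v', w', \<gamma>')"] exI[of _ "(u', v', \<beta>')"] exI[of _ "(t', u', \<alpha>')"])
      (auto simp: X.comps_cells_Hor cells1_triples_map_def)
qed

text \<open>Two consecutive arrows between composable pairs of 1-cells are four 2-cells arranged in
  a square, the configuration of the interchange law.\<close>

lemma cellmap_lifts_squares:
  assumes "surj_on_comp_pairs (cells1_pairs X) (cells1_pairs Y) (cells1_pairs_map F)"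
  shows "lifts_squares (cells X) (cells Y) (cellmap F)"
  unfolding lifts_squares_def
proof (intro allI impI)
  fix b' b a' a assume ba: "(b', b) \<in> comps (cells Y) Ver" "(a', a) \<in> comps (cells Y) Ver"
    "(b, a) \<in> comps (cells Y) Hor"
  obtain u v w \<beta>' \<beta> \<alpha>' \<alpha> where c: "b' = (v, w, \<beta>')" "b = (v, w, \<beta>)" "a' = (u, v, \<alpha>')"
    "a = (u, v, \<alpha>)"
    "u \<in> Ob Y" "v \<in> Ob Y" "w \<in> Ob Y" "\<beta>' \<in> Arr (Hom Y v w)" "\<beta> \<in> Arr (Hom Y v w)"
      "\<alpha>' \<in> Arr (Hom Y u v)" "\<alpha> \<in> Arr (Hom Y u v)"
    "Dom (Hom Y v w) \<beta>' = Cod (Hom Y v w) \<beta>" "Dom (Hom Y u v) \<alpha>' = Cod (Hom Y u v) \<alpha>"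
    using ba by (auto simp: Y.comps_cells_Ver Y.comps_cells_Hor)
  then have "(((u, v, w), (\<beta>', \<alpha>')), ((u, v, w), (\<beta>, \<alpha>))) \<in> comp_pairs (cells1_pairs Y)"
    by (simp add: comp_pairs_def cells1_pairs_def sum_cat_def prod_cat_def)
  also have "\<dots> = (\<lambda>(g, f). (amap (cells1_pairs_map F) g, amap (cells1_pairs_map F) f)) `
    comp_pairs (cells1_pairs X)"
    using assms by (simp add: surj_on_comp_pairs_def)
  finally obtain g f where gf: "(g, f) \<in> comp_pairs (cells1_pairs X)"
    "amap (cells1_pairs_map F) g = ((u, v, w), (\<beta>', \<alpha>'))"
    "amap (cells1_pairs_map F) f = ((u, v, w), (\<beta>, \<alpha>))"
    by auto
  then obtain x y z \<delta>' \<delta> \<gamma>' \<gamma> where "g = ((x, y, z), (\<delta>', \<gamma>'))" "f = ((x, y, z), (\<delta>, \<gamma>))"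
    "x \<in> Ob X" "y \<in> Ob X" "z \<in> Ob X" "\<delta>' \<in> Arr (Hom X y z)" "\<delta> \<in> Arr (Hom X y z)"
      "\<gamma>' \<in> Arr (Hom X x y)" "\<gamma> \<in> Arr (Hom X x y)"
    "Dom (Hom X y z) \<delta>' = Cod (Hom X y z) \<delta>" "Dom (Hom X x y) \<gamma>' = Cod (Hom X x y) \<gamma>"
    by (cases g; cases f) (auto simp: comp_pairs_def cells1_pairs_def sum_cat_def prod_cat_def)
  with gf(2,3) c(1-4) show "\<exists>y' y x' x. (y', y) \<in> comps (cells X) Ver \<and>
    (x', x) \<in> comps (cells X) Ver \<and> (y, x) \<in> comps (cells X) Hor \<and>
        cellmap F y' = b' \<and> cellmap F y = b \<and> cellmap F x' = a' \<and> cellmap F x = a"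
    by (intro exI[of _ "(y, z, \<delta>')"] exI[of _ "(y, z, \<delta>)"] exI[of _ "(x, y, \<gamma>')"] exI[of _
      "(x, y, \<gamma>)"])
      (auto simp: X.comps_cells_Hor X.comps_cells_Ver cells1_pairs_map_def)
qed

lemma cellmap_lifts_triples:
  assumes "surj_on_comp_triples (cells1 X) (cells1 Y) (cells1_map F)"
    and "surj_on_arrows (cells1_triples X) (cells1_triples Y) (cells1_triples_map F)"
  shows "lifts_triples (cells X) (cells Y) (cellmap F)"
  unfolding lifts_triples_def
proof (intro allI impI)
  fix i c b a assume cba: "(c, b) \<in> comps (cells Y) i" "(b, a) \<in> comps (cells Y) i"
  show "\<exists>z y x. (z, y) \<in> comps (cells X) i \<and> (y, x) \<in> comps (cells X) i \<and>
    cellmap F z = c \<and> cellmap F y = b \<and> cellmap F x = a"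
  proof (cases i)
    case Hor
    with lifts_triples_Hor[OF assms(2)] cba show ?thesis by simp
  next
    case Ver
    with lifts_triples_Ver[OF assms(1)] cba show ?thesis by simp
  qed
qed

end

theorem corollary9p11:
  fixes E B :: "'u twocat" and F :: "'u twofun"
  assumes "infinite (UNIV :: 'u set)"
    and "two_category E" and "two_category B" and "two_functor E B F"
    and "fob F ` Ob E = Ob B"
    and "surj_on_comp_triples (cells1 E) (cells1 B) (cells1_map F)"
    and "surj_on_comp_pairs (cells1_pairs E) (cells1_pairs B) (cells1_pairs_map F)"
    and "surj_on_arrows (cells1_triples E) (cells1_triples B) (cells1_triples_map F)"
  shows "effective_descent CatCat (E, F, B)"
proof -
  interpret two_functor E B F by fact
  interpret lifting_two_functor "(E, F, B)"
    using assms(1,4) cellmap_lifts_triples[OF assms(6,8)] cellmap_lifts_squares[OF assms(7)]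
    by unfold_locales (simp_all add: CatCat_simps CatCat_Arr)
  show ?thesis by (rule effective_descent)
qed

end
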